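(* Let $n \geq 1$. (1) For every $t \in \{4,6,10\} \cup \{3,5,7,\dots\}$, $\lambda(n, C_t) \geq \Omega(n^{1/t})$. (2) For all $t \geq 2$, $\lambda(n, K_{2,t}) \geq \Omega(t^{1/4} n^{1/4})$. (3) For all $t \geq 3$, $\lambda(n, K_{t,(t-1)!+1}) \geq \Omega\left(n^{\frac{1}{2}(1-1/t)}\right)$.
   Context: An orthonormal representation of a graph $G$ is a map $f: V(G) \to \mathbb{R}^d$ (some $d$) with $\|f(u)\|=1$ for all $u$ and $\langle f(u), f(v)\rangle = 0$ for all distinct non-adjacent $u,v$. For a graph $G$, $\vartheta(\overline{G})$ (the Lovász theta function of the complement of $G$) equals the maximum, over all orthonormal representations $f$ of $G$, of the largest eigenvalue of the Gram matrix $(\langle f(u), f(v)\rangle)_{u,v}$. A graph is $H$-free if it contains no (not necessarily induced) subgraph isomorphic to $H$. $\lambda(n,H)$ denotes the maximum of $\vartheta(\overline{G})$ over all $H$-free simple graphs $G$ on $n$ vertices. $C_k$ is the cycle of length $k$ and $K_{a,b}$ the complete bipartite graph. The implied constants in (1) may depend on $t$; those in (2) and (3) are as in the paper's statement. *)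

theory Defs
  imports
    Complex_Main
    "Graph_Theory.Pair_Digraph"
    "Graph_Theory.Digraph_Isomorphism"
    "Graph_Theory.Kuratowski"
    "Jordan_Normal_Form.Spectral_Radius"
begin

text \<open>
  A finite simple graph is a symmetric loop-free arc relation, i.e. a
  \<^locale>\<open>pair_graph\<close>; an undirected edge \<open>uv\<close> is the pair of arcs \<open>(u,v)\<close>, \<open>(v,u)\<close>.
\<close>

definition graph_compl :: "'a pair_pre_digraph \<Rightarrow> 'a pair_pre_digraph" where
  "graph_compl G = \<lparr> pverts = pverts G,
     parcs = {(u, v). u \<in> pverts G \<and> v \<in> pverts G \<and> u \<noteq> v \<and> (u, v) \<notin> parcs G} \<rparr>"

definition orthonormal_rep :: "'a pair_pre_digraph \<Rightarrow> nat \<Rightarrow> ('a \<Rightarrow> real vec) \<Rightarrow> bool" where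
  "orthonormal_rep G d f \<longleftrightarrow>
     (\<forall>u\<in>pverts G. f u \<in> carrier_vec d \<and> scalar_prod (f u) (f u) = 1) \<and>
     (\<forall>u\<in>pverts G. \<forall>v\<in>pverts G.
        u \<noteq> v \<and> (u, v) \<notin> parcs G \<longrightarrow> scalar_prod (f u) (f v) = 0)"

definition gram_matrix :: "nat \<Rightarrow> (nat \<Rightarrow> real vec) \<Rightarrow> real mat" where
  "gram_matrix n f = mat n n (\<lambda>(u, v). scalar_prod (f u) (f v))"

definition largest_eigenvalue :: "real mat \<Rightarrow> real" where
  "largest_eigenvalue A = Max (spectrum A)"

text \<open>
  The Lovasz theta function of a graph with vertex set \<open>{0..<n}\<close>, \<open>n \<ge> 1\<close>.  With the convention
  that the vectors of distinct \<^emph>\<open>non-adjacent\<close> vertices are orthogonal, the largest eigenvalue of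
  the Gram matrix, maximised over the orthonormal representations of \<open>G\<close>, is theta of the
  \<^emph>\<open>complement\<close> of \<open>G\<close>; hence theta of \<open>G\<close> itself ranges over those of \<open>graph_compl G\<close>.
  The eigenvalues are at most \<open>n\<close> (the trace), so the supremum is that of a bounded set.
\<close>

definition lovasz_theta :: "nat pair_pre_digraph \<Rightarrow> real" where
  "lovasz_theta G =
     Sup {largest_eigenvalue (gram_matrix (card (pverts G)) f) | f.
            \<exists>d. orthonormal_rep (graph_compl G) d f}"

definition graph_free :: "'b pair_pre_digraph \<Rightarrow> 'a pair_pre_digraph \<Rightarrow> bool" where
  "graph_free H G \<longleftrightarrow>
     \<not> (\<exists>S :: 'a pair_pre_digraph.
          subgraph (with_proj S) (with_proj G) \<and> digraph_iso (with_proj H) (with_proj S))"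

text \<open>
  Everything is invariant under isomorphism, so the graphs on \<open>n\<close> vertices are represented by
  the finitely many ones with vertex set \<open>{0..<n}\<close>.
\<close>

definition lambda_free :: "nat \<Rightarrow> 'b pair_pre_digraph \<Rightarrow> real" where
  "lambda_free n H =
     Max {lovasz_theta (graph_compl G) | G. pair_graph G \<and> pverts G = {0..<n} \<and> graph_free H G}"

definition cycle_graph :: "nat \<Rightarrow> nat pair_pre_digraph" where
  "cycle_graph k = \<lparr> pverts = {0..<k},
     parcs = {(i, j). i < k \<and> j < k \<and> (j = (i + 1) mod k \<or> i = (j + 1) mod k)} \<rparr>"

definition complete_bipartite_graph :: "nat \<Rightarrow> nat \<Rightarrow> (nat + nat) pair_pre_digraph" where
  "complete_bipartite_graph a b = (let U = Inl ` {0..<a}; V = Inr ` {0..<b} in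
     \<lparr> pverts = U \<union> V, parcs = U \<times> V \<union> V \<times> U \<rparr>)"

lemma graph_compl_graph_compl:
  assumes "pair_graph G"
  shows "graph_compl (graph_compl G) = G"
proof -
  interpret pair_graph G by fact
  show ?thesis
    using pair_no_loops in_arcsD1 in_arcsD2
    by (cases G) (force simp: graph_compl_def)
qed

lemma pair_graph_cycle_graph:
  assumes "k \<ge> 3"
  shows "pair_graph (cycle_graph k)"
proof -
  have "parcs (cycle_graph k) \<subseteq> {0..<k} \<times> {0..<k}"
    by (auto simp: cycle_graph_def)
  then have fin: "finite (parcs (cycle_graph k))"
    by (rule finite_subset) simp
  have loop: "Suc i mod k \<noteq> i" if "i < k" for i
    using that assms by (cases "Suc i = k") auto
  show ?thesis
    using fin loop
    by unfold_locales (auto simp: cycle_graph_def symmetric_def sym_def, metis+)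
qed

lemma complete_bipartite_graph:
  "complete_bipartite_digraph a b (with_proj (complete_bipartite_graph a b))"
  unfolding complete_bipartite_digraph_pair_def
proof (intro conjI exI)
  show "pverts (complete_bipartite_graph a b) = Inl ` {0..<a} \<union> Inr ` {0..<b}"
    and "parcs (complete_bipartite_graph a b) =
      Inl ` {0..<a} \<times> Inr ` {0..<b} \<union> Inr ` {0..<b} \<times> Inl ` {0..<a}"
    and "finite (pverts (complete_bipartite_graph a b))"
    by (simp_all add: complete_bipartite_graph_def Let_def)
qed (auto simp: card_image)

end

theory Submission
  imports Defs "HOL-Algebra.Algebraic_Closure_Type" "Berlekamp_Zassenhaus.Finite_Field"
begin

hide_const (open) Polynomials.degree Polynomials.lead_coeff Coset.order up_ring.monom up_ring.coeff
  Divisibility.prime Divisibility.irreducible module.smult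

text \<open>If a symmetric matrix \<open>A\<close> is supported on the edges of an \<open>H\<close>-free graph with \<open>N \<le> n\<close> vertices and
  its eigenvalues are at least \<open>-\<mu>\<close>, then \<open>I + A / \<mu>\<close> is the Gram matrix of an orthonormal representation,
  so \<open>\<lambda>(n, H) \<ge> 1 + (sum of the entries of A) / (\<mu> N)\<close>. Each bound comes from a graph of small negative
  spectrum over a finite field. For \<open>K\<^sub>2\<^sub>,\<^sub>t\<close> and \<open>C\<^sub>4\<close> the codegrees are almost constant. For \<open>C\<^sub>6\<close> and
  \<open>C\<^sub>1\<^sub>0\<close> the graphs are polarities of generalised polygons, and the Fourier transform reduces their
  spectrum to kernels of size \<open>q\<close>. For odd \<open>t\<close> one takes a Cayley graph on \<open>F\<^sup>t\<close> with connection set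
  \<open>{\<phi> x + \<phi> y}\<close>, where \<open>\<phi> x = (x, x\<^sup>3, \<dots>)\<close> and \<open>x\<close>, \<open>y\<close> are separated by the trace of \<open>x ^ (2 t + 1)\<close>: the
  eigenvalues are products of two character sums, which are bounded by Stepanov's method, and a product is
  at least minus a quarter of the squared difference of its factors. For \<open>K\<^sub>t\<^sub>,\<^sub>(\<^sub>t\<^sub>-\<^sub>1\<^sub>)\<^sub>!\<^sub>+\<^sub>1\<close> it is an induced
  subgraph of a projective norm graph, selected by the barrier method so that its smallest eigenvalue is
  reduced as well.\<close>

section \<open>Quadratic forms\<close>

text \<open>Only the negative end of the spectrum is charged, so a bipartite incidence graph is
  useless: its least eigenvalue is minus its degree. Hence the polarities: an even cycle still lifts
  to the incidence structure, while the eigenvalue equal to the degree occurs with positive sign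
  only. For odd \<open>t\<close>, a single curve \<open>{\<phi> x}\<close> as connection set would
  give degree about \<open>q\<close> against negative eigenvalues of order \<open>sqrt q\<close>,
  that is, only the exponent \<open>1 / (2 * t)\<close>; sums of two points raise the degree to the
  order of \<open>q * q\<close>, and the quarter-square inequality keeps the negative part at order
  \<open>q\<close>. Isolated vertices may be added freely, so a geometric sequence of orders
  suffices wherever the constant may depend on \<open>t\<close>. For the bicliques one constant must
  serve all \<open>t\<close>, but consecutive norm graphs differ in order by a factor of about
  \<open>2 ^ t\<close>, which padding cannot absorb; the induced subgraphs fill these gaps. Since
  types cannot depend on \<open>q\<close>, all fields of one characteristic are realised as sets of
  Frobenius fixed points inside one algebraically closed type.\<close>

definition bform :: "'a set \<Rightarrow> ('a \<Rightarrow> 'a \<Rightarrow> real) \<Rightarrow> ('a \<Rightarrow> real) \<Rightarrow> ('a \<Rightarrow> real) \<Rightarrow> real" where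
  "bform V K x y = (\<Sum>u\<in>V. \<Sum>v\<in>V. K u v * x u * y v)"

definition sym_on2 :: "'a set \<Rightarrow> ('a \<Rightarrow> 'a \<Rightarrow> real) \<Rightarrow> bool" where
  "sym_on2 V K \<longleftrightarrow> (\<forall>u\<in>V. \<forall>v\<in>V. K u v = K v u)"

definition psd :: "'a set \<Rightarrow> ('a \<Rightarrow> 'a \<Rightarrow> real) \<Rightarrow> bool" where
  "psd V K \<longleftrightarrow> (\<forall>x. bform V K x x \<ge> 0)"

lemma bform_cong:
  assumes "\<And>u v. u \<in> V \<Longrightarrow> v \<in> V \<Longrightarrow> K u v = K' u v"
    and "\<And>u. u \<in> V \<Longrightarrow> x u = x' u" "\<And>u. u \<in> V \<Longrightarrow> y u = y' u"
  shows "bform V K x y = bform V K' x' y'"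
  unfolding bform_def using assms by (intro sum.cong) auto

lemma bform_sym: "sym_on2 V K \<Longrightarrow> bform V K x y = bform V K y x"
  unfolding bform_def sym_on2_def
  by (subst sum.swap) (auto intro!: sum.cong simp: mult_ac)

lemma bform_add_left: "bform V K (\<lambda>u. x u + y u) z = bform V K x z + bform V K y z"
  by (simp add: bform_def sum.distrib algebra_simps)

lemma bform_add_right: "bform V K z (\<lambda>u. x u + y u) = bform V K z x + bform V K z y"
  by (simp add: bform_def sum.distrib algebra_simps)

lemma bform_scale_left: "bform V K (\<lambda>u. c * x u) z = c * bform V K x z"
  by (simp add: bform_def sum_distrib_left algebra_simps)

lemma bform_scale_right: "bform V K z (\<lambda>u. c * x u) = c * bform V K z x"
  by (simp add: bform_def sum_distrib_left algebra_simps)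

lemma bform_add_kernel: "bform V (\<lambda>u v. K u v + L u v) x y = bform V K x y + bform V L x y"
  by (simp add: bform_def sum.distrib algebra_simps)

lemma bform_scale_kernel: "bform V (\<lambda>u v. c * K u v) x y = c * bform V K x y"
  by (simp add: bform_def sum_distrib_left algebra_simps)

lemma bform_diff_kernel: "bform V (\<lambda>u v. K u v - L u v) x y = bform V K x y - bform V L x y"
  by (simp add: bform_def sum_subtractf algebra_simps)

lemma bform_delta:
  assumes "finite V"
  shows "bform V (\<lambda>u v. if u = v then c else 0) x y = c * (\<Sum>u\<in>V. x u * y u)"
proof -
  have "(\<Sum>v\<in>V. (if u = v then c else 0) * x u * y v) = c * (x u * y u)" if "u \<in> V" for u
  proof -
    have "(\<Sum>v\<in>V. (if u = v then c else 0) * x u * y v) = (\<Sum>v\<in>V. if u = v then c * (x u * y u) else 0)"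
      by (intro sum.cong) auto
    then show ?thesis using assms that by simp
  qed
  then show ?thesis by (simp add: bform_def sum_distrib_left)
qed

lemma bform_const: "bform V (\<lambda>u v. c) x y = c * (\<Sum>u\<in>V. x u) * (\<Sum>u\<in>V. y u)"
  by (simp add: bform_def sum_distrib_left sum_distrib_right mult_ac)

lemma bform_Cauchy_Schwarz:
  assumes "sym_on2 V K" "psd V K"
  shows "(bform V K x y)\<^sup>2 \<le> bform V K x x * bform V K y y"
proof -
  let ?b = "bform V K"
  have q: "?b x x + 2 * t * ?b x y + t\<^sup>2 * ?b y y \<ge> 0" for t
  proof -
    have "?b (\<lambda>u. x u + t * y u) (\<lambda>u. x u + t * y u) \<ge> 0"
      using assms(2) by (simp add: psd_def)
    then show ?thesis
      using bform_sym[OF assms(1), of y x]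
      by (simp add: bform_add_left bform_add_right bform_scale_left bform_scale_right
          power2_eq_square algebra_simps)
  qed
  have yy: "?b y y \<ge> 0" using assms(2) by (simp add: psd_def)
  show ?thesis
  proof (cases "?b y y = 0")
    case True
    have "?b x y = 0"
    proof (rule ccontr)
      assume "?b x y \<noteq> 0"
      \<comment> \<open>At this \<open>t\<close> the quadratic, which is affine in \<open>t\<close>
        here, takes the value -1.\<close>
      then show False
        using q[of "- (?b x x + 1) / (2 * ?b x y)"] True by (simp add: field_simps)
    qed
    then show ?thesis using True by simp
  next
    case False
    then have "?b y y > 0" using yy by simp
    then show ?thesis
      using q[of "- ?b x y / ?b y y"] by (simp add: field_simps power2_eq_square)
  qed
qed

text \<open>Cholesky elimination: the new element \<open>w\<close> is the pivot, and the recursion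
  continues with the Schur complement \<open>K'\<close>. A zero pivot forces its whole row to
  vanish, so that \<open>w\<close> can be sent to the zero vector.\<close>

lemma psd_gram:
  fixes K :: "'a \<Rightarrow> 'a \<Rightarrow> real"
  assumes "finite V" "sym_on2 V K" "psd V K"
  shows "\<exists>(d::nat) f. \<forall>u\<in>V. \<forall>v\<in>V. K u v = (\<Sum>i<d. f u i * f v i)"
  using assms
proof (induction V arbitrary: K rule: finite_induct)
  case empty
  then show ?case by simp
next
  case (insert w V)
  note sym = insert.prems(1)[unfolded sym_on2_def, rule_format]
  have form: "bform (insert w V) K x x =
      K w w * (x w)\<^sup>2 + 2 * x w * (\<Sum>v\<in>V. K w v * x v) + bform V K x x" for x
  proof -
    have "bform (insert w V) K x x = K w w * (x w)\<^sup>2 + (\<Sum>v\<in>V. K w v * x w * x v)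
        + (\<Sum>u\<in>V. K u w * x u * x w) + bform V K x x"
      using insert.hyps by (simp add: bform_def sum.distrib power2_eq_square algebra_simps)
    also have "(\<Sum>u\<in>V. K u w * x u * x w) = (\<Sum>v\<in>V. K w v * x w * x v)"
      using sym by (intro sum.cong) auto
    finally show ?thesis by (simp add: sum_distrib_left mult_ac)
  qed
  have nonneg: "K w w * (x w)\<^sup>2 + 2 * x w * (\<Sum>v\<in>V. K w v * x v) + bform V K x x \<ge> 0" for x
    using insert.prems(2) form by (simp add: psd_def)
  have symV: "sym_on2 V K" using sym by (auto simp: sym_on2_def)
  have psdV: "psd V K"
    unfolding psd_def
  proof
    fix x :: "'a \<Rightarrow> real"
    have "bform V K (x(w := 0)) (x(w := 0)) = bform V K x x"
      using insert.hyps by (intro bform_cong) auto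
    then show "bform V K x x \<ge> 0" using nonneg[of "x(w := 0)"] by simp
  qed
  have ww: "K w w \<ge> 0"
    using nonneg[of "\<lambda>u. if u = w then 1 else 0"] insert.hyps
    by (simp add: bform_def if_distrib sum.If_cases cong: if_cong) 
  define K' where "K' = (\<lambda>u v. K u v - K w u * K w v / K w w)"
  show ?case
  proof (cases "K w w = 0")
    case True
    have zero: "K w u = 0" if "u \<in> V" for u
    proof (rule ccontr)
      assume nz: "K w u \<noteq> 0"
      \<comment> \<open>The vector with entries \<open>t\<close> at \<open>w\<close> and 1 at
        \<open>u\<close> would give the form the value -1.\<close>
      define t where "t = - (K u u + 1) / (2 * K w u)"
      define x where "x = (\<lambda>v. if v = w then t else if v = u then 1 else (0::real))"
      have uw: "u \<noteq> w" using that insert.hyps by auto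
      have s: "(\<Sum>v\<in>V. K w v * x v) = K w u"
      proof -
        have "(\<Sum>v\<in>V. K w v * x v) = (\<Sum>v\<in>V. if v = u then K w u else 0)"
          using insert.hyps by (intro sum.cong) (auto simp: x_def)
        then show ?thesis using that insert.hyps by simp
      qed
      have "bform V K x x = bform V K (\<lambda>v. if v = u then 1 else 0) (\<lambda>v. if v = u then 1 else 0)"
        using insert.hyps by (intro bform_cong) (auto simp: x_def)
      also have "\<dots> = K u u"
      proof -
        have "(\<Sum>v\<in>V. K a v * (if a = u then 1 else 0) * (if v = u then 1 else 0)) = (if a = u then K u u else 0)" for a
        proof -
          have "(\<Sum>v\<in>V. K a v * (if a = u then 1 else 0) * (if v = u then 1 else 0)) =
            (\<Sum>v\<in>V. if v = u then (if a = u then K u u else 0) else 0)"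
            by (intro sum.cong) auto
          then show ?thesis using that insert.hyps by simp
        qed
        then show ?thesis using that insert.hyps by (simp add: bform_def)
      qed
      finally show False using nonneg[of x] s True nz by (simp add: x_def t_def field_simps)
    qed
    obtain d :: nat and f where f: "\<forall>u\<in>V. \<forall>v\<in>V. K u v = (\<Sum>i<d. f u i * f v i)"
      using insert.IH[OF symV psdV] by auto
    have "\<forall>u\<in>insert w V. \<forall>v\<in>insert w V. K u v = (\<Sum>i<d. (f(w := \<lambda>_. 0)) u i * (f(w := \<lambda>_. 0)) v i)"
      using f True zero sym insert.hyps by auto
    then show ?thesis by blast
  next
    case False
    then have pos: "K w w > 0" using ww by simp
    have sym': "sym_on2 V K'" using sym by (auto simp: sym_on2_def K'_def)
    have psd': "psd V K'"
      unfolding psd_def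
    proof
      fix x :: "'a \<Rightarrow> real"
      define s where "s = (\<Sum>v\<in>V. K w v * x v)"
      have eq: "bform V K' x x = bform V K x x - s\<^sup>2 / K w w"
      proof -
        have "bform V (\<lambda>u v. K w u * K w v / K w w) x x = s\<^sup>2 / K w w"
          by (simp add: bform_def s_def power2_eq_square sum_product sum_divide_distrib mult_ac)
        then show ?thesis unfolding K'_def bform_diff_kernel by simp
      qed
      \<comment> \<open>This value at \<open>w\<close> minimises the form in that coordinate; the
        minimum is the form of the Schur complement.\<close>
      define y where "y = x(w := - s / K w w)"
      have 1: "(\<Sum>v\<in>V. K w v * y v) = s"
        unfolding s_def y_def using insert.hyps by (intro sum.cong) auto
      have 2: "bform V K y y = bform V K x x"
        using insert.hyps by (intro bform_cong) (auto simp: y_def)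
      show "0 \<le> bform V K' x x"
        using nonneg[of y] pos unfolding 1 2 eq by (simp add: y_def field_simps power2_eq_square)
    qed
    obtain d :: nat and f where f: "\<forall>u\<in>V. \<forall>v\<in>V. K' u v = (\<Sum>i<d. f u i * f v i)"
      using insert.IH[OF sym' psd'] by auto
    define g where "g = (\<lambda>u i. if u = w then (if i = d then sqrt (K w w) else 0)
      else if i = d then K w u / sqrt (K w w) else f u i)"
    have "K u v = (\<Sum>i<Suc d. g u i * g v i)" if "u \<in> insert w V" "v \<in> insert w V" for u v
    proof -
      have uw: "K u w = K w u" and vw: "K v w = K w v" using sym that by auto
      have K': "K u v = K' u v + K w u * K w v / K w w" by (simp add: K'_def)
      show ?thesis
        using that f pos insert.hyps uw vw K' by (auto simp: g_def)
    qed
    then show ?thesis by blast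
  qed
qed

lemma sum_mult_le_sum_squares:
  fixes x :: "'a \<Rightarrow> real"
  assumes "finite V" "u \<in> V" "v \<in> V"
  shows "\<bar>x u\<bar> * \<bar>x v\<bar> \<le> (\<Sum>u\<in>V. (x u)\<^sup>2)"
proof -
  have *: "(x u)\<^sup>2 \<le> (\<Sum>u\<in>V. (x u)\<^sup>2)" if "u \<in> V" for u
    using that assms by (intro member_le_sum) auto
  have "2 * (\<bar>x u\<bar> * \<bar>x v\<bar>) \<le> (x u)\<^sup>2 + (x v)\<^sup>2"
    using sum_squares_bound[of "\<bar>x u\<bar>" "\<bar>x v\<bar>"] by simp
  then show ?thesis using *[OF assms(2)] *[OF assms(3)] by linarith
qed

text \<open>With \<open>w = C x\<close>, so that \<open>K w = x\<close>, Cauchy-Schwarz for the form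
  of \<open>K\<close> bounds the fourth power of the length of \<open>x\<close> by the form at
  \<open>x\<close> times the form at \<open>w\<close>, and the latter is at most
  \<open>\<gamma>\<close> times the squared length of \<open>x\<close>. This replaces a compactness
  argument on the unit sphere.\<close>

lemma psd_invertible_coercive:
  fixes K C :: "'a \<Rightarrow> 'a \<Rightarrow> real"
  assumes fin: "finite V" and sym: "sym_on2 V K" and psd: "psd V K"
    and inv: "\<And>u w. u \<in> V \<Longrightarrow> w \<in> V \<Longrightarrow> (\<Sum>v\<in>V. K u v * C v w) = (if u = w then 1 else 0)"
  shows "\<exists>e>0. \<forall>x. bform V K x x \<ge> e * (\<Sum>u\<in>V. (x u)\<^sup>2)"
proof -
  define \<gamma> where "\<gamma> = 1 + (\<Sum>u\<in>V. \<Sum>v\<in>V. \<bar>C u v\<bar>)"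
  have \<gamma>: "\<gamma> > 0" unfolding \<gamma>_def by (intro add_pos_nonneg sum_nonneg) auto
  have "bform V K x x \<ge> (1 / \<gamma>) * (\<Sum>u\<in>V. (x u)\<^sup>2)" for x
  proof -
    define S where "S = (\<Sum>u\<in>V. (x u)\<^sup>2)"
    define w where "w = (\<lambda>v. \<Sum>k\<in>V. C v k * x k)"
    have Kw: "(\<Sum>v\<in>V. K u v * w v) = x u" if "u \<in> V" for u
    proof -
      have "(\<Sum>v\<in>V. K u v * w v) = (\<Sum>v\<in>V. \<Sum>k\<in>V. K u v * C v k * x k)"
        by (simp add: w_def sum_distrib_left mult_ac)
      also have "\<dots> = (\<Sum>k\<in>V. (\<Sum>v\<in>V. K u v * C v k) * x k)"
        by (subst sum.swap) (simp add: sum_distrib_right)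
      also have "\<dots> = (\<Sum>k\<in>V. if u = k then x u else 0)"
        using that inv by (intro sum.cong) auto
      finally show ?thesis using that fin by simp
    qed
    have form: "bform V K y w = (\<Sum>u\<in>V. y u * x u)" for y
    proof -
      have "bform V K y w = (\<Sum>u\<in>V. y u * (\<Sum>v\<in>V. K u v * w v))"
        by (simp add: bform_def sum_distrib_left mult_ac)
      then show ?thesis using Kw by simp
    qed
    have xw: "bform V K x w = S" by (simp add: form S_def power2_eq_square)
    have ww: "bform V K w w \<le> \<gamma> * S"
    proof -
      have "bform V K w w = (\<Sum>u\<in>V. \<Sum>k\<in>V. C u k * (x u * x k))"
        unfolding form by (simp add: w_def sum_distrib_right sum_distrib_left mult_ac)
      also have "\<dots> \<le> (\<Sum>u\<in>V. \<Sum>k\<in>V. \<bar>C u k\<bar> * S)"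
      proof (intro sum_mono)
        fix u k assume "u \<in> V" "k \<in> V"
        then have "\<bar>x u\<bar> * \<bar>x k\<bar> \<le> S" unfolding S_def using fin by (intro sum_mult_le_sum_squares)
        then have "\<bar>C u k * (x u * x k)\<bar> \<le> \<bar>C u k\<bar> * S"
          by (simp add: abs_mult mult_left_mono)
        then show "C u k * (x u * x k) \<le> \<bar>C u k\<bar> * S" by linarith
      qed
      also have "\<dots> = (\<Sum>u\<in>V. \<Sum>k\<in>V. \<bar>C u k\<bar>) * S" by (simp add: sum_distrib_right)
      also have "\<dots> \<le> \<gamma> * S" unfolding \<gamma>_def S_def
        by (intro mult_right_mono) (auto intro: sum_nonneg)
      finally show ?thesis .
    qed
    have S0: "S \<ge> 0" unfolding S_def by (intro sum_nonneg) auto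
    have xx: "bform V K x x \<ge> 0" using psd by (simp add: psd_def)
    have "S\<^sup>2 \<le> bform V K x x * (\<gamma> * S)"
      using bform_Cauchy_Schwarz[OF sym psd, of x w] mult_left_mono[OF ww xx] xw by simp
    then have "S = 0 \<or> S \<le> bform V K x x * \<gamma>"
      using S0 by (cases "S = 0") (auto simp: power2_eq_square mult_ac)
    then show ?thesis using \<gamma> xx by (auto simp: S_def[symmetric] field_simps)
  qed
  then show ?thesis using \<gamma> by (intro exI[of _ "1 / \<gamma>"]) auto
qed

text \<open>The infimum of all \<open>y\<close> such that \<open>y - K\<close> is positive semidefinite is an eigenvalue:
  otherwise \<open>y - K\<close> would be invertible, hence coercive, and \<open>y\<close> could be decreased.\<close>

lemma eigenvalue_ge_Rayleigh:
  fixes K :: "nat \<Rightarrow> nat \<Rightarrow> real"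
  assumes sym: "sym_on2 {0..<n} K" and x: "(\<Sum>u<n. (x u)\<^sup>2) > 0"
    and r: "bform {0..<n} K x x \<ge> r * (\<Sum>u<n. (x u)\<^sup>2)"
  shows "\<exists>y\<ge>r. eigenvalue (mat n n (\<lambda>(i, j). K i j)) y"
proof -
  let ?V = "{0..<n}"
  have V: "?V = {..<n}" by auto
  define B where "B = (\<lambda>y u v. (if u = v then y else 0) - K u v)"
  have form: "bform ?V (B y) z z = y * (\<Sum>u<n. (z u)\<^sup>2) - bform ?V K z z" for y z
    unfolding B_def bform_diff_kernel by (simp add: bform_delta V power2_eq_square)
  define Y where "Y = {y. psd ?V (B y)}"
  \<comment> \<open>A crude upper bound for the form, which makes \<open>Y\<close>
    non-empty.\<close>
  define \<kappa> where "\<kappa> = (\<Sum>u\<in>?V. \<Sum>v\<in>?V. \<bar>K u v\<bar>)"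
  have "\<kappa> \<in> Y"
    unfolding Y_def psd_def mem_Collect_eq form
  proof
    fix z :: "nat \<Rightarrow> real"
    have "bform ?V K z z \<le> (\<Sum>u\<in>?V. \<Sum>v\<in>?V. \<bar>K u v\<bar> * (\<Sum>u<n. (z u)\<^sup>2))"
      unfolding bform_def
    proof (intro sum_mono)
      fix u v assume "u \<in> ?V" "v \<in> ?V"
      then have "\<bar>z u\<bar> * \<bar>z v\<bar> \<le> (\<Sum>u<n. (z u)\<^sup>2)" by (intro sum_mult_le_sum_squares) auto
      then have "\<bar>K u v * z u * z v\<bar> \<le> \<bar>K u v\<bar> * (\<Sum>u<n. (z u)\<^sup>2)"
        by (simp add: abs_mult mult_left_mono mult.assoc)
      then show "K u v * z u * z v \<le> \<bar>K u v\<bar> * (\<Sum>u<n. (z u)\<^sup>2)" by linarith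
    qed
    then show "0 \<le> \<kappa> * (\<Sum>u<n. (z u)\<^sup>2) - bform ?V K z z"
      by (simp add: \<kappa>_def sum_distrib_right)
  qed
  have lower: "y \<ge> r" if "y \<in> Y" for y
  proof -
    have "y * (\<Sum>u<n. (x u)\<^sup>2) - bform ?V K x x \<ge> 0" using that by (simp add: Y_def psd_def form)
    then have "y * (\<Sum>u<n. (x u)\<^sup>2) \<ge> r * (\<Sum>u<n. (x u)\<^sup>2)" using r by linarith
    then show ?thesis using x by simp
  qed
  have bdd: "bdd_below Y" using lower by (auto simp: bdd_below_def)
  define y where "y = Inf Y"
  have ne: "Y \<noteq> {}" using \<open>\<kappa> \<in> Y\<close> by auto
  have "y \<ge> r" unfolding y_def using ne lower by (intro cInf_greatest) auto
  have psdy: "psd ?V (B y)"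
    unfolding psd_def form
  proof
    fix z :: "nat \<Rightarrow> real"
    show "0 \<le> y * (\<Sum>u<n. (z u)\<^sup>2) - bform ?V K z z"
    proof (cases "(\<Sum>u<n. (z u)\<^sup>2) = 0")
      case True
      then show ?thesis using \<open>\<kappa> \<in> Y\<close> by (auto simp: Y_def psd_def form dest: spec[of _ z])
    next
      case False
      then have pos: "(\<Sum>u<n. (z u)\<^sup>2) > 0" by (simp add: sum_nonneg order_less_le)
      have "bform ?V K z z / (\<Sum>u<n. (z u)\<^sup>2) \<le> y"
        unfolding y_def
      proof (intro cInf_greatest ne)
        fix y' assume "y' \<in> Y"
        then have "0 \<le> y' * (\<Sum>u<n. (z u)\<^sup>2) - bform ?V K z z" by (simp add: Y_def psd_def form)
        then show "bform ?V K z z / (\<Sum>u<n. (z u)\<^sup>2) \<le> y'" using pos by (simp add: field_simps)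
      qed
      then show ?thesis using pos by (simp add: field_simps)
    qed
  qed
  define M where "M = mat n n (\<lambda>(i, j). K i j)"
  have M: "M \<in> carrier_mat n n" by (simp add: M_def)
  define N where "N = mat n n (\<lambda>(i, j). B y i j)"
  have N: "N \<in> carrier_mat n n" by (simp add: N_def)
  have NM: "N = (-1) \<cdot>\<^sub>m char_matrix M y"
    by (rule eq_matI) (auto simp: N_def M_def B_def char_matrix_def)
  have "det N = 0"
  proof (rule ccontr)
    assume "det N \<noteq> 0"
    then obtain C where C: "C \<in> carrier_mat n n" "N * C = 1\<^sub>m n"
      using det_non_zero_imp_unit[OF N, of "()"] by (auto simp: Units_def ring_mat_def)
    have inv: "(\<Sum>v\<in>?V. B y u v * C $$ (v, w)) = (if u = w then 1 else 0)"
      if "u \<in> ?V" "w \<in> ?V" for u w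
    proof -
      have "(N * C) $$ (u, w) = (\<Sum>v\<in>?V. B y u v * C $$ (v, w))"
        using that C(1) by (simp add: N_def scalar_prod_def)
      then show ?thesis using C(2) that by simp
    qed
    have symB: "sym_on2 ?V (B y)" using sym by (auto simp: sym_on2_def B_def)
    obtain e where e: "e > 0" "\<And>z. bform ?V (B y) z z \<ge> e * (\<Sum>u\<in>?V. (z u)\<^sup>2)"
      using psd_invertible_coercive[OF _ symB psdy inv] by auto
    have "y - e \<in> Y"
      unfolding Y_def psd_def mem_Collect_eq
    proof
      fix z :: "nat \<Rightarrow> real"
      show "0 \<le> bform ?V (B (y - e)) z z"
        using e(2)[of z] unfolding form by (simp add: V algebra_simps)
    qed
    then have "y \<le> y - e" unfolding y_def using bdd by (intro cInf_lower)
    then show False using e(1) by simp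
  qed
  moreover have cM: "char_matrix M y \<in> carrier_mat n n" using M by (auto simp: char_matrix_def)
  ultimately have "det (char_matrix M y) = 0"
    using NM det_smult[of "-1" "char_matrix M y"] cM by auto
  then have "eigenvalue M y" using eigenvalue_det[OF M] by simp
  then show ?thesis using \<open>y \<ge> r\<close> M_def by auto
qed

section \<open>A lower bound for theta\<close>

lemma scalar_prod_unit_bound:
  fixes a b :: "real vec"
  assumes "a \<in> carrier_vec d" "b \<in> carrier_vec d" "scalar_prod a a = 1" "scalar_prod b b = 1"
  shows "\<bar>scalar_prod a b\<bar> \<le> 1"
proof -
  have sums: "(\<Sum>i=0..<d. (a $ i)\<^sup>2) = 1" "(\<Sum>i=0..<d. (b $ i)\<^sup>2) = 1"
    using assms by (auto simp: scalar_prod_def power2_eq_square)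
  have ab: "scalar_prod a b = (\<Sum>i=0..<d. a $ i * b $ i)"
    using assms by (auto simp: scalar_prod_def)
  have "0 \<le> (\<Sum>i=0..<d. (a $ i + b $ i)\<^sup>2)" "0 \<le> (\<Sum>i=0..<d. (a $ i - b $ i)\<^sup>2)"
    by (auto intro: sum_nonneg)
  moreover have "(\<Sum>i=0..<d. (a $ i + b $ i)\<^sup>2) = 2 + 2 * scalar_prod a b"
    by (simp add: ab sums power2_sum sum.distrib sum_distrib_left mult_ac)
  moreover have "(\<Sum>i=0..<d. (a $ i - b $ i)\<^sup>2) = 2 - 2 * scalar_prod a b"
    by (simp add: ab sums power2_diff sum.distrib sum_subtractf sum_distrib_left mult_ac)
  ultimately show ?thesis by linarith
qed

text \<open>The eigenvector equation is read at a coordinate of largest absolute value. The bound is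
  what makes the supremum in \<open>lovasz_theta\<close> one of a bounded set.\<close>

lemma eigenvalue_bounded_entries:
  fixes A :: "real mat"
  assumes A: "A \<in> carrier_mat n n" and ent: "\<And>i j. i < n \<Longrightarrow> j < n \<Longrightarrow> \<bar>A $$ (i, j)\<bar> \<le> 1"
    and ev: "eigenvalue A \<mu>"
  shows "\<mu> \<le> real n"
proof -
  obtain v where v: "v \<in> carrier_vec n" "v \<noteq> 0\<^sub>v n" and Av: "A *\<^sub>v v = \<mu> \<cdot>\<^sub>v v"
    using ev A by (auto simp: eigenvalue_def eigenvector_def)
  obtain k where k: "k < n" "v $ k \<noteq> 0" using v by (metis eq_vecI index_zero_vec carrier_vecD)
  define m where "m = Max ((\<lambda>i. \<bar>v $ i\<bar>) ` {0..<n})"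
  have fin: "finite ((\<lambda>i. \<bar>v $ i\<bar>) ` {0..<n})" by simp
  have le: "\<bar>v $ i\<bar> \<le> m" if "i < n" for i unfolding m_def using that by (intro Max_ge) auto
  have "m \<in> (\<lambda>i. \<bar>v $ i\<bar>) ` {0..<n}" unfolding m_def using k(1) by (intro Max_in) auto
  then obtain i where i: "i < n" "m = \<bar>v $ i\<bar>" by auto
  have m: "m > 0" using le[OF k(1)] k(2) by linarith
  have "(A *\<^sub>v v) $ i = (\<Sum>j=0..<n. A $$ (i, j) * v $ j)"
    using A v i by (auto simp: scalar_prod_def)
  then have "\<mu> * v $ i = (\<Sum>j=0..<n. A $$ (i, j) * v $ j)" using Av v i by simp
  then have "\<bar>\<mu>\<bar> * m \<le> (\<Sum>j=0..<n. \<bar>A $$ (i, j) * v $ j\<bar>)"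
    using sum_abs[of "\<lambda>j. A $$ (i, j) * v $ j" "{0..<n}"] by (simp add: i(2) abs_mult[symmetric])
  also have "\<dots> \<le> (\<Sum>j=0..<n. 1 * m)"
    unfolding abs_mult using ent le i by (intro sum_mono mult_mono) auto
  finally have "\<bar>\<mu>\<bar> * m \<le> real n * m" by simp
  then show ?thesis using m by simp
qed

lemma largest_eigenvalue_le_lovasz_theta:
  assumes G: "pair_graph G" "pverts G = {0..<n}" and f: "orthonormal_rep G d f"
  shows "largest_eigenvalue (gram_matrix n f) \<le> lovasz_theta (graph_compl G)"
proof -
  have cc: "graph_compl (graph_compl G) = G" using G by (intro graph_compl_graph_compl)
  have cn: "card (pverts (graph_compl G)) = n" using G by (simp add: graph_compl_def)
  let ?S = "{largest_eigenvalue (gram_matrix n f) |f. \<exists>d. orthonormal_rep G d f}"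
  \<comment> \<open>The term \<open>Max {}\<close> covers an empty spectrum, as for
    \<open>n = 0\<close>, where \<open>largest_eigenvalue\<close> is an unspecified value.\<close>
  have bound: "largest_eigenvalue (gram_matrix n g) \<le> max (real n) (Max {})"
    if "orthonormal_rep G e g" for e g
  proof (cases "spectrum (gram_matrix n g) = {}")
    case True
    then show ?thesis by (simp add: largest_eigenvalue_def)
  next
    case False
    have gm: "gram_matrix n g \<in> carrier_mat n n" by (simp add: gram_matrix_def)
    have ev: "\<mu> \<le> real n" if "\<mu> \<in> spectrum (gram_matrix n g)" for \<mu>
    proof (rule eigenvalue_bounded_entries[OF gm])
      show "eigenvalue (gram_matrix n g) \<mu>" using that by (simp add: spectrum_def)
      fix i j assume "i < n" "j < n"
      then show "\<bar>gram_matrix n g $$ (i, j)\<bar> \<le> 1"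
        using \<open>orthonormal_rep G e g\<close> G(2)
        by (auto simp: gram_matrix_def orthonormal_rep_def intro!: scalar_prod_unit_bound[of _ e])
    qed
    have "Max (spectrum (gram_matrix n g)) \<in> spectrum (gram_matrix n g)"
      using False card_finite_spectrum(1)[OF gm] by (intro Max_in)
    then have "Max (spectrum (gram_matrix n g)) \<le> real n" by (rule ev)
    then show ?thesis by (simp add: largest_eigenvalue_def)
  qed
  have "bdd_above ?S" using bound by (auto simp: bdd_above_def)
  then have "largest_eigenvalue (gram_matrix n f) \<le> Sup ?S"
    using f by (intro cSup_upper) auto
  then show ?thesis by (simp add: lovasz_theta_def cc cn)
qed

lemma lovasz_theta_le_lambda_free:
  assumes "pair_graph G" "pverts G = {0..<n}" "graph_free H G"
  shows "lovasz_theta (graph_compl G) \<le> lambda_free n H"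
proof -
  let ?\<G> = "{G :: nat pair_pre_digraph. pair_graph G \<and> pverts G = {0..<n} \<and> graph_free H G}"
  have "?\<G> \<subseteq> (\<lambda>E. \<lparr>pverts = {0..<n}, parcs = E\<rparr>) ` Pow ({0..<n} \<times> {0..<n})"
  proof
    fix G assume G: "G \<in> ?\<G>"
    then interpret pair_graph G by simp
    have "G = \<lparr>pverts = {0..<n}, parcs = parcs G\<rparr>" using G by (cases G) auto
    moreover have "parcs G \<subseteq> {0..<n} \<times> {0..<n}" using in_arcsD1 in_arcsD2 G by auto
    ultimately show "G \<in> (\<lambda>E. \<lparr>pverts = {0..<n}, parcs = E\<rparr>) ` Pow ({0..<n} \<times> {0..<n})" by blast
  qed
  then have "finite ?\<G>" by (rule finite_subset) simp
  then have "finite ((\<lambda>G. lovasz_theta (graph_compl G)) ` ?\<G>)" by (rule finite_imageI)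
  moreover have "{lovasz_theta (graph_compl G) | G. pair_graph G \<and> pverts G = {0..<n} \<and> graph_free H G}
      = (\<lambda>G. lovasz_theta (graph_compl G)) ` ?\<G>" by auto
  ultimately show ?thesis unfolding lambda_free_def using assms by (intro Max_ge) auto
qed

text \<open>Containment in a bare relation on an arbitrary type: the algebraic constructions keep
  their natural vertices, and the passage to graphs on \<open>{0..<n}\<close> happens only once, in
  \<open>lambda_free_ge\<close>.\<close>

definition embeds :: "'b pair_pre_digraph \<Rightarrow> 'v set \<Rightarrow> ('v \<Rightarrow> 'v \<Rightarrow> bool) \<Rightarrow> bool" where
  "embeds H V E \<longleftrightarrow> (\<exists>h. inj_on h (pverts H) \<and> h ` pverts H \<subseteq> V \<and> (\<forall>(a, b)\<in>parcs H. E (h a) (h b)))"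

lemma not_graph_freeD:
  fixes H :: "'b pair_pre_digraph" and G :: "'a pair_pre_digraph"
  assumes "\<not> graph_free H G"
  shows "\<exists>h. inj_on h (pverts H) \<and> h ` pverts H \<subseteq> pverts G \<and> (\<forall>(a, b)\<in>parcs H. (h a, h b) \<in> parcs G)"
proof -
  obtain S :: "'a pair_pre_digraph" and f where S: "subgraph (with_proj S) (with_proj G)"
    and iso: "pre_digraph.digraph_isomorphism (with_proj H) f" and eq: "with_proj S = app_iso f (with_proj H)"
    using assms by (auto simp: graph_free_def digraph_iso_def)
  have verts: "pverts S = iso_verts f ` pverts H"
    using arg_cong[OF eq, of verts] by simp
  have arcs: "parcs S = iso_arcs f ` parcs H"
    using arg_cong[OF eq, of arcs] by simp
  have tl: "iso_tail f = fst" and hd: "iso_head f = snd"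
    using arg_cong[OF eq, of tail] arg_cong[OF eq, of head] by simp_all
  note iso' = iso[unfolded pre_digraph.digraph_isomorphism_def]
  have arc: "iso_arcs f (a, b) = (iso_verts f a, iso_verts f b)" if "(a, b) \<in> parcs H" for a b
  proof -
    have "iso_verts f a = fst (iso_arcs f (a, b))" "iso_verts f b = snd (iso_arcs f (a, b))"
      using iso' that by (auto simp: tl hd)
    then show ?thesis by (simp add: prod_eq_iff)
  qed
  have "pverts S \<subseteq> pverts G" "parcs S \<subseteq> parcs G"
    using S by (auto simp: subgraph_def)
  moreover have "inj_on (iso_verts f) (pverts H)" using iso' by simp
  ultimately show ?thesis
    using verts arcs arc by (intro exI[of _ "iso_verts f"]) (auto simp: image_subset_iff)
qed

text \<open>The Gram matrix of the representation is \<open>I + A / \<mu>\<close> on \<open>V\<close>, extended by isolated vertices;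
  the lower bound is its Rayleigh quotient at the indicator function of \<open>V\<close>.\<close>

theorem lambda_free_ge:
  fixes V :: "'v set" and A :: "'v \<Rightarrow> 'v \<Rightarrow> real" and H :: "'b pair_pre_digraph"
  assumes V: "finite V" "V \<noteq> {}" "card V \<le> n"
    and E: "symp E" and emb: "\<not> embeds H V E"
    and H: "\<And>a. a \<in> pverts H \<Longrightarrow> \<exists>b. (a, b) \<in> parcs H"
    and A: "sym_on2 V A" "\<And>u v. u \<in> V \<Longrightarrow> v \<in> V \<Longrightarrow> A u v \<noteq> 0 \<Longrightarrow> u \<noteq> v \<and> E u v"
    and \<mu>: "\<mu> > 0" "\<And>x. bform V A x x \<ge> - \<mu> * (\<Sum>u\<in>V. (x u)\<^sup>2)"
  shows "lambda_free n H \<ge> 1 + (\<Sum>u\<in>V. \<Sum>v\<in>V. A u v) / (\<mu> * card V)"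
proof -
  define m where "m = card V"
  have m: "m > 0" "m \<le> n" using V by (auto simp: m_def card_gt_0_iff)
  obtain g where g: "bij_betw g {0..<m} V"
    using ex_bij_betw_nat_finite[OF V(1)] by (auto simp: m_def)
  have gV: "g i \<in> V" if "i < m" for i using g that by (auto simp: bij_betw_def)
  have ginj: "g i = g j \<longleftrightarrow> i = j" if "i < m" "j < m" for i j
    using g that by (auto simp: bij_betw_def inj_on_def)
  define G where "G = \<lparr>pverts = {0..<n}, parcs = {(i, j). i < m \<and> j < m \<and> i \<noteq> j \<and> E (g i) (g j)}\<rparr>"
  have vG: "pverts G = {0..<n}" by (simp add: G_def)
  have pG: "pair_graph G"
  proof -
    have "parcs G \<subseteq> {0..<n} \<times> {0..<n}" using m by (auto simp: G_def)
    then have fin: "finite (parcs G)" by (rule finite_subset) simp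
    show ?thesis
      using fin m E
      by unfold_locales (auto simp: G_def symmetric_def sym_def dest: sympD)
  qed
  have free: "graph_free H G"
  proof (rule ccontr)
    assume "\<not> graph_free H G"
    then obtain h where h: "inj_on h (pverts H)"
      "\<forall>(a, b)\<in>parcs H. (h a, h b) \<in> parcs G" using not_graph_freeD by blast
    \<comment> \<open>Every vertex of \<open>H\<close> lies on an arc, so a copy of \<open>H\<close>
      avoids the isolated vertices \<open>m, ..., n - 1\<close>.\<close>
    have hm: "h a < m" if "a \<in> pverts H" for a
      using H[OF that] h(2) by (auto simp: G_def)
    have "inj_on (g \<circ> h) (pverts H)"
      using h(1) hm ginj by (auto simp: inj_on_def)
    moreover have "(g \<circ> h) ` pverts H \<subseteq> V" using hm gV by auto
    moreover have "\<forall>(a, b)\<in>parcs H. E ((g \<circ> h) a) ((g \<circ> h) b)" using h(2) by (auto simp: G_def)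
    ultimately show False using emb unfolding embeds_def by blast
  qed
  define K where "K = (\<lambda>i j. (if i = j then 1 else 0) + (if i < m \<and> j < m then A (g i) (g j) / \<mu> else 0))"
  have symK: "sym_on2 {0..<n} K" using A(1) gV by (auto simp: sym_on2_def K_def)
  have formK: "bform {0..<n} K x x = (\<Sum>i<n. (x i)\<^sup>2) + (\<Sum>i<m. \<Sum>j<m. A (g i) (g j) * x i * x j) / \<mu>" for x
  proof -
    have "bform {0..<n} (\<lambda>i j. if i < m \<and> j < m then A (g i) (g j) / \<mu> else 0) x x =
        (\<Sum>i=0..<n. \<Sum>j=0..<n. if i < m \<and> j < m then A (g i) (g j) * x i * x j / \<mu> else 0)"
      unfolding bform_def by (intro sum.cong) auto
    also have "\<dots> = (\<Sum>i=0..<n. if i < m then (\<Sum>j=0..<n. if j < m then A (g i) (g j) * x i * x j / \<mu> else 0) else 0)"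
      by (intro sum.cong) auto
    also have "\<dots> = (\<Sum>i<m. \<Sum>j<m. A (g i) (g j) * x i * x j / \<mu>)"
    proof -
      have "{0..<n} \<inter> {i. i < m} = {..<m}" using m by auto
      then show ?thesis by (simp add: sum.If_cases)
    qed
    also have "\<dots> = (\<Sum>i<m. \<Sum>j<m. A (g i) (g j) * x i * x j) / \<mu>" by (simp add: sum_divide_distrib)
    finally show ?thesis unfolding K_def bform_add_kernel
      by (simp add: bform_delta power2_eq_square atLeast0LessThan)
  qed
  have reindex: "(\<Sum>i<m. \<Sum>j<m. A (g i) (g j) * x (g i) * x (g j)) = bform V A x x" for x
    unfolding bform_def
    using g sum.reindex_bij_betw[of g "{..<m}" V "\<lambda>u. \<Sum>v\<in>V. A u v * x u * x v"]
    by (simp add: atLeast0LessThan sum.reindex_bij_betw[of g "{..<m}" V "\<lambda>v. A u v * x u * x v" for u])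
  have psdK: "psd {0..<n} K"
    unfolding psd_def formK
  proof
    fix x :: "nat \<Rightarrow> real"
    define y where "y = (\<lambda>u. x (inv_into {0..<m} g u))"
    have y: "y (g i) = x i" if "i < m" for i
      using g that by (simp add: y_def bij_betw_def inv_into_f_f)
    have "(\<Sum>i<m. \<Sum>j<m. A (g i) (g j) * x i * x j) = bform V A y y"
      unfolding reindex[symmetric] using y by (intro sum.cong) auto
    also have "\<dots> \<ge> - \<mu> * (\<Sum>u\<in>V. (y u)\<^sup>2)" by (rule \<mu>)
    also have "(\<Sum>u\<in>V. (y u)\<^sup>2) = (\<Sum>i<m. (x i)\<^sup>2)"
      using sum.reindex_bij_betw[OF g, of "\<lambda>u. (y u)\<^sup>2"] y by (simp add: atLeast0LessThan)
    finally have "(\<Sum>i<m. \<Sum>j<m. A (g i) (g j) * x i * x j) / \<mu> \<ge> - (\<Sum>i<m. (x i)\<^sup>2)"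
      using \<mu>(1) by (simp add: field_simps)
    moreover have "(\<Sum>i<m. (x i)\<^sup>2) \<le> (\<Sum>i<n. (x i)\<^sup>2)"
      using m by (intro sum_mono2) auto
    ultimately show "0 \<le> (\<Sum>i<n. (x i)\<^sup>2) + (\<Sum>i<m. \<Sum>j<m. A (g i) (g j) * x i * x j) / \<mu>" by linarith
  qed
  obtain d f where f: "\<forall>u\<in>{0..<n}. \<forall>v\<in>{0..<n}. K u v = (\<Sum>i<(d::nat). f u i * f v i)"
    using psd_gram[OF _ symK psdK] by auto
  define F where "F = (\<lambda>u. vec d (f u))"
  have FK: "scalar_prod (F u) (F v) = K u v" if "u < n" "v < n" for u v
    using f that by (simp add: F_def scalar_prod_def atLeast0LessThan)
  have rep: "orthonormal_rep G d F"
    unfolding orthonormal_rep_def vG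
  proof (intro conjI ballI impI)
    fix u assume u: "u \<in> {0..<n}"
    show "F u \<in> carrier_vec d" by (simp add: F_def)
    have "A (g u) (g u) = 0" if "u < m" using A(2) gV that by blast
    then show "scalar_prod (F u) (F u) = 1" using u by (simp add: FK) (simp add: K_def)
    fix v assume v: "v \<in> {0..<n}" and uv: "u \<noteq> v \<and> (u, v) \<notin> parcs G"
    have "A (g u) (g v) = 0" if "u < m" "v < m"
      using uv that A(2)[OF gV gV] by (auto simp: G_def)
    then show "scalar_prod (F u) (F v) = 0" using u v uv by (simp add: FK) (auto simp: K_def)
  qed
  let ?r = "1 + (\<Sum>u\<in>V. \<Sum>v\<in>V. A u v) / (\<mu> * card V)"
  have "\<exists>y\<ge>?r. eigenvalue (mat n n (\<lambda>(i, j). K i j)) y"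
  proof (rule eigenvalue_ge_Rayleigh[OF symK])
    define x where "x = (\<lambda>i. if i < m then 1 else 0 :: real)"
    have sq: "(\<Sum>u<n. (x u)\<^sup>2) = real m"
    proof -
      have "{..<n} \<inter> {i. i < m} = {..<m}" using m by auto
      moreover have "(\<Sum>u<n. (x u)\<^sup>2) = (\<Sum>u<n. if u < m then 1 else 0)"
        by (intro sum.cong) (auto simp: x_def)
      ultimately show ?thesis by (simp add: sum.If_cases)
    qed
    show "0 < (\<Sum>u<n. (x u)\<^sup>2)" using sq m by simp
    have "(\<Sum>i<m. \<Sum>j<m. A (g i) (g j) * x i * x j) = (\<Sum>u\<in>V. \<Sum>v\<in>V. A u v)"
      using reindex[of "\<lambda>_. 1"] by (simp add: x_def bform_def)
    then show "?r * (\<Sum>u<n. (x u)\<^sup>2) \<le> bform {0..<n} K x x"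
      using sq m \<mu>(1) by (simp add: formK m_def[symmetric] distrib_right)
  qed
  moreover have gmK: "mat n n (\<lambda>(i, j). K i j) = gram_matrix n F"
    unfolding gram_matrix_def by (rule eq_matI) (auto simp: FK)
  ultimately obtain y where y: "y \<ge> ?r" "y \<in> spectrum (gram_matrix n F)" by (auto simp: spectrum_def)
  have "gram_matrix n F \<in> carrier_mat n n" by (simp add: gram_matrix_def)
  then have "y \<le> largest_eigenvalue (gram_matrix n F)"
    unfolding largest_eigenvalue_def using y(2) by (intro Max_ge card_finite_spectrum(1))
  also have "\<dots> \<le> lovasz_theta (graph_compl G)"
    by (rule largest_eigenvalue_le_lovasz_theta[OF pG vG rep])
  also have "\<dots> \<le> lambda_free n H"
    by (rule lovasz_theta_le_lambda_free[OF pG vG free])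
  finally show ?thesis using y(1) by simp
qed

text \<open>One vertex and zero weights. This covers the values of \<open>n\<close> that are too
  small for a construction.\<close>

corollary lambda_free_ge_1:
  assumes "n \<ge> 1" and H: "\<And>a. a \<in> pverts H \<Longrightarrow> \<exists>b. (a, b) \<in> parcs H" "pverts H \<noteq> {}"
  shows "lambda_free n H \<ge> 1"
proof -
  obtain a b where ab: "(a, b) \<in> parcs H" using H by blast
  have "lambda_free n H \<ge> 1 + (\<Sum>u\<in>{()}. \<Sum>v\<in>{()}. 0) / (1 * real (card {()}))"
  proof (rule lambda_free_ge[where E = "\<lambda>_ _. False"])
    show "\<not> embeds H {()} (\<lambda>_ _. False)" using ab by (auto simp: embeds_def)
  qed (use assms in \<open>auto simp: sym_on2_def bform_def symp_def\<close>)
  then show ?thesis by simp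
qed

section \<open>Sparse principal submatrices\<close>

text \<open>The sign of \<open>c\<close> is a consequence: a negative \<open>c\<close> would
  dominate for large \<open>t\<close>, and for \<open>c = 0\<close> an affine function bounded below
  must be constant.\<close>

lemma discriminant_le_0:
  fixes a b c :: real
  assumes q: "\<And>t. a + 2 * t * b + t\<^sup>2 * c \<ge> 0"
  shows "b\<^sup>2 \<le> a * c"
proof (cases "c = 0")
  case True
  have "b = 0"
  proof (rule ccontr)
    assume "b \<noteq> 0"
    then show False using q[of "- (a + 1) / (2 * b)"] True by (simp add: field_simps)
  qed
  then show ?thesis using True by simp
next
  case False
  have "c > 0"
  proof (rule ccontr)
    assume "\<not> c > 0"
    then have c: "c < 0" using False by simp
    define t where "t = 1 + (\<bar>a\<bar> + 2 * \<bar>b\<bar>) / - c"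
    have t: "t \<ge> 1" using c by (simp add: t_def divide_nonneg_neg)
    have "\<bar>a\<bar> + 2 * \<bar>b\<bar> = (t - 1) * - c" using c by (simp add: t_def)
    then have "\<bar>a\<bar> + 2 * \<bar>b\<bar> < t * - c" using c by (simp add: algebra_simps)
    then have "(\<bar>a\<bar> + 2 * \<bar>b\<bar>) * t < t * - c * t" using t by (intro mult_strict_right_mono) auto
    moreover have "a + 2 * t * b \<le> (\<bar>a\<bar> + 2 * \<bar>b\<bar>) * t"
    proof -
      have "a \<le> \<bar>a\<bar> * t" using mult_left_mono[OF t, of "\<bar>a\<bar>"] by simp
      moreover have "2 * t * b \<le> 2 * t * \<bar>b\<bar>" using t by (intro mult_left_mono) auto
      ultimately show ?thesis by (simp add: algebra_simps)
    qed
    ultimately have "a + 2 * t * b + t\<^sup>2 * c < 0" by (simp add: power2_eq_square algebra_simps)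
    then show False using q[of t] by simp
  qed
  then show ?thesis using q[of "- b / c"] by (simp add: field_simps power2_eq_square)
qed

lemma sum_Cauchy_Schwarz:
  fixes x y :: "'b \<Rightarrow> real"
  shows "(\<Sum>i\<in>W. x i * y i)\<^sup>2 \<le> (\<Sum>i\<in>W. (x i)\<^sup>2) * (\<Sum>i\<in>W. (y i)\<^sup>2)"
proof (rule discriminant_le_0)
  fix t
  have "0 \<le> (\<Sum>i\<in>W. (x i + t * y i)\<^sup>2)" by (intro sum_nonneg) simp
  also have "\<dots> = (\<Sum>i\<in>W. (x i)\<^sup>2 + 2 * t * (x i * y i) + t\<^sup>2 * (y i)\<^sup>2)"
    by (intro sum.cong refl) (simp add: power2_eq_square algebra_simps)
  also have "\<dots> = (\<Sum>i\<in>W. (x i)\<^sup>2) + 2 * t * (\<Sum>i\<in>W. x i * y i) + t\<^sup>2 * (\<Sum>i\<in>W. (y i)\<^sup>2)"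
    unfolding sum.distrib sum_distrib_left ..
  finally show "0 \<le> (\<Sum>i\<in>W. (x i)\<^sup>2) + 2 * t * (\<Sum>i\<in>W. x i * y i) + t\<^sup>2 * (\<Sum>i\<in>W. (y i)\<^sup>2)" .
qed

section \<open>Inner products and rank-one updates\<close>

definition dot :: "nat \<Rightarrow> (nat \<Rightarrow> real) \<Rightarrow> (nat \<Rightarrow> real) \<Rightarrow> real" where
  "dot d x y = (\<Sum>k<d. x k * y k)"

lemma dot_commute: "dot d x y = dot d y x"
  by (simp add: dot_def mult.commute)

lemma dot_add_left: "dot d (\<lambda>k. x k + y k) z = dot d x z + dot d y z"
  by (simp add: dot_def sum.distrib algebra_simps)

lemma dot_diff_left: "dot d (\<lambda>k. x k - y k) z = dot d x z - dot d y z"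
  by (simp add: dot_def sum_subtractf algebra_simps)

lemma dot_scale_left: "dot d (\<lambda>k. c * x k) z = c * dot d x z"
  by (simp add: dot_def sum_distrib_left algebra_simps)

lemma dot_add_right: "dot d z (\<lambda>k. x k + y k) = dot d z x + dot d z y"
  by (simp add: dot_def sum.distrib algebra_simps)

lemma dot_diff_right: "dot d z (\<lambda>k. x k - y k) = dot d z x - dot d z y"
  by (simp add: dot_def sum_subtractf algebra_simps)

lemma dot_scale_right: "dot d z (\<lambda>k. c * x k) = c * dot d z x"
  by (simp add: dot_def sum_distrib_left algebra_simps)

lemma dot_sum_right: "dot d z (\<lambda>k. \<Sum>i\<in>W. c i * v i k) = (\<Sum>i\<in>W. c i * dot d z (v i))"
  unfolding dot_def sum_distrib_left by (subst sum.swap) (simp add: mult_ac)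

lemmas dot_linear = dot_add_left dot_diff_left dot_scale_left dot_add_right dot_diff_right dot_scale_right

lemma dot_nonneg [simp]: "dot d x x \<ge> 0"
  by (auto simp: dot_def intro: sum_nonneg)

lemma dot_self_eq_0: "dot d x x = 0 \<Longrightarrow> dot d y x = 0"
  by (auto simp: dot_def sum_nonneg_eq_0_iff)

lemma dot_Cauchy_Schwarz: "(dot d x y)\<^sup>2 \<le> dot d x x * dot d y y"
proof (rule discriminant_le_0)
  fix t
  have "0 \<le> dot d (\<lambda>k. x k + t * y k) (\<lambda>k. x k + t * y k)" by simp
  then show "dot d x x + 2 * t * dot d x y + t\<^sup>2 * dot d y y \<ge> 0"
    by (simp add: dot_linear dot_commute[of d y x] power2_eq_square algebra_simps)
qed

text \<open>The operator \<open>u - \<Sum>\<^sub>i v\<^sub>i v\<^sub>i\<^sup>T\<close>; its inverse is built with the Sherman-Morrison formula.\<close>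

definition lop :: "nat \<Rightarrow> ('i \<Rightarrow> nat \<Rightarrow> real) \<Rightarrow> real \<Rightarrow> 'i set \<Rightarrow> (nat \<Rightarrow> real) \<Rightarrow> nat \<Rightarrow> real" where
  "lop d v u W y = (\<lambda>k. u * y k - (\<Sum>i\<in>W. dot d (v i) y * v i k))"

definition resolvent :: "nat \<Rightarrow> ('i \<Rightarrow> nat \<Rightarrow> real) \<Rightarrow> real \<Rightarrow> 'i set \<Rightarrow> ((nat \<Rightarrow> real) \<Rightarrow> nat \<Rightarrow> real) \<Rightarrow> bool" where
  "resolvent d v u W R \<longleftrightarrow> (\<forall>x. lop d v u W (R x) = x)"

text \<open>Positive definiteness with an explicit margin \<open>e\<close>, which passes to subsets
  and to larger \<open>u\<close> without any spectral argument.\<close>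

definition coercive :: "nat \<Rightarrow> ('i \<Rightarrow> nat \<Rightarrow> real) \<Rightarrow> real \<Rightarrow> 'i set \<Rightarrow> bool" where
  "coercive d v u W \<longleftrightarrow> (\<exists>e>0. \<forall>y. dot d y (lop d v u W y) \<ge> e * dot d y y)"

lemma dot_lop: "dot d x (lop d v u W y) = u * dot d x y - (\<Sum>i\<in>W. dot d (v i) x * dot d (v i) y)"
  unfolding lop_def dot_diff_right dot_scale_right dot_sum_right by (simp add: dot_commute mult_ac)

lemma dot_lop_sym: "dot d (lop d v u W x) y = dot d x (lop d v u W y)"
  unfolding dot_commute[of d "lop d v u W x" y] dot_lop by (simp add: dot_commute mult_ac)

lemma dot_resolvent_sym:
  assumes "resolvent d v u W R"
  shows "dot d x (R y) = dot d y (R x)"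
proof -
  have "dot d x (R y) = dot d (lop d v u W (R x)) (R y)" using assms by (simp add: resolvent_def)
  also have "\<dots> = dot d (R x) (lop d v u W (R y))" by (rule dot_lop_sym)
  also have "\<dots> = dot d (R x) y" using assms by (simp add: resolvent_def)
  finally show ?thesis by (simp add: dot_commute)
qed

lemma coerciveD: "coercive d v u W \<Longrightarrow> dot d y (lop d v u W y) \<ge> 0"
  unfolding coercive_def by (meson dot_nonneg mult_nonneg_nonneg order_trans less_imp_le)

lemma coercive_subset:
  assumes "coercive d v u W'" "W \<subseteq> W'" "finite W'"
  shows "coercive d v u W"
proof -
  have "dot d y (lop d v u W' y) \<le> dot d y (lop d v u W y)" for y
    unfolding dot_lop using assms by (simp add: sum_mono2)
  then show ?thesis using assms(1) unfolding coercive_def by (meson order_trans)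
qed

lemma coercive_increase:
  assumes "coercive d v u W" "\<delta> \<ge> 0"
  shows "coercive d v (u + \<delta>) W"
proof -
  have "dot d y (lop d v u W y) \<le> dot d y (lop d v (u + \<delta>) W y)" for y
    unfolding dot_lop using assms by (simp add: algebra_simps)
  then show ?thesis using assms(1) unfolding coercive_def by (meson order_trans)
qed

text \<open>The Sherman-Morrison formula. By the matrix determinant lemma the condition below 1 says
  that subtracting the square of \<open>v i\<close> multiplies the determinant by a positive
  factor.\<close>

lemma resolvent_insert:
  assumes R: "resolvent d v u W R" and i: "i \<notin> W" "finite W" and s: "dot d (v i) (R (v i)) < 1"
  shows "resolvent d v u (insert i W) (\<lambda>x k. R x k + dot d (v i) (R x) / (1 - dot d (v i) (R (v i))) * R (v i) k)"
  unfolding resolvent_def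
proof (intro allI ext)
  fix x k
  define s where "s = dot d (v i) (R (v i))"
  define c where "c = dot d (v i) (R x) / (1 - s)"
  have c: "c * (1 - s) = dot d (v i) (R x)" using assms(4) by (simp add: c_def s_def)
  have 1: "u * R x k - (\<Sum>j\<in>W. dot d (v j) (R x) * v j k) = x k"
    using R by (metis resolvent_def lop_def)
  have 2: "u * R (v i) k - (\<Sum>j\<in>W. dot d (v j) (R (v i)) * v j k) = v i k"
    using R by (metis resolvent_def lop_def)
  have "lop d v u (insert i W) (\<lambda>k. R x k + c * R (v i) k) k =
      u * R x k + c * (u * R (v i) k) - (dot d (v i) (R x) + c * s) * v i k
      - (\<Sum>j\<in>W. dot d (v j) (R x) * v j k) - c * (\<Sum>j\<in>W. dot d (v j) (R (v i)) * v j k)"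
    unfolding lop_def using i
    by (simp add: dot_linear s_def sum.distrib sum_distrib_left algebra_simps)
  also have "\<dots> = (u * R x k - (\<Sum>j\<in>W. dot d (v j) (R x) * v j k))
      + c * (u * R (v i) k - (\<Sum>j\<in>W. dot d (v j) (R (v i)) * v j k)) - (dot d (v i) (R x) + c * s) * v i k"
    by (simp add: algebra_simps)
  also have "\<dots> = x k + c * v i k - (dot d (v i) (R x) + c * s) * v i k" unfolding 1 2 ..
  also have "\<dots> = x k + (c * (1 - s) - dot d (v i) (R x)) * v i k" by (simp add: algebra_simps)
  also have "\<dots> = x k" unfolding c by simp
  finally show "lop d v u (insert i W) (\<lambda>k. R x k + dot d (v i) (R x) / (1 - dot d (v i) (R (v i))) * R (v i) k) k = x k"
    by (simp add: c_def s_def)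
qed

lemma resolvent_exists:
  assumes "finite W" "u > 0" "coercive d v u W"
  shows "\<exists>R. resolvent d v u W R"
  using assms
proof (induction W rule: finite_induct)
  case empty
  have "resolvent d v u {} (\<lambda>x k. x k / u)" using empty by (auto simp: resolvent_def lop_def)
  then show ?case by blast
next
  case (insert i W)
  obtain R where R: "resolvent d v u W R"
    using insert coercive_subset[OF insert.prems(2), of W] by auto
  define w where "w = R (v i)"
  have Lw: "lop d v u W w = v i" using R by (simp add: resolvent_def w_def)
  define s where "s = dot d (v i) w"
  have s0: "s \<ge> 0"
    using coerciveD[OF coercive_subset[OF insert.prems(2), of W], of w] Lw insert.hyps
    by (simp add: s_def dot_commute subset_insertI)
  obtain e where e: "e > 0" "\<And>y. dot d y (lop d v u (insert i W) y) \<ge> e * dot d y y"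
    using insert.prems(2) by (auto simp: coercive_def)
  \<comment> \<open>Coercivity after the insertion, tested on \<open>w\<close>, yields
    \<open>e * dot d w w \<le> s - s * s\<close>. Hence \<open>s \<le> 1\<close>, and
    \<open>s = 1\<close> would make \<open>w\<close> null and so \<open>s = 0\<close>.\<close>
  have "dot d w (lop d v u (insert i W) w) = dot d w (lop d v u W w) - s * s"
    unfolding dot_lop using insert.hyps by (simp add: s_def)
  then have "e * dot d w w \<le> s - s * s" using e(2)[of w] Lw by (simp add: s_def dot_commute)
  moreover have "e * dot d w w \<ge> 0" using e(1) by simp
  ultimately have ss: "s * s \<le> s" "e * dot d w w \<le> s - s * s" by auto
  have "s < 1"
  proof (rule ccontr)
    assume "\<not> s < 1"
    moreover have "\<not> s > 1"
    proof
      assume "s > 1"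
      then have "s * 1 < s * s" by (intro mult_strict_left_mono) auto
      then show False using ss(1) by simp
    qed
    ultimately have "s = 1" by simp
    then have "dot d w w = 0" using ss(2) e(1) dot_nonneg[of d w] by (simp add: mult_le_0_iff)
    then show False using dot_self_eq_0[of d w "v i"] \<open>s = 1\<close> by (simp add: s_def)
  qed
  then show ?case using resolvent_insert[OF R insert.hyps(2,1)] by (auto simp: s_def w_def)
qed

text \<open>Cauchy-Schwarz for the form of \<open>lop\<close> bounds the square of
  \<open>dot d y (v i)\<close> by \<open>s\<close> times the form at \<open>y\<close>; the margin
  therefore shrinks by the factor \<open>1 - s\<close> at most.\<close>

lemma coercive_insert:
  assumes co: "coercive d v u W" and R: "resolvent d v u W R" and i: "i \<notin> W" "finite W"
    and s: "dot d (v i) (R (v i)) < 1"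
  shows "coercive d v u (insert i W)"
proof -
  obtain e where e: "e > 0" "\<And>y. dot d y (lop d v u W y) \<ge> e * dot d y y"
    using co by (auto simp: coercive_def)
  define s where "s = dot d (v i) (R (v i))"
  have Lw: "lop d v u W (R (v i)) = v i" using R by (simp add: resolvent_def)
  have "dot d y (lop d v u (insert i W) y) \<ge> (1 - s) * e * dot d y y" for y
  proof -
    define q where "q = dot d y (lop d v u W y)"
    have "(dot d y (v i))\<^sup>2 \<le> q * s"
    proof (rule discriminant_le_0)
      fix t
      let ?z = "\<lambda>k. y k + t * R (v i) k"
      have "0 \<le> dot d ?z (lop d v u W ?z)" by (rule coerciveD[OF co])
      also have "lop d v u W ?z = (\<lambda>k. lop d v u W y k + t * lop d v u W (R (v i)) k)"
        by (simp add: lop_def dot_linear sum.distrib sum_distrib_left algebra_simps)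
      also have "dot d ?z (\<lambda>k. lop d v u W y k + t * lop d v u W (R (v i)) k) =
          q + t * dot d y (v i) + t * dot d (R (v i)) (lop d v u W y) + t * t * s"
        unfolding Lw by (simp add: dot_linear q_def s_def dot_commute[of d "R (v i)" "v i"] algebra_simps)
      also have "dot d (R (v i)) (lop d v u W y) = dot d y (v i)"
        unfolding dot_lop_sym[symmetric] Lw by (rule dot_commute)
      finally show "q + 2 * t * dot d y (v i) + t\<^sup>2 * s \<ge> 0" by (simp add: power2_eq_square algebra_simps)
    qed
    moreover have "dot d y (lop d v u (insert i W) y) = q - (dot d y (v i))\<^sup>2"
      unfolding q_def dot_lop using i by (simp add: dot_commute[of d y "v i"] power2_eq_square)
    ultimately have "dot d y (lop d v u (insert i W) y) \<ge> (1 - s) * q" by (simp add: algebra_simps)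
    moreover have "(1 - s) * q \<ge> (1 - s) * (e * dot d y y)"
      using e(2) assms(5) unfolding q_def s_def by (intro mult_left_mono) auto
    ultimately show ?thesis by (simp add: mult.assoc)
  qed
  moreover have "(1 - s) * e > 0" using e(1) assms(5) by (simp add: s_def)
  ultimately show ?thesis unfolding coercive_def by blast
qed

text \<open>One step of the barrier argument of Batson, Spielman and Srivastava.\<close>

lemma barrier_step:
  fixes v :: "'i \<Rightarrow> nat \<Rightarrow> real"
  assumes I: "finite I" "W \<subseteq> I" and u: "u > 0" and co: "coercive d v u W" and R: "resolvent d v u W R"
    and \<Phi>: "(\<Sum>j\<in>I. dot d (v j) (R (v j))) \<le> \<phi>" and \<delta>: "\<delta> > 0"
    and l: "\<And>y. (\<Sum>j\<in>I. (dot d (v j) y)\<^sup>2) \<le> 2 * l * dot d y y" "l \<ge> 0"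
    and cnt: "2 * l / \<delta> + \<phi> < real (card (I - W))"
  shows "\<exists>i\<in>I - W. \<exists>R'. coercive d v (u + \<delta>) (insert i W) \<and> resolvent d v (u + \<delta>) (insert i W) R' \<and>
    (\<Sum>j\<in>I. dot d (v j) (R' (v j))) \<le> \<phi>"
proof -
  have finW: "finite W" using I finite_subset by blast
  have co': "coercive d v (u + \<delta>) W" using coercive_increase[OF co] \<delta> by simp
  obtain R1 where R1: "resolvent d v (u + \<delta>) W R1"
    using resolvent_exists[OF finW _ co'] u \<delta> by auto
  define S where "S = (\<Sum>j\<in>I. dot d (R1 (v j)) (R1 (v j)))"
  have S0: "S \<ge> 0" unfolding S_def by (intro sum_nonneg) simp
  \<comment> \<open>Adding \<open>i\<close> is admissible if \<open>s i < 1\<close>, and it then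
    raises the potential by \<open>a i / (1 - s i)\<close>, as Sherman-Morrison shows.\<close>
  define s where "s = (\<lambda>i. dot d (v i) (R1 (v i)))"
  define a where "a = (\<lambda>i. \<Sum>j\<in>I. (dot d (v j) (R1 (v i)))\<^sup>2)"
  have s_nonneg: "s i \<ge> 0" for i
    using coerciveD[OF co', of "R1 (v i)"] R1 by (simp add: resolvent_def s_def dot_commute)
  have a_nonneg: "a i \<ge> 0" for i unfolding a_def by (intro sum_nonneg) simp
  \<comment> \<open>The potential that is gained by moving the barrier from \<open>u\<close> to
    \<open>u + \<delta>\<close>, available to pay for the new index.\<close>
  define \<Delta> where "\<Delta> = (\<Sum>j\<in>I. dot d (v j) (R (v j))) - (\<Sum>j\<in>I. s j)"
  \<comment> \<open>The resolvent identity: the difference of the two inverses is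
    \<open>\<delta>\<close> times their product, and that product dominates the square of the
    smaller one.\<close>
  have gain: "dot d x (R x) - dot d x (R1 x) \<ge> \<delta> * dot d (R1 x) (R1 x)" for x
  proof -
    define w w' where "w = R1 x" and "w' = R x"
    have L1: "lop d v (u + \<delta>) W w = x" and L: "lop d v u W w' = x"
      using R R1 by (simp_all add: resolvent_def w_def w'_def)
    have sh: "lop d v (u + \<delta>) W w = (\<lambda>k. lop d v u W w k + \<delta> * w k)"
      by (simp add: lop_def algebra_simps)
    have "dot d x w' = dot d w' (\<lambda>k. lop d v u W w k + \<delta> * w k)"
      using L1 sh by (simp add: dot_commute)
    also have "\<dots> = dot d w' (lop d v u W w) + \<delta> * dot d w' w" by (simp add: dot_linear)
    also have "dot d w' (lop d v u W w) = dot d x w" unfolding dot_lop_sym[symmetric] L ..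
    finally have 1: "dot d x w' - dot d x w = \<delta> * dot d w' w" by simp
    let ?z = "\<lambda>k. w' k - w k"
    have "lop d v u W ?z = (\<lambda>k. lop d v u W w' k - lop d v u W w k)"
      by (simp add: lop_def dot_linear sum_subtractf algebra_simps)
    also have "\<dots> = (\<lambda>k. \<delta> * w k)"
    proof
      fix k
      have "lop d v u W w k + \<delta> * w k = x k" using fun_cong[OF sh, of k] L1 by simp
      then show "lop d v u W w' k - lop d v u W w k = \<delta> * w k" using L by simp
    qed
    finally have "0 \<le> \<delta> * (dot d w' w - dot d w w)"
      using coerciveD[OF co, of ?z] by (simp add: dot_linear right_diff_distrib)
    then show ?thesis using 1 \<delta> by (simp add: w_def w'_def right_diff_distrib)
  qed
  have \<Delta>S: "\<Delta> \<ge> \<delta> * S"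
    unfolding \<Delta>_def S_def s_def sum_subtractf[symmetric] sum_distrib_left
    by (intro sum_mono gain)
  have aS: "(\<Sum>i\<in>I. a i) \<le> 2 * l * S"
    unfolding a_def S_def sum_distrib_left by (intro sum_mono l(1))
  \<comment> \<open>By averaging: if every index of \<open>I - W\<close> were bad, then
    \<open>a i / \<Delta> + s i \<ge> 1\<close> for all of them, although these numbers sum to at
    most \<open>2 * l / \<delta> + \<phi>\<close>, which is below the number of indices.\<close>
  have "\<exists>i\<in>I - W. s i < 1 \<and> a i \<le> \<Delta> * (1 - s i)"
  proof (rule ccontr)
    assume "\<not> ?thesis"
    then have neg: "1 \<le> s i \<or> \<Delta> * (1 - s i) < a i" if "i \<in> I - W" for i using that by force
    have "I - W \<noteq> {}"
    proof
      assume empty: "I - W = {}"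
      have "2 * l / \<delta> + \<phi> < 0" using cnt unfolding empty by simp
      moreover have "2 * l / \<delta> \<ge> 0" using l \<delta> by simp
      moreover have "\<phi> \<ge> 0"
      proof -
        have "dot d (v j) (R (v j)) \<ge> 0" for j
          using coerciveD[OF co, of "R (v j)"] R by (simp add: resolvent_def dot_commute)
        then have "0 \<le> (\<Sum>j\<in>I. dot d (v j) (R (v j)))" by (intro sum_nonneg) simp
        then show ?thesis using \<Phi> by linarith
      qed
      ultimately show False by simp
    qed
    then obtain i0 where i0: "i0 \<in> I - W" by blast
    show False
    proof (cases "\<Delta> > 0")
      case True
      have "1 \<le> a i / \<Delta> + s i" if "i \<in> I - W" for i
      proof (cases "1 \<le> s i")
        case True
        then show ?thesis using a_nonneg[of i] \<open>\<Delta> > 0\<close> by (simp add: add_increasing)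
      next
        case False
        then have "(1 - s i) * \<Delta> < a i" using neg[OF that] by (simp add: mult.commute)
        then have "1 - s i < a i / \<Delta>" using \<open>\<Delta> > 0\<close> by (simp only: pos_less_divide_eq)
        then show ?thesis by linarith
      qed
      then have "real (card (I - W)) \<le> (\<Sum>i\<in>I - W. a i / \<Delta> + s i)"
        using sum_mono[of "I - W" "\<lambda>_. 1" "\<lambda>i. a i / \<Delta> + s i"] by simp
      also have "\<dots> \<le> (\<Sum>i\<in>I. a i / \<Delta> + s i)"
        using I a_nonneg s_nonneg True by (intro sum_mono2) auto
      also have "\<dots> = (\<Sum>i\<in>I. a i) / \<Delta> + (\<Sum>i\<in>I. s i)" by (simp add: sum.distrib sum_divide_distrib)
      also have "(\<Sum>i\<in>I. a i) / \<Delta> \<le> 2 * l / \<delta>"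
      proof -
        have "(\<Sum>i\<in>I. a i) * \<delta> \<le> 2 * l * S * \<delta>" using aS \<delta> by (intro mult_right_mono) auto
        also have "\<dots> = 2 * l * (\<delta> * S)" by simp
        also have "\<dots> \<le> 2 * l * \<Delta>" using \<Delta>S l(2) by (intro mult_left_mono) auto
        finally show ?thesis using True \<delta> by (simp add: field_simps)
      qed
      also have "(\<Sum>i\<in>I. s i) \<le> \<phi>" using \<Phi> True by (simp add: \<Delta>_def)
      finally show False using cnt by simp
    next
      case False
      \<comment> \<open>Without any gain all the vectors \<open>R1 (v j)\<close> are null, and any
        index at all can be added for free.\<close>
      then have "\<delta> * S = 0" "\<Delta> = 0" using \<Delta>S S0 \<delta> mult_nonneg_nonneg[of \<delta> S] by linarith+
      then have "S = 0" using \<delta> by simp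
      then have "dot d (R1 (v i0)) (R1 (v i0)) = 0"
        using i0 I(1) unfolding S_def by (subst (asm) sum_nonneg_eq_0_iff) auto
      then have "s i0 = 0" by (simp add: s_def dot_self_eq_0)
      moreover have "a i0 = 0"
      proof -
        have "a i0 \<le> (\<Sum>i\<in>I. a i)" using i0 I(1) a_nonneg by (intro member_le_sum) auto
        then show ?thesis using aS \<open>S = 0\<close> a_nonneg[of i0] by simp
      qed
      ultimately show False using neg[OF i0] \<open>\<Delta> = 0\<close> by simp
    qed
  qed
  then obtain i where i: "i \<in> I - W" "s i < 1" "a i \<le> \<Delta> * (1 - s i)" by blast
  define R' where "R' = (\<lambda>x k. R1 x k + dot d (v i) (R1 x) / (1 - dot d (v i) (R1 (v i))) * R1 (v i) k)"
  have "resolvent d v (u + \<delta>) (insert i W) R'"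
    unfolding R'_def using R1 i finW by (intro resolvent_insert) (auto simp: s_def)
  moreover have "coercive d v (u + \<delta>) (insert i W)"
    using co' R1 i finW by (intro coercive_insert) (auto simp: s_def)
  moreover have "(\<Sum>j\<in>I. dot d (v j) (R' (v j))) \<le> \<phi>"
  proof -
    have "dot d (v j) (R' (v j)) = s j + (dot d (v j) (R1 (v i)))\<^sup>2 / (1 - s i)" for j
      using dot_resolvent_sym[OF R1, of "v i" "v j"]
      unfolding R'_def dot_add_right dot_scale_right by (simp add: s_def power2_eq_square)
    then have "(\<Sum>j\<in>I. dot d (v j) (R' (v j))) = (\<Sum>j\<in>I. s j) + a i / (1 - s i)"
      by (simp add: sum.distrib a_def sum_divide_distrib)
    also have "a i / (1 - s i) \<le> \<Delta>" using i(2,3) by (simp add: pos_divide_le_eq)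
    finally show ?thesis using \<Phi> by (simp add: \<Delta>_def)
  qed
  ultimately show ?thesis using i(1) by blast
qed

text \<open>After the shift by \<open>l\<close> the matrix is the Gram matrix of vectors
  \<open>f i\<close>. Keeping the sum of their squares over \<open>W\<close> below the barrier
  \<open>u\<close> bounds the Gram matrix on \<open>W\<close> by \<open>u\<close> as well, because a
  matrix and its transpose have the same norm. The barrier ends at \<open>l * (1 + 6 * r)\<close>,
  and undoing the shift leaves \<open>6 * r * l\<close>.\<close>

theorem sparse_principal_submatrix:
  fixes M :: "'i \<Rightarrow> 'i \<Rightarrow> real"
  assumes I: "finite I" and k: "k > 0" "16 * k \<le> card I" and l: "l > 0"
    and sym: "sym_on2 I M" and diag: "\<And>i. i \<in> I \<Longrightarrow> M i i = 0"
    and bound: "\<And>x. \<bar>bform I M x x\<bar> \<le> l * (\<Sum>i\<in>I. (x i)\<^sup>2)"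
  shows "\<exists>W\<subseteq>I. card W = k \<and> (\<forall>x. bform W M x x \<le> 6 * sqrt (k / card I) * l * (\<Sum>i\<in>W. (x i)\<^sup>2))"
proof -
  define N where "N = real (card I)"
  define r where "r = sqrt (k / N)"
  have N: "N > 0" using k by (simp add: N_def)
  have r: "r > 0" "r \<le> 1 / 4" "r\<^sup>2 = k / N"
  proof -
    show "r > 0" using k N by (simp add: r_def)
    show "r\<^sup>2 = k / N" using N by (simp add: r_def)
    have "real k / N \<le> 1 / 16" using k(2) N by (simp add: N_def field_simps)
    then have "r \<le> sqrt ((1 / 4)\<^sup>2)" unfolding r_def by (intro real_sqrt_le_mono) (simp add: power2_eq_square)
    then show "r \<le> 1 / 4" by (simp del: real_sqrt_pow2_iff)
  qed
  define P where "P = (\<lambda>i j. (if i = j then l else 0) + M i j)"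
  have formP: "bform I P x x = l * (\<Sum>i\<in>I. (x i)\<^sup>2) + bform I M x x" for x
    unfolding P_def bform_add_kernel using I by (simp add: bform_delta power2_eq_square)
  have "sym_on2 I P" using sym by (auto simp: sym_on2_def P_def)
  moreover have "psd I P"
    unfolding psd_def
  proof
    fix x show "0 \<le> bform I P x x" using bound[of x] unfolding formP by linarith
  qed
  ultimately obtain d f where f: "\<forall>i\<in>I. \<forall>j\<in>I. P i j = (\<Sum>k<(d::nat). f i k * f j k)"
    using psd_gram[OF I] by blast
  then have fP: "dot d (f i) (f j) = P i j" if "i \<in> I" "j \<in> I" for i j using that by (simp add: dot_def)
  have form: "dot d (\<lambda>k. \<Sum>i\<in>W. x i * f i k) (\<lambda>k. \<Sum>i\<in>W. x i * f i k) = bform W P x x" if "W \<subseteq> I" for W x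
  proof -
    have "dot d (\<lambda>k. \<Sum>i\<in>W. x i * f i k) (\<lambda>k. \<Sum>i\<in>W. x i * f i k) =
        (\<Sum>i\<in>W. x i * (\<Sum>j\<in>W. x j * dot d (f i) (f j)))"
      by (simp add: dot_sum_right dot_commute[of d "\<lambda>k. \<Sum>i\<in>W. x i * f i k"])
    also have "\<dots> = bform W P x x"
      unfolding bform_def sum_distrib_left using that fP by (intro sum.cong refl) (auto simp: subset_iff mult_ac)
    finally show ?thesis .
  qed
  \<comment> \<open>The sum of the squares of the \<open>f j\<close> has the same norm as the Gram
    matrix \<open>P\<close>, which is at most \<open>2 * l\<close>.\<close>
  have upper: "(\<Sum>j\<in>I. (dot d (f j) y)\<^sup>2) \<le> 2 * l * dot d y y" for y
  proof -
    define x where "x = (\<lambda>j. dot d (f j) y)"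
    define S where "S = (\<Sum>j\<in>I. (x j)\<^sup>2)"
    have S0: "S \<ge> 0" unfolding S_def by (intro sum_nonneg) simp
    let ?w = "\<lambda>k. \<Sum>j\<in>I. x j * f j k"
    have "dot d y ?w = S"
      by (simp add: dot_sum_right S_def x_def dot_commute[of d y] power2_eq_square)
    then have "S\<^sup>2 \<le> dot d y y * dot d ?w ?w" using dot_Cauchy_Schwarz[of d y ?w] by simp
    also have "dot d ?w ?w = bform I P x x" by (rule form) simp
    also have "dot d y y * bform I P x x \<le> dot d y y * (2 * l * S)"
    proof (intro mult_left_mono)
      show "bform I P x x \<le> 2 * l * S" using bound[of x] unfolding formP S_def by linarith
    qed simp
    finally have "S * S \<le> (2 * l * dot d y y) * S" by (simp add: power2_eq_square mult_ac)
    then have "S \<le> 2 * l * dot d y y"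
      using S0 l by (cases "S = 0") (auto simp: mult_le_cancel_right)
    then show ?thesis by (simp add: S_def x_def)
  qed
  \<comment> \<open>The value \<open>\<phi>\<close> is the initial potential, since each
    \<open>f i\<close> has squared length \<open>l\<close>. All \<open>k\<close> steps together
    raise the barrier by \<open>k * \<delta> = 2 * l * r\<close>. The counting condition of
    \<open>barrier_step\<close> becomes \<open>r + 1 / (1 + 4 * r) < 1 - r * r\<close>, which holds
    as \<open>r \<le> 1 / 4\<close>.\<close>
  define u0 \<delta> \<phi> where "u0 = l * (1 + 4 * r)" and "\<delta> = 2 * l / (N * r)" and "\<phi> = N * l / u0"
  have u0: "u0 > 0" and \<delta>: "\<delta> > 0" using l r N by (simp_all add: u0_def \<delta>_def)
  have "\<exists>W\<subseteq>I. card W = j \<and> coercive d f (u0 + real j * \<delta>) W \<and>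
      (\<exists>R. resolvent d f (u0 + real j * \<delta>) W R \<and> (\<Sum>i\<in>I. dot d (f i) (R (f i))) \<le> \<phi>)" if "j \<le> k" for j
    using that
  proof (induction j)
    case 0
    have "coercive d f u0 {}" unfolding coercive_def dot_lop using u0 by (intro exI[of _ u0]) auto
    moreover have "resolvent d f u0 {} (\<lambda>x k. (1 / u0) * x k)" using u0 by (auto simp: resolvent_def lop_def)
    moreover have "(\<Sum>i\<in>I. dot d (f i) (\<lambda>k. (1 / u0) * f i k)) \<le> \<phi>"
    proof -
      have "dot d (f i) (\<lambda>k. (1 / u0) * f i k) = l / u0" if "i \<in> I" for i
        unfolding dot_scale_right using that fP diag by (simp add: P_def)
      then show ?thesis by (simp add: \<phi>_def N_def)
    qed
    ultimately show ?case by (intro exI[of _ "{}"]) auto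
  next
    case (Suc j)
    then obtain W R where W: "W \<subseteq> I" "card W = j" "coercive d f (u0 + real j * \<delta>) W"
      "resolvent d f (u0 + real j * \<delta>) W R" "(\<Sum>i\<in>I. dot d (f i) (R (f i))) \<le> \<phi>" by auto
    have finW: "finite W" using W(1) I finite_subset by blast
    have "2 * l / \<delta> + \<phi> < N - real k"
    proof -
      have 1: "2 * l / \<delta> = N * r" using l r N by (simp add: \<delta>_def)
      have 2: "\<phi> = N * (1 / (1 + 4 * r))" using l by (simp add: \<phi>_def u0_def)
      have 3: "real k = N * r\<^sup>2" using r(3) N by simp
      have "r + 1 / (1 + 4 * r) < 1 - r\<^sup>2"
      proof -
        have "(r + r\<^sup>2) * (1 + 4 * r) < 4 * r"
        proof -
          have "(1 + r) * (1 + 4 * r) \<le> (1 + 1/4) * (1 + 4 * (1/4))" using r by (intro mult_mono) auto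
          then have "r * ((1 + r) * (1 + 4 * r)) < r * 4" using r by (intro mult_strict_left_mono) auto
          then show ?thesis by (simp add: power2_eq_square algebra_simps)
        qed
        then have "r + r\<^sup>2 < 4 * r / (1 + 4 * r)" using r by (simp add: pos_less_divide_eq)
        moreover have "1 / (1 + 4 * r) = 1 - 4 * r / (1 + 4 * r)" using r by (simp add: field_simps)
        ultimately show ?thesis by linarith
      qed
      then have "N * (r + 1 / (1 + 4 * r)) < N * (1 - r\<^sup>2)" using N by (intro mult_strict_left_mono)
      then show ?thesis unfolding 1 2 3 by (simp add: algebra_simps)
    qed
    also have "N - real k \<le> real (card (I - W))"
      using W Suc.prems card_mono[OF I W(1)] finW by (simp add: card_Diff_subset N_def of_nat_diff)
    finally have cnt: "2 * l / \<delta> + \<phi> < real (card (I - W))" .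
    have uj: "u0 + real j * \<delta> > 0" using u0 \<delta> by (simp add: add_pos_nonneg)
    obtain i R' where i: "i \<in> I - W" "coercive d f (u0 + real j * \<delta> + \<delta>) (insert i W)"
      "resolvent d f (u0 + real j * \<delta> + \<delta>) (insert i W) R'" "(\<Sum>j\<in>I. dot d (f j) (R' (f j))) \<le> \<phi>"
      using barrier_step[OF I W(1) uj W(3,4,5) \<delta> upper _ cnt] l by auto
    have "u0 + real j * \<delta> + \<delta> = u0 + real (Suc j) * \<delta>" by (simp add: algebra_simps)
    note i' = i(2,3)[unfolded this]
    have "insert i W \<subseteq> I" "card (insert i W) = Suc j" using i(1) W finW by auto
    then show ?case using i' i(4) by blast
  qed
  then obtain W where W: "W \<subseteq> I" "card W = k" "coercive d f (u0 + real k * \<delta>) W" by blast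
  define u where "u = u0 + real k * \<delta>"
  have u_pos: "u > 0" using u0 \<delta> by (simp add: u_def add_pos_nonneg)
  have u: "u = l * (1 + 6 * r)"
  proof -
    have "real k = N * (r * r)" using r(3) N by (simp add: power2_eq_square)
    then have "real k * \<delta> = 2 * l * r" using r(1) N by (simp add: \<delta>_def)
    then show ?thesis by (simp add: u_def u0_def algebra_simps)
  qed
  have finW: "finite W" using W(1) I finite_subset by blast
  \<comment> \<open>The transposition of \<open>upper\<close> in the other direction, now on
    \<open>W\<close>.\<close>
  have "bform W M x x \<le> 6 * r * l * (\<Sum>i\<in>W. (x i)\<^sup>2)" for x
  proof -
    let ?y = "\<lambda>k. \<Sum>i\<in>W. x i * f i k"
    define Y where "Y = dot d ?y ?y"
    define X2 where "X2 = (\<Sum>i\<in>W. (x i)\<^sup>2)"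
    have X2: "X2 \<ge> 0" unfolding X2_def by (intro sum_nonneg) simp
    have Yeq: "Y = (\<Sum>i\<in>W. x i * dot d (f i) ?y)"
      unfolding Y_def by (subst dot_sum_right) (simp add: dot_commute)
    have "Y\<^sup>2 \<le> X2 * (\<Sum>i\<in>W. (dot d (f i) ?y)\<^sup>2)"
      unfolding X2_def by (subst Yeq) (rule sum_Cauchy_Schwarz)
    also have "\<dots> \<le> X2 * (u * Y)"
    proof (intro mult_left_mono X2)
      have "dot d ?y (lop d f u W ?y) \<ge> 0" using W(3) unfolding u_def by (rule coerciveD)
      then show "(\<Sum>i\<in>W. (dot d (f i) ?y)\<^sup>2) \<le> u * Y" by (simp add: dot_lop Y_def power2_eq_square)
    qed
    finally have "Y * Y \<le> (u * X2) * Y" by (simp add: power2_eq_square mult_ac)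
    moreover have "Y \<ge> 0" by (simp add: Y_def)
    ultimately have "Y \<le> u * X2" using X2 u_pos by (cases "Y = 0") (auto simp: mult_le_cancel_right)
    moreover have "Y = bform W P x x" unfolding Y_def by (rule form[OF W(1)])
    moreover have "bform W P x x = l * X2 + bform W M x x"
      unfolding P_def bform_add_kernel X2_def using finW by (simp add: bform_delta power2_eq_square)
    ultimately show ?thesis unfolding u X2_def by (simp add: algebra_simps)
  qed
  then show ?thesis using W unfolding r_def N_def by blast
qed

section \<open>Graphs over subfields of an algebraically closed field\<close>

lemma mult_le_weighted_squares:
  fixes a b m :: real
  assumes m: "m > 0"
  shows "a * b \<le> (m / 2) * a\<^sup>2 + (1 / (2 * m)) * b\<^sup>2"
proof -
  have "0 \<le> (m * a - b)\<^sup>2" by simp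
  then have *: "2 * m * (a * b) \<le> m\<^sup>2 * a\<^sup>2 + b\<^sup>2"
    by (simp add: power2_diff power_mult_distrib algebra_simps)
  have "a * b = (1 / (2 * m)) * (2 * m * (a * b))" using m by simp
  also have "\<dots> \<le> (1 / (2 * m)) * (m\<^sup>2 * a\<^sup>2 + b\<^sup>2)" using m * by (intro mult_left_mono) auto
  also have "\<dots> = (m / 2) * a\<^sup>2 + (1 / (2 * m)) * b\<^sup>2" using m by (simp add: distrib_left power2_eq_square)
  finally show ?thesis .
qed

text \<open>The mean of \<open>x\<close> is split off: regularity kills the cross terms and yields
  the main term, and on the rest \<open>z\<close> the form is controlled by the length of
  \<open>A z\<close>. That length is what codegrees compute, see
  \<open>sum_sq_adjacency\<close>.\<close>

lemma bform_regular:
  fixes A :: "'a \<Rightarrow> 'a \<Rightarrow> real"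
  assumes V: "finite V" "V \<noteq> {}" and sym: "sym_on2 V A" and m: "m > 0"
    and reg: "\<And>u. u \<in> V \<Longrightarrow> (\<Sum>v\<in>V. A u v) = d"
    and bound: "\<And>z. (\<Sum>u\<in>V. z u) = 0 \<Longrightarrow> (\<Sum>u\<in>V. (\<Sum>v\<in>V. A u v * z v)\<^sup>2) \<le> m\<^sup>2 * (\<Sum>u\<in>V. (z u)\<^sup>2)"
  shows "\<bar>bform V A x x - d / card V * (\<Sum>u\<in>V. x u)\<^sup>2\<bar> \<le> m * (\<Sum>u\<in>V. (x u)\<^sup>2)"
proof -
  have cV: "real (card V) > 0" using V by (simp add: card_gt_0_iff)
  define c where "c = (\<Sum>u\<in>V. x u) / card V"
  define z where "z = (\<lambda>u. x u - c)"
  have z0: "(\<Sum>u\<in>V. z u) = 0" using cV by (simp add: z_def sum_subtractf c_def)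
  have x: "x = (\<lambda>u. c + z u)" by (auto simp: z_def)
  have cz: "bform V A (\<lambda>u. c) z = 0"
  proof -
    have "bform V A (\<lambda>u. c) z = bform V A z (\<lambda>u. c)" using sym by (rule bform_sym)
    also have "\<dots> = (\<Sum>u\<in>V. c * z u * (\<Sum>v\<in>V. A u v))"
      by (simp add: bform_def sum_distrib_left mult_ac)
    also have "\<dots> = c * d * (\<Sum>u\<in>V. z u)" using reg by (simp add: sum_distrib_left mult_ac)
    finally show ?thesis using z0 by simp
  qed
  have cc: "bform V A (\<lambda>u. c) (\<lambda>u. c) = d / card V * (\<Sum>u\<in>V. x u)\<^sup>2"
  proof -
    have "bform V A (\<lambda>u. c) (\<lambda>u. c) = (\<Sum>u\<in>V. c\<^sup>2 * (\<Sum>v\<in>V. A u v))"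
      by (simp add: bform_def sum_distrib_left mult_ac power2_eq_square)
    also have "\<dots> = (\<Sum>u\<in>V. c\<^sup>2 * d)" using reg by (intro sum.cong) auto
    finally show ?thesis using cV by (simp add: c_def power2_eq_square)
  qed
  have "bform V A x x = bform V A (\<lambda>u. c) (\<lambda>u. c) + 2 * bform V A (\<lambda>u. c) z + bform V A z z"
    unfolding x bform_add_left bform_add_right using bform_sym[OF sym, of z "\<lambda>u. c"] by simp
  then have 1: "bform V A x x - d / card V * (\<Sum>u\<in>V. x u)\<^sup>2 = bform V A z z" using cz cc by simp
  have "\<bar>bform V A z z\<bar> = \<bar>\<Sum>u\<in>V. z u * (\<Sum>v\<in>V. A u v * z v)\<bar>"
    by (simp add: bform_def sum_distrib_left mult_ac)
  also have "\<dots> \<le> (\<Sum>u\<in>V. \<bar>z u * (\<Sum>v\<in>V. A u v * z v)\<bar>)" by (rule sum_abs)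
  also have "\<dots> \<le> (\<Sum>u\<in>V. (m / 2) * (z u)\<^sup>2 + (1 / (2 * m)) * (\<Sum>v\<in>V. A u v * z v)\<^sup>2)"
  proof (rule sum_mono)
    fix u
    show "\<bar>z u * (\<Sum>v\<in>V. A u v * z v)\<bar> \<le> (m / 2) * (z u)\<^sup>2 + (1 / (2 * m)) * (\<Sum>v\<in>V. A u v * z v)\<^sup>2"
      using mult_le_weighted_squares[OF m, of "\<bar>z u\<bar>" "\<bar>\<Sum>v\<in>V. A u v * z v\<bar>"] by (simp add: abs_mult)
  qed
  also have "\<dots> = (m / 2) * (\<Sum>u\<in>V. (z u)\<^sup>2) + (1 / (2 * m)) * (\<Sum>u\<in>V. (\<Sum>v\<in>V. A u v * z v)\<^sup>2)"
    by (simp add: sum.distrib sum_distrib_left)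
  also have "\<dots> \<le> m * (\<Sum>u\<in>V. (z u)\<^sup>2)"
  proof -
    have "(1 / (2 * m)) * (\<Sum>u\<in>V. (\<Sum>v\<in>V. A u v * z v)\<^sup>2) \<le> (1 / (2 * m)) * (m\<^sup>2 * (\<Sum>u\<in>V. (z u)\<^sup>2))"
      using bound[OF z0] m by (intro mult_left_mono) auto
    also have "\<dots> = (m / 2) * (\<Sum>u\<in>V. (z u)\<^sup>2)" using m by (simp add: power2_eq_square)
    finally show ?thesis by simp
  qed
  finally have 2: "\<bar>bform V A z z\<bar> \<le> m * (\<Sum>u\<in>V. (z u)\<^sup>2)" .
  have "(\<Sum>u\<in>V. (x u)\<^sup>2) = (\<Sum>u\<in>V. (z u)\<^sup>2 + 2 * c * z u + c\<^sup>2)"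
    by (simp add: x power2_sum algebra_simps)
  also have "\<dots> = (\<Sum>u\<in>V. (z u)\<^sup>2) + 2 * c * (\<Sum>u\<in>V. z u) + card V * c\<^sup>2"
    unfolding sum.distrib sum_distrib_left by simp
  finally have "(\<Sum>u\<in>V. (z u)\<^sup>2) \<le> (\<Sum>u\<in>V. (x u)\<^sup>2)" using z0 by simp
  then have "m * (\<Sum>u\<in>V. (z u)\<^sup>2) \<le> m * (\<Sum>u\<in>V. (x u)\<^sup>2)" using m by simp
  then show ?thesis using 1 2 by linarith
qed

corollary bform_ge_of_regular:
  fixes A :: "'a \<Rightarrow> 'a \<Rightarrow> real"
  assumes V: "finite V" "V \<noteq> {}" and sym: "sym_on2 V A" and m: "m > 0"
    and reg: "d \<ge> 0" "\<And>u. u \<in> V \<Longrightarrow> (\<Sum>v\<in>V. A u v) = d"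
    and bound: "\<And>z. (\<Sum>u\<in>V. z u) = 0 \<Longrightarrow> (\<Sum>u\<in>V. (\<Sum>v\<in>V. A u v * z v)\<^sup>2) \<le> m\<^sup>2 * (\<Sum>u\<in>V. (z u)\<^sup>2)"
  shows "bform V A x x \<ge> - m * (\<Sum>u\<in>V. (x u)\<^sup>2)"
proof -
  have "d / card V * (\<Sum>u\<in>V. x u)\<^sup>2 \<ge> 0" using reg(1) by simp
  moreover have "\<bar>bform V A x x - d / card V * (\<Sum>u\<in>V. x u)\<^sup>2\<bar> \<le> m * (\<Sum>u\<in>V. (x u)\<^sup>2)"
    by (rule bform_regular[OF V sym m reg(2) bound])
  ultimately show ?thesis unfolding mult_minus_left abs_le_iff by linarith
qed

text \<open>The square of an adjacency matrix counts common neighbours, which gives spectral bounds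
  without knowing any eigenvector.\<close>

lemma sum_sq_adjacency:
  fixes A :: "'a \<Rightarrow> 'a \<Rightarrow> real"
  shows "(\<Sum>u\<in>V. (\<Sum>v\<in>V. A u v * z v)\<^sup>2) = bform V (\<lambda>v w. \<Sum>u\<in>V. A u v * A u w) z z"
proof -
  have "(\<Sum>u\<in>V. (\<Sum>v\<in>V. A u v * z v)\<^sup>2) = (\<Sum>u\<in>V. \<Sum>v\<in>V. \<Sum>w\<in>V. A u v * A u w * z v * z w)"
    by (simp add: power2_eq_square sum_product mult_ac)
  also have "\<dots> = (\<Sum>v\<in>V. \<Sum>w\<in>V. \<Sum>u\<in>V. A u v * A u w * z v * z w)"
    by (subst sum.swap) (intro sum.cong refl sum.swap)
  finally show ?thesis by (simp add: bform_def sum_distrib_right)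
qed

text \<open>Removing the loops costs at most \<open>1\<close> in the smallest eigenvalue.\<close>

lemma lambda_free_ge_adjacency:
  fixes V :: "'v set" and E :: "'v \<Rightarrow> 'v \<Rightarrow> bool" and H :: "'b pair_pre_digraph"
  assumes V: "finite V" "V \<noteq> {}" "card V \<le> n"
    and E: "symp E" and emb: "\<not> embeds H V (\<lambda>u v. u \<noteq> v \<and> E u v)"
    and H: "\<And>a. a \<in> pverts H \<Longrightarrow> \<exists>b. (a, b) \<in> parcs H"
    and m: "m \<ge> 0" "\<And>x. bform V (\<lambda>u v. of_bool (E u v)) x x \<ge> - m * (\<Sum>u\<in>V. (x u)\<^sup>2)"
    and d: "\<And>u. u \<in> V \<Longrightarrow> real (card {v \<in> V. E u v}) = d" and L: "real (card {u \<in> V. E u u}) \<le> l * real (card V)"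
  shows "lambda_free n H \<ge> 1 + (d - l) / (m + 1)"
proof -
  define A where "A = (\<lambda>u v. of_bool (E u v) - (if u = v then of_bool (E u u) else (0::real)))"
  have sum1: "(\<Sum>v\<in>V. A u v) = d - of_bool (E u u)" if "u \<in> V" for u
  proof -
    have "(\<Sum>v\<in>V. of_bool (E u v) :: real) = card {v \<in> V. E u v}"
      using V(1) by (simp add: of_bool_def sum.If_cases Int_def)
    then show ?thesis using that V(1) d unfolding A_def by (simp add: sum_subtractf)
  qed
  have loops: "(\<Sum>u\<in>V. of_bool (E u u) :: real) = card {u \<in> V. E u u}"
    using V(1) by (simp add: of_bool_def sum.If_cases Int_def)
  have tot: "(\<Sum>u\<in>V. \<Sum>v\<in>V. A u v) \<ge> (d - l) * card V"
  proof -
    have "(\<Sum>u\<in>V. \<Sum>v\<in>V. A u v) = (\<Sum>u\<in>V. d - of_bool (E u u))" using sum1 by (intro sum.cong) auto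
    also have "\<dots> = d * card V - card {u \<in> V. E u u}"
      using loops by (simp add: sum_subtractf)
    finally show ?thesis using L by (simp add: algebra_simps)
  qed
  have cV: "real (card V) > 0" using V by (simp add: card_gt_0_iff)
  have "1 + (\<Sum>u\<in>V. \<Sum>v\<in>V. A u v) / ((m + 1) * card V) \<le> lambda_free n H"
  proof (rule lambda_free_ge[OF V _ emb H])
    show "symp (\<lambda>u v. u \<noteq> v \<and> E u v)" using E by (auto simp: symp_def)
    show "sym_on2 V A" using E by (auto simp: sym_on2_def A_def symp_def)
    show "u \<noteq> v \<and> u \<noteq> v \<and> E u v" if "A u v \<noteq> 0" for u v using that by (auto simp: A_def split: if_splits)
    show "m + 1 > 0" using m(1) by simp
    fix x :: "'v \<Rightarrow> real"
    have 1: "bform V A x x = bform V (\<lambda>u v. of_bool (E u v)) x x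
        - bform V (\<lambda>u v. if u = v then of_bool (E u u) else 0) x x"
      unfolding A_def by (rule bform_diff_kernel)
    have 2: "bform V (\<lambda>u v. if u = v then of_bool (E u u) else 0) x x = (\<Sum>u\<in>V. of_bool (E u u) * (x u)\<^sup>2)"
    proof -
      have "(\<Sum>v\<in>V. (if u = v then of_bool (E u u) else 0) * x u * x v) = of_bool (E u u) * (x u)\<^sup>2" if "u \<in> V" for u
      proof -
        have "(\<Sum>v\<in>V. (if u = v then of_bool (E u u) else 0) * x u * x v) =
          (\<Sum>v\<in>V. if u = v then of_bool (E u u) * (x u)\<^sup>2 else 0)"
          by (intro sum.cong) (auto simp: power2_eq_square)
        then show ?thesis using that V(1) by simp
      qed
      then show ?thesis by (simp add: bform_def)
    qed
    have 3: "(\<Sum>u\<in>V. of_bool (E u u) * (x u)\<^sup>2) \<le> (\<Sum>u\<in>V. (x u)\<^sup>2)" by (intro sum_mono) auto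
    show "bform V A x x \<ge> - (m + 1) * (\<Sum>u\<in>V. (x u)\<^sup>2)"
      using m(2)[of x] 1 2 3 by (simp add: algebra_simps)
  qed
  moreover have "(d - l) / (m + 1) \<le> (\<Sum>u\<in>V. \<Sum>v\<in>V. A u v) / ((m + 1) * card V)"
  proof -
    have "(d - l) / (m + 1) = (d - l) * card V / ((m + 1) * card V)" using cV by simp
    also have "\<dots> \<le> (\<Sum>u\<in>V. \<Sum>v\<in>V. A u v) / ((m + 1) * card V)"
      using tot m(1) cV by (intro divide_right_mono) auto
    finally show ?thesis .
  qed
  ultimately show ?thesis by linarith
qed

text \<open>If \<open>p = [:- a, 1:] * r\<close>, then \<open>pderiv p\<close> and \<open>r\<close>
  agree at \<open>a\<close>; so \<open>a\<close> is not a root of \<open>r\<close>, and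
  \<open>r\<close> inherits the hypothesis.\<close>

lemma card_roots_separable:
  fixes p :: "'a :: alg_closed_field poly"
  assumes "p \<noteq> 0" "\<And>x. poly p x = 0 \<Longrightarrow> poly (pderiv p) x \<noteq> 0"
  shows "card {x. poly p x = 0} = degree p"
  using assms
proof (induction "degree p" arbitrary: p)
  case 0
  then obtain c where "p = [:c:]" using degree_eq_zeroE by metis
  with 0 show ?case by auto
next
  case (Suc d)
  obtain a where a: "poly p a = 0" using alg_closed_imp_poly_has_root[of p] Suc.hyps(2) by auto
  then obtain r where r: "p = [:- a, 1:] * r" by (auto simp: poly_eq_0_iff_dvd)
  have r0: "r \<noteq> 0" using Suc.prems r by auto
  have pd: "poly (pderiv p) x = poly r x + (x - a) * poly (pderiv r) x" for x
  proof -
    have "pderiv p = [:- a, 1:] * pderiv r + r * pderiv [:- a, 1:]" by (simp only: r pderiv_mult)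
    then have "poly (pderiv p) x = poly ([:- a, 1:] * pderiv r + r * pderiv [:- a, 1:]) x" by (rule arg_cong)
    then show ?thesis by (simp add: pderiv_pCons algebra_simps)
  qed
  have ra: "poly r a \<noteq> 0" using Suc.prems(2)[OF a] pd[of a] by simp
  have "degree p = Suc (degree r)"
    unfolding r using r0 by (subst degree_mult_eq) auto
  then have deg: "degree r = d" using Suc.hyps(2) by simp
  have "card {x. poly r x = 0} = degree r"
  proof (rule Suc.hyps(1))
    show "poly (pderiv r) x \<noteq> 0" if "poly r x = 0" for x
      using Suc.prems(2)[of x] pd[of x] that by (auto simp: r)
  qed (use deg r0 in auto)
  moreover have "{x. poly p x = 0} = insert a {x. poly r x = 0}" by (auto simp: r)
  moreover have "finite {x. poly r x = 0}" using r0 by (rule poly_roots_finite)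
  ultimately show ?case using ra deg Suc.hyps(2) by simp
qed

section \<open>Finite fields as sets of Frobenius fixed points\<close>

definition Fq :: "nat \<Rightarrow> 'a :: field set" where "Fq q = {x. x ^ q = x}"

locale finite_subfield =
  fixes p e q :: nat and ty :: "'a :: alg_closed_field itself"
  assumes char: "CHAR('a) = p" and p: "prime p" and e: "e > 0" and q: "q = p ^ e"
begin

abbreviation F :: "'a set" where "F \<equiv> Fq q"

lemma q_gt_1: "q > 1"
  unfolding q using prime_gt_1_nat[OF p] e by (metis one_less_power)

lemma Frob_add: "(x + y :: 'a) ^ p ^ k = x ^ p ^ k + y ^ p ^ k"
  using char p by (intro freshmans_dream') auto

lemma Frob_minus: "(- x :: 'a) ^ p ^ k = - (x ^ p ^ k)"
proof -
  have "x ^ p ^ k + (- x) ^ p ^ k = (x + (- x)) ^ p ^ k" by (rule Frob_add[symmetric])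
  also have "\<dots> = 0" using prime_gt_0_nat[OF p] by (simp add: power_0_left)
  finally show ?thesis by (simp add: eq_neg_iff_add_eq_0 add.commute)
qed

lemma Frob_diff: "(x - y :: 'a) ^ p ^ k = x ^ p ^ k - y ^ p ^ k"
  using Frob_add[of x "- y" k] Frob_minus[of y k] by simp

lemma Frob_sum: "(\<Sum>i\<in>I. f i :: 'a) ^ p ^ k = (\<Sum>i\<in>I. f i ^ p ^ k)"
  using char p by (intro freshmans_dream_sum') auto

lemma Frob_eq_iff: "(x :: 'a) ^ p ^ k = y ^ p ^ k \<longleftrightarrow> x = y"
proof
  assume "x ^ p ^ k = y ^ p ^ k"
  then have "(x - y) ^ p ^ k = 0" by (simp add: Frob_diff)
  then show "x = y" by simp
qed simp

lemma F_closed [simp]: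
  "0 \<in> F" "1 \<in> F" "x \<in> F \<Longrightarrow> y \<in> F \<Longrightarrow> x + y \<in> F" "x \<in> F \<Longrightarrow> - x \<in> F"
  "x \<in> F \<Longrightarrow> y \<in> F \<Longrightarrow> x - y \<in> F" "x \<in> F \<Longrightarrow> y \<in> F \<Longrightarrow> x * y \<in> F"
  "x \<in> F \<Longrightarrow> inverse x \<in> F" "x \<in> F \<Longrightarrow> y \<in> F \<Longrightarrow> x / y \<in> F" "x \<in> F \<Longrightarrow> x ^ k \<in> F"
  using q_gt_1 Frob_add[of x y e] Frob_minus[of x e] Frob_diff[of x y e]
  by (auto simp: Fq_def q[symmetric] power_mult_distrib power_0_left field_simps power_inverse power_divide
      simp flip: power_mult) (metis mult.commute power_mult)

lemma F_sum: "(\<And>i. i \<in> I \<Longrightarrow> f i \<in> F) \<Longrightarrow> (\<Sum>i\<in>I. f i) \<in> F"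
  by (induction I rule: infinite_finite_induct) auto

lemma finite_F [simp]: "finite F" and card_F: "card F = q"
proof -
  let ?P = "monom 1 q - monom 1 1 :: 'a poly"
  have deg: "degree ?P = q"
    using q_gt_1 degree_add_eq_left[of "- monom 1 1" "monom 1 q :: 'a poly"] by (simp add: degree_monom_eq)
  then have P0: "?P \<noteq> 0" using q_gt_1 by auto
  have roots: "{x. poly ?P x = 0} = F" by (auto simp: Fq_def poly_monom)
  show "finite F" using poly_roots_finite[OF P0] unfolding roots .
  \<comment> \<open>Hence the derivative of \<open>?P\<close> is the constant -1 and all roots are
    simple.\<close>
  have "(of_nat q :: 'a) = 0"
    using char p e by (simp add: q of_nat_eq_0_iff_char_dvd dvd_power)
  then have "pderiv ?P = -1" by (simp add: pderiv_diff pderiv_monom monom_0 one_pCons)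
  then have "card {x. poly ?P x = 0} = q"
    using card_roots_separable[OF P0] deg by simp
  then show "card F = q" unfolding roots .
qed

lemma F_power_q: "x \<in> F \<Longrightarrow> x ^ q = x"
  by (simp add: Fq_def)

lemma F_power_q_1: "x \<in> F \<Longrightarrow> x \<noteq> 0 \<Longrightarrow> x ^ (q - 1) = 1"
proof -
  assume x: "x \<in> F" "x \<noteq> 0"
  have "x * x ^ (q - 1) = x ^ q" using q_gt_1 by (simp flip: power_Suc)
  then show ?thesis using x by (simp add: Fq_def)
qed

end

text \<open>The form is the sum, over the classes, of the squared class sums of \<open>z\<close>.
  Such kernels enter the codegree matrices with a negative sign and can therefore be
  dropped.\<close>

lemma bform_same_class_nonneg:
  assumes "finite V"
  shows "bform V (\<lambda>u v. of_bool (f u = f v)) z z \<ge> 0"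
proof -
  have "(\<Sum>x\<in>f ` V. (\<Sum>u\<in>V. of_bool (f u = x) * z u)\<^sup>2) =
      (\<Sum>x\<in>f ` V. \<Sum>u\<in>V. \<Sum>v\<in>V. of_bool (f u = x) * z u * (of_bool (f v = x) * z v))"
    unfolding power2_eq_square sum_product ..
  also have "\<dots> = (\<Sum>u\<in>V. \<Sum>v\<in>V. \<Sum>x\<in>f ` V. of_bool (f u = x) * z u * (of_bool (f v = x) * z v))"
    by (subst sum.swap) (intro sum.cong refl sum.swap)
  also have "\<dots> = (\<Sum>u\<in>V. \<Sum>v\<in>V. of_bool (f u = f v) * z u * z v)"
  proof (intro sum.cong refl)
    fix u v assume "u \<in> V" "v \<in> V"
    have "(\<Sum>x\<in>f ` V. of_bool (f u = x) * z u * (of_bool (f v = x) * z v)) =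
        (\<Sum>x\<in>f ` V. if x = f u then of_bool (f u = f v) * z u * z v else 0)"
      by (intro sum.cong) auto
    then show "(\<Sum>x\<in>f ` V. of_bool (f u = x) * z u * (of_bool (f v = x) * z v)) = of_bool (f u = f v) * z u * z v"
      using \<open>u \<in> V\<close> assms by simp
  qed
  finally have "bform V (\<lambda>u v. of_bool (f u = f v)) z z = (\<Sum>x\<in>f ` V. (\<Sum>u\<in>V. of_bool (f u = x) * z u)\<^sup>2)"
    by (simp add: bform_def)
  then show ?thesis by (simp add: sum_nonneg)
qed

section \<open>Complete bipartite graphs with two vertices on one side\<close>

lemma sum_of_bool_card: "finite V \<Longrightarrow> (\<Sum>u\<in>V. of_bool (P u)) = real (card {u \<in> V. P u})"
  by (simp add: of_bool_def sum.If_cases Int_def)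

locale finite_subfield_char2 = finite_subfield p e q ty for p e q :: nat and ty :: "'a :: alg_closed_field itself" +
  assumes p2: "p = 2"
begin

lemma add_self [simp]: "(x :: 'a) + x = 0"
  using char p2 uminus_CHAR_2[of x] by (metis add.right_inverse)

lemma neg_eq [simp]: "- (x :: 'a) = x"
  using char p2 uminus_CHAR_2[of x] by simp

lemma diff_eq [simp]: "(x :: 'a) - y = x + y"
  using diff_conv_add_uminus[of x y] by simp

lemma add_eq_0_iff [simp]: "(x :: 'a) + y = 0 \<longleftrightarrow> x = y"
  by (metis add_eq_0_iff2 neg_eq)

lemma add_cancel [simp]: "(x :: 'a) + (x + y) = y"
  by (metis add.assoc add_0 add_self)

lemma square_eq_iff: "(x :: 'a) * x = y * y \<longleftrightarrow> x = y"
  using Frob_eq_iff[of x 1 y] p2 by (simp add: power2_eq_square)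

text \<open>In characteristic 2 adjoining one outside element \<open>w\<close> exactly doubles a
  subgroup, as \<open>w + w = 0\<close>.\<close>

lemma subgroup_exists:
  assumes "a \<le> e"
  shows "\<exists>H\<subseteq>F. 0 \<in> H \<and> (\<forall>x\<in>H. \<forall>y\<in>H. x + y \<in> H) \<and> card H = 2 ^ a"
  using assms
proof (induction a)
  case 0
  show ?case by (intro exI[of _ "{0}"]) auto
next
  case (Suc a)
  then obtain H where H: "H \<subseteq> F" "0 \<in> H" "\<And>x y. x \<in> H \<Longrightarrow> y \<in> H \<Longrightarrow> x + y \<in> H" "card H = 2 ^ a" by auto
  have fin: "finite H" using H(1) finite_F finite_subset by blast
  have "card H < card F" 
  proof -
    have "(2::nat) ^ a < 2 ^ e" using Suc.prems by (intro power_strict_increasing) auto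
    then show ?thesis using H(4) card_F p2 unfolding q by simp
  qed
  then obtain w where w: "w \<in> F" "w \<notin> H" using H(1) by (metis less_irrefl subset_antisym subsetI)
  let ?H = "H \<union> (+) w ` H"
  have disj: "H \<inter> (+) w ` H = {}"
  proof (rule ccontr)
    assume "H \<inter> (+) w ` H \<noteq> {}"
    then obtain h where h: "h \<in> H" "w + h \<in> H" by auto
    then have "h + (w + h) \<in> H" using H(3) by blast
    then show False using w by (simp add: add.left_commute[of h])
  qed
  have "card ?H = card H + card ((+) w ` H)" using disj fin by (intro card_Un_disjoint) auto
  also have "card ((+) w ` H) = card H" by (intro card_image) auto
  finally have "card ?H = 2 ^ Suc a" using H(4) by simp
  moreover have "x + y \<in> ?H" if xy: "x \<in> ?H" "y \<in> ?H" for x y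
  proof -
    obtain x' y' where "x = x' \<or> x = w + x'" "y = y' \<or> y = w + y'" "x' \<in> H" "y' \<in> H" using xy by blast
    moreover have "(w + x') + (w + y') = x' + y'" "x' + (w + y') = w + (x' + y')" "(w + x') + y' = w + (x' + y')"
      by (simp_all add: add_ac)
    ultimately show ?thesis using H(3)[of x' y'] by (metis UnI1 UnI2 image_eqI)
  qed
  ultimately show ?case using H w by (intro exI[of _ ?H]) (auto 0 3)
qed

end

lemma complete_bipartite_graph_arcs:
  assumes "s > 0" "t > 0" "a \<in> pverts (complete_bipartite_graph s t)"
  shows "\<exists>b. (a, b) \<in> parcs (complete_bipartite_graph s t)"
proof (cases a)
  case (Inl i)
  then show ?thesis using assms
    by (intro exI[of _ "Inr 0"]) (auto simp: complete_bipartite_graph_def Let_def)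
next
  case (Inr i)
  then show ?thesis using assms
    by (intro exI[of _ "Inl 0"]) (auto simp: complete_bipartite_graph_def Let_def)
qed

lemma embeds_complete_bipartiteD:
  assumes "embeds (complete_bipartite_graph s t) V E"
  obtains f g where "inj_on f {0..<s}" "f ` {0..<s} \<subseteq> V" "inj_on g {0..<t}" "g ` {0..<t} \<subseteq> V"
    "\<And>i j. i < s \<Longrightarrow> j < t \<Longrightarrow> E (g j) (f i)"
proof -
  obtain h where h: "inj_on h (pverts (complete_bipartite_graph s t))"
    "h ` pverts (complete_bipartite_graph s t) \<subseteq> V"
    "\<forall>(a, b)\<in>parcs (complete_bipartite_graph s t). E (h a) (h b)"
    using assms by (auto simp: embeds_def)
  show thesis
  proof
    show "inj_on (h \<circ> Inl) {0..<s}" "inj_on (h \<circ> Inr) {0..<t}"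
      using h(1) by (auto simp: complete_bipartite_graph_def Let_def inj_on_def)
    show "(h \<circ> Inl) ` {0..<s} \<subseteq> V" "(h \<circ> Inr) ` {0..<t} \<subseteq> V"
      using h(2) by (auto simp: complete_bipartite_graph_def Let_def)
    show "E ((h \<circ> Inr) j) ((h \<circ> Inl) i)" if "i < s" "j < t" for i j
      using h(3) that by (auto simp: complete_bipartite_graph_def Let_def)
  qed
qed

context finite_subfield_char2
begin

text \<open>The vertices are the pairs of an element \<open>x\<close> of \<open>F\<close> and a coset \<open>c + S\<close> of an additive
  subgroup of order \<open>s\<close>; two of them are adjacent if \<open>c + d + x * y \<in> S\<close>.\<close>

lemma lambda_free_K2t_field:
  fixes H :: "'h pair_pre_digraph"
  assumes H: "\<And>(V :: ('a \<times> 'a) set) E. embeds H V E \<Longrightarrow> embeds (complete_bipartite_graph 2 t) V E"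
      "\<And>a. a \<in> pverts H \<Longrightarrow> \<exists>b. (a, b) \<in> parcs H"
    and S: "S \<subseteq> F" "0 \<in> S" "\<And>x y. x \<in> S \<Longrightarrow> y \<in> S \<Longrightarrow> x + y \<in> S" "card S = s"
    and st: "s < t" and n: "real q * real q \<le> real s * real n"
  shows "lambda_free n H \<ge> sqrt (real q)"
proof -
  have finS: "finite S" using S(1) finite_F finite_subset by blast
  have s0: "s > 0" using S(2,4) finS by (auto simp: card_gt_0_iff)
  have S_add_iff: "x + y \<in> S \<longleftrightarrow> y \<in> S" if "x \<in> S" for x y
    using S(3)[of x y] S(3)[of x "x + y"] that by auto
  \<comment> \<open>A canonical representative of the coset of \<open>c\<close>: the choice depends
    only on the predicate, which is the same for all elements of a coset. So the quotient by
    \<open>S\<close> is realised inside \<open>F\<close>, as the set \<open>Q\<close>.\<close>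
  define rep where "rep = (\<lambda>c. SOME d. d \<in> F \<and> d + c \<in> S)"
  have rep: "rep c \<in> F" "rep c + c \<in> S" if "c \<in> F" for c
    using someI[of "\<lambda>d. d \<in> F \<and> d + c \<in> S" c] that S(2) by (auto simp: rep_def)
  have rep_eq_iff: "rep c = rep d \<longleftrightarrow> c + d \<in> S" if "c \<in> F" "d \<in> F" for c d
  proof
    assume "rep c = rep d"
    then have "(rep c + c) + (rep c + d) \<in> S" using rep that S(3) by metis
    then show "c + d \<in> S" by (simp add: add_ac)
  next
    assume cd: "c + d \<in> S"
    have "x + c \<in> S \<longleftrightarrow> x + d \<in> S" for x
      using S_add_iff[OF cd, of "x + c"] by (simp add: add_ac)
    then show "rep c = rep d" by (simp add: rep_def)
  qed
  define Q where "Q = rep ` F"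
  have QF: "Q \<subseteq> F" using rep by (auto simp: Q_def)
  have finQ: "finite Q" by (simp add: Q_def)
  have rep_Q: "rep c = c" if "c \<in> Q" for c
  proof -
    have "c \<in> rep ` F" using that by (simp add: Q_def)
    then obtain d where d: "d \<in> F" "c = rep d" by auto
    have "rep (rep d) = rep d" using rep[OF d(1)] rep_eq_iff[of "rep d" d] d(1) by blast
    then show ?thesis using d(2) by metis
  qed
  have coset_card: "card {c \<in> F. c + d \<in> S} = s" if "d \<in> F" for d
  proof -
    have "{c \<in> F. c + d \<in> S} = (+) d ` S"
    proof (intro Set.set_eqI iffI)
      fix c assume "c \<in> {c \<in> F. c + d \<in> S}"
      then have "c + d \<in> S" by simp
      moreover have "d + (c + d) = c" by (metis add.commute add_cancel)
      ultimately show "c \<in> (+) d ` S" by (metis image_eqI)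
    qed (use that S(1) in \<open>auto simp: add_ac\<close>)
    then show ?thesis using S(4) by (simp add: card_image)
  qed
  have sQ: "s * card Q = q"
  proof -
    have "card F = (\<Sum>r\<in>Q. card {c \<in> F. rep c = r})"
    proof -
      have "F = (\<Union>r\<in>Q. {c \<in> F. rep c = r})" by (auto simp: Q_def)
      then have "card F = card (\<Union>r\<in>Q. {c \<in> F. rep c = r})" by (rule arg_cong)
      also have "\<dots> = (\<Sum>r\<in>Q. card {c \<in> F. rep c = r})"
        using finQ by (intro card_UN_disjoint) auto
      finally show ?thesis .
    qed
    also have "\<dots> = (\<Sum>r\<in>Q. s)"
    proof (intro sum.cong refl)
      fix r assume r: "r \<in> Q"
      have "{c \<in> F. rep c = r} = {c \<in> F. c + r \<in> S}"
        using r rep_eq_iff[of _ r] rep_Q[OF r] QF by auto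
      then show "card {c \<in> F. rep c = r} = s" using coset_card r QF by auto
    qed
    finally show ?thesis by (simp add: card_F mult.commute)
  qed
  have cQ: "card Q > 0" using sQ q_gt_1 by (metis gr0I mult_0_right not_less_zero)
  define V where "V = F \<times> Q"
  have Fne: "F \<noteq> {}" using F_closed(1) by blast
  have V: "finite V" "V \<noteq> {}" "card V = q * card Q"
    using cQ finQ Fne by (auto simp: V_def card_cartesian_product card_F)
  have "s * card V \<le> s * n"
  proof -
    have "s * card V = q * q" using V(3) sQ by (metis mult.left_commute)
    then show ?thesis using n by (metis of_nat_le_iff of_nat_mult)
  qed
  then have Vn: "card V \<le> n" using s0 by simp
  define E where "E = (\<lambda>u v :: 'a \<times> 'a. snd u + snd v + fst u * fst v \<in> S)"
  have E: "symp E" by (auto simp: E_def symp_def add_ac mult_ac)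
  have E_iff: "E (y, d) (x, c) \<longleftrightarrow> d = rep (c + x * y)" if "x \<in> F" "c \<in> Q" "y \<in> F" "d \<in> Q" for x c y d
  proof -
    have "d \<in> F" "c \<in> F" using that QF by auto
    then have "d = rep (c + x * y) \<longleftrightarrow> d + (c + x * y) \<in> S"
      using that rep_eq_iff[of d "c + x * y"] rep_Q[of d] by simp
    then show ?thesis by (simp add: E_def add_ac mult_ac)
  qed
  \<comment> \<open>For \<open>x \<noteq> x'\<close> the common neighbours correspond to the
    \<open>y\<close> for which \<open>(x + x') * y\<close> lies in a fixed coset of
    \<open>S\<close>; multiplication by \<open>x + x'\<close> is bijective, so there are
    \<open>s\<close> of them.\<close>
  have codeg: "card {u \<in> V. E u (x, c) \<and> E u (x', c')} = (if x = x' then (if c = c' then q else 0) else s)"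
    if xc: "x \<in> F" "c \<in> Q" "x' \<in> F" "c' \<in> Q" for x c x' c'
  proof -
    have "{u \<in> V. E u (x, c) \<and> E u (x', c')} =
      (\<lambda>y. (y, rep (c + x * y))) ` {y \<in> F. rep (c + x * y) = rep (c' + x' * y)}"
      using xc E_iff QF by (auto simp: V_def Q_def subset_iff)
    then have "card {u \<in> V. E u (x, c) \<and> E u (x', c')} = card {y \<in> F. rep (c + x * y) = rep (c' + x' * y)}"
      by (simp add: card_image inj_on_def)
    also have "{y \<in> F. rep (c + x * y) = rep (c' + x' * y)} = {y \<in> F. (c + c') + (x + x') * y \<in> S}"
      using rep_eq_iff xc QF by (auto simp: algebra_simps subset_iff)
    also have "card \<dots> = (if x = x' then (if c = c' then q else 0) else s)"
    proof (cases "x = x'")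
      case True
      moreover have "c + c' \<in> S \<longleftrightarrow> c = c'" using rep_eq_iff[of c c'] rep_Q xc QF by auto
      ultimately show ?thesis using S(2) card_F by (auto simp: card_F)
    next
      case False
      then have nz: "x + x' \<noteq> 0" by simp
      have "{y \<in> F. (c + c') + (x + x') * y \<in> S} = (\<lambda>z. z / (x + x')) ` {z \<in> F. z + (c + c') \<in> S}"
      proof (intro Set.set_eqI iffI)
        fix y assume "y \<in> {y \<in> F. (c + c') + (x + x') * y \<in> S}"
        then have 1: "(x + x') * y \<in> {z \<in> F. z + (c + c') \<in> S}"
          using xc by (auto simp: add_ac)
        have 2: "y = (x + x') * y / (x + x')" using nz by (metis nonzero_mult_div_cancel_left)
        show "y \<in> (\<lambda>z. z / (x + x')) ` {z \<in> F. z + (c + c') \<in> S}" by (subst 2) (rule imageI[OF 1])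
      qed (use xc nz in \<open>auto simp: add_ac\<close>)
      moreover have "inj_on (\<lambda>z. z / (x + x')) {z \<in> F. z + (c + c') \<in> S}" using nz by (auto simp: inj_on_def)
      ultimately show ?thesis using coset_card[of "c + c'"] False xc QF by (simp add: card_image subset_iff)
    qed
    finally show ?thesis .
  qed
  have deg: "card {v \<in> V. E u v} = q" if "u \<in> V" for u
  proof -
    have "{v \<in> V. E u v} = {v \<in> V. E v u \<and> E v u}" using E by (metis sympD)
    then show ?thesis using that codeg[of "fst u" "snd u" "fst u" "snd u"] by (auto simp: V_def)
  qed
  have emb: "\<not> embeds H V (\<lambda>u v. u \<noteq> v \<and> E u v)"
  proof
    assume "embeds H V (\<lambda>u v. u \<noteq> v \<and> E u v)"
    then have "embeds (complete_bipartite_graph 2 t) V (\<lambda>u v. u \<noteq> v \<and> E u v)" by (rule H(1))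
    then obtain f g where fg: "inj_on f {0..<2::nat}" "f ` {0..<2} \<subseteq> V" "inj_on g {0..<t}" "g ` {0..<t} \<subseteq> V"
      "\<And>i j. i < 2 \<Longrightarrow> j < t \<Longrightarrow> g j \<noteq> f i \<and> E (g j) (f i)"
      by (rule embeds_complete_bipartiteD) blast
    have ne: "f 0 \<noteq> f 1" using inj_onD[OF fg(1), of 0 1] by auto
    have fV: "f 0 \<in> V" "f 1 \<in> V" using fg(2) by auto
    have "g ` {0..<t} \<subseteq> {u \<in> V. E u (f 0) \<and> E u (f 1)}" using fg(4,5) by auto
    then have "card (g ` {0..<t}) \<le> card {u \<in> V. E u (f 0) \<and> E u (f 1)}" using V(1) by (intro card_mono) auto
    then have "t \<le> card {u \<in> V. E u (f 0) \<and> E u (f 1)}" using fg(3) by (simp add: card_image)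
    also have "\<dots> \<le> s"
    proof -
      obtain x c x' c' where "f 0 = (x, c)" "f 1 = (x', c')" by fastforce
      then show ?thesis using codeg[of x c x' c'] ne fV by (auto simp: V_def split: if_splits)
    qed
    finally show False using st by simp
  qed
  have loops: "real (card {u \<in> V. E u u}) \<le> 1 * real (card V)"
    using V(1) by (simp add: card_mono)
  have "lambda_free n H \<ge> 1 + (real q - 1) / (sqrt q + 1)"
  proof (rule lambda_free_ge_adjacency[OF V(1,2) Vn E emb _ _ _ _ loops])
    show "\<exists>b. (a, b) \<in> parcs H" if "a \<in> pverts H" for a using H(2)[OF that] .
    show "real (card {v \<in> V. E u v}) = real q" if "u \<in> V" for u using deg that by simp
    fix x :: "'a \<times> 'a \<Rightarrow> real"
    show "bform V (\<lambda>u v. of_bool (E u v)) x x \<ge> - sqrt q * (\<Sum>u\<in>V. (x u)\<^sup>2)"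
    proof (rule bform_ge_of_regular[OF V(1,2)])
      show "sym_on2 V (\<lambda>u v. of_bool (E u v))" using E by (auto simp: sym_on2_def symp_def)
      show "(\<Sum>v\<in>V. of_bool (E u v)) = real q" if "u \<in> V" for u
        using deg[OF that] V(1) by (simp add: of_bool_def sum.If_cases Int_def)
      fix z :: "'a \<times> 'a \<Rightarrow> real" assume z: "(\<Sum>u\<in>V. z u) = 0"
      \<comment> \<open>The square of the adjacency matrix is \<open>q\<close> times the identity
        plus \<open>s\<close> times the difference of the all-ones kernel and the same-class kernel.
        The all-ones kernel vanishes on \<open>z\<close>.\<close>
      have "(\<Sum>u\<in>V. of_bool (E u v) * of_bool (E u w)) =
          (if v = w then real q else 0) + (real s - real s * of_bool (fst v = fst w))"
        if "v \<in> V" "w \<in> V" for v w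
      proof -
        have "(\<Sum>u\<in>V. of_bool (E u v) * of_bool (E u w)) = real (card {u \<in> V. E u v \<and> E u w})"
          using sum_of_bool_card[OF V(1)] by (simp flip: of_bool_conj)
        then show ?thesis
          using codeg[of "fst v" "snd v" "fst w" "snd w"] that by (auto simp: V_def prod_eq_iff)
      qed
      then have "(\<Sum>u\<in>V. (\<Sum>v\<in>V. of_bool (E u v) * z v)\<^sup>2) =
        bform V (\<lambda>v w. (if v = w then real q else 0) + (real s - real s * of_bool (fst v = fst w))) z z"
        unfolding sum_sq_adjacency by (intro bform_cong) auto
      also have "\<dots> = q * (\<Sum>u\<in>V. (z u)\<^sup>2) - s * bform V (\<lambda>v w. of_bool (fst v = fst w)) z z"
        using V(1) z by (simp add: bform_add_kernel bform_diff_kernel bform_scale_kernel bform_delta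
            bform_const power2_eq_square)
      also have "\<dots> \<le> q * (\<Sum>u\<in>V. (z u)\<^sup>2)"
        using bform_same_class_nonneg[OF V(1), of fst z] by simp
      finally show "(\<Sum>u\<in>V. (\<Sum>v\<in>V. of_bool (E u v) * z v)\<^sup>2) \<le> (sqrt q)\<^sup>2 * (\<Sum>u\<in>V. (z u)\<^sup>2)" by simp
    qed (use q_gt_1 in auto)
  qed auto
  moreover have "1 + (real q - 1) / (sqrt q + 1) = sqrt q"
  proof -
    have "real q - 1 = (sqrt q - 1) * (sqrt q + 1)" by (simp add: algebra_simps)
    moreover have "sqrt q + 1 \<noteq> 0" using real_sqrt_ge_zero[of q] by linarith
    ultimately show ?thesis by simp
  qed
  ultimately show ?thesis by simp
qed

end

text \<open>Since \<open>bool\<close> has two elements, \<open>bool mod_ring\<close> is the prime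
  field of order 2.\<close>

type_synonym K2 = "bool mod_ring alg_closure"

lemma CHAR_K2: "CHAR(K2) = 2"
  by simp

lemma finite_subfield_K2:
  assumes "k > 0"
  shows "finite_subfield_char2 TYPE(K2) 2 k (2 ^ k)"
  using assms by unfold_locales (auto simp: CHAR_K2)

lemma ex_power_between:
  fixes b x :: real
  assumes "b > 1" "x \<ge> 1"
  shows "\<exists>k. b ^ k \<le> x \<and> x < b ^ Suc k"
proof -
  have "\<exists>k. x < b ^ k" using assms real_arch_pow[of b x] by auto
  define m where "m = (LEAST k. x < b ^ k)"
  have m: "x < b ^ m" unfolding m_def using \<open>\<exists>k. x < b ^ k\<close> by (rule LeastI_ex)
  have "m \<noteq> 0" using m assms by (metis not_less power_0)
  then obtain k where k: "m = Suc k" using not0_implies_Suc by blast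
  have "\<not> x < b ^ k" using not_less_Least[of k "\<lambda>k. x < b ^ k"] k by (simp add: m_def)
  then show ?thesis using m k by (intro exI[of _ k]) auto
qed

text \<open>Stated for every \<open>H\<close> whose copies yield copies of
  \<open>complete_bipartite_graph 2 t\<close>, so that the quadrilateral is covered by
  \<open>t = 2\<close>. With powers of two such that \<open>s < t \<le> 2 * s\<close> and
  \<open>q * q \<le> s * n < 4 * (q * q)\<close> the graph has \<open>q * q / s\<close> vertices,
  hence at most \<open>n\<close>.\<close>

lemma lambda_free_ge_of_embeds_K2t:
  fixes H :: "'h pair_pre_digraph"
  assumes "t \<ge> 2" "n \<ge> t" "pverts H \<noteq> {}"
    and H: "\<And>(V :: (K2 \<times> K2) set) E. embeds H V E \<Longrightarrow> embeds (complete_bipartite_graph 2 t) V E"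
      "\<And>a. a \<in> pverts H \<Longrightarrow> \<exists>b. (a, b) \<in> parcs H"
  shows "lambda_free n H \<ge> 1 / 2 * real t powr (1/4) * real n powr (1/4)"
proof -
  obtain a where a: "2 ^ a \<le> real (t - 1)" "real (t - 1) < 2 ^ Suc a"
    using ex_power_between[of 2 "real (t - 1)"] assms by auto
  define s :: nat where "s = 2 ^ a"
  have "real t - 1 < 2 * real s" "real s \<le> real t - 1" using a assms by (auto simp: s_def of_nat_diff)
  then have s: "s < t" "t \<le> 2 * s" using assms by linarith+
  have sn: "real s * real n \<ge> 1"
  proof -
    have "1 \<le> s * n" using s assms by (cases s; cases n) auto
    then show ?thesis by (metis of_nat_1 of_nat_le_iff of_nat_mult)
  qed
  obtain k where k: "4 ^ k \<le> real s * real n" "real s * real n < 4 ^ Suc k"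
    using ex_power_between[of 4 "real s * real n"] sn by auto
  define q :: nat where "q = 2 ^ k"
  have qq: "real q * real q = 4 ^ k" by (simp add: q_def flip: power_mult_distrib)
  \<comment> \<open>A subgroup of order \<open>s\<close> must fit into the field. From
    \<open>s \<le> n\<close> one has \<open>s * s \<le> s * n < 4 * (q * q)\<close>, and both
    \<open>s\<close> and \<open>q\<close> are powers of two.\<close>
  have sq: "s \<le> q"
  proof (rule ccontr)
    assume "\<not> s \<le> q"
    then have "k < a" by (simp add: s_def q_def)
    then have "(4 :: real) ^ Suc k \<le> 4 ^ a" using \<open>k < a\<close> by (intro power_increasing) auto
    also have "\<dots> = real s * real s" by (simp add: s_def flip: power_mult_distrib)
    also have "\<dots> \<le> real s * real n" using s assms by (intro mult_left_mono) auto
    finally show False using k(2) by linarith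
  qed
  have tn: "real t * real n \<le> 2 * (real s * real n)" using s(2)
    by (metis mult.assoc mult_right_mono of_nat_0_le_iff of_nat_le_iff of_nat_mult of_nat_numeral)
  \<comment> \<open>The factor 8 would be true as well; 16 has the exact fourth root 2, whence the
    constant \<open>1 / 2\<close>.\<close>
  have "real t * real n \<le> 16 * (real q * real q)"
  proof -
    have "(0::real) \<le> 4 ^ k" by simp
    then show ?thesis
      using k(2) tn unfolding qq power_Suc by linarith
  qed
  then have "(real t * real n) powr (1/4) \<le> (16 * (real q * real q)) powr (1/4)"
    by (intro powr_mono2) auto
  also have "\<dots> = 2 * sqrt q"
  proof -
    have eq: "16 * (real q * real q) = (2 * sqrt q) powr 4"
      by (simp add: powr_numeral power_mult_distrib) (simp add: power4_eq_xxxx)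
    show ?thesis unfolding eq powr_powr by simp
  qed
  finally have final: "1 / 2 * real t powr (1/4) * real n powr (1/4) \<le> sqrt q"
    by (simp add: powr_mult)
  show ?thesis
  proof (cases "k = 0")
    case True
    have "lambda_free n H \<ge> 1"
      using assms(1-3) H(2) by (intro lambda_free_ge_1) auto
    then show ?thesis using final True by (simp add: q_def)
  next
    case False
    then interpret finite_subfield_char2 2 k q "TYPE(K2)"
      unfolding q_def by (intro finite_subfield_K2) simp
    have "a \<le> k" using sq by (simp add: s_def q_def)
    then obtain S where "S \<subseteq> F" "0 \<in> S" "\<forall>x\<in>S. \<forall>y\<in>S. x + y \<in> S" "card S = s"
      using subgroup_exists[of a] by (auto simp: s_def)
    then have "lambda_free n H \<ge> sqrt q"
      using s(1) k(1) qq by (intro lambda_free_K2t_field[OF H, of S s]) auto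
    then show ?thesis using final by linarith
  qed
qed

lemma lambda_free_K2t:
  assumes "t \<ge> 2" "n \<ge> t"
  shows "lambda_free n (complete_bipartite_graph 2 t) \<ge> 1 / 2 * real t powr (1/4) * real n powr (1/4)"
proof (rule lambda_free_ge_of_embeds_K2t[OF assms])
  show "pverts (complete_bipartite_graph 2 t) \<noteq> {}" by (auto simp: complete_bipartite_graph_def Let_def)
qed (use assms complete_bipartite_graph_arcs[of 2 t] in auto)

section \<open>Additive characters\<close>

lemma complex_cmod_square: "(complex_of_real (cmod z))\<^sup>2 = z * cnj z"
  by (metis complex_norm_square of_real_power)

context finite_subfield
begin

definition tr :: "'a \<Rightarrow> 'a" where "tr x = (\<Sum>i<e. x ^ p ^ i)"

text \<open>Some natural number that represents an element of the prime field. Only its residue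
  modulo \<open>p\<close> matters for \<open>\<chi>\<close>, by \<open>cis_mod_p\<close>.\<close>

definition idx :: "'a \<Rightarrow> nat" where "idx y = (SOME j. of_nat j = y)"

definition \<chi> :: "'a \<Rightarrow> complex" where "\<chi> x = cis (2 * pi * real (idx (tr x)) / real p)"

lemma p_gt_1: "p > 1"
  using prime_gt_1_nat[OF p] .

lemma tr_add: "tr (x + y) = tr x + tr y"
  by (simp add: tr_def Frob_add sum.distrib)

lemma tr_Frob:
  assumes "x \<in> F"
  shows "tr (x ^ p) = tr x"
proof -
  obtain e' where e': "e = Suc e'" using e not0_implies_Suc by blast
  have "tr (x ^ p) = (\<Sum>i<e. x ^ p ^ Suc i)" by (simp add: tr_def power_mult mult.commute flip: power_mult)
  also have "\<dots> = (\<Sum>i<e'. x ^ p ^ Suc i) + x ^ q" by (simp add: e' q)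
  also have "x ^ q = x ^ p ^ 0" using assms by (simp add: F_power_q)
  also have "(\<Sum>i<e'. x ^ p ^ Suc i) + x ^ p ^ 0 = tr x"
    unfolding tr_def unfolding e' by (subst sum.lessThan_Suc_shift) simp
  finally show ?thesis .
qed

lemma of_nat_power_p: "(of_nat j :: 'a) ^ p = of_nat j"
proof (induction j)
  case 0
  then show ?case using p_gt_1 by simp
next
  case (Suc j)
  then show ?case using Frob_add[of 1 "of_nat j" 1] by simp
qed

lemma of_nat_eq_iff_mod: "(of_nat i :: 'a) = of_nat j \<longleftrightarrow> i mod p = j mod p"
  using of_nat_eq_iff_cong_CHAR[where 'a = 'a, of i j] char by (simp add: cong_def)

lemma prime_subfield: "{y :: 'a. y ^ p = y} = of_nat ` {..<p}"
proof -
  interpret P: finite_subfield p 1 p "TYPE('a)"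
    using char p by unfold_locales auto
  have "of_nat ` {..<p} \<subseteq> {y :: 'a. y ^ p = y}" using of_nat_power_p by auto
  moreover have "card (of_nat ` {..<p} :: 'a set) = p"
    using of_nat_eq_iff_mod by (subst card_image) (auto simp: inj_on_def)
  moreover have "card {y :: 'a. y ^ p = y} = p" "finite {y :: 'a. y ^ p = y}"
    using P.card_F P.finite_F by (simp_all add: Fq_def)
  ultimately show ?thesis by (metis card_subset_eq)
qed

lemma of_nat_idx:
  assumes "x \<in> F"
  shows "of_nat (idx (tr x)) = tr x"
proof -
  have "tr x ^ p = tr (x ^ p)"
    using Frob_sum[of "\<lambda>i. x ^ p ^ i" "{..<e}" 1] by (simp add: tr_def mult.commute flip: power_mult)
  then have "tr x \<in> of_nat ` {..<p}" using tr_Frob[OF assms] prime_subfield by auto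
  then show ?thesis unfolding idx_def by (metis (mono_tags) imageE someI)
qed

lemma cis_mod_p:
  assumes "i mod p = j mod p"
  shows "cis (2 * pi * real i / real p) = cis (2 * pi * real j / real p)"
proof -
  have "cis (2 * pi * real i / real p) = cis (2 * pi * real (i mod p) / real p)" for i
  proof -
    have "real i = real (i mod p) + real p * real (i div p)"
      by (metis mod_mult_div_eq of_nat_add of_nat_mult)
    then have "2 * pi * real i / real p = 2 * pi * real (i mod p) / real p + 2 * pi * real (i div p)"
      using p_gt_1 by (simp add: field_simps)
    then show ?thesis by (simp add: cis_multiple_2pi flip: cis_mult)
  qed
  then show ?thesis using assms by metis
qed

lemma \<chi>_eqI: "x \<in> F \<Longrightarrow> tr x = of_nat j \<Longrightarrow> \<chi> x = cis (2 * pi * real j / real p)"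
  using of_nat_idx[of x] by (auto simp: \<chi>_def of_nat_eq_iff_mod intro!: cis_mod_p)

lemma \<chi>_add: "x \<in> F \<Longrightarrow> y \<in> F \<Longrightarrow> \<chi> (x + y) = \<chi> x * \<chi> y"
  using \<chi>_eqI[of "x + y" "idx (tr x) + idx (tr y)"] of_nat_idx[of x] of_nat_idx[of y]
  by (simp add: tr_add \<chi>_def cis_mult add_divide_distrib distrib_left)

lemma norm_\<chi> [simp]: "norm (\<chi> x) = 1"
  by (simp add: \<chi>_def)

lemma \<chi>_nonzero [simp]: "\<chi> x \<noteq> 0"
  using norm_\<chi>[of x] by (metis norm_zero zero_neq_one)

lemma \<chi>_0 [simp]: "\<chi> 0 = 1"
  using \<chi>_add[of 0 0] by simp

lemma \<chi>_minus: "x \<in> F \<Longrightarrow> \<chi> (- x) = cnj (\<chi> x)"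
proof -
  assume "x \<in> F"
  then have "\<chi> x * \<chi> (- x) = 1" using \<chi>_add[of x "- x"] by simp
  moreover have "\<chi> x * cnj (\<chi> x) = 1" by (simp add: complex_norm_square[symmetric])
  ultimately show ?thesis by (metis \<chi>_nonzero mult_left_cancel)
qed

lemma \<chi>_diff: "x \<in> F \<Longrightarrow> y \<in> F \<Longrightarrow> \<chi> (x - y) = \<chi> x * cnj (\<chi> y)"
  using \<chi>_add[of x "- y"] \<chi>_minus[of y] by simp

lemma \<chi>_Frob: "x \<in> F \<Longrightarrow> \<chi> (x ^ p) = \<chi> x"
  by (simp add: \<chi>_def tr_Frob)

lemma \<chi>_Frob_power: "x \<in> F \<Longrightarrow> \<chi> (x ^ p ^ k) = \<chi> x"
proof (induction k)
  case (Suc k)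
  have "x ^ p ^ Suc k = (x ^ p ^ k) ^ p" by (simp add: mult.commute flip: power_mult)
  then show ?case using Suc by (simp add: \<chi>_Frob)
qed simp

lemma \<chi>_sum: "finite I \<Longrightarrow> (\<And>i. i \<in> I \<Longrightarrow> f i \<in> F) \<Longrightarrow> \<chi> (\<Sum>i\<in>I. f i) = (\<Prod>i\<in>I. \<chi> (f i))"
proof (induction I rule: finite_induct)
  case (insert i I)
  then show ?case using \<chi>_add[of "f i" "\<Sum>i\<in>I. f i"] F_sum[of I f] by simp
qed simp

text \<open>The trace is a polynomial of degree at most \<open>p ^ (e - 1)\<close>, which is less
  than \<open>q\<close>, so it cannot vanish on all of \<open>F\<close>.\<close>

lemma ex_\<chi>_neq_1: "\<exists>x\<in>F. \<chi> x \<noteq> 1"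
proof -
  let ?P = "\<Sum>i<e. monom 1 (p ^ i) :: 'a poly"
  obtain e' where e': "e = Suc e'" using e not0_implies_Suc by blast
  have "coeff ?P (p ^ e') = (\<Sum>i<e. if i = e' then 1 else 0)"
    unfolding coeff_sum using p_gt_1 by (intro sum.cong) auto
  then have c: "coeff ?P (p ^ e') = 1" using e' by simp
  then have nz: "?P \<noteq> 0" by auto
  have "degree ?P \<le> p ^ e'"
  proof (intro degree_sum_le)
    fix i assume "i \<in> {..<e}"
    then have "p ^ i \<le> p ^ e'" using e' p_gt_1 by (intro power_increasing) auto
    then show "degree (monom 1 (p ^ i) :: 'a poly) \<le> p ^ e'" by (simp add: degree_monom_eq)
  qed simp
  then have "card {x. poly ?P x = 0} \<le> p ^ e'" using card_poly_roots_bound[OF nz] by linarith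
  also have "p ^ e' < q" using p_gt_1 by (simp add: q e')
  also have "q = card F" by (simp add: card_F)
  finally have "\<not> F \<subseteq> {x. poly ?P x = 0}"
    using card_mono[OF poly_roots_finite[OF nz], of F] by (meson not_less)
  then obtain x where x: "x \<in> F" "poly ?P x \<noteq> 0" by auto
  then have trx: "tr x \<noteq> 0" by (simp add: tr_def poly_sum poly_monom)
  have "\<chi> x \<noteq> 1"
  proof
    assume 1: "\<chi> x = 1"
    define j where "j = idx (tr x) mod p"
    have "\<chi> x = cis (2 * pi * real j / real p)"
      unfolding \<chi>_def j_def by (intro cis_mod_p) simp
    moreover have j: "j < p" using p_gt_1 by (simp add: j_def)
    have "j \<noteq> 0"
    proof
      assume "j = 0"
      then have "(of_nat (idx (tr x)) :: 'a) = of_nat 0"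
        unfolding of_nat_eq_iff_mod j_def by simp
      then show False using of_nat_idx[OF x(1)] trx by simp
    qed
    ultimately have "cos (2 * pi * real j / real p) = 1" using 1 by (metis cis.sel(1) one_complex.sel(1))
    then obtain n :: int where n: "2 * pi * real j / real p = real_of_int n * 2 * pi"
      by (metis cos_one_2pi_int mult.commute mult.left_commute)
    then have "real j = real_of_int n * real p" using p_gt_1 by (simp add: field_simps)
    then have "int j = n * int p" by (metis of_int_eq_iff of_int_mult of_int_of_nat_eq)
    then have "int p dvd int j" by simp
    then show False using j \<open>j \<noteq> 0\<close> by (auto dest: dvd_imp_le)
  qed
  then show ?thesis using x by blast
qed

lemma sum_\<chi>:
  assumes "c \<in> F"
  shows "(\<Sum>x\<in>F. \<chi> (c * x)) = (if c = 0 then of_nat q else 0)"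
proof (cases "c = 0")
  case True
  then show ?thesis by (simp add: card_F)
next
  case False
  obtain y where y: "y \<in> F" "\<chi> y \<noteq> 1" using ex_\<chi>_neq_1 by blast
  define z where "z = y / c"
  have z: "z \<in> F" "c * z = y" using assms y False by (auto simp: z_def)
  have "(\<Sum>x\<in>F. \<chi> (c * x)) = (\<Sum>x\<in>F. \<chi> (c * (x + z)))"
    by (rule sum.reindex_bij_witness[of _ "\<lambda>x. x + z" "\<lambda>x. x - z"]) (use z in auto)
  also have "\<dots> = (\<Sum>x\<in>F. \<chi> (c * x) * \<chi> y)"
    using assms z y by (intro sum.cong) (auto simp: distrib_left \<chi>_add)
  also have "\<dots> = (\<Sum>x\<in>F. \<chi> (c * x)) * \<chi> y" by (simp add: sum_distrib_right)
  finally show ?thesis using False y(2) by simp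
qed

definition tuples :: "nat \<Rightarrow> (nat \<Rightarrow> 'a) set" where "tuples k = {..<k} \<rightarrow>\<^sub>E F"

definition \<psi> :: "nat \<Rightarrow> (nat \<Rightarrow> 'a) \<Rightarrow> (nat \<Rightarrow> 'a) \<Rightarrow> complex" where
  "\<psi> k c u = \<chi> (\<Sum>i<k. c i * u i)"

lemma finite_tuples [simp]: "finite (tuples k)"
  by (simp add: tuples_def finite_PiE)

lemma card_tuples: "card (tuples k) = q ^ k"
  by (simp add: tuples_def card_PiE card_F)

lemma tuplesD: "u \<in> tuples k \<Longrightarrow> i < k \<Longrightarrow> u i \<in> F"
  by (auto simp: tuples_def)

lemma tuples_eqI: "u \<in> tuples k \<Longrightarrow> v \<in> tuples k \<Longrightarrow> (\<And>i. i < k \<Longrightarrow> u i = v i) \<Longrightarrow> u = v"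
  unfolding tuples_def by (auto intro: PiE_ext)

lemma sum_\<chi>_tuples:
  assumes "\<And>i. i < k \<Longrightarrow> w i \<in> F"
  shows "(\<Sum>c\<in>tuples k. \<chi> (\<Sum>i<k. c i * w i)) = (if \<forall>i<k. w i = 0 then of_nat (q ^ k) else 0)"
proof -
  have "(\<Sum>c\<in>tuples k. \<chi> (\<Sum>i<k. c i * w i)) = (\<Sum>c\<in>tuples k. \<Prod>i<k. \<chi> (w i * c i))"
    using assms by (intro sum.cong refl) (subst \<chi>_sum, auto simp: tuplesD mult.commute)
  also have "\<dots> = (\<Prod>i<k. \<Sum>x\<in>F. \<chi> (w i * x))"
    unfolding tuples_def by (subst prod_sum_PiE) auto
  also have "\<dots> = (\<Prod>i<k. if w i = 0 then of_nat q else 0)"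
    using assms sum_\<chi> by (intro prod.cong) auto
  also have "\<dots> = (if \<forall>i<k. w i = 0 then of_nat (q ^ k) else 0)"
  proof (cases "\<forall>i<k. w i = 0")
    case True
    then show ?thesis by simp
  next
    case False
    then show ?thesis by (intro trans[OF prod_zero]) auto
  qed
  finally show ?thesis .
qed

lemma Parseval_tuples:
  fixes z :: "(nat \<Rightarrow> 'a) \<Rightarrow> complex"
  shows "(\<Sum>c\<in>tuples k. (cmod (\<Sum>u\<in>tuples k. z u * \<psi> k c u))\<^sup>2) = real (q ^ k) * (\<Sum>u\<in>tuples k. (cmod (z u))\<^sup>2)"
proof -
  have "of_real (\<Sum>c\<in>tuples k. (cmod (\<Sum>u\<in>tuples k. z u * \<psi> k c u))\<^sup>2) =
      (\<Sum>c\<in>tuples k. \<Sum>u\<in>tuples k. \<Sum>v\<in>tuples k. (z u * cnj (z v)) * (\<psi> k c u * cnj (\<psi> k c v)))"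
    by (simp add: complex_cmod_square sum_product mult_ac)
  also have "\<dots> = (\<Sum>u\<in>tuples k. \<Sum>v\<in>tuples k. (z u * cnj (z v)) * (\<Sum>c\<in>tuples k. \<psi> k c u * cnj (\<psi> k c v)))"
    unfolding sum_distrib_left by (subst sum.swap) (intro sum.cong refl sum.swap)
  also have "\<dots> = (\<Sum>u\<in>tuples k. \<Sum>v\<in>tuples k. if u = v then of_nat (q ^ k) * (z u * cnj (z u)) else 0)"
  proof (intro sum.cong refl)
    fix u v assume uv: "u \<in> tuples k" "v \<in> tuples k"
    have "(\<Sum>c\<in>tuples k. \<psi> k c u * cnj (\<psi> k c v)) = (\<Sum>c\<in>tuples k. \<chi> (\<Sum>i<k. c i * (u i - v i)))"
    proof (intro sum.cong refl)
      fix c assume c: "c \<in> tuples k"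
      have "(\<Sum>i<k. c i * u i) \<in> F" "(\<Sum>i<k. c i * v i) \<in> F"
        using c uv by (auto intro!: F_sum simp: tuplesD)
      then show "\<psi> k c u * cnj (\<psi> k c v) = \<chi> (\<Sum>i<k. c i * (u i - v i))"
        unfolding \<psi>_def by (simp add: \<chi>_diff[symmetric] right_diff_distrib sum_subtractf)
    qed
    also have "\<dots> = (if u = v then of_nat (q ^ k) else 0)"
      using uv tuples_eqI[OF uv] by (subst sum_\<chi>_tuples) (auto simp: tuplesD)
    finally show "z u * cnj (z v) * (\<Sum>c\<in>tuples k. \<psi> k c u * cnj (\<psi> k c v)) =
        (if u = v then of_nat (q ^ k) * (z u * cnj (z u)) else 0)" by simp
  qed
  also have "\<dots> = of_real (real (q ^ k) * (\<Sum>u\<in>tuples k. (cmod (z u))\<^sup>2))"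
    by (simp add: complex_cmod_square sum_distrib_left del: of_nat_power)
  finally show ?thesis unfolding of_real_eq_iff .
qed

lemma Parseval_F:
  fixes z :: "'a \<Rightarrow> complex"
  shows "(\<Sum>c\<in>F. (cmod (\<Sum>u\<in>F. z u * \<chi> (u * c)))\<^sup>2) = real q * (\<Sum>u\<in>F. (cmod (z u))\<^sup>2)"
proof -
  have "of_real (\<Sum>c\<in>F. (cmod (\<Sum>u\<in>F. z u * \<chi> (u * c)))\<^sup>2) =
      (\<Sum>c\<in>F. \<Sum>u\<in>F. \<Sum>v\<in>F. (z u * cnj (z v)) * (\<chi> (u * c) * cnj (\<chi> (v * c))))"
    by (simp add: complex_cmod_square sum_product mult_ac)
  also have "\<dots> = (\<Sum>u\<in>F. \<Sum>v\<in>F. (z u * cnj (z v)) * (\<Sum>c\<in>F. \<chi> (u * c) * cnj (\<chi> (v * c))))"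
    unfolding sum_distrib_left by (subst sum.swap) (intro sum.cong refl sum.swap)
  also have "\<dots> = (\<Sum>u\<in>F. \<Sum>v\<in>F. if u = v then of_nat q * (z u * cnj (z u)) else 0)"
  proof (intro sum.cong refl)
    fix u v assume uv: "u \<in> F" "v \<in> F"
    have "(\<Sum>c\<in>F. \<chi> (u * c) * cnj (\<chi> (v * c))) = (\<Sum>c\<in>F. \<chi> ((u - v) * c))"
      using uv by (intro sum.cong refl) (simp add: \<chi>_diff[symmetric] left_diff_distrib)
    then show "z u * cnj (z v) * (\<Sum>c\<in>F. \<chi> (u * c) * cnj (\<chi> (v * c))) =
        (if u = v then of_nat q * (z u * cnj (z u)) else 0)"
      using uv by (simp add: sum_\<chi>)
  qed
  also have "\<dots> = of_real (real q * (\<Sum>u\<in>F. (cmod (z u))\<^sup>2))"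
    by (simp add: complex_cmod_square sum_distrib_left)
  finally show ?thesis unfolding of_real_eq_iff .
qed

end

section \<open>Operator norms of character kernels\<close>

lemma sum_Times: "(\<Sum>x\<in>A \<times> B. f x) = (\<Sum>a\<in>A. \<Sum>b\<in>B. f (a, b))"
  by (simp add: sum.cartesian_product case_prod_unfold)

lemma sum_square_le_card:
  fixes x :: "'b \<Rightarrow> complex"
  assumes "finite S"
  shows "(cmod (\<Sum>a\<in>S. x a))\<^sup>2 \<le> real (card S) * (\<Sum>a\<in>S. (cmod (x a))\<^sup>2)"
proof -
  have "(cmod (\<Sum>a\<in>S. x a))\<^sup>2 \<le> (\<Sum>a\<in>S. cmod (x a))\<^sup>2"
    by (intro power_mono norm_sum) auto
  also have "\<dots> = (\<Sum>a\<in>S. \<Sum>b\<in>S. cmod (x a) * cmod (x b))" by (simp add: power2_eq_square sum_product)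
  also have "\<dots> \<le> (\<Sum>a\<in>S. \<Sum>b\<in>S. ((cmod (x a))\<^sup>2 + (cmod (x b))\<^sup>2) / 2)"
  proof (intro sum_mono)
    fix a b
    show "cmod (x a) * cmod (x b) \<le> ((cmod (x a))\<^sup>2 + (cmod (x b))\<^sup>2) / 2"
      using sum_squares_bound[of "cmod (x a)" "cmod (x b)"] by simp
  qed
  also have "\<dots> = real (card S) * (\<Sum>a\<in>S. (cmod (x a))\<^sup>2)"
    by (simp add: sum.distrib add_divide_distrib flip: sum_divide_distrib sum_distrib_left)
  finally show ?thesis .
qed

text \<open>By rescaling \<open>x\<close> and \<open>y\<close> this says that the operator norm of \<open>H\<close> is at most \<open>m\<close>.\<close>

definition opnorm_le :: "'x set \<Rightarrow> real \<Rightarrow> ('x \<Rightarrow> 'x \<Rightarrow> complex) \<Rightarrow> bool" where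
  "opnorm_le U m H \<longleftrightarrow> (\<forall>x y. cmod (\<Sum>a\<in>U. \<Sum>b\<in>U. H a b * x a * y b) \<le>
     m / 2 * ((\<Sum>a\<in>U. (cmod (x a))\<^sup>2) + (\<Sum>b\<in>U. (cmod (y b))\<^sup>2)))"

lemma opnorm_le_swap:
  assumes "opnorm_le U m (\<lambda>a b. H b a)"
  shows "opnorm_le U m H"
  unfolding opnorm_le_def
proof (intro allI)
  fix x y :: "'a \<Rightarrow> complex"
  have "(\<Sum>a\<in>U. \<Sum>b\<in>U. H a b * x a * y b) = (\<Sum>a\<in>U. \<Sum>b\<in>U. H b a * y a * x b)"
    by (subst sum.swap) (simp add: mult_ac)
  moreover have "cmod (\<Sum>a\<in>U. \<Sum>b\<in>U. H b a * y a * x b) \<le> m / 2 * ((\<Sum>a\<in>U. (cmod (y a))\<^sup>2) + (\<Sum>b\<in>U. (cmod (x b))\<^sup>2))"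
    using assms unfolding opnorm_le_def by blast
  ultimately show "cmod (\<Sum>a\<in>U. \<Sum>b\<in>U. H a b * x a * y b) \<le> m / 2 * ((\<Sum>a\<in>U. (cmod (x a))\<^sup>2) + (\<Sum>b\<in>U. (cmod (y b))\<^sup>2))"
    by (simp add: add.commute)
qed

lemma opnorm_leI:
  assumes m: "m > 0"
    and bound: "\<And>x. (\<Sum>b\<in>U. (cmod (\<Sum>a\<in>U. H a b * x a))\<^sup>2) \<le> m\<^sup>2 * (\<Sum>a\<in>U. (cmod (x a))\<^sup>2)"
  shows "opnorm_le U m H"
  unfolding opnorm_le_def
proof (intro allI)
  fix x y :: "'a \<Rightarrow> complex"
  define w where "w = (\<lambda>b. \<Sum>a\<in>U. H a b * x a)"
  have "(\<Sum>a\<in>U. \<Sum>b\<in>U. H a b * x a * y b) = (\<Sum>b\<in>U. w b * y b)"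
    unfolding w_def sum_distrib_right by (rule sum.swap)
  also have "cmod \<dots> \<le> (\<Sum>b\<in>U. cmod (w b) * cmod (y b))"
    by (intro order_trans[OF norm_sum]) (simp add: norm_mult)
  also have "\<dots> \<le> (\<Sum>b\<in>U. (1 / (2 * m)) * (cmod (w b))\<^sup>2 + (m / 2) * (cmod (y b))\<^sup>2)"
  proof (intro sum_mono)
    fix b
    show "cmod (w b) * cmod (y b) \<le> (1 / (2 * m)) * (cmod (w b))\<^sup>2 + (m / 2) * (cmod (y b))\<^sup>2"
      using mult_le_weighted_squares[OF m, of "cmod (y b)" "cmod (w b)"] by (simp add: mult.commute add.commute)
  qed
  also have "\<dots> = (1 / (2 * m)) * (\<Sum>b\<in>U. (cmod (w b))\<^sup>2) + (m / 2) * (\<Sum>b\<in>U. (cmod (y b))\<^sup>2)"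
    by (simp add: sum.distrib sum_distrib_left)
  also have "\<dots> \<le> (1 / (2 * m)) * (m\<^sup>2 * (\<Sum>a\<in>U. (cmod (x a))\<^sup>2)) + (m / 2) * (\<Sum>b\<in>U. (cmod (y b))\<^sup>2)"
    using bound[of x] m unfolding w_def by (intro add_right_mono mult_left_mono) auto
  also have "\<dots> = m / 2 * ((\<Sum>a\<in>U. (cmod (x a))\<^sup>2) + (\<Sum>b\<in>U. (cmod (y b))\<^sup>2))"
    using m by (simp add: power2_eq_square distrib_left)
  finally show "cmod (\<Sum>a\<in>U. \<Sum>b\<in>U. H a b * x a * y b) \<le> m / 2 * ((\<Sum>a\<in>U. (cmod (x a))\<^sup>2) + (\<Sum>b\<in>U. (cmod (y b))\<^sup>2))" .
qed

text \<open>Grouping the \<open>a\<close> by the value of \<open>P\<close> turns the sum into a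
  Fourier transform of the fibre sums \<open>U\<close>; the bijection \<open>g\<close> merely
  permutes the frequencies. Passing from \<open>U\<close> to \<open>x\<close> costs a factor
  \<open>k\<close> by Cauchy-Schwarz on the fibres.\<close>

lemma (in finite_subfield) opnorm_le_fibres:
  assumes H: "\<And>a b. a \<in> F \<Longrightarrow> b \<in> F \<Longrightarrow> H a b = \<chi> (P a * g b)"
    and P: "\<And>a. a \<in> F \<Longrightarrow> P a \<in> F" and g: "bij_betw g F F"
    and k: "k > 0" "\<And>v. v \<in> F \<Longrightarrow> card {a \<in> F. P a = v} \<le> k"
  shows "opnorm_le F (sqrt (real k * real q)) H"
proof (rule opnorm_leI)
  show "sqrt (real k * real q) > 0" using k q_gt_1 by simp
  fix x :: "'a \<Rightarrow> complex"
  define U where "U = (\<lambda>v. \<Sum>a\<in>{a \<in> F. P a = v}. x a)"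
  have "(\<Sum>b\<in>F. (cmod (\<Sum>a\<in>F. H a b * x a))\<^sup>2) = (\<Sum>b\<in>F. (cmod (\<Sum>a\<in>F. \<chi> (P a * g b) * x a))\<^sup>2)"
    by (simp add: H)
  also have "\<dots> = (\<Sum>c\<in>F. (cmod (\<Sum>a\<in>F. \<chi> (P a * c) * x a))\<^sup>2)"
    by (rule sum.reindex_bij_betw[OF g, of "\<lambda>c. (cmod (\<Sum>a\<in>F. \<chi> (P a * c) * x a))\<^sup>2"])
  also have "\<dots> = (\<Sum>c\<in>F. (cmod (\<Sum>v\<in>F. U v * \<chi> (v * c)))\<^sup>2)"
  proof (rule sum.cong[OF refl])
    fix c
    have "(\<Sum>a\<in>F. \<chi> (P a * c) * x a) = (\<Sum>v\<in>F. \<Sum>a\<in>{a \<in> F. P a = v}. \<chi> (P a * c) * x a)"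
      using P by (intro sum.group[symmetric]) auto
    also have "\<dots> = (\<Sum>v\<in>F. U v * \<chi> (v * c))"
      unfolding U_def sum_distrib_right by (intro sum.cong refl) (auto simp: mult.commute)
    finally show "(cmod (\<Sum>a\<in>F. \<chi> (P a * c) * x a))\<^sup>2 = (cmod (\<Sum>v\<in>F. U v * \<chi> (v * c)))\<^sup>2" by simp
  qed
  also have "\<dots> = real q * (\<Sum>v\<in>F. (cmod (U v))\<^sup>2)" by (rule Parseval_F)
  also have "\<dots> \<le> real q * (\<Sum>v\<in>F. real k * (\<Sum>a\<in>{a \<in> F. P a = v}. (cmod (x a))\<^sup>2))"
  proof (intro mult_left_mono sum_mono)
    fix v assume v: "v \<in> F"
    have "(cmod (U v))\<^sup>2 \<le> real (card {a \<in> F. P a = v}) * (\<Sum>a\<in>{a \<in> F. P a = v}. (cmod (x a))\<^sup>2)"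
      unfolding U_def by (intro sum_square_le_card) simp
    also have "\<dots> \<le> real k * (\<Sum>a\<in>{a \<in> F. P a = v}. (cmod (x a))\<^sup>2)"
      using k(2)[OF v] by (intro mult_right_mono sum_nonneg) auto
    finally show "(cmod (U v))\<^sup>2 \<le> real k * (\<Sum>a\<in>{a \<in> F. P a = v}. (cmod (x a))\<^sup>2)" .
  qed simp
  also have "\<dots> = real q * real k * (\<Sum>v\<in>F. \<Sum>a\<in>{a \<in> F. P a = v}. (cmod (x a))\<^sup>2)"
    by (simp add: sum_distrib_left mult.assoc)
  also have "(\<Sum>v\<in>F. \<Sum>a\<in>{a \<in> F. P a = v}. (cmod (x a))\<^sup>2) = (\<Sum>a\<in>F. (cmod (x a))\<^sup>2)"
    using P by (intro sum.group) auto
  finally show "(\<Sum>b\<in>F. (cmod (\<Sum>a\<in>F. H a b * x a))\<^sup>2) \<le> (sqrt (real k * real q))\<^sup>2 * (\<Sum>a\<in>F. (cmod (x a))\<^sup>2)"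
    by (simp add: mult.commute)
qed

text \<open>If a matrix on \<open>U \<times> W\<close> is translation invariant in the second coordinate, then its quadratic
  form splits over the characters of \<open>W\<close>.\<close>

lemma bform_ge_Fourier:
  fixes A :: "'x \<times> 'w \<Rightarrow> 'x \<times> 'w \<Rightarrow> real" and ep :: "'c \<Rightarrow> 'w \<Rightarrow> complex"
  assumes fin: "finite U" "finite W" "finite C" and N: "N > 0"
    and Parseval: "\<And>z :: 'w \<Rightarrow> complex. (\<Sum>c\<in>C. (cmod (\<Sum>u\<in>W. z u * ep c u))\<^sup>2) = N * (\<Sum>u\<in>W. (cmod (z u))\<^sup>2)"
    and A: "\<And>a u b v. a \<in> U \<Longrightarrow> u \<in> W \<Longrightarrow> b \<in> U \<Longrightarrow> v \<in> W \<Longrightarrow>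
      of_real (N * A (a, u) (b, v)) = (\<Sum>c\<in>C. H c a b * ep c u * ep (\<sigma> c) v)"
    and \<sigma>: "bij_betw \<sigma> C C"
    and H: "\<And>c (z :: 'x \<times> 'w \<Rightarrow> real) Z. c \<in> C \<Longrightarrow> Z = (\<lambda>c a. \<Sum>u\<in>W. of_real (z (a, u)) * ep c u) \<Longrightarrow>
      Re (\<Sum>a\<in>U. \<Sum>b\<in>U. H c a b * Z c a * Z (\<sigma> c) b) \<ge>
        - m / 2 * ((\<Sum>a\<in>U. (cmod (Z c a))\<^sup>2) + (\<Sum>b\<in>U. (cmod (Z (\<sigma> c) b))\<^sup>2))"
  shows "bform (U \<times> W) A z z \<ge> - m * (\<Sum>u\<in>U \<times> W. (z u)\<^sup>2)"
proof -
  define Z where "Z = (\<lambda>c a. \<Sum>u\<in>W. of_real (z (a, u)) * ep c u)"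
  have "complex_of_real (N * bform (U \<times> W) A z z) = (\<Sum>a\<in>U. \<Sum>u\<in>W. \<Sum>b\<in>U. \<Sum>v\<in>W. complex_of_real (N * A (a, u) (b, v)) * (of_real (z (a, u)) * of_real (z (b, v))))"
    by (simp add: bform_def sum_distrib_left sum_Times mult_ac)
  also have "\<dots> = (\<Sum>a\<in>U. \<Sum>u\<in>W. \<Sum>b\<in>U. \<Sum>v\<in>W. \<Sum>c\<in>C. H c a b * (of_real (z (a, u)) * ep c u) * (of_real (z (b, v)) * ep (\<sigma> c) v))"
  proof (intro sum.cong refl)
    fix a u b v assume "a \<in> U" "u \<in> W" "b \<in> U" "v \<in> W"
    then have eq: "complex_of_real (N * A (a, u) (b, v)) = (\<Sum>c\<in>C. H c a b * ep c u * ep (\<sigma> c) v)" by (rule A)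
    show "complex_of_real (N * A (a, u) (b, v)) * (of_real (z (a, u)) * of_real (z (b, v))) =
        (\<Sum>c\<in>C. H c a b * (of_real (z (a, u)) * ep c u) * (of_real (z (b, v)) * ep (\<sigma> c) v))"
      unfolding eq sum_distrib_right by (intro sum.cong refl) (simp add: mult_ac)
  qed
  also have "\<dots> = (\<Sum>c\<in>C. \<Sum>a\<in>U. \<Sum>b\<in>U. H c a b * Z c a * Z (\<sigma> c) b)"
  proof -
    have "(\<Sum>a\<in>U. \<Sum>u\<in>W. \<Sum>b\<in>U. \<Sum>v\<in>W. \<Sum>c\<in>C. H c a b * (of_real (z (a, u)) * ep c u) * (of_real (z (b, v)) * ep (\<sigma> c) v)) =
        (\<Sum>a\<in>U. \<Sum>u\<in>W. \<Sum>b\<in>U. \<Sum>c\<in>C. \<Sum>v\<in>W. H c a b * (of_real (z (a, u)) * ep c u) * (of_real (z (b, v)) * ep (\<sigma> c) v))"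
      by (intro sum.cong refl sum.swap)
    also have "\<dots> = (\<Sum>a\<in>U. \<Sum>u\<in>W. \<Sum>b\<in>U. \<Sum>c\<in>C. H c a b * (of_real (z (a, u)) * ep c u) * Z (\<sigma> c) b)"
      by (simp add: Z_def sum_distrib_left)
    also have "\<dots> = (\<Sum>a\<in>U. \<Sum>b\<in>U. \<Sum>u\<in>W. \<Sum>c\<in>C. H c a b * (of_real (z (a, u)) * ep c u) * Z (\<sigma> c) b)"
      by (intro sum.cong refl sum.swap)
    also have "\<dots> = (\<Sum>a\<in>U. \<Sum>b\<in>U. \<Sum>c\<in>C. \<Sum>u\<in>W. H c a b * (of_real (z (a, u)) * ep c u) * Z (\<sigma> c) b)"
      by (intro sum.cong refl sum.swap)
    also have "\<dots> = (\<Sum>a\<in>U. \<Sum>b\<in>U. \<Sum>c\<in>C. H c a b * Z c a * Z (\<sigma> c) b)"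
      by (simp add: Z_def sum_distrib_left sum_distrib_right mult_ac)
    also have "\<dots> = (\<Sum>a\<in>U. \<Sum>c\<in>C. \<Sum>b\<in>U. H c a b * Z c a * Z (\<sigma> c) b)"
      by (intro sum.cong refl sum.swap)
    also have "\<dots> = (\<Sum>c\<in>C. \<Sum>a\<in>U. \<Sum>b\<in>U. H c a b * Z c a * Z (\<sigma> c) b)"
      by (rule sum.swap)
    finally show ?thesis .
  qed
  finally have "N * bform (U \<times> W) A z z = Re (\<Sum>c\<in>C. \<Sum>a\<in>U. \<Sum>b\<in>U. H c a b * Z c a * Z (\<sigma> c) b)"
    by (metis Re_complex_of_real)
  also have "\<dots> = (\<Sum>c\<in>C. Re (\<Sum>a\<in>U. \<Sum>b\<in>U. H c a b * Z c a * Z (\<sigma> c) b))" by (rule Re_sum)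
  also have "\<dots> \<ge> (\<Sum>c\<in>C. - m / 2 * ((\<Sum>a\<in>U. (cmod (Z c a))\<^sup>2) + (\<Sum>b\<in>U. (cmod (Z (\<sigma> c) b))\<^sup>2)))"
    by (intro sum_mono H[of _ Z z]) (simp_all add: Z_def)
  also have "(\<Sum>c\<in>C. - m / 2 * ((\<Sum>a\<in>U. (cmod (Z c a))\<^sup>2) + (\<Sum>b\<in>U. (cmod (Z (\<sigma> c) b))\<^sup>2))) =
      - m / 2 * ((\<Sum>c\<in>C. \<Sum>a\<in>U. (cmod (Z c a))\<^sup>2) + (\<Sum>c\<in>C. \<Sum>b\<in>U. (cmod (Z (\<sigma> c) b))\<^sup>2))"
    by (simp only: sum_distrib_left[symmetric] sum.distrib)
  \<comment> \<open>As \<open>\<sigma>\<close> permutes \<open>C\<close>, both halves have the same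
    energy, which Parseval evaluates.\<close>
  also have "(\<Sum>c\<in>C. \<Sum>b\<in>U. (cmod (Z (\<sigma> c) b))\<^sup>2) = (\<Sum>c\<in>C. \<Sum>b\<in>U. (cmod (Z c b))\<^sup>2)"
    by (rule sum.reindex_bij_betw[OF \<sigma>, of "\<lambda>c. \<Sum>b\<in>U. (cmod (Z c b))\<^sup>2"])
  also have "(\<Sum>c\<in>C. \<Sum>b\<in>U. (cmod (Z c b))\<^sup>2) = N * (\<Sum>u\<in>U \<times> W. (z u)\<^sup>2)"
  proof -
    have "(\<Sum>c\<in>C. \<Sum>b\<in>U. (cmod (Z c b))\<^sup>2) = (\<Sum>b\<in>U. \<Sum>c\<in>C. (cmod (Z c b))\<^sup>2)" by (rule sum.swap)
    also have "\<dots> = (\<Sum>b\<in>U. N * (\<Sum>u\<in>W. (z (b, u))\<^sup>2))"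
      unfolding Z_def by (simp add: Parseval)
    finally show ?thesis by (simp add: sum_distrib_left sum_Times)
  qed
  finally have "N * (- m * (\<Sum>u\<in>U \<times> W. (z u)\<^sup>2)) \<le> N * bform (U \<times> W) A z z" by (simp add: algebra_simps)
  then show ?thesis using N by (metis mult_le_cancel_left_pos)
qed

section \<open>Hexagons\<close>

context finite_subfield
begin

text \<open>The affine part of a polarity graph: a first coordinate and \<open>k\<close> further
  ones, each edge equation being linear in the latter. The involution \<open>\<tau>\<close> is the
  polarity; it exchanges the coordinates of points and lines, and together with the symmetry of
  \<open>f\<close> it makes the relation symmetric.\<close>

definition matching_adj :: "nat \<Rightarrow> (nat \<Rightarrow> nat) \<Rightarrow> (nat \<Rightarrow> 'a \<Rightarrow> 'a \<Rightarrow> 'a) \<Rightarrow> 'a \<times> (nat \<Rightarrow> 'a) \<Rightarrow> 'a \<times> (nat \<Rightarrow> 'a) \<Rightarrow> bool" where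
  "matching_adj k \<tau> f u v \<longleftrightarrow> (\<forall>i<k. snd u i + snd v (\<tau> i) = f i (fst u) (fst v))"

text \<open>Used on cycles: two distinct vertices with a common neighbour have distinct first
  coordinates.\<close>

lemma matching_adj_unique:
  assumes \<tau>: "\<And>i. i < k \<Longrightarrow> \<tau> i < k" "\<And>i. i < k \<Longrightarrow> \<tau> (\<tau> i) = i"
    and "matching_adj k \<tau> f u v" "matching_adj k \<tau> f u v'" "fst v = fst v'"
    and v: "v \<in> F \<times> tuples k" "v' \<in> F \<times> tuples k"
  shows "v = v'"
proof -
  have "snd v i = snd v' i" if "i < k" for i
  proof -
    have "snd u (\<tau> i) + snd v i = snd u (\<tau> i) + snd v' i"
      using assms that unfolding matching_adj_def by metis
    then show ?thesis by simp
  qed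
  then have "snd v = snd v'" using v by (intro tuples_eqI[of _ k]) auto
  then show ?thesis using assms(5) by (simp add: prod_eq_iff)
qed

text \<open>The adjacency relation is invariant under translations of the last \<open>k\<close>
  coordinates (twisted by \<open>\<tau>\<close>), so a Fourier transform in them leaves one kernel
  on \<open>F\<close> per frequency. Non-zero frequencies are bounded by \<open>m\<close>, and the
  zero frequency contributes a square.\<close>

lemma lambda_free_ge_matching:
  assumes \<tau>: "\<And>i. i < k \<Longrightarrow> \<tau> i < k" "\<And>i. i < k \<Longrightarrow> \<tau> (\<tau> i) = i"
    and fF: "\<And>i a b. i < k \<Longrightarrow> a \<in> F \<Longrightarrow> b \<in> F \<Longrightarrow> f i a b \<in> F"
    and fsym: "\<And>i a b. i < k \<Longrightarrow> f (\<tau> i) b a = f i a b"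
    and m: "m \<ge> 0" "\<And>c. c \<in> tuples k \<Longrightarrow> \<exists>i<k. c i \<noteq> 0 \<Longrightarrow> opnorm_le F m (\<lambda>a b. \<chi> (- (\<Sum>i<k. c i * f i a b)))"
    and n: "q ^ Suc k \<le> n"
    and emb: "\<not> embeds H (F \<times> tuples k) (\<lambda>u v. u \<noteq> v \<and> matching_adj k \<tau> f u v)"
    and H: "\<And>a. a \<in> pverts H \<Longrightarrow> \<exists>b. (a, b) \<in> parcs H"
  shows "lambda_free n H \<ge> 1 + (real q - 1) / (m + 1)"
proof -
  let ?V = "F \<times> tuples k" and ?E = "matching_adj k \<tau> f"
  have Fne: "F \<noteq> {}" using F_closed(1) by blast
  have tne: "tuples k \<noteq> {}" using card_tuples[of k] q_gt_1 by (metis card.empty power_not_zero not_one_less_zero)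
  have \<tau>bij: "bij_betw \<tau> {..<k} {..<k}"
    using \<tau> by (intro bij_betw_byWitness[of _ \<tau>]) auto
  have sym: "symp ?E"
  proof (rule sympI)
    fix u v assume uv: "?E u v"
    show "?E v u"
      unfolding matching_adj_def
    proof (intro allI impI)
      fix i assume i: "i < k"
      have "snd u (\<tau> i) + snd v (\<tau> (\<tau> i)) = f (\<tau> i) (fst u) (fst v)"
        using uv \<tau>(1)[OF i] by (simp add: matching_adj_def)
      then show "snd v i + snd u (\<tau> i) = f i (fst v) (fst u)"
        using fsym[OF i, of "fst u" "fst v"] \<tau>(2)[OF i] by (simp add: add.commute)
    qed
  qed
  have deg: "card {v \<in> ?V. ?E u v} = q" if u: "u \<in> ?V" for u
  proof -
    let ?g = "\<lambda>b. (b, \<lambda>j\<in>{..<k}. f (\<tau> j) (fst u) b - snd u (\<tau> j))"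
    have "{v \<in> ?V. ?E u v} = ?g ` F"
    proof (intro Set.set_eqI iffI)
      fix v assume v: "v \<in> {v \<in> ?V. ?E u v}"
      have "snd v j = f (\<tau> j) (fst u) (fst v) - snd u (\<tau> j)" if j: "j < k" for j
      proof -
        have "snd u (\<tau> j) + snd v (\<tau> (\<tau> j)) = f (\<tau> j) (fst u) (fst v)"
          using v \<tau>(1)[OF j] by (simp add: matching_adj_def)
        then show ?thesis using \<tau>(2)[OF j] by (simp add: algebra_simps)
      qed
      moreover have "snd v \<in> extensional {..<k}" using v by (auto simp: tuples_def PiE_def)
      ultimately have "snd v = (\<lambda>j\<in>{..<k}. f (\<tau> j) (fst u) (fst v) - snd u (\<tau> j))"
        by (intro extensionalityI[of _ "{..<k}"]) auto
      then have eq: "v = ?g (fst v)" by (simp add: prod_eq_iff)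
      have "fst v \<in> F" using v by auto
      with eq show "v \<in> ?g ` F" by (rule image_eqI[of v ?g "fst v"])
    next
      fix v assume "v \<in> ?g ` F"
      then obtain b where b: "b \<in> F" "v = ?g b" by auto
      have "snd v \<in> tuples k"
        unfolding tuples_def using b u \<tau>(1) fF by (auto simp: tuplesD)
      moreover have "?E u v" unfolding matching_adj_def using b \<tau> by simp
      ultimately show "v \<in> {v \<in> ?V. ?E u v}" using b by (auto simp: mem_Times_iff)
    qed
    moreover have "inj_on ?g F" by (auto simp: inj_on_def)
    ultimately show ?thesis by (simp add: card_image card_F)
  qed
  \<comment> \<open>Reindexing moves the exchange of coordinates from the vertex \<open>v\<close> to
    the frequency.\<close>
  define \<sigma> where "\<sigma> = (\<lambda>c :: nat \<Rightarrow> 'a. \<lambda>i\<in>{..<k}. c (\<tau> i))"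
  have \<sigma>t: "\<sigma> c \<in> tuples k" if "c \<in> tuples k" for c
    using that \<tau>(1) by (auto simp: \<sigma>_def tuples_def)
  have "\<sigma> (\<sigma> c) = c" if "c \<in> tuples k" for c
    by (rule tuples_eqI[OF \<sigma>t[OF \<sigma>t[OF that]] that]) (auto simp: \<sigma>_def \<tau>)
  then have \<sigma>bij: "bij_betw \<sigma> (tuples k) (tuples k)"
    using \<sigma>t by (intro bij_betw_byWitness[of _ \<sigma>]) auto
  have form: "bform ?V (\<lambda>u v. of_bool (?E u v)) x x \<ge> - m * (\<Sum>u\<in>?V. (x u)\<^sup>2)" for x
  proof (rule bform_ge_Fourier[where N = "real (q ^ k)" and C = "tuples k" and ep = "\<psi> k" and \<sigma> = \<sigma>
        and H = "\<lambda>c a b. \<chi> (- (\<Sum>i<k. c i * f i a b))"])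
    show "real (q ^ k) > 0" using q_gt_1 by simp
    fix a u b v assume ab: "a \<in> F" "u \<in> tuples k" "b \<in> F" "v \<in> tuples k"
    have "\<chi> (- (\<Sum>i<k. c i * f i a b)) * \<psi> k c u * \<psi> k (\<sigma> c) v = \<chi> (\<Sum>i<k. c i * (u i + v (\<tau> i) - f i a b))"
      if c: "c \<in> tuples k" for c
    proof -
      have "(\<Sum>i<k. \<sigma> c i * v i) = (\<Sum>i<k. c (\<tau> i) * v (\<tau> (\<tau> i)))"
        using \<tau> by (intro sum.cong) (auto simp: \<sigma>_def)
      also have "\<dots> = (\<Sum>i<k. c i * v (\<tau> i))"
        by (rule sum.reindex_bij_betw[OF \<tau>bij, of "\<lambda>i. c i * v (\<tau> i)"])
      finally have eq: "\<psi> k (\<sigma> c) v = \<chi> (\<Sum>i<k. c i * v (\<tau> i))" by (simp add: \<psi>_def)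
      have "(\<Sum>i<k. c i * u i) \<in> F" "(\<Sum>i<k. c i * v (\<tau> i)) \<in> F" "(\<Sum>i<k. c i * f i a b) \<in> F"
        using c ab \<tau>(1) fF by (auto intro!: F_sum simp: tuplesD)
      then have "\<chi> ((\<Sum>i<k. c i * u i) + (\<Sum>i<k. c i * v (\<tau> i)) - (\<Sum>i<k. c i * f i a b)) =
          \<chi> (- (\<Sum>i<k. c i * f i a b)) * \<psi> k c u * \<psi> k (\<sigma> c) v"
        unfolding eq unfolding \<psi>_def by (simp add: \<chi>_diff \<chi>_add \<chi>_minus mult_ac)
      then show ?thesis by (simp add: right_diff_distrib distrib_left sum.distrib sum_subtractf)
    qed
    then have "(\<Sum>c\<in>tuples k. \<chi> (- (\<Sum>i<k. c i * f i a b)) * \<psi> k c u * \<psi> k (\<sigma> c) v) =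
        (\<Sum>c\<in>tuples k. \<chi> (\<Sum>i<k. c i * (u i + v (\<tau> i) - f i a b)))" by (intro sum.cong) auto
    also have "\<dots> = (if \<forall>i<k. u i + v (\<tau> i) - f i a b = 0 then of_nat (q ^ k) else 0)"
      using ab \<tau>(1) fF by (intro sum_\<chi>_tuples) (auto simp: tuplesD)
    also have "\<dots> = of_real (real (q ^ k) * of_bool (?E (a, u) (b, v)))"
      by (simp add: matching_adj_def)
    finally show "complex_of_real (real (q ^ k) * of_bool (?E (a, u) (b, v))) =
        (\<Sum>c\<in>tuples k. \<chi> (- (\<Sum>i<k. c i * f i a b)) * \<psi> k c u * \<psi> k (\<sigma> c) v)" by (rule HOL.sym)
  next
    fix c and z :: "'a \<times> (nat \<Rightarrow> 'a) \<Rightarrow> real" and Z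
    assume c: "c \<in> tuples k" and Z: "Z = (\<lambda>c a. \<Sum>u\<in>tuples k. of_real (z (a, u)) * \<psi> k c u)"
    let ?S = "\<Sum>a\<in>F. \<Sum>b\<in>F. \<chi> (- (\<Sum>i<k. c i * f i a b)) * Z c a * Z (\<sigma> c) b"
    show "Re ?S \<ge> - m / 2 * ((\<Sum>a\<in>F. (cmod (Z c a))\<^sup>2) + (\<Sum>b\<in>F. (cmod (Z (\<sigma> c) b))\<^sup>2))"
    proof (cases "\<exists>i<k. c i \<noteq> 0")
      case True
      have "cmod ?S \<le> m / 2 * ((\<Sum>a\<in>F. (cmod (Z c a))\<^sup>2) + (\<Sum>b\<in>F. (cmod (Z (\<sigma> c) b))\<^sup>2))"
        using m(2)[OF c True] by (simp add: opnorm_le_def)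
      then show ?thesis using abs_Re_le_cmod[of ?S] by linarith
    next
      case False
      then have c0: "c i = 0" if "i < k" for i using that by auto
      have \<sigma>0: "\<sigma> c i = 0" if "i < k" for i using that c0 \<tau>(1) by (auto simp: \<sigma>_def)
      \<comment> \<open>At frequency zero the transform of the real function \<open>z\<close> is
        real and does not see the twist, so the sum is a square. The eigenvalue \<open>q\<close>
        sits here, with the harmless sign.\<close>
      define y where "y = (\<lambda>a. \<Sum>u\<in>tuples k. z (a, u))"
      have Zy: "Z c a = of_real (y a)" "Z (\<sigma> c) a = of_real (y a)" for a
        by (simp_all add: Z \<psi>_def c0 \<sigma>0 y_def)
      have "?S = (\<Sum>a\<in>F. \<Sum>b\<in>F. of_real (y a) * of_real (y b))" by (simp add: c0 Zy)
      also have "\<dots> = of_real ((\<Sum>a\<in>F. y a)\<^sup>2)" by (simp add: power2_eq_square sum_product)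
      finally have "Re ?S \<ge> 0" by simp
      moreover have "m / 2 * ((\<Sum>a\<in>F. (cmod (Z c a))\<^sup>2) + (\<Sum>b\<in>F. (cmod (Z (\<sigma> c) b))\<^sup>2)) \<ge> 0"
        using m(1) by (intro mult_nonneg_nonneg add_nonneg_nonneg sum_nonneg) auto
      ultimately show ?thesis by linarith
    qed
  qed (use \<sigma>bij Parseval_tuples in auto)
  show ?thesis
  proof (rule lambda_free_ge_adjacency[OF _ _ _ sym emb H m(1) form])
    show "finite ?V" "?V \<noteq> {}" using Fne tne by auto
    show "card ?V \<le> n" using n by (simp add: card_cartesian_product card_F card_tuples)
    show "real (card {v \<in> ?V. ?E u v}) = real q" if "u \<in> ?V" for u using deg[OF that] by simp
    have "card {u \<in> ?V. ?E u u} \<le> card ?V" by (rule card_mono) auto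
    then show "real (card {u \<in> ?V. ?E u u}) \<le> 1 * real (card ?V)" by (simp only: mult_1 of_nat_le_iff)
  qed
qed

end

lemma cycle_graph_arcs:
  assumes "k > 0" "a \<in> pverts (cycle_graph k)"
  shows "\<exists>b. (a, b) \<in> parcs (cycle_graph k)"
  using assms by (intro exI[of _ "(a + 1) mod k"]) (auto simp: cycle_graph_def)

lemma embeds_cycleD:
  assumes "embeds (cycle_graph k) V E"
  obtains h where "inj_on h {..<k}" "\<And>i. i < k \<Longrightarrow> h i \<in> V" "\<And>i. i < k \<Longrightarrow> E (h i) (h (Suc i mod k))"
proof -
  obtain h where h: "inj_on h (pverts (cycle_graph k))" "h ` pverts (cycle_graph k) \<subseteq> V"
    "\<forall>(a, b)\<in>parcs (cycle_graph k). E (h a) (h b)"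
    using assms by (auto simp: embeds_def)
  show thesis
  proof
    show "inj_on h {..<k}" using h(1) by (simp add: cycle_graph_def atLeast0LessThan)
    show "h i \<in> V" if "i < k" for i using h(2) that by (auto simp: cycle_graph_def)
    show "E (h i) (h (Suc i mod k))" if "i < k" for i
      using h(3) that by (auto simp: cycle_graph_def)
  qed
qed

text \<open>Between two consecutive orders \<open>K * B ^ j\<close> monotonicity loses at most the
  factor \<open>D\<close>; below \<open>K\<close> the trivial bound 1 takes over.\<close>

lemma powr_lower_bound_of_geometric:
  fixes f :: "nat \<Rightarrow> real"
  assumes 1: "\<And>n. n \<ge> 1 \<Longrightarrow> f n \<ge> 1" and B: "B > 1" and K: "K \<ge> 1" and \<alpha>: "\<alpha> > 0" and c: "c > 0"
    and f: "\<And>j n. K * B ^ j \<le> real n \<Longrightarrow> f n \<ge> c * (B ^ j) powr \<alpha>"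
  shows "\<exists>C>0. \<forall>n\<ge>1. f n \<ge> C * real n powr \<alpha>"
proof -
  define D where "D = (K * B) powr \<alpha>"
  have KB: "K * B \<ge> K" "K * B > 0" using B K by (simp_all add: mult_le_cancel_left1)
  have D: "D > 0" using B K by (simp add: D_def)
  have "min 1 c / D * real n powr \<alpha> \<le> f n" if n: "n \<ge> 1" for n
  proof (cases "real n < K")
    case True
    have "real n powr \<alpha> \<le> D" unfolding D_def by (intro powr_mono2) (use True KB \<alpha> in linarith)+
    then have "min 1 c / D * real n powr \<alpha> \<le> min 1 c / D * D" using D c by (intro mult_left_mono) auto
    also have "\<dots> \<le> 1" using D by simp
    finally show ?thesis using 1[OF n] by linarith
  next
    case False
    then obtain j where j: "B ^ j \<le> real n / K" "real n / K < B ^ Suc j"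
      using ex_power_between[OF B, of "real n / K"] K by auto
    have "real n powr \<alpha> \<le> (K * B * B ^ j) powr \<alpha>"
      using j K \<alpha> by (intro powr_mono2) (auto simp: field_simps)
    also have "\<dots> = D * (B ^ j) powr \<alpha>" using B K by (simp add: D_def powr_mult)
    finally have "min 1 c / D * real n powr \<alpha> \<le> min 1 c / D * (D * (B ^ j) powr \<alpha>)"
      using D c by (intro mult_left_mono) auto
    also have "\<dots> \<le> c * (B ^ j) powr \<alpha>" using D by (simp add: mult_right_mono)
    also have "\<dots> \<le> f n" using j K by (intro f) (simp add: field_simps)
    finally show ?thesis .
  qed
  then show ?thesis using D c by (intro exI[of _ "min 1 c / D"]) auto
qed

context finite_subfield_char2
begin

lemma two_eq_0: "(2 :: 'a) = 0"
  using add_self[of 1] unfolding one_add_one .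

text \<open>In terms of \<open>x = a0 + a2\<close>, \<open>y = a1 + a2\<close> and the squared
  differences \<open>d0\<close>, \<open>d1\<close> the first relation reads
  \<open>x * d0 = y * d1\<close>, and the square of the second one
  \<open>x ^ 4 * d0 = y ^ 4 * d1\<close>. So \<open>x / y\<close> is a cube root of unity in
  \<open>F\<close>, and the only one is 1 because \<open>q\<close> is 2 modulo 3.\<close>

lemma hexagon_free_algebra:
  fixes a b :: "nat \<Rightarrow> 'a"
  assumes q3: "q mod 3 = 2" and F: "a0 \<in> F" "a1 \<in> F" "a2 \<in> F" "b0 \<in> F" "b1 \<in> F" "b2 \<in> F"
    and d: "a0 \<noteq> a2" "a1 \<noteq> a2" "a0 \<noteq> a1" "b0 \<noteq> b2"
    and e1: "a0 * (b0\<^sup>2 + b2\<^sup>2) + a1 * (b0\<^sup>2 + b1\<^sup>2) + a2 * (b1\<^sup>2 + b2\<^sup>2) = 0"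
    and e2: "a0\<^sup>2 * (b0 + b2) + a1\<^sup>2 * (b0 + b1) + a2\<^sup>2 * (b1 + b2) = 0"
  shows False
proof -
  have sq: "(x + y :: 'a)\<^sup>2 = x\<^sup>2 + y\<^sup>2" for x y using Frob_add[of x y 1] p2 by simp
  have p4: "(z\<^sup>2)\<^sup>2 = z ^ 4" for z :: 'a by (simp flip: power_mult)
  define x y where "x = a0 + a2" and "y = a1 + a2"
  define d0 d1 where "d0 = (b0 + b2)\<^sup>2" and "d1 = (b0 + b1)\<^sup>2"
  have xy: "x \<noteq> 0" "y \<noteq> 0" "x \<noteq> y" using d by (auto simp: x_def y_def)
  have d0: "d0 \<noteq> 0" using d by (simp add: d0_def)
  have s: "(b1 + b2)\<^sup>2 = d0 + d1" by (simp add: d0_def d1_def sq add_ac)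
  have "x * d0 + y * d1 = a0 * (b0\<^sup>2 + b2\<^sup>2) + a1 * (b0\<^sup>2 + b1\<^sup>2) + a2 * (b1\<^sup>2 + b2\<^sup>2)"
    using s by (simp add: x_def y_def d0_def d1_def sq algebra_simps)
  then have 1: "x * d0 = y * d1" using e1 by simp
  have "(a0\<^sup>2 * (b0 + b2) + a1\<^sup>2 * (b0 + b1) + a2\<^sup>2 * (b1 + b2))\<^sup>2 = 0" using e2 by simp
  then have "a0 ^ 4 * d0 + a1 ^ 4 * d1 + a2 ^ 4 * (d0 + d1) = 0"
    unfolding s[symmetric] d0_def d1_def
    by (simp add: sq power_mult_distrib p4 two_eq_0 algebra_simps del: add_eq_0_iff)
  moreover have "x ^ 4 = a0 ^ 4 + a2 ^ 4" "y ^ 4 = a1 ^ 4 + a2 ^ 4"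
    using Frob_add[of _ _ 2] p2 by (simp_all add: x_def y_def)
  ultimately have "x ^ 4 * d0 = y ^ 4 * d1" by (simp add: algebra_simps)
  then have "x ^ 3 * (x * d0) = y ^ 3 * (y * d1)" by (simp add: power_Suc numeral_eq_Suc mult_ac)
  then have "x ^ 3 = y ^ 3" using 1 xy d0 by auto
  define r where "r = x / y"
  have r: "r ^ 3 = 1" "r \<in> F" using \<open>x ^ 3 = y ^ 3\<close> xy F by (auto simp: r_def power_divide x_def y_def)
  have "r = r ^ q" using r by (simp add: F_power_q)
  also have "q = 3 * (q div 3) + 2" using q3 by presburger
  also have "r ^ (3 * (q div 3) + 2) = r\<^sup>2" using r by (simp add: power_add power_mult power2_eq_square)
  finally have "r = r\<^sup>2" .
  moreover have "r \<noteq> 0" using r(1) by auto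
  ultimately have "r = 1" by (metis mult_cancel_right1 power2_eq_square)
  then show False using xy by (simp add: r_def)
qed

lemma lambda_free_C6_field:
  assumes q3: "q mod 3 = 2" and n: "q ^ 3 \<le> n"
  shows "lambda_free n (cycle_graph 6) \<ge> sqrt (real q) / 2"
proof -
  define f where "f = (\<lambda>i (a::'a) b. if i = (0::nat) then a * b\<^sup>2 else a\<^sup>2 * b)"
  define \<tau> where "\<tau> = (\<lambda>i. 1 - i :: nat)"
  have \<tau>: "\<tau> i < 2" "\<tau> (\<tau> i) = i" if "i < 2" for i using that by (auto simp: \<tau>_def)
  let ?E = "matching_adj 2 \<tau> f"
  have "lambda_free n (cycle_graph 6) \<ge> 1 + (real q - 1) / (sqrt (real 4 * real q) + 1)"
  proof (rule lambda_free_ge_matching[of 2 \<tau> f])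
    show "\<tau> i < 2" "\<tau> (\<tau> i) = i" if "i < 2" for i using that by (auto simp: \<tau>_def)
    show "f i a b \<in> F" if "a \<in> F" "b \<in> F" for i a b using that by (simp add: f_def)
    show "f (\<tau> i) b a = f i a b" if "i < 2" for i a b
      using that less_2_cases[of i] by (auto simp: f_def \<tau>_def)
    show "q ^ Suc 2 \<le> n" using n by (simp add: numeral_3_eq_3)
    show "\<exists>b. (a, b) \<in> parcs (cycle_graph 6)" if "a \<in> pverts (cycle_graph 6)" for a
      using that by (intro cycle_graph_arcs) auto
    fix c assume c: "c \<in> tuples 2" "\<exists>i<2. c i \<noteq> 0"
    define P where "P = (\<lambda>a. c 0 * a + (c 1)\<^sup>2 * a ^ 4)"
    have cF: "c 0 \<in> F" "c 1 \<in> F" using tuplesD[OF c(1)] by auto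
    show "opnorm_le F (sqrt (real 4 * real q)) (\<lambda>a b. \<chi> (- (\<Sum>i<2. c i * f i a b)))"
    proof (rule opnorm_le_fibres[of _ P "\<lambda>b. b\<^sup>2"])
      fix a b assume ab: "a \<in> F" "b \<in> F"
      \<comment> \<open>Frobenius invariance of \<open>\<chi>\<close> makes both phases multiples of
        the square of \<open>b\<close>, with the quartic \<open>P a\<close> as coefficient. Its
        fibres have at most four elements.\<close>
      have "(c 1 * (a\<^sup>2 * b))\<^sup>2 = (c 1)\<^sup>2 * a ^ 4 * b\<^sup>2" by (simp add: power_mult_distrib flip: power_mult)
      then have "\<chi> (c 1 * (a\<^sup>2 * b)) = \<chi> ((c 1)\<^sup>2 * a ^ 4 * b\<^sup>2)"
        using \<chi>_Frob[of "c 1 * (a\<^sup>2 * b)"] ab cF p2 by simp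
      then have "\<chi> (c 0 * (a * b\<^sup>2) + c 1 * (a\<^sup>2 * b)) = \<chi> (c 0 * (a * b\<^sup>2) + (c 1)\<^sup>2 * a ^ 4 * b\<^sup>2)"
        using ab cF by (simp add: \<chi>_add)
      then show "\<chi> (- (\<Sum>i<2. c i * f i a b)) = \<chi> (P a * b\<^sup>2)"
        by (simp add: numeral_2_eq_2 f_def P_def algebra_simps)
    next
      show "P a \<in> F" if "a \<in> F" for a using that cF by (simp add: P_def)
      have inj: "inj_on (\<lambda>b. b\<^sup>2) F" using square_eq_iff by (auto simp: inj_on_def power2_eq_square)
      then show "bij_betw (\<lambda>b. b\<^sup>2) F F"
        unfolding bij_betw_def by (intro conjI endo_inj_surj) auto
      fix v assume "v \<in> F"
      let ?p = "[:v, c 0, 0, 0, (c 1)\<^sup>2:]"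
      have nz: "?p \<noteq> 0" using c(2) less_2_cases by auto
      have "{a \<in> F. P a = v} \<subseteq> {a. poly ?p a = 0}"
        by (auto simp: P_def numeral_eq_Suc algebra_simps)
      then have "card {a \<in> F. P a = v} \<le> card {a. poly ?p a = 0}"
        using poly_roots_finite[OF nz] by (rule card_mono[rotated])
      also have "\<dots> \<le> degree ?p" by (rule card_poly_roots_bound[OF nz])
      also have "\<dots> \<le> 4" by simp
      finally show "card {a \<in> F. P a = v} \<le> 4" .
    qed simp
  next
    show "\<not> embeds (cycle_graph 6) (F \<times> tuples 2) (\<lambda>u v. u \<noteq> v \<and> ?E u v)"
    proof
      assume "embeds (cycle_graph 6) (F \<times> tuples 2) (\<lambda>u v. u \<noteq> v \<and> ?E u v)"
      then obtain h where h: "inj_on h {..<6}" "\<And>i. i < 6 \<Longrightarrow> h i \<in> F \<times> tuples 2"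
        "\<And>i. i < 6 \<Longrightarrow> h i \<noteq> h (Suc i mod 6) \<and> ?E (h i) (h (Suc i mod 6))"
        by (rule embeds_cycleD) blast
      have E: "snd (h i) 0 + snd (h j) 1 = fst (h i) * (fst (h j))\<^sup>2"
        "snd (h i) 1 + snd (h j) 0 = (fst (h i))\<^sup>2 * fst (h j)"
        "snd (h j) 0 + snd (h i) 1 = fst (h j) * (fst (h i))\<^sup>2"
        "snd (h j) 1 + snd (h i) 0 = (fst (h j))\<^sup>2 * fst (h i)"
        if "i < 6" "j = Suc i mod 6" for i j
        using h(3)[OF that(1)] that(2) by (auto simp: matching_adj_def f_def \<tau>_def less_2_cases_iff add.commute mult.commute)
      have EE: "?E (h i) (h j)" "?E (h j) (h i)" if "i < 6" "j = Suc i mod 6" for i j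
        using E[OF that] by (auto simp: matching_adj_def f_def \<tau>_def less_2_cases_iff)
      have ne: "fst (h i) \<noteq> fst (h k)" if "i < 6" "k < 6" "i \<noteq> k" "?E (h j) (h i)" "?E (h j) (h k)" for i j k
      proof
        assume eq: "fst (h i) = fst (h k)"
        have "h i = h k"
          using matching_adj_unique[of 2 \<tau> f "h j" "h i" "h k"] \<tau> that h(2) eq by blast
        then show False using h(1) that by (auto simp: inj_on_def)
      qed
      have F: "fst (h i) \<in> F" if "i < 6" for i using h(2)[OF that] by auto
      show False
      proof (rule hexagon_free_algebra[OF q3, of "fst (h 0)" "fst (h 2)" "fst (h 4)" "fst (h 1)" "fst (h 3)" "fst (h 5)"])
        show "fst (h 0) \<noteq> fst (h 4)" using ne[of 0 4 5] EE[of 4 5] EE[of 5 0] by simp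
        show "fst (h 2) \<noteq> fst (h 4)" using ne[of 2 4 3] EE[of 2 3] EE[of 3 4] by simp
        show "fst (h 0) \<noteq> fst (h 2)" using ne[of 0 2 1] EE[of 0 1] EE[of 1 2] by simp
        show "fst (h 1) \<noteq> fst (h 5)" using ne[of 1 5 0] EE[of 0 1] EE[of 5 0] by simp
        have e1: "snd (h 0) 0 + snd (h 1) 1 = fst (h 0) * (fst (h 1))\<^sup>2"
          "snd (h 2) 0 + snd (h 1) 1 = fst (h 2) * (fst (h 1))\<^sup>2"
          "snd (h 2) 0 + snd (h 3) 1 = fst (h 2) * (fst (h 3))\<^sup>2"
          "snd (h 4) 0 + snd (h 3) 1 = fst (h 4) * (fst (h 3))\<^sup>2"
          "snd (h 4) 0 + snd (h 5) 1 = fst (h 4) * (fst (h 5))\<^sup>2"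
          "snd (h 0) 0 + snd (h 5) 1 = fst (h 0) * (fst (h 5))\<^sup>2"
          using E(1)[of 0 1] E(3)[of 1 2] E(1)[of 2 3] E(3)[of 3 4] E(1)[of 4 5] E(3)[of 5 0] by simp_all
        have "fst (h 0) * (fst (h 1))\<^sup>2 + fst (h 2) * (fst (h 1))\<^sup>2 + fst (h 2) * (fst (h 3))\<^sup>2
            + fst (h 4) * (fst (h 3))\<^sup>2 + fst (h 4) * (fst (h 5))\<^sup>2 + fst (h 0) * (fst (h 5))\<^sup>2 = 0"
          unfolding e1[symmetric] by (simp add: add_ac)
        then show "fst (h 0) * ((fst (h 1))\<^sup>2 + (fst (h 5))\<^sup>2) + fst (h 2) * ((fst (h 1))\<^sup>2 + (fst (h 3))\<^sup>2)
            + fst (h 4) * ((fst (h 3))\<^sup>2 + (fst (h 5))\<^sup>2) = 0"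
          by (simp only: distrib_left add_ac)
        have e2: "snd (h 0) 1 + snd (h 1) 0 = (fst (h 0))\<^sup>2 * fst (h 1)"
          "snd (h 2) 1 + snd (h 1) 0 = (fst (h 2))\<^sup>2 * fst (h 1)"
          "snd (h 2) 1 + snd (h 3) 0 = (fst (h 2))\<^sup>2 * fst (h 3)"
          "snd (h 4) 1 + snd (h 3) 0 = (fst (h 4))\<^sup>2 * fst (h 3)"
          "snd (h 4) 1 + snd (h 5) 0 = (fst (h 4))\<^sup>2 * fst (h 5)"
          "snd (h 0) 1 + snd (h 5) 0 = (fst (h 0))\<^sup>2 * fst (h 5)"
          using E(2)[of 0 1] E(4)[of 1 2] E(2)[of 2 3] E(4)[of 3 4] E(2)[of 4 5] E(4)[of 5 0] by simp_all
        have "(fst (h 0))\<^sup>2 * fst (h 1) + (fst (h 2))\<^sup>2 * fst (h 1) + (fst (h 2))\<^sup>2 * fst (h 3)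
            + (fst (h 4))\<^sup>2 * fst (h 3) + (fst (h 4))\<^sup>2 * fst (h 5) + (fst (h 0))\<^sup>2 * fst (h 5) = 0"
          unfolding e2[symmetric] by (simp add: add_ac)
        then show "(fst (h 0))\<^sup>2 * (fst (h 1) + fst (h 5)) + (fst (h 2))\<^sup>2 * (fst (h 1) + fst (h 3))
            + (fst (h 4))\<^sup>2 * (fst (h 3) + fst (h 5)) = 0"
          by (simp only: distrib_left add_ac)
      qed (use F in auto)
    qed
  qed simp_all
  moreover have "1 + (real q - 1) / (sqrt (real 4 * real q) + 1) \<ge> sqrt (real q) / 2"
  proof -
    define s where "s = sqrt (real q)"
    have s: "s \<ge> 0" "real q = s * s" by (simp_all add: s_def)
    have "sqrt (real 4 * real q) = 2 * s" by (simp add: s_def real_sqrt_mult)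
    then show ?thesis using s unfolding s_def[symmetric] by (simp add: field_simps) 
  qed
  ultimately show ?thesis by linarith
qed

end

lemma lambda_free_cycle_ge_1:
  assumes "n \<ge> 1" "t \<ge> 1"
  shows "lambda_free n (cycle_graph t) \<ge> 1"
proof (rule lambda_free_ge_1[OF assms(1)])
  show "\<exists>b. (a, b) \<in> parcs (cycle_graph t)" if "a \<in> pverts (cycle_graph t)" for a
    using assms that by (intro cycle_graph_arcs) auto
qed (use assms in \<open>auto simp: cycle_graph_def\<close>)

lemma lambda_free_C6: "\<exists>c>0. \<forall>n\<ge>1. lambda_free n (cycle_graph 6) \<ge> c * real n powr (1 / 6)"
proof (rule powr_lower_bound_of_geometric[where B = 64 and K = 8 and c = "1 / 2"])
  show "lambda_free n (cycle_graph 6) \<ge> 1" if "n \<ge> 1" for n using that by (intro lambda_free_cycle_ge_1) auto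
  fix j n :: nat assume n: "8 * 64 ^ j \<le> real n"
  \<comment> \<open>An odd power of 2 is 2 modulo 3, and \<open>q ^ 3 = 8 * 64 ^ j\<close> explains
    \<open>K\<close> and \<open>B\<close>.\<close>
  define q :: nat where "q = 2 ^ (2 * j + 1)"
  interpret finite_subfield_char2 2 "2 * j + 1" q "TYPE(K2)"
    unfolding q_def by (intro finite_subfield_K2) simp
  have "(2 * 4 ^ j) mod (3::nat) = 2"
  proof (induction j)
    case (Suc j)
    then show ?case by (simp add: mod_mult_eq) presburger
  qed simp
  then have q3: "q mod 3 = 2" by (simp add: q_def power_mult)
  have q4: "real q = 2 * 4 ^ j" by (simp add: q_def power_mult)
  have "((4::real) ^ j) ^ 3 = (4 ^ 3) ^ j" by (metis mult.commute power_mult)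
  then have "real (q ^ 3) = 8 * 64 ^ j" unfolding of_nat_power q4 power_mult_distrib by simp
  then have "q ^ 3 \<le> n" using n by (metis of_nat_le_iff)
  then have "lambda_free n (cycle_graph 6) \<ge> sqrt (real q) / 2" using q3 by (intro lambda_free_C6_field)
  moreover have "sqrt (real q) \<ge> 2 ^ j"
    by (intro real_le_rsqrt) (simp add: q4 power2_eq_square flip: power_mult_distrib)
  moreover have "((64::real) ^ j) powr (1 / 6) = 2 ^ j"
  proof -
    have eq: "(64::real) ^ j = (2 ^ j) powr 6"
    proof -
      have "(64::real) ^ j = (2 ^ 6) ^ j" by simp
      also have "\<dots> = (2 ^ j) ^ 6" by (metis mult.commute power_mult)
      also have "\<dots> = (2 ^ j) powr 6" by (rule powr_numeral[symmetric]) simp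
      finally show ?thesis .
    qed
    show ?thesis unfolding eq powr_powr by simp
  qed
  ultimately show "lambda_free n (cycle_graph 6) \<ge> 1 / 2 * (64 ^ j) powr (1 / 6)" by simp
qed auto

section \<open>Systems of products of linear forms\<close>

text \<open>Elimination of one unknown per equation. It supplies the linear dependence below and
  later the auxiliary function of Stepanov's method.\<close>

lemma homogeneous_system_solution:
  fixes C :: "'i \<Rightarrow> 'j \<Rightarrow> 'a :: field"
  assumes "finite B" "finite A" "card B < card A"
  shows "\<exists>w. (\<exists>k\<in>A. w k \<noteq> 0) \<and> (\<forall>b\<in>B. (\<Sum>k\<in>A. w k * C k b) = 0)"
  using assms
proof (induction B arbitrary: A C rule: finite_induct)
  case empty
  then obtain k where "k \<in> A" by (metis all_not_in_conv card.empty less_irrefl)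
  then show ?case by (intro exI[of _ "\<lambda>_. 1"]) auto
next
  case (insert b B)
  show ?case
  proof (cases "\<forall>k\<in>A. C k b = 0")
    case True
    then show ?thesis using insert.IH[of A C] insert.prems insert.hyps by auto
  next
    case False
    then obtain k0 where k0: "k0 \<in> A" "C k0 b \<noteq> 0" by blast
    define A' where "A' = A - {k0}"
    have A: "A = insert k0 A'" "k0 \<notin> A'" "finite A'" using k0 insert.prems by (auto simp: A'_def)
    define C' where "C' = (\<lambda>k j. C k j - C k b / C k0 b * C k0 j)"
    have "card B < card A'" using insert.prems insert.hyps A by simp
    then obtain w where w: "\<exists>k\<in>A'. w k \<noteq> 0" "\<forall>j\<in>B. (\<Sum>k\<in>A'. w k * C' k j) = 0"
      using insert.IH[OF A(3), of C'] by auto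
    define t where "t = - (\<Sum>k\<in>A'. w k * C k b) / C k0 b"
    define w' where "w' = w(k0 := t)"
    have sum: "(\<Sum>k\<in>A. w' k * C k j) = t * C k0 j + (\<Sum>k\<in>A'. w k * C k j)" for j
    proof -
      have "(\<Sum>k\<in>A'. w' k * C k j) = (\<Sum>k\<in>A'. w k * C k j)"
        using A(2) by (intro sum.cong) (auto simp: w'_def)
      then show ?thesis unfolding A(1) using A(2,3) by (simp add: w'_def)
    qed
    have "(\<Sum>k\<in>A. w' k * C k j) = 0" if "j \<in> insert b B" for j
    proof (cases "j = b")
      case True
      then show ?thesis using k0 by (simp add: sum t_def)
    next
      case False
      then have "(\<Sum>k\<in>A'. w k * C' k j) = 0" using w(2) that by auto
      also have "(\<Sum>k\<in>A'. w k * C' k j) = (\<Sum>k\<in>A'. w k * C k j) - (\<Sum>k\<in>A'. w k * C k b) / C k0 b * C k0 j"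
        unfolding sum_divide_distrib sum_distrib_right sum_subtractf[symmetric]
        by (intro sum.cong refl) (simp add: C'_def right_diff_distrib)
      finally show ?thesis by (simp add: sum t_def)
    qed
    moreover have "\<exists>k\<in>A. w' k \<noteq> 0" using w(1) A by (auto simp: w'_def)
    ultimately show ?thesis by blast
  qed
qed

text \<open>Lagrange interpolation at the nodes \<open>- \<alpha> i / \<beta> i\<close>, where \<open>\<beta> i = 0\<close> is the node at infinity.\<close>

lemma Lagrange_basis_linear_forms:
  fixes \<alpha> \<beta> :: "'i \<Rightarrow> 'a :: field" and P :: "'a poly"
  assumes "finite I" "I \<noteq> {}" "degree P < card I"
    and "\<And>i k. i \<in> I \<Longrightarrow> k \<in> I \<Longrightarrow> i \<noteq> k \<Longrightarrow> \<alpha> i * \<beta> k \<noteq> \<alpha> k * \<beta> i"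
  shows "\<exists>c. P = (\<Sum>k\<in>I. smult (c k) (\<Prod>i\<in>I - {k}. [:\<alpha> i, \<beta> i:]))"
  using assms
proof (induction I arbitrary: P rule: finite_ne_induct)
  case (singleton m)
  then have "degree P = 0" by simp
  then obtain c where "P = [:c:]" by (rule degree_eq_zeroE)
  then show ?case by (intro exI[of _ "\<lambda>_. c"]) simp
next
  case (insert m I)
  let ?\<Pi> = "\<Prod>i\<in>I. [:\<alpha> i, \<beta> i:]"
  have degPi: "degree ?\<Pi> \<le> card I"
  proof -
    have "degree ?\<Pi> \<le> (\<Sum>i\<in>I. degree [:\<alpha> i, \<beta> i:])"
      using degree_prod_sum_le[of I "\<lambda>i. [:\<alpha> i, \<beta> i:]"] insert.hyps by (simp add: o_def)
    also have "\<dots> \<le> (\<Sum>i\<in>I. 1)" by (intro sum_mono) simp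
    finally show ?thesis by simp
  qed
  have degP: "degree P \<le> card I" using insert.prems insert.hyps by simp
  have degc: "degree (P - smult c ?\<Pi>) \<le> card I" for c
    using degP degPi degree_smult_le[of c ?\<Pi>] by (intro degree_diff_le) auto
  \<comment> \<open>The multiple of \<open>?\<Pi>\<close> is chosen so that the difference vanishes
    at the node of \<open>m\<close>: at the root \<open>r\<close>, or, for the node at infinity, in
    its top coefficient.\<close>
  have "\<exists>c P'. P = smult c ?\<Pi> + [:\<alpha> m, \<beta> m:] * P' \<and> degree P' < card I"
  proof (cases "\<beta> m = 0")
    case False
    define r where "r = - \<alpha> m / \<beta> m"
    have nz: "poly ?\<Pi> r \<noteq> 0"
    proof -
      have "\<alpha> i + r * \<beta> i \<noteq> 0" if "i \<in> I" for i
      proof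
        assume "\<alpha> i + r * \<beta> i = 0"
        then have "\<alpha> i * \<beta> m = \<alpha> m * \<beta> i" using False by (simp add: r_def field_simps)
        then show False using insert.prems(2)[of i m] that insert.hyps by auto
      qed
      then show ?thesis using insert.hyps by (simp add: poly_prod)
    qed
    define c where "c = poly P r / poly ?\<Pi> r"
    have "poly (P - smult c ?\<Pi>) r = 0" using nz by (simp add: c_def)
    then have "[:- r, 1:] dvd P - smult c ?\<Pi>" by (simp only: poly_eq_0_iff_dvd)
    then obtain P2 where P2: "P - smult c ?\<Pi> = [:- r, 1:] * P2" by (rule dvdE)
    have lin: "[:\<alpha> m, \<beta> m:] = smult (\<beta> m) [:- r, 1:]" using False by (simp add: r_def)
    have "P = smult c ?\<Pi> + [:\<alpha> m, \<beta> m:] * smult (1 / \<beta> m) P2"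
      unfolding lin using P2 False by (simp add: algebra_simps)
    moreover have "degree (smult (1 / \<beta> m) P2) < card I"
    proof (cases "P2 = 0")
      case True
      then show ?thesis using insert.hyps by (simp add: card_gt_0_iff)
    next
      case False
      then have "degree (P - smult c ?\<Pi>) = Suc (degree P2)" unfolding P2 by (subst degree_mult_eq) auto
      then have "degree P2 < card I" using degc[of c] by simp
      then show ?thesis using degree_smult_le[of "1 / \<beta> m" P2] by linarith
    qed
    ultimately show ?thesis by blast
  next
    case True
    have nz: "\<beta> i \<noteq> 0 \<and> \<alpha> m \<noteq> 0" if "i \<in> I" for i
      using insert.prems(2)[of m i] that insert.hyps True by auto
    have \<alpha>m: "\<alpha> m \<noteq> 0" using nz insert.hyps by blast
    have co: "coeff ?\<Pi> (card I) = (\<Prod>i\<in>I. \<beta> i)"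
    proof -
      have "degree ?\<Pi> = (\<Sum>i\<in>I. degree [:\<alpha> i, \<beta> i:])"
        using nz by (intro degree_prod_eq_sum_degree) auto
      also have "\<dots> = (\<Sum>i\<in>I. 1)" using nz by (intro sum.cong) auto
      finally have "degree ?\<Pi> = card I" by simp
      then have "coeff ?\<Pi> (card I) = lead_coeff ?\<Pi>" by simp
      also have "\<dots> = (\<Prod>i\<in>I. lead_coeff [:\<alpha> i, \<beta> i:])" by (rule lead_coeff_prod)
      also have "\<dots> = (\<Prod>i\<in>I. \<beta> i)" using nz by (intro prod.cong) auto
      finally show ?thesis .
    qed
    define c where "c = coeff P (card I) / (\<Prod>i\<in>I. \<beta> i)"
    have "coeff (P - smult c ?\<Pi>) (card I) = 0" using nz insert.hyps by (simp add: co c_def)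
    moreover have "card I > 0" using insert.hyps by (simp add: card_gt_0_iff)
    ultimately have "degree (P - smult c ?\<Pi>) < card I"
      using degc[of c] by (metis degree_0 le_neq_implies_less leading_coeff_0_iff)
    then have "degree (smult (1 / \<alpha> m) (P - smult c ?\<Pi>)) < card I"
      using degree_smult_le[of "1 / \<alpha> m" "P - smult c ?\<Pi>"] by linarith
    moreover have "P = smult c ?\<Pi> + [:\<alpha> m, \<beta> m:] * smult (1 / \<alpha> m) (P - smult c ?\<Pi>)"
      using True \<alpha>m by simp
    ultimately show ?thesis by blast
  qed
  then obtain c P' where P': "P = smult c ?\<Pi> + [:\<alpha> m, \<beta> m:] * P'" "degree P' < card I" by blast
  obtain c' where c': "P' = (\<Sum>k\<in>I. smult (c' k) (\<Prod>i\<in>I - {k}. [:\<alpha> i, \<beta> i:]))"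
    using insert.IH[OF P'(2)] insert.prems(2) by auto
  define d where "d = c'(m := c)"
  have "(\<Sum>k\<in>insert m I. smult (d k) (\<Prod>i\<in>insert m I - {k}. [:\<alpha> i, \<beta> i:])) =
      smult c ?\<Pi> + (\<Sum>k\<in>I. smult (d k) (\<Prod>i\<in>insert m I - {k}. [:\<alpha> i, \<beta> i:]))"
    using insert.hyps by (simp add: d_def)
  also have "(\<Sum>k\<in>I. smult (d k) (\<Prod>i\<in>insert m I - {k}. [:\<alpha> i, \<beta> i:])) =
      (\<Sum>k\<in>I. [:\<alpha> m, \<beta> m:] * smult (c' k) (\<Prod>i\<in>I - {k}. [:\<alpha> i, \<beta> i:]))"
  proof (intro sum.cong refl)
    fix k assume k: "k \<in> I"
    then have "insert m I - {k} = insert m (I - {k})" "k \<noteq> m" using insert.hyps by auto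
    then show "smult (d k) (\<Prod>i\<in>insert m I - {k}. [:\<alpha> i, \<beta> i:]) =
        [:\<alpha> m, \<beta> m:] * smult (c' k) (\<Prod>i\<in>I - {k}. [:\<alpha> i, \<beta> i:])"
      using insert.hyps by (simp add: d_def mult_smult_right del: mult_pCons_left)
  qed
  also have "smult c ?\<Pi> + \<dots> = P" unfolding P'(1) by (subst c') (simp only: sum_distrib_left)
  finally show ?case by metis
qed

lemma prod_linear_forms_expand:
  fixes \<alpha> \<beta> :: "'i \<Rightarrow> 'a :: field"
  assumes "finite J" "card J \<le> s"
  shows "\<exists>d. \<forall>z. (\<Prod>i\<in>J. \<alpha> i + \<beta> i * z) = (\<Sum>e\<le>s. d e * z ^ e)"
proof -
  let ?\<Pi> = "\<Prod>i\<in>J. [:\<alpha> i, \<beta> i:]"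
  have "degree ?\<Pi> \<le> (\<Sum>i\<in>J. degree [:\<alpha> i, \<beta> i:])" using degree_prod_sum_le[of J "\<lambda>i. [:\<alpha> i, \<beta> i:]"] assms by (simp add: o_def)
  also have "\<dots> \<le> (\<Sum>i\<in>J. 1)" by (intro sum_mono) simp
  also have "\<dots> \<le> s" using assms by simp
  finally have deg: "degree ?\<Pi> \<le> s" .
  have "(\<Prod>i\<in>J. \<alpha> i + \<beta> i * z) = (\<Sum>e\<le>s. coeff ?\<Pi> e * z ^ e)" for z
  proof -
    have "(\<Prod>i\<in>J. \<alpha> i + \<beta> i * z) = poly ?\<Pi> z" by (simp add: poly_prod mult.commute)
    also have "\<dots> = (\<Sum>e\<le>degree ?\<Pi>. coeff ?\<Pi> e * z ^ e)" by (rule poly_altdef)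
    also have "\<dots> = (\<Sum>e\<le>s. coeff ?\<Pi> e * z ^ e)"
      using deg by (intro sum.mono_neutral_left) (auto simp: coeff_eq_0)
    finally show ?thesis .
  qed
  then show ?thesis by blast
qed

text \<open>Polynomial functions in \<open>x 0, \<dots>, x (s - 1)\<close> of degree at most \<open>j\<close> (in \<open>stair\<close>) or \<open>j + 1\<close>
  (in \<open>stair_up\<close>) in \<open>x j\<close>.\<close>

fun stair :: "(nat \<Rightarrow> 'p \<Rightarrow> 'a :: field) \<Rightarrow> nat \<Rightarrow> ('p \<Rightarrow> 'a) set" where
  "stair x 0 = {\<lambda>p. c | c. True}"
| "stair x (Suc s) = {\<lambda>p. \<Sum>e\<le>s. x s p ^ e * g e p | g. \<forall>e\<le>s. g e \<in> stair x s}"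

fun stair_up :: "(nat \<Rightarrow> 'p \<Rightarrow> 'a :: field) \<Rightarrow> nat \<Rightarrow> ('p \<Rightarrow> 'a) set" where
  "stair_up x 0 = {\<lambda>p. c | c. True}"
| "stair_up x (Suc s) = {\<lambda>p. \<Sum>e\<le>Suc s. x s p ^ e * g e p | g. \<forall>e\<le>Suc s. g e \<in> stair_up x s}"

lemma stair_linear:
  "(\<lambda>p. 0) \<in> stair x s"
  "f \<in> stair x s \<Longrightarrow> g \<in> stair x s \<Longrightarrow> (\<lambda>p. f p + g p) \<in> stair x s"
  "f \<in> stair x s \<Longrightarrow> (\<lambda>p. a * f p) \<in> stair x s"
proof -
  have "(\<lambda>p. 0) \<in> stair x s \<and> (\<forall>f\<in>stair x s. \<forall>g\<in>stair x s. (\<lambda>p. f p + g p) \<in> stair x s) \<and>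
      (\<forall>f\<in>stair x s. \<forall>a. (\<lambda>p. a * f p) \<in> stair x s)"
  proof (induction s)
    case 0
    show ?case by auto
  next
    case (Suc s)
    have "(\<lambda>p. 0) = (\<lambda>p. \<Sum>e\<le>s. x s p ^ e * (\<lambda>p. 0) p)" by simp
    then have "(\<lambda>p. 0) \<in> stair x (Suc s)" using Suc.IH by (simp del: mult_zero_right) (intro exI[of _ "\<lambda>e p. 0"], simp)
    moreover have "(\<lambda>p. f p + g p) \<in> stair x (Suc s)" if "f \<in> stair x (Suc s)" "g \<in> stair x (Suc s)" for f g
    proof -
      obtain f' g' where "f = (\<lambda>p. \<Sum>e\<le>s. x s p ^ e * f' e p)" "\<forall>e\<le>s. f' e \<in> stair x s"
        "g = (\<lambda>p. \<Sum>e\<le>s. x s p ^ e * g' e p)" "\<forall>e\<le>s. g' e \<in> stair x s" using \<open>f \<in> _\<close> \<open>g \<in> _\<close> by auto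
      then show ?thesis using Suc.IH
        by (auto intro!: exI[of _ "\<lambda>e p. f' e p + g' e p"] simp: distrib_left sum.distrib)
    qed
    moreover have "(\<lambda>p. a * f p) \<in> stair x (Suc s)" if "f \<in> stair x (Suc s)" for f a
    proof -
      obtain f' where "f = (\<lambda>p. \<Sum>e\<le>s. x s p ^ e * f' e p)" "\<forall>e\<le>s. f' e \<in> stair x s" using \<open>f \<in> _\<close> by auto
      then show ?thesis using Suc.IH
        by (auto intro!: exI[of _ "\<lambda>e p. a * f' e p"] simp: sum_distrib_left mult_ac)
    qed
    ultimately show ?case by blast
  qed
  then show "(\<lambda>p. 0) \<in> stair x s"
    "f \<in> stair x s \<Longrightarrow> g \<in> stair x s \<Longrightarrow> (\<lambda>p. f p + g p) \<in> stair x s"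
    "f \<in> stair x s \<Longrightarrow> (\<lambda>p. a * f p) \<in> stair x s" by auto
qed

lemma stair_up_linear:
  "(\<lambda>p. 0) \<in> stair_up x s"
  "f \<in> stair_up x s \<Longrightarrow> g \<in> stair_up x s \<Longrightarrow> (\<lambda>p. f p + g p) \<in> stair_up x s"
  "f \<in> stair_up x s \<Longrightarrow> (\<lambda>p. a * f p) \<in> stair_up x s"
proof -
  have "(\<lambda>p. 0) \<in> stair_up x s \<and> (\<forall>f\<in>stair_up x s. \<forall>g\<in>stair_up x s. (\<lambda>p. f p + g p) \<in> stair_up x s) \<and>
      (\<forall>f\<in>stair_up x s. \<forall>a. (\<lambda>p. a * f p) \<in> stair_up x s)"
  proof (induction s)
    case 0
    show ?case by auto
  next
    case (Suc s)
    have "(\<lambda>p. 0) \<in> stair_up x (Suc s)"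
      using Suc.IH by (simp only: stair_up.simps mem_Collect_eq) (intro exI[of _ "\<lambda>e p. 0"], simp)
    moreover have "(\<lambda>p. f p + g p) \<in> stair_up x (Suc s)" if fg0: "f \<in> stair_up x (Suc s)" "g \<in> stair_up x (Suc s)" for f g
    proof -
      obtain f' g' where fg: "f = (\<lambda>p. \<Sum>e\<le>Suc s. x s p ^ e * f' e p)" "\<forall>e\<le>Suc s. f' e \<in> stair_up x s"
        "g = (\<lambda>p. \<Sum>e\<le>Suc s. x s p ^ e * g' e p)" "\<forall>e\<le>Suc s. g' e \<in> stair_up x s"
        using fg0 unfolding stair_up.simps mem_Collect_eq by blast
      then have "(\<lambda>p. f p + g p) = (\<lambda>p. \<Sum>e\<le>Suc s. x s p ^ e * (f' e p + g' e p))"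
        by (simp only: distrib_left sum.distrib)
      then show ?thesis unfolding stair_up.simps mem_Collect_eq using Suc.IH fg
        by (intro exI[of _ "\<lambda>e p. f' e p + g' e p"]) blast
    qed
    moreover have "(\<lambda>p. a * f p) \<in> stair_up x (Suc s)" if fg0: "f \<in> stair_up x (Suc s)" for f a
    proof -
      obtain f' where f: "f = (\<lambda>p. \<Sum>e\<le>Suc s. x s p ^ e * f' e p)" "\<forall>e\<le>Suc s. f' e \<in> stair_up x s"
        using fg0 unfolding stair_up.simps mem_Collect_eq by blast
      then have "(\<lambda>p. a * f p) = (\<lambda>p. \<Sum>e\<le>Suc s. x s p ^ e * (a * f' e p))"
        by (simp only: sum_distrib_left mult.left_commute)
      then show ?thesis unfolding stair_up.simps mem_Collect_eq using Suc.IH f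
        by (intro exI[of _ "\<lambda>e p. a * f' e p"]) blast
    qed
    ultimately show ?case by blast
  qed
  then show "(\<lambda>p. 0) \<in> stair_up x s"
    "f \<in> stair_up x s \<Longrightarrow> g \<in> stair_up x s \<Longrightarrow> (\<lambda>p. f p + g p) \<in> stair_up x s"
    "f \<in> stair_up x s \<Longrightarrow> (\<lambda>p. a * f p) \<in> stair_up x s" by auto
qed

lemma stair_sum: "finite I \<Longrightarrow> (\<And>i. i \<in> I \<Longrightarrow> g i \<in> stair x s) \<Longrightarrow> (\<lambda>p. \<Sum>i\<in>I. a i * g i p) \<in> stair x s"
  by (induction I rule: finite_induct) (simp_all add: stair_linear)

lemma stair_up_sum: "finite I \<Longrightarrow> (\<And>i. i \<in> I \<Longrightarrow> g i \<in> stair_up x s) \<Longrightarrow> (\<lambda>p. \<Sum>i\<in>I. a i * g i p) \<in> stair_up x s"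
  by (induction I rule: finite_induct) (simp_all add: stair_up_linear)

text \<open>Functions in \<open>stair\<close> have degree 0 in \<open>x 0\<close>, and
  \<open>stair_up\<close> allows degree 1 there.\<close>

lemma stair_times_x0: "f \<in> stair x (Suc s) \<Longrightarrow> (\<lambda>p. x 0 p * f p) \<in> stair_up x (Suc s)"
proof (induction s arbitrary: f)
  case 0
  then obtain c where "f = (\<lambda>p. c)" by auto
  then have "(\<lambda>p. x 0 p * f p) = (\<lambda>p. \<Sum>e\<le>Suc 0. x 0 p ^ e * (if e = 0 then 0 else c))" by simp
  then show ?case unfolding stair_up.simps mem_Collect_eq
    by (intro exI[of _ "\<lambda>e p. if e = 0 then 0 else c"]) auto
next
  case (Suc s)
  then obtain g where g: "f = (\<lambda>p. \<Sum>e\<le>Suc s. x (Suc s) p ^ e * g e p)" "\<forall>e\<le>Suc s. g e \<in> stair x (Suc s)"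
    unfolding stair.simps(2)[of x "Suc s"] mem_Collect_eq by blast
  define h where "h = (\<lambda>e p. if e \<le> Suc s then x 0 p * g e p else 0)"
  have "(\<lambda>p. x 0 p * f p) = (\<lambda>p. \<Sum>e\<le>Suc (Suc s). x (Suc s) p ^ e * h e p)"
  proof
    fix p
    have "x 0 p * f p = (\<Sum>e\<le>Suc s. x (Suc s) p ^ e * h e p)"
      unfolding g(1) sum_distrib_left by (intro sum.cong refl) (simp add: h_def)
    then show "x 0 p * f p = (\<Sum>e\<le>Suc (Suc s). x (Suc s) p ^ e * h e p)" by (simp add: h_def)
  qed
  moreover have "h e \<in> stair_up x (Suc s)" for e
    using Suc.IH g(2) stair_up_linear(1) by (cases "e \<le> Suc s") (auto simp: h_def simp del: stair.simps stair_up.simps)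
  ultimately show ?case unfolding stair_up.simps(2)[of x "Suc s"] mem_Collect_eq by blast
qed

text \<open>The monomials span, with \<open>j + 1\<close> possible exponents for
  \<open>x j\<close>.\<close>

lemma stair_spanned:
  "\<exists>B. finite B \<and> card B \<le> fact s \<and> (\<forall>f\<in>stair x s. \<exists>c. f = (\<lambda>p. \<Sum>m\<in>B. c m * m p))"
proof (induction s)
  case 0
  show ?case by (intro exI[of _ "{\<lambda>p. 1}"]) auto
next
  case (Suc s)
  then obtain B where B: "finite B" "card B \<le> fact s" "\<And>f. f \<in> stair x s \<Longrightarrow> \<exists>c. f = (\<lambda>p. \<Sum>m\<in>B. c m * m p)" by blast
  let ?h = "\<lambda>(e, m) p. x s p ^ e * m p"
  let ?B = "?h ` ({..s} \<times> B)"
  have "card ?B \<le> card ({..s} \<times> B)" using B(1) by (intro card_image_le) auto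
  also have "\<dots> = Suc s * card B" by (simp add: card_cartesian_product)
  also have "\<dots> \<le> Suc s * fact s" using B(2) by (intro mult_le_mono2)
  finally have card: "card ?B \<le> fact (Suc s)" by simp
  have "\<exists>c. f = (\<lambda>p. \<Sum>m\<in>?B. c m * m p)" if fs: "f \<in> stair x (Suc s)" for f
  proof -
    obtain g where g: "f = (\<lambda>p. \<Sum>e\<le>s. x s p ^ e * g e p)" "\<forall>e\<le>s. g e \<in> stair x s" using fs by auto
    have "\<forall>e. \<exists>c. e \<in> {..s} \<longrightarrow> g e = (\<lambda>p. \<Sum>m\<in>B. c m * m p)" using g(2) B(3) by auto
    from choice[OF this] obtain c where c: "\<And>e. e \<in> {..s} \<Longrightarrow> g e = (\<lambda>p. \<Sum>m\<in>B. c e m * m p)" by blast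
    have "f p = (\<Sum>m\<in>?B. (\<Sum>em\<in>{em \<in> {..s} \<times> B. ?h em = m}. c (fst em) (snd em)) * m p)" for p
    proof -
      have "f p = (\<Sum>e\<le>s. \<Sum>m\<in>B. c e m * (x s p ^ e * m p))"
        unfolding g(1) by (intro sum.cong refl) (simp add: c sum_distrib_left mult_ac)
      also have "\<dots> = (\<Sum>em\<in>{..s} \<times> B. c (fst em) (snd em) * ?h em p)"
        by (simp add: sum.cartesian_product case_prod_unfold)
      also have "\<dots> = (\<Sum>m\<in>?B. \<Sum>em\<in>{em \<in> {..s} \<times> B. ?h em = m}. c (fst em) (snd em) * ?h em p)"
        using B(1) by (intro sum.image_gen) auto
      also have "\<dots> = (\<Sum>m\<in>?B. (\<Sum>em\<in>{em \<in> {..s} \<times> B. ?h em = m}. c (fst em) (snd em)) * m p)"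
        unfolding sum_distrib_right by (intro sum.cong refl) auto
      finally show ?thesis .
    qed
    then show ?thesis
      by (intro exI[of _ "\<lambda>m. \<Sum>em\<in>{em \<in> {..s} \<times> B. ?h em = m}. c (fst em) (snd em)"]) (rule ext)
  qed
  then show ?case using card B(1) by (intro exI[of _ ?B]) auto
qed

text \<open>Induction on the number of variables. The powers of the last variable \<open>x s\<close>
  are interpolated at the nodes of \<open>I\<close>; the term of \<open>k\<close> omits the form of
  \<open>k\<close>, which leaves \<open>I - {k}\<close>, with one index fewer, for the induction
  hypothesis. Of the remaining forms in \<open>x s\<close>, that of \<open>i\<close> completes the
  product of \<open>i\<close>, and the other \<open>s\<close> forms have total degree at most
  \<open>s\<close>, as \<open>stair\<close> demands.\<close>

lemma stair_up_decompose:
  fixes \<alpha> \<beta> :: "'i \<Rightarrow> nat \<Rightarrow> 'a :: field"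
  assumes "finite I" "card I = Suc s"
    and "\<And>i k j. i \<in> I \<Longrightarrow> k \<in> I \<Longrightarrow> i \<noteq> k \<Longrightarrow> j < s \<Longrightarrow> \<alpha> i j * \<beta> k j \<noteq> \<alpha> k j * \<beta> i j"
    and "f \<in> stair_up x s"
  shows "\<exists>g. (\<forall>i\<in>I. g i \<in> stair x s) \<and> f = (\<lambda>p. \<Sum>i\<in>I. (\<Prod>j<s. \<alpha> i j + \<beta> i j * x j p) * g i p)"
  using assms
proof (induction s arbitrary: I f)
  case 0
  then obtain i where "I = {i}" by (metis One_nat_def card_1_singletonE)
  then show ?case using 0 by (intro exI[of _ "\<lambda>_. f"]) auto
next
  case (Suc s)
  note finI = \<open>finite I\<close>
  obtain f' where f': "f = (\<lambda>p. \<Sum>e\<le>Suc s. x s p ^ e * f' e p)" "\<forall>e\<le>Suc s. f' e \<in> stair_up x s"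
    using Suc.prems(4) unfolding stair_up.simps mem_Collect_eq by blast
  have Ine: "I \<noteq> {}" using Suc.prems(2) by auto
  have "\<forall>e. \<exists>c. e \<le> Suc s \<longrightarrow> (\<forall>z. z ^ e = (\<Sum>k\<in>I. c k * (\<Prod>i\<in>I - {k}. \<alpha> i s + \<beta> i s * z)))"
  proof (intro allI)
    fix e
    have "\<exists>c. \<forall>z. z ^ e = (\<Sum>k\<in>I. c k * (\<Prod>i\<in>I - {k}. \<alpha> i s + \<beta> i s * z))" if "e \<le> Suc s"
    proof -
    have "degree (monom 1 e :: 'a poly) < card I" using that Suc.prems(2) by (simp add: degree_monom_eq)
    then obtain c where c: "(monom 1 e :: 'a poly) = (\<Sum>k\<in>I. smult (c k) (\<Prod>i\<in>I - {k}. [:\<alpha> i s, \<beta> i s:]))"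
      using Lagrange_basis_linear_forms[of I "monom 1 e" "\<lambda>i. \<alpha> i s" "\<lambda>i. \<beta> i s"] finI Ine Suc.prems(3) by auto
    have "z ^ e = (\<Sum>k\<in>I. c k * (\<Prod>i\<in>I - {k}. \<alpha> i s + \<beta> i s * z))" for z
      using arg_cong[OF c, of "\<lambda>P. poly P z"] by (simp add: poly_monom poly_sum poly_prod mult.commute)
    then show ?thesis by blast
    qed
    then show "\<exists>c. e \<le> Suc s \<longrightarrow> (\<forall>z. z ^ e = (\<Sum>k\<in>I. c k * (\<Prod>i\<in>I - {k}. \<alpha> i s + \<beta> i s * z)))" by blast
  qed
  from choice[OF this] obtain c
    where c: "\<And>e z. e \<le> Suc s \<Longrightarrow> z ^ e = (\<Sum>k\<in>I. c e k * (\<Prod>i\<in>I - {k}. \<alpha> i s + \<beta> i s * z))"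
    by blast
  define h where "h = (\<lambda>k p. \<Sum>e\<le>Suc s. c e k * f' e p)"
  have h: "h k \<in> stair_up x s" for k unfolding h_def using f'(2) by (intro stair_up_sum) auto
  have "\<exists>g. (\<forall>i\<in>I - {k}. g i \<in> stair x s) \<and> h k = (\<lambda>p. \<Sum>i\<in>I - {k}. (\<Prod>j<s. \<alpha> i j + \<beta> i j * x j p) * g i p)"
    if "k \<in> I" for k
    using Suc.prems(1-3) h that by (intro Suc.IH) auto
  then have "\<forall>k. \<exists>g. k \<in> I \<longrightarrow> (\<forall>i\<in>I - {k}. g i \<in> stair x s) \<and> h k = (\<lambda>p. \<Sum>i\<in>I - {k}. (\<Prod>j<s. \<alpha> i j + \<beta> i j * x j p) * g i p)"
    by blast
  from choice[OF this] obtain g where g: "\<And>k i. k \<in> I \<Longrightarrow> i \<in> I - {k} \<Longrightarrow> g k i \<in> stair x s"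
    "\<And>k. k \<in> I \<Longrightarrow> h k = (\<lambda>p. \<Sum>i\<in>I - {k}. (\<Prod>j<s. \<alpha> i j + \<beta> i j * x j p) * g k i p)"
    by blast
  define G where "G = (\<lambda>i p. \<Sum>k\<in>I - {i}. (\<Prod>i'\<in>I - {k} - {i}. \<alpha> i' s + \<beta> i' s * x s p) * g k i p)"
  have "f p = (\<Sum>i\<in>I. (\<Prod>j<Suc s. \<alpha> i j + \<beta> i j * x j p) * G i p)" for p
  proof -
    let ?l = "\<lambda>i. \<alpha> i s + \<beta> i s * x s p" and ?t = "\<lambda>i. \<Prod>j<s. \<alpha> i j + \<beta> i j * x j p"
    have "f p = (\<Sum>e\<le>Suc s. \<Sum>k\<in>I. c e k * (\<Prod>i\<in>I - {k}. ?l i) * f' e p)"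
      unfolding f'(1) by (intro sum.cong refl) (simp add: c sum_distrib_right)
    also have "\<dots> = (\<Sum>k\<in>I. (\<Prod>i\<in>I - {k}. ?l i) * h k p)"
      unfolding h_def sum_distrib_left by (subst sum.swap) (simp only: mult_ac)
    also have "\<dots> = (\<Sum>k\<in>I. \<Sum>i\<in>I - {k}. (\<Prod>i\<in>I - {k}. ?l i) * (?t i * g k i p))"
      by (intro sum.cong refl) (simp add: g(2) sum_distrib_left)
    also have "\<dots> = (\<Sum>k\<in>I. \<Sum>i\<in>I - {k}. (?t i * ?l i) * ((\<Prod>i'\<in>I - {k} - {i}. ?l i') * g k i p))"
    proof (intro sum.cong refl)
      fix k i assume "k \<in> I" "i \<in> I - {k}"
      then have "(\<Prod>i\<in>I - {k}. ?l i) = ?l i * (\<Prod>i'\<in>I - {k} - {i}. ?l i')"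
        using finI by (intro prod.remove) auto
      then show "(\<Prod>i\<in>I - {k}. ?l i) * (?t i * g k i p) = (?t i * ?l i) * ((\<Prod>i'\<in>I - {k} - {i}. ?l i') * g k i p)"
        by (simp add: mult_ac)
    qed
    also have "\<dots> = (\<Sum>k\<in>I. \<Sum>i\<in>I. if i \<noteq> k then (?t i * ?l i) * ((\<Prod>i'\<in>I - {k} - {i}. ?l i') * g k i p) else 0)"
      using finI by (intro sum.cong refl sum.mono_neutral_cong_left) auto
    also have "\<dots> = (\<Sum>i\<in>I. \<Sum>k\<in>I. if i \<noteq> k then (?t i * ?l i) * ((\<Prod>i'\<in>I - {k} - {i}. ?l i') * g k i p) else 0)"
      by (rule sum.swap)
    also have "\<dots> = (\<Sum>i\<in>I. \<Sum>k\<in>I - {i}. (?t i * ?l i) * ((\<Prod>i'\<in>I - {k} - {i}. ?l i') * g k i p))"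
      using finI by (intro sum.cong refl sum.mono_neutral_cong_right) auto
    also have "\<dots> = (\<Sum>i\<in>I. (\<Prod>j<Suc s. \<alpha> i j + \<beta> i j * x j p) * G i p)"
      by (simp add: G_def sum_distrib_left)
    finally show ?thesis .
  qed
  moreover have "G i \<in> stair x (Suc s)" if i: "i \<in> I" for i
  proof -
    have "\<exists>d. \<forall>z. (\<Prod>i'\<in>I - {k} - {i}. \<alpha> i' s + \<beta> i' s * z) = (\<Sum>e\<le>s. d e * z ^ e)" if "k \<in> I - {i}" for k
    proof (rule prod_linear_forms_expand)
      have "i \<in> I - {k}" "k \<in> I" using that i by auto
      then have "card (I - {k} - {i}) = card I - 1 - 1" using finI by (simp only: card_Diff_singleton)
      then show "card (I - {k} - {i}) \<le> s" using Suc.prems(2) by simp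
    qed (use finI in auto)
    then have "\<forall>k. \<exists>d. k \<in> I - {i} \<longrightarrow> (\<forall>z. (\<Prod>i'\<in>I - {k} - {i}. \<alpha> i' s + \<beta> i' s * z) = (\<Sum>e\<le>s. d e * z ^ e))"
      by blast
    from choice[OF this] obtain d
      where d: "\<And>k z. k \<in> I - {i} \<Longrightarrow> (\<Prod>i'\<in>I - {k} - {i}. \<alpha> i' s + \<beta> i' s * z) = (\<Sum>e\<le>s. d k e * z ^ e)"
      by blast
    have "G i p = (\<Sum>e\<le>s. x s p ^ e * (\<Sum>k\<in>I - {i}. d k e * g k i p))" for p
    proof -
      have "G i p = (\<Sum>k\<in>I - {i}. \<Sum>e\<le>s. x s p ^ e * (d k e * g k i p))"
        unfolding G_def by (intro sum.cong refl) (simp add: d sum_distrib_left sum_distrib_right mult_ac)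
      also have "\<dots> = (\<Sum>e\<le>s. x s p ^ e * (\<Sum>k\<in>I - {i}. d k e * g k i p))"
        unfolding sum_distrib_left by (rule sum.swap)
      finally show ?thesis .
    qed
    moreover have "(\<lambda>p. \<Sum>k\<in>I - {i}. d k e * g k i p) \<in> stair x s" for e
      using finI g(1) i by (intro stair_sum) auto
    ultimately show ?thesis unfolding stair.simps mem_Collect_eq
      by (intro exI[of _ "\<lambda>e p. \<Sum>k\<in>I - {i}. d k e * g k i p"]) auto
  qed
  ultimately show ?case by (intro exI[of _ G]) auto
qed

text \<open>A theorem of Kollar, Ronyai and Szabo. On the solution set every function of \<open>stair_up\<close>
  agrees with one of \<open>stair\<close>, so that the latter is closed under multiplication by \<open>x 0\<close> and has
  dimension at most \<open>s!\<close>.\<close>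

theorem card_solutions_product_system:
  fixes x :: "nat \<Rightarrow> 'p \<Rightarrow> 'a :: field" and a :: "nat \<Rightarrow> nat \<Rightarrow> 'a"
  assumes s: "s > 0" and dist: "\<And>i k j. i < s \<Longrightarrow> k < s \<Longrightarrow> i \<noteq> k \<Longrightarrow> j < s \<Longrightarrow> a i j \<noteq> a k j"
    and sol: "\<And>p i. p \<in> S \<Longrightarrow> i < s \<Longrightarrow> (\<Prod>j<s. x j p - a i j) = b i"
  shows "card (x 0 ` S) \<le> fact s"
proof -
  \<comment> \<open>The decomposition needs \<open>s + 1\<close> products. The index
    \<open>s\<close> is the node at infinity, whose product is constantly 1.\<close>
  define \<alpha> \<beta> where "\<alpha> = (\<lambda>i j. if i < s then - a i j else 1)" and "\<beta> = (\<lambda>i (j::nat). if i < s then 1 else (0::'a))"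
  define b' where "b' = (\<lambda>i. if i < s then b i else 1)"
  have prod: "(\<Prod>j<s. \<alpha> i j + \<beta> i j * x j p) = b' i" if "p \<in> S" for i p
  proof (cases "i < s")
    case True
    then have "(\<Prod>j<s. \<alpha> i j + \<beta> i j * x j p) = (\<Prod>j<s. x j p - a i j)" by (simp add: \<alpha>_def \<beta>_def)
    then show ?thesis using sol[OF that True] True by (simp add: b'_def)
  qed (simp add: \<alpha>_def \<beta>_def b'_def)
  have reduce: "\<exists>g\<in>stair x s. \<forall>p\<in>S. f p = g p" if f: "f \<in> stair_up x s" for f
  proof -
    have "\<alpha> i j * \<beta> k j \<noteq> \<alpha> k j * \<beta> i j" if "i \<in> {..s}" "k \<in> {..s}" "i \<noteq> k" "j < s" for i k j
      using dist[of i k j] that by (auto simp: \<alpha>_def \<beta>_def)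
    then obtain g where g: "\<forall>i\<in>{..s}. g i \<in> stair x s" "f = (\<lambda>p. \<Sum>i\<in>{..s}. (\<Prod>j<s. \<alpha> i j + \<beta> i j * x j p) * g i p)"
      using stair_up_decompose[of "{..s}" s \<alpha> \<beta> f x] f by auto
    have "(\<lambda>p. \<Sum>i\<in>{..s}. b' i * g i p) \<in> stair x s" using g(1) by (intro stair_sum) auto
    moreover have "\<forall>p\<in>S. f p = (\<Sum>i\<in>{..s}. b' i * g i p)" unfolding g(2) using prod by simp
    ultimately show ?thesis by (intro bexI[of _ "\<lambda>p. \<Sum>i\<in>{..s}. b' i * g i p"]) auto
  qed
  obtain s' where s': "s = Suc s'" using s not0_implies_Suc by blast
  have pow: "\<exists>g\<in>stair x s. \<forall>p\<in>S. x 0 p ^ k = g p" for k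
  proof (induction k)
    case 0
    have one: "(\<lambda>p. 1) \<in> stair_up x s"
    proof (induction s)
      case (Suc s)
      have "(\<lambda>p. 1) = (\<lambda>p. \<Sum>e\<le>Suc s. x s p ^ e * (if e = 0 then 1 else 0))"
        by (simp add: sum.delta' if_distrib cong: if_cong)
      moreover have "(\<lambda>p. if e = 0 then 1 else 0) \<in> stair_up x s" for e :: nat
        using Suc stair_up_linear(1) by (cases "e = 0") auto
      ultimately show ?case unfolding stair_up.simps mem_Collect_eq
        by (intro exI[of _ "\<lambda>e p. if e = 0 then 1 else 0"]) auto
    qed auto
    then show ?case using reduce[OF one] by simp
  next
    case (Suc k)
    then obtain g where g: "g \<in> stair x s" "\<forall>p\<in>S. x 0 p ^ k = g p" by blast
    then obtain g' where "g' \<in> stair x s" "\<forall>p\<in>S. x 0 p * g p = g' p"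
      using reduce[of "\<lambda>p. x 0 p * g p"] stair_times_x0[of g x s'] s' by blast
    then show ?case using g by (intro bexI[of _ g']) auto
  qed
  obtain B where B: "finite B" "card B \<le> fact s" "\<And>f. f \<in> stair x s \<Longrightarrow> \<exists>c. f = (\<lambda>p. \<Sum>m\<in>B. c m * m p)"
    using stair_spanned[of s x] by blast
  have "\<forall>k. \<exists>c. \<forall>p\<in>S. x 0 p ^ k = (\<Sum>m\<in>B. c m * m p)"
  proof
    fix k
    obtain g where g: "g \<in> stair x s" "\<forall>p\<in>S. x 0 p ^ k = g p" using pow by blast
    obtain c where "g = (\<lambda>p. \<Sum>m\<in>B. c m * m p)" using B(3)[OF g(1)] by blast
    then show "\<exists>c. \<forall>p\<in>S. x 0 p ^ k = (\<Sum>m\<in>B. c m * m p)" using g(2) by auto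
  qed
  from choice[OF this] obtain c where c: "\<And>k p. p \<in> S \<Longrightarrow> x 0 p ^ k = (\<Sum>m\<in>B. c k m * m p)" by blast
  \<comment> \<open>There are \<open>card B + 1\<close> powers of \<open>x 0\<close> in the span of
    \<open>B\<close>, so they satisfy a linear relation on \<open>S\<close>. It is a polynomial
    equation of degree at most \<open>s!\<close> for the values of \<open>x 0\<close>.\<close>
  obtain w where w: "\<exists>k\<in>{..card B}. w k \<noteq> 0" "\<forall>m\<in>B. (\<Sum>k\<in>{..card B}. w k * c k m) = 0"
    using homogeneous_system_solution[of B "{..card B}" c] B(1) by auto
  define P where "P = (\<Sum>k\<le>card B. monom (w k) k)"
  have "coeff P k = w k" if "k \<le> card B" for k
    using that by (simp add: P_def coeff_sum sum.delta)
  then have P0: "P \<noteq> 0" using w(1) by force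
  have degP: "degree P \<le> card B"
    unfolding P_def by (intro degree_sum_le) (auto intro: order_trans[OF degree_monom_le])
  have "x 0 ` S \<subseteq> {z. poly P z = 0}"
  proof (intro subsetI, elim imageE, simp only: mem_Collect_eq)
    fix p assume p: "p \<in> S"
    have "poly P (x 0 p) = (\<Sum>k\<le>card B. \<Sum>m\<in>B. w k * c k m * m p)"
      unfolding P_def poly_sum by (simp add: poly_monom c[OF p] sum_distrib_left mult.assoc)
    also have "\<dots> = (\<Sum>m\<in>B. (\<Sum>k\<le>card B. w k * c k m) * m p)"
      unfolding sum_distrib_right by (rule sum.swap)
    finally show "poly P (x 0 p) = 0" using w(2) by simp
  qed
  then have "card (x 0 ` S) \<le> card {z. poly P z = 0}" using poly_roots_finite[OF P0] by (rule card_mono[rotated])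
  also have "\<dots> \<le> degree P" by (rule card_poly_roots_bound[OF P0])
  finally show ?thesis using degP B(2) by linarith
qed

section \<open>Norm graphs\<close>

lemma sum_powers_times_pred: "(\<Sum>j<s. r ^ j) * (r - 1) = r ^ s - (1::nat)" if "r \<ge> 1"
proof (induction s)
  case (Suc s)
  have "(\<Sum>j<Suc s. r ^ j) * (r - 1) = (r ^ s - 1) + r ^ s * (r - 1)" using Suc by (simp add: distrib_right)
  also have "\<dots> = r ^ Suc s - 1"
    using that by (simp add: right_diff_distrib' mult.commute)
  finally show ?case .
qed simp

locale norm_graph = finite_subfield_char2 p e q ty for p e q :: nat and ty :: "'a :: alg_closed_field itself" +
  fixes k s r :: nat
  assumes k: "k > 0" and s: "s > 0" and r: "r = 2 ^ k" and q_r: "q = r ^ s"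
begin

sublocale S: finite_subfield_char2 p k r ty
  using char p p2 k r by unfold_locales auto

text \<open>The exponent of the norm map from \<open>F\<close> to \<open>S.F\<close>:
  \<open>x ^ D\<close> is the product of the conjugates \<open>x ^ r ^ j\<close>.\<close>

definition D :: nat where "D = (\<Sum>j<s. r ^ j)"

definition V :: "('a \<times> 'a) set" where "V = F \<times> (S.F - {0})"

text \<open>The projective norm graph of Alon, Ronyai and Szabo, in characteristic 2.\<close>

definition E :: "'a \<times> 'a \<Rightarrow> 'a \<times> 'a \<Rightarrow> bool" where
  "E u v \<longleftrightarrow> (fst u + fst v) ^ D = snd u * snd v"

lemma r_gt_1: "r > 1" using S.q_gt_1 .

lemma D_eq: "D * (r - 1) = q - 1"
  unfolding D_def q_r using r_gt_1 by (intro sum_powers_times_pred) simp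

text \<open>Makes \<open>y ^ D - c\<close> separable in characteristic 2 for
  \<open>c \<noteq> 0\<close>.\<close>

lemma odd_D: "odd D"
proof -
  obtain s' where s': "s = Suc s'" using s not0_implies_Suc by blast
  have "D = 1 + r * (\<Sum>j<s'. r ^ j)"
    unfolding D_def by (simp only: s' sum.lessThan_Suc_shift) (simp add: sum_distrib_left)
  moreover have "even r" using k by (simp add: r)
  ultimately show ?thesis by simp
qed

lemma D_pos: "D > 0" using odd_D by (rule odd_pos)

lemma norm_eq_prod: "(x :: 'a) ^ D = (\<Prod>j<s. x ^ r ^ j)"
  by (simp add: D_def power_sum)

lemma norm_in_S:
  assumes "x \<in> F" "x \<noteq> 0"
  shows "x ^ D \<in> S.F - {0}"
proof -
  have "(x ^ D) ^ (r - 1) = x ^ (q - 1)" by (simp only: flip: power_mult D_eq)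
  then have "(x ^ D) ^ (r - 1) = 1" using F_power_q_1[OF assms] by simp
  then have "(x ^ D) ^ r = x ^ D"
    using power_minus_mult[of r "x ^ D"] r_gt_1 by simp
  then show ?thesis using assms by (simp add: Fq_def)
qed

lemma finite_V: "finite V" and card_V: "card V = q * (r - 1)"
  by (simp_all add: V_def card_cartesian_product card_F S.card_F card_Diff_singleton)

lemma V_ne: "V \<noteq> {}"
proof -
  have "(0, 1) \<in> V" by (simp add: V_def)
  then show ?thesis by blast
qed

lemma symp_E: "symp E"
  by (auto simp: symp_def E_def add.commute mult.commute)

text \<open>All \<open>D\<close> roots exist in the algebraic closure and are simple; they lie in
  \<open>F\<close> because \<open>D * (r - 1) = q - 1\<close>.\<close>

lemma card_norm_fibre:
  assumes c: "c \<in> S.F" "c \<noteq> 0"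
  shows "card {y \<in> F. y ^ D = c} = D"
proof -
  let ?P = "monom 1 D + [:- c:] :: 'a poly"
  have deg: "degree ?P = D"
    using D_pos by (subst degree_add_eq_left) (auto simp: degree_monom_eq)
  have P0: "?P \<noteq> 0" using deg D_pos by auto
  have roots: "{y. poly ?P y = 0} = {y. y ^ D = c}" by (auto simp: poly_monom)
  have "(of_nat D :: 'a) \<noteq> 0"
    using odd_D char p2 by (simp add: of_nat_eq_0_iff_char_dvd)
  moreover have "pderiv ?P = monom (of_nat D) (D - 1)"
    by (simp only: pderiv_add pderiv_monom) (simp add: pderiv_pCons)
  moreover have "x \<noteq> 0" if "poly ?P x = 0" for x
    using that c(2) D_pos by (auto simp: poly_monom power_0_left)
  ultimately have "poly (pderiv ?P) x \<noteq> 0" if "poly ?P x = 0" for x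
    using that by (simp add: poly_monom)
  then have "card {y. poly ?P y = 0} = D"
    using card_roots_separable[OF P0] deg by metis
  moreover have "y \<in> F" if "y ^ D = c" for y
  proof -
    have "y ^ (q - 1) = c ^ (r - 1)" unfolding that[symmetric] by (simp only: D_eq flip: power_mult)
    also have "\<dots> = 1" using S.F_power_q_1[OF c] .
    finally have "y ^ q = y" using power_minus_mult[of q y] q_gt_1 by simp
    then show ?thesis by (simp add: Fq_def)
  qed
  then have "{y \<in> F. y ^ D = c} = {y. y ^ D = c}" by auto
  ultimately show ?thesis unfolding roots by simp
qed

text \<open>For \<open>A \<noteq> B\<close> a common neighbour is determined by its first coordinate
  \<open>C\<close>, and the condition is that \<open>(C + A) / (C + B)\<close> has norm
  \<open>a / b\<close>. This Moebius map is a bijection onto the norm fibre without the value 1,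
  which would belong to \<open>C\<close> at infinity; 1 lies in the fibre exactly when
  \<open>a = b\<close>.\<close>

lemma codegree:
  assumes v: "(A, a) \<in> V" and w: "(B, b) \<in> V"
  shows "card {u \<in> V. E u (A, a) \<and> E u (B, b)} =
    (if A = B then if a = b then q - 1 else 0 else D - of_bool (a = b))"
proof -
  have AB: "A \<in> F" "B \<in> F" "a \<in> S.F" "b \<in> S.F" "a \<noteq> 0" "b \<noteq> 0" using v w by (auto simp: V_def)
  define T where "T = {C \<in> F. C \<noteq> A \<and> C \<noteq> B \<and> (C + A) ^ D / a = (C + B) ^ D / b}"
  have "{u \<in> V. E u (A, a) \<and> E u (B, b)} = (\<lambda>C. (C, (C + A) ^ D / a)) ` T"
  proof (intro Set.set_eqI iffI)
    fix u assume "u \<in> {u \<in> V. E u (A, a) \<and> E u (B, b)}"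
    moreover obtain C c where "u = (C, c)" by fastforce
    ultimately have u: "u = (C, c)" "C \<in> F" "c \<noteq> 0" "(C + A) ^ D = c * a" "(C + B) ^ D = c * b"
      by (auto simp: V_def E_def)
    have "C \<noteq> A" "C \<noteq> B" using u AB D_pos by (auto simp: power_0_left)
    moreover have "(C + A) ^ D / a = c" "(C + B) ^ D / b = c" using u AB by auto
    ultimately show "u \<in> (\<lambda>C. (C, (C + A) ^ D / a)) ` T" using u(1,2) by (auto simp: T_def)
  next
    fix u assume "u \<in> (\<lambda>C. (C, (C + A) ^ D / a)) ` T"
    then obtain C where C: "u = (C, (C + A) ^ D / a)" "C \<in> F" "C \<noteq> A" "C \<noteq> B"
      "(C + A) ^ D / a = (C + B) ^ D / b" by (auto simp: T_def)
    have "(C + A) ^ D \<in> S.F - {0}" using C AB by (intro norm_in_S) auto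
    then have "(C + A) ^ D / a \<in> S.F - {0}" using AB(3,5) by simp
    then have "(C, (C + A) ^ D / a) \<in> V" using C(2) by (simp add: V_def)
    moreover have "E u (A, a)" using C(1) AB by (simp add: E_def)
    moreover have "E u (B, b)" unfolding C(1) C(5) using AB by (simp add: E_def)
    ultimately show "u \<in> {u \<in> V. E u (A, a) \<and> E u (B, b)}" using C(1) by simp
  qed
  then have card: "card {u \<in> V. E u (A, a) \<and> E u (B, b)} = card T"
    by (simp add: card_image inj_on_def)
  show ?thesis
  proof (cases "A = B")
    case True
    show ?thesis
    proof (cases "a = b")
      case ab: True
      then have "T = F - {A}" using True by (auto simp: T_def)
      then show ?thesis using True ab AB card by (simp add: card_Diff_singleton card_F)
    next
      case False
      have "C + A \<noteq> 0" if "C \<noteq> A" for C using that by simp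
      then have "T = {}" using True False AB by (auto simp: T_def field_simps)
      then show ?thesis using True False card by simp
    qed
  next
    case False
    define Y where "Y = {y \<in> F. y ^ D = a / b}"
    have ab: "a / b \<in> S.F" "a / b \<noteq> 0" using AB by auto
    have cY: "card Y = D" unfolding Y_def by (rule card_norm_fibre[OF ab])
    have finY: "finite Y" by (simp add: Y_def)
    have "bij_betw (\<lambda>C. (C + A) / (C + B)) T (Y - {1})"
    proof (rule bij_betw_byWitness[where f' = "\<lambda>y. (A + y * B) / (1 + y)"])
      show "\<forall>C\<in>T. (A + (C + A) / (C + B) * B) / (1 + (C + A) / (C + B)) = C"
      proof
        fix C assume "C \<in> T"
        then have nz: "C + B \<noteq> 0" by (auto simp: T_def)
        have 1: "1 + (C + A) / (C + B) = (A + B) / (C + B)"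
          using nz by (simp add: field_simps)
        have 2: "A + (C + A) / (C + B) * B = C * (A + B) / (C + B)"
          using nz by (simp add: field_simps)
        show "(A + (C + A) / (C + B) * B) / (1 + (C + A) / (C + B)) = C"
          unfolding 1 2 using nz False by simp
      qed
      have inv: "(A + y * B) / (1 + y) + A = y * (A + B) / (1 + y)" "(A + y * B) / (1 + y) + B = (A + B) / (1 + y)"
        if "y \<noteq> 1" for y
      proof -
        have nz: "1 + y \<noteq> 0" using that by auto
        show "(A + y * B) / (1 + y) + A = y * (A + B) / (1 + y)"
          using nz by (simp add: field_simps)
        show "(A + y * B) / (1 + y) + B = (A + B) / (1 + y)"
          using nz by (simp add: field_simps)
      qed
      show "\<forall>y\<in>Y - {1}. ((A + y * B) / (1 + y) + A) / ((A + y * B) / (1 + y) + B) = y"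
      proof
        fix y assume y: "y \<in> Y - {1}"
        then have nz: "1 + y \<noteq> 0" "y \<noteq> 1" by auto
        show "((A + y * B) / (1 + y) + A) / ((A + y * B) / (1 + y) + B) = y"
          unfolding inv[OF nz(2)] using nz False by simp
      qed
      show "(\<lambda>C. (C + A) / (C + B)) ` T \<subseteq> Y - {1}"
      proof (intro image_subsetI)
        fix C assume C: "C \<in> T"
        then have nz: "C + A \<noteq> 0" "C + B \<noteq> 0" "C \<in> F" by (auto simp: T_def)
        have "((C + A) / (C + B)) ^ D = a / b" using C nz AB by (simp add: T_def power_divide field_simps)
        moreover have "(C + A) / (C + B) \<noteq> 1" using nz False by simp
        ultimately show "(C + A) / (C + B) \<in> Y - {1}" using nz AB by (simp add: Y_def)
      qed
      show "(\<lambda>y. (A + y * B) / (1 + y)) ` (Y - {1}) \<subseteq> T"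
      proof (intro image_subsetI)
        fix y assume y: "y \<in> Y - {1}"
        then have nz: "1 + y \<noteq> 0" "y \<noteq> 1" "y \<in> F" "y ^ D = a / b" by (auto simp: Y_def)
        then have y0: "y \<noteq> 0" using ab D_pos by (auto simp: power_0_left)
        let ?C = "(A + y * B) / (1 + y)"
        have "?C + A \<noteq> 0" "?C + B \<noteq> 0" unfolding inv[OF nz(2)] using nz y0 False by simp_all
        then have "?C \<noteq> A" "?C \<noteq> B" by auto
        moreover have "(?C + A) ^ D / a = (?C + B) ^ D / b"
          unfolding inv[OF nz(2)] using nz AB by (simp add: power_divide power_mult_distrib)
        ultimately show "?C \<in> T" using nz AB by (simp add: T_def)
      qed
    qed
    then have "card T = card (Y - {1})" by (rule bij_betw_same_card)
    also have "\<dots> = D - of_bool (a = b)"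
    proof (cases "a = b")
      case True
      then have "1 \<in> Y" using AB by (simp add: Y_def)
      then show ?thesis using True cY finY by (simp add: card_Diff_singleton)
    next
      case ne: False
      then have "1 \<notin> Y" using AB by (auto simp: Y_def)
      then show ?thesis using ne cY by simp
    qed
    finally show ?thesis using False card by simp
  qed
qed

lemma degree_E: "u \<in> V \<Longrightarrow> card {v \<in> V. E u v} = q - 1"
proof -
  assume u: "u \<in> V"
  obtain A a where Aa: "u = (A, a)" by fastforce
  have "{v \<in> V. E u v} = {v \<in> V. E v (A, a) \<and> E v (A, a)}" using symp_E Aa by (metis sympD)
  then show ?thesis using codegree[of A a A a] u Aa by simp
qed

lemma no_loops: "u \<in> V \<Longrightarrow> \<not> E u u"
  using D_pos by (auto simp: E_def V_def power_0_left)

text \<open>By \<open>codegree\<close> the square of the adjacency matrix is \<open>q\<close> times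
  the identity, plus \<open>D\<close> times the all-ones kernel, minus two multiples of same-class
  kernels (for \<open>fst\<close> and \<open>snd\<close>). On functions of sum zero it is therefore
  at most \<open>q\<close>.\<close>

lemma form_bound:
  "\<bar>bform V (\<lambda>u v. of_bool (E u v)) x x - real (q - 1) / card V * (\<Sum>u\<in>V. x u)\<^sup>2\<bar> \<le> sqrt q * (\<Sum>u\<in>V. (x u)\<^sup>2)"
proof (rule bform_regular[OF finite_V V_ne])
  show "sym_on2 V (\<lambda>u v. of_bool (E u v))" using symp_E by (auto simp: sym_on2_def symp_def)
  show "(\<Sum>v\<in>V. of_bool (E u v)) = real (q - 1)" if "u \<in> V" for u
    using degree_E[OF that] sum_of_bool_card[OF finite_V] by simp
  show "sqrt q > 0" using q_gt_1 by simp
  fix z :: "'a \<times> 'a \<Rightarrow> real" assume z: "(\<Sum>u\<in>V. z u) = 0"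
  have "(\<Sum>u\<in>V. of_bool (E u v) * of_bool (E u w)) =
      ((if v = w then real q else 0) + (real D - real D * of_bool (fst v = fst w))) - of_bool (snd v = snd w)"
    if "v \<in> V" "w \<in> V" for v w
  proof -
    obtain A a B b where vw: "v = (A, a)" "w = (B, b)" by fastforce
    have "(\<Sum>u\<in>V. of_bool (E u v) * of_bool (E u w)) = real (card {u \<in> V. E u v \<and> E u w})"
      using sum_of_bool_card[OF finite_V] by (simp flip: of_bool_conj)
    then show ?thesis
      using codegree[of A a B b] that D_pos q_gt_1 unfolding vw by (auto simp: of_nat_diff)
  qed
  then have "(\<Sum>u\<in>V. (\<Sum>v\<in>V. of_bool (E u v) * z v)\<^sup>2) =
    bform V (\<lambda>v w. ((if v = w then real q else 0) + (real D - real D * of_bool (fst v = fst w))) - of_bool (snd v = snd w)) z z"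
    unfolding sum_sq_adjacency by (intro bform_cong) auto
  also have "\<dots> = q * (\<Sum>u\<in>V. (z u)\<^sup>2) - D * bform V (\<lambda>v w. of_bool (fst v = fst w)) z z
      - bform V (\<lambda>v w. of_bool (snd v = snd w)) z z"
    using finite_V z by (simp add: bform_add_kernel bform_diff_kernel bform_scale_kernel bform_delta
        bform_const power2_eq_square)
  also have "\<dots> \<le> q * (\<Sum>u\<in>V. (z u)\<^sup>2)"
  proof -
    have "real D * bform V (\<lambda>v w. of_bool (fst v = fst w)) z z \<ge> 0"
      using bform_same_class_nonneg[OF finite_V, of fst z] by (intro mult_nonneg_nonneg) auto
    then show ?thesis using bform_same_class_nonneg[OF finite_V, of snd z] by linarith
  qed
  finally show "(\<Sum>u\<in>V. (\<Sum>v\<in>V. of_bool (E u v) * z v)\<^sup>2) \<le> (sqrt q)\<^sup>2 * (\<Sum>u\<in>V. (z u)\<^sup>2)" by simp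
qed

text \<open>Dividing the equation of \<open>f i\<close> by that of \<open>f s\<close> and inverting
  turns \<open>Suc s\<close> adjacencies into \<open>s\<close> equations that prescribe the norm of
  \<open>1 / (fst u + A s) + c i\<close>. The conjugates \<open>x j\<close> of the unknown are
  treated as independent variables in \<open>card_solutions_product_system\<close>.\<close>

lemma not_embeds_biclique: "\<not> embeds (complete_bipartite_graph (Suc s) (fact s + 1)) V E"
proof
  assume emb: "embeds (complete_bipartite_graph (Suc s) (fact s + 1)) V E"
  obtain f g where fg: "inj_on f {0..<Suc s}" "f ` {0..<Suc s} \<subseteq> V"
    "inj_on g {0..<fact s + (1::nat)}" "g ` {0..<fact s + (1::nat)} \<subseteq> V"
    "\<And>i j. i < Suc s \<Longrightarrow> j < fact s + 1 \<Longrightarrow> E (g j) (f i)"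
  using embeds_complete_bipartiteD[OF emb] by blast
  define A a where "A = (\<lambda>i. fst (f i))" and "a = (\<lambda>i. snd (f i))"
  have AV: "A i \<in> F" "a i \<in> S.F" "a i \<noteq> 0" if "i \<le> s" for i
    using fg(2) that by (auto simp: A_def a_def V_def image_subset_iff mem_Times_iff)
  define U where "U = g ` {0..<fact s + 1}"
  have U: "fst u \<in> F" "snd u \<noteq> 0" if "u \<in> U" for u
    using fg(4) that by (auto simp: U_def V_def image_subset_iff mem_Times_iff)
  have adj: "(fst u + A i) ^ D = snd u * a i" if "u \<in> U" "i \<le> s" for u i
    using fg(5)[of i] that by (auto simp: U_def E_def A_def a_def)
  have cU: "card U = fact s + 1" using fg(3) by (simp add: U_def card_image)
  then obtain u0 where u0: "u0 \<in> U" by (metis card.empty ex_in_conv add_is_0 one_neq_zero)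
  have Ainj: "A i \<noteq> A j" if "i \<le> s" "j \<le> s" "i \<noteq> j" for i j
  proof
    assume eq: "A i = A j"
    then have "snd u0 * a i = snd u0 * a j" using adj[OF u0 that(1)] adj[OF u0 that(2)] by (simp only:)
    then have "f i = f j" using eq U(2)[OF u0] by (simp add: prod_eq_iff A_def a_def)
    then show False using fg(1) that by (auto simp: inj_on_def)
  qed
  have nz: "fst u + A i \<noteq> 0" if "u \<in> U" "i \<le> s" for u i
    using adj[OF that] U(2)[OF that(1)] AV(3)[OF that(2)] D_pos by (auto simp: power_0_left)
  define x :: "nat \<Rightarrow> 'a \<times> 'a \<Rightarrow> 'a" where "x = (\<lambda>j u. (1 / (fst u + A s)) ^ r ^ j)"
  define c where "c = (\<lambda>i. 1 / (A i + A s))"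
  have cF: "c i \<noteq> c j" if "i < s" "j < s" "i \<noteq> j" for i j
    using Ainj[of i j] Ainj[of i s] Ainj[of j s] that by (simp add: c_def)
  have "card (x 0 ` U) \<le> fact s"
  proof (rule card_solutions_product_system[OF s])
    fix i i' j assume "i < s" "i' < s" "i \<noteq> i'" "j < s"
    then show "c i ^ r ^ j \<noteq> c i' ^ r ^ j"
      using cF[of i i'] Frob_eq_iff[of "c i" "k * j" "c i'"] p2 by (simp add: r power_mult)
  next
    fix u i assume u: "u \<in> U" and i: "i < s"
    have "(\<Prod>j<s. x j u - c i ^ r ^ j) = (\<Prod>j<s. (1 / (fst u + A s) + c i) ^ r ^ j)"
    proof (intro prod.cong refl)
      fix j
      show "x j u - c i ^ r ^ j = (1 / (fst u + A s) + c i) ^ r ^ j"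
        using Frob_add[of "1 / (fst u + A s)" "c i" "k * j"] p2 by (simp add: x_def r power_mult)
    qed
    also have "\<dots> = (1 / (fst u + A s) + c i) ^ D" by (rule norm_eq_prod[symmetric])
    also have "1 / (fst u + A s) + c i = (fst u + A i) / ((fst u + A s) * (A i + A s))"
    proof -
      have "A i + A s \<noteq> 0" "fst u + A s \<noteq> 0" using Ainj[of i s] nz[OF u, of s] i by auto
      then have "1 / (fst u + A s) + c i = ((A i + A s) + (fst u + A s)) / ((fst u + A s) * (A i + A s))"
        unfolding c_def by (subst add_frac_eq) auto
      also have "(A i + A s) + (fst u + A s) = (fst u + A i) + (A s + A s)" by (simp only: add_ac)
      finally show ?thesis by (simp only: add_self add_0_right)
    qed
    also have "\<dots> ^ D = a i / (a s * (A i + A s) ^ D)"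
      using adj[OF u, of i] adj[OF u, of s] i U(2)[OF u] by (simp add: power_divide power_mult_distrib)
    finally show "(\<Prod>j<s. x j u - c i ^ r ^ j) = a i / (a s * (A i + A s) ^ D)" .
  qed
  moreover have "inj_on (x 0) U"
  proof (rule inj_onI)
    fix u u' assume u: "u \<in> U" "u' \<in> U" and eq: "x 0 u = x 0 u'"
    have f: "fst u = fst u'" using eq by (simp add: x_def)
    then have "snd u * a s = snd u' * a s" using adj[OF u(1) order_refl] adj[OF u(2) order_refl] by (simp only:)
    then show "u = u'" using f AV(3)[of s] by (simp add: prod_eq_iff)
  qed
  ultimately show False using cU by (simp add: card_image)
qed

text \<open>A random induced subgraph on \<open>n\<close> vertices would lose a logarithmic factor in the smallest
  eigenvalue; \<open>sparse_principal_submatrix\<close> provides one that does not.\<close>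

lemma lambda_free_norm_graph:
  assumes n: "n > 0" "16 * n \<le> card V" "real r \<le> real n"
  shows "lambda_free n (complete_bipartite_graph (Suc s) (fact s + 1)) \<ge> sqrt (real n / real r) / 18"
proof -
  define N where "N = real (card V)"
  define d where "d = real (q - 1)"
  define l where "l = sqrt q + 1"
  have r1: "real r \<ge> 2" using r_gt_1 by simp
  have N: "N = real q * (real r - 1)" using r_gt_1 by (simp add: N_def card_V of_nat_diff)
  have d: "d = real q - 1" using q_gt_1 by (simp add: d_def of_nat_diff)
  have q1: "real q > 1" using q_gt_1 by simp
  have rq: "real r \<le> real q"
  proof -
    have "r ^ 1 \<le> r ^ s" using r_gt_1 s by (intro power_increasing) auto
    then show ?thesis by (simp add: q_r)
  qed
  have N0: "N > 0" using N r1 q1 by simp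
  have dN: "d / N \<ge> 1 / r" "d / N \<le> 1"
  proof -
    have "N \<le> d * r" unfolding N d using rq by (simp add: algebra_simps)
    then show "d / N \<ge> 1 / r" using N0 r1 by (simp add: field_simps)
    have "real q * 1 \<le> real q * (real r - 1)" using r1 q1 by (intro mult_left_mono) auto
    then show "d / N \<le> 1" using N0 unfolding N d by (simp add: divide_le_eq)
  qed
  have l: "l > 0" by (simp add: l_def add_nonneg_pos)
  define A where "A = (\<lambda>u v. of_bool (E u v) :: real)"
  define M where "M = (\<lambda>u v. (d / N - A u v) - (if u = v then d / N else 0))"
  have formM: "bform W M x x = d / N * (\<Sum>u\<in>W. x u)\<^sup>2 - bform W A x x - d / N * (\<Sum>u\<in>W. (x u)\<^sup>2)"
    if "finite W" for W x
    unfolding M_def bform_diff_kernel using that by (simp add: bform_delta bform_const power2_eq_square)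
  have "\<exists>W\<subseteq>V. card W = n \<and> (\<forall>x. bform W M x x \<le> 6 * sqrt (n / card V) * l * (\<Sum>u\<in>W. (x u)\<^sup>2))"
  proof (rule sparse_principal_submatrix[OF finite_V n(1,2) l])
    show "sym_on2 V M" using symp_E by (auto simp: sym_on2_def M_def A_def symp_def)
    show "M u u = 0" if "u \<in> V" for u using no_loops[OF that] by (simp add: M_def A_def)
    fix x :: "'a \<times> 'a \<Rightarrow> real"
    define X2 where "X2 = (\<Sum>u\<in>V. (x u)\<^sup>2)"
    have "X2 \<ge> 0" unfolding X2_def by (intro sum_nonneg) simp
    then have "d / N * X2 \<le> 1 * X2" "d / N * X2 \<ge> 0" using dN N0 r1
      by (intro mult_right_mono, auto simp: d_def)
    moreover have "\<bar>bform V A x x - d / N * (\<Sum>u\<in>V. x u)\<^sup>2\<bar> \<le> sqrt q * X2"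
      using form_bound[of x] unfolding A_def d_def N_def X2_def .
    ultimately show "\<bar>bform V M x x\<bar> \<le> l * (\<Sum>u\<in>V. (x u)\<^sup>2)"
      unfolding formM[OF finite_V] X2_def[symmetric] l_def distrib_right by linarith
  qed
  then obtain W where W: "W \<subseteq> V" "card W = n" "\<And>x. bform W M x x \<le> 6 * sqrt (n / N) * l * (\<Sum>u\<in>W. (x u)\<^sup>2)"
    unfolding N_def by blast
  have finW: "finite W" using W(1) finite_V finite_subset by blast
  \<comment> \<open>The 1 pays for the removed diagonal, as \<open>d / N \<le> 1\<close>.\<close>
  define m where "m = 6 * sqrt (n / N) * l + 1"
  have m0: "m > 0" using l N0 by (simp add: m_def add_nonneg_pos)
  have lower: "bform W A x x \<ge> d / N * (\<Sum>u\<in>W. x u)\<^sup>2 - m * (\<Sum>u\<in>W. (x u)\<^sup>2)" for x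
  proof -
    define X2 where "X2 = (\<Sum>u\<in>W. (x u)\<^sup>2)"
    have "X2 \<ge> 0" unfolding X2_def by (intro sum_nonneg) simp
    then have "d / N * X2 \<le> 1 * X2" using dN by (intro mult_right_mono) auto
    then show ?thesis
      using W(3)[of x] unfolding formM[OF finW] X2_def[symmetric] m_def distrib_right by linarith
  qed
  have "lambda_free n (complete_bipartite_graph (Suc s) (fact s + 1)) \<ge> 1 + (\<Sum>u\<in>W. \<Sum>v\<in>W. A u v) / (m * card W)"
  proof (rule lambda_free_ge[OF finW _ _ symp_E])
    show "W \<noteq> {}" using W(2) n(1) by auto
    show "card W \<le> n" using W(2) by simp
    show "\<not> embeds (complete_bipartite_graph (Suc s) (fact s + 1)) W E"
      using not_embeds_biclique W(1) unfolding embeds_def by blast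
    show "\<exists>b. (a, b) \<in> parcs (complete_bipartite_graph (Suc s) (fact s + 1))"
      if "a \<in> pverts (complete_bipartite_graph (Suc s) (fact s + 1))" for a
      using that by (intro complete_bipartite_graph_arcs) auto
    show "sym_on2 W A" using symp_E by (auto simp: sym_on2_def A_def symp_def)
    show "u \<noteq> v \<and> E u v" if "u \<in> W" "v \<in> W" "A u v \<noteq> 0" for u v
      using that no_loops[of u] W(1) by (auto simp: A_def)
    show "m > 0" by (rule m0)
    fix x :: "'a \<times> 'a \<Rightarrow> real"
    have "d / N * (\<Sum>u\<in>W. x u)\<^sup>2 \<ge> 0" using N0 by (simp add: d_def)
    then show "bform W A x x \<ge> - m * (\<Sum>u\<in>W. (x u)\<^sup>2)"
      using lower[of x] unfolding mult_minus_left by linarith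
  qed
  moreover have "(\<Sum>u\<in>W. \<Sum>v\<in>W. A u v) \<ge> d / N * (real n)\<^sup>2 - m * real n"
    using lower[of "\<lambda>_. 1"] W(2) by (simp add: bform_def)
  then have "(\<Sum>u\<in>W. \<Sum>v\<in>W. A u v) / (m * card W) \<ge> (d / N * (real n)\<^sup>2 - m * real n) / (m * card W)"
    using m0 by (intro divide_right_mono) auto
  moreover have "(d / N * (real n)\<^sup>2 - m * real n) / (m * card W) = d / N * real n / m - 1"
    using W(2) n(1) m0 by (simp add: diff_divide_distrib power2_eq_square)
  moreover have "d / N * real n / m \<ge> sqrt (real n / real r) / 18"
  proof -
    define y where "y = sqrt (real n / real r)"
    have y: "y \<ge> 1" "y * y = real n / real r" using n(3) r1 by (simp_all add: y_def)
    \<comment> \<open>The fraction \<open>17 / 12\<close> is slightly above the square root of 2.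
      With \<open>l \<le> 2 * sqrt q\<close> it leads to
      \<open>m \<le> 17 * y + 1 \<le> 18 * y\<close>.\<close>
    have "sqrt (n / N) * sqrt q \<le> 17 / 12 * y"
    proof -
      have "n / N * q = n / (real r - 1)" using q1 by (simp add: N)
      also have "\<dots> \<le> 2 * (n / r)"
        using r1 mult_left_mono[of 2 "real r" "real n"] by (simp add: field_simps)
      also have "\<dots> \<le> (17 / 12 * y)\<^sup>2"
      proof -
        have "(17 / 12 * y)\<^sup>2 = 289 / 144 * (n / r)" unfolding y(2)[symmetric] by (simp add: power2_eq_square)
        moreover have "n / r \<ge> 0" by simp
        ultimately show ?thesis by linarith
      qed
      finally have "sqrt (n / N * q) \<le> 17 / 12 * y" using y by (intro real_le_lsqrt) auto
      then show ?thesis by (simp only: real_sqrt_mult)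
    qed
    moreover have "l \<le> 2 * sqrt q" using q1 by (simp add: l_def)
    then have "sqrt (n / N) * l \<le> sqrt (n / N) * (2 * sqrt q)" using N0 by (intro mult_left_mono) auto
    ultimately have my: "m \<le> 18 * y" using y(1) by (simp add: m_def)
    have "d / N * real n \<ge> y * y" using mult_right_mono[OF dN(1), of "real n"] y(2) by simp
    then have "y * y / (18 * y) \<le> d / N * real n / m"
      using my m0 y(1) mult_nonneg_nonneg[of y y] by (intro frac_le) linarith+
    then show ?thesis using y(1) unfolding y_def[symmetric] by simp
  qed
  ultimately show ?thesis by linarith
qed

end

text \<open>As \<open>r\<close> runs through powers of two, it exceeds \<open>n powr (1 / t)\<close>
  by at most the absolute factor 8, so \<open>sqrt (n / r) / 18\<close> has the right order
  uniformly in \<open>t\<close>. The constant is \<open>3 * 18\<close>, where 3 bounds the square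
  root of 8. For \<open>r > n\<close> the trivial bound 1 is enough.\<close>

lemma lambda_free_biclique:
  assumes t: "t \<ge> 3" and n: "n \<ge> 1"
  shows "lambda_free n (complete_bipartite_graph t (fact (t - 1) + 1)) \<ge> 1 / 54 * real n powr (1/2 * (1 - 1 / real t))"
proof -
  obtain s where ts: "t = Suc s" "s \<ge> 2" using t by (cases t) auto
  have "(2::real) ^ t > 1" using t by (intro one_less_power) auto
  then obtain k' where k': "(2 ^ t) ^ k' \<le> 32 * real n" "32 * real n < (2 ^ t) ^ Suc k'"
    using ex_power_between[of "2 ^ t" "32 * real n"] n by auto
  define k where "k = Suc k'"
  define r :: nat where "r = 2 ^ k"
  have rt: "real r ^ t = (2 ^ t) ^ k" by (simp add: r_def mult.commute flip: power_mult)
  interpret norm_graph 2 "k * s" "r ^ s" "TYPE(K2)" k s r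
  proof -
    interpret finite_subfield_char2 2 "k * s" "2 ^ (k * s)" "TYPE(K2)"
      using ts by (intro finite_subfield_K2) (simp add: k_def)
    show "norm_graph TYPE(K2) 2 (k * s) (r ^ s) k s r"
      using ts finite_subfield_char2_axioms power_mult[of "2::nat" k s] by unfold_locales (auto simp: k_def r_def simp del: mult_Suc power_Suc)
  qed
  have r1: "real r > 1" using r_gt_1 by simp
  have cV: "16 * n \<le> card V"
  proof -
    have "32 * real n \<le> real r ^ t" using k' by (simp add: rt k_def)
    also have "\<dots> = real r ^ s * real r" using ts by simp
    also have "\<dots> \<le> real r ^ s * (2 * (real r - 1))"
      using r_gt_1 by (intro mult_left_mono) auto
    also have "\<dots> = 2 * (real (r ^ s) * (real r - 1))" by simp
    finally have "16 * real n \<le> real (r ^ s) * (real r - 1)" by linarith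
    also have "\<dots> = real (card V)" using r_gt_1 by (simp add: card_V of_nat_diff)
    finally show ?thesis by (metis of_nat_le_iff of_nat_mult of_nat_numeral)
  qed
  define x where "x = real n powr (1 / real t)"
  have x: "x > 0" "x ^ t = real n" using n t by (simp_all add: x_def powr_realpow[symmetric] powr_powr)
  have "real r \<le> 8 * x"
  proof -
    have "real r ^ t = 2 ^ t * (2 ^ t) ^ k'" by (simp add: rt k_def)
    also have "\<dots> \<le> 2 ^ t * (32 * real n)" using k' by (intro mult_left_mono) auto
    \<comment> \<open>Here \<open>t \<ge> 3\<close> bounds the \<open>t\<close>-th root of 32 by
      4.\<close>
    also have "\<dots> \<le> 2 ^ t * (4 ^ t * real n)"
    proof -
      have "(4::real) ^ 3 \<le> 4 ^ t" using t by (intro power_increasing) auto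
      then show ?thesis by (intro mult_left_mono mult_right_mono) auto
    qed
    also have "\<dots> = (2 * (4 * x)) ^ t" by (simp only: power_mult_distrib x(2))
    also have "2 * (4 * x) = 8 * x" by simp
    finally have "real r ^ t \<le> (8 * x) ^ t" .
    then show ?thesis using x(1) t power_mono_iff[of "real r" "8 * x" t] by linarith
  qed
  define y where "y = real n powr (1/2 * (1 - 1 / real t))"
  have y: "y > 0" "y * y = real n / x"
  proof -
    show "y > 0" using n by (simp add: y_def)
    have "y * y = real n powr (1 - 1 / real t)" unfolding y_def by (simp flip: powr_add)
    also have "\<dots> = real n / x" using n by (simp add: x_def powr_diff)
    finally show "y * y = real n / x" .
  qed
  have ny: "y * y \<le> 8 * (real n / real r)"
    using \<open>real r \<le> 8 * x\<close> r1 x(1) n unfolding y(2) by (simp add: field_simps)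
  show ?thesis
  proof (cases "real r \<le> real n")
    case True
    have "(3 * sqrt (real n / real r))\<^sup>2 = 9 * (real n / real r)" by (simp add: power_mult_distrib)
    moreover have "real n / real r \<ge> 0" by simp
    ultimately have "y\<^sup>2 \<le> (3 * sqrt (real n / real r))\<^sup>2"
      using ny unfolding power2_eq_square by linarith
    then have "y \<le> 3 * sqrt (real n / real r)" by (rule power2_le_imp_le) simp
    moreover have "lambda_free n (complete_bipartite_graph (Suc s) (fact s + 1)) \<ge> sqrt (real n / real r) / 18"
      using n cV True by (intro lambda_free_norm_graph) auto
    ultimately have "1 / 54 * y \<le> lambda_free n (complete_bipartite_graph (Suc s) (fact s + 1))" by linarith
    then show ?thesis by (simp only: y_def ts(1) diff_Suc_1)
  next
    case False
    then have "real n / real r \<le> 1" using r1 by simp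
    then have "y\<^sup>2 \<le> 3\<^sup>2" using ny by (simp add: power2_eq_square)
    then have "y \<le> 3" by (rule power2_le_imp_le) simp
    moreover have "lambda_free n (complete_bipartite_graph (Suc s) (fact s + 1)) \<ge> 1"
    proof (rule lambda_free_ge_1[OF n])
      show "pverts (complete_bipartite_graph (Suc s) (fact s + 1)) \<noteq> {}"
        by (auto simp: complete_bipartite_graph_def Let_def)
    qed (use complete_bipartite_graph_arcs[of "Suc s" "fact s + 1"] in auto)
    ultimately have "1 / 54 * y \<le> lambda_free n (complete_bipartite_graph (Suc s) (fact s + 1))" by linarith
    then show ?thesis by (simp only: y_def ts(1) diff_Suc_1)
  qed
qed

section \<open>Decagons\<close>

text \<open>A type with three elements, to serve as the modulus of the prime field of order
  3.\<close>

datatype three = Three0 | Three1 | Three2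

lemma CARD_three [simp]: "CARD(three) = 3"
proof -
  have UNIV: "UNIV = {Three0, Three1, Three2}" by (auto intro: three.exhaust)
  show ?thesis by (subst UNIV) simp
qed

instance three :: prime_card
  by standard simp

type_synonym K3 = "three mod_ring alg_closure"

lemma CHAR_K3: "CHAR(K3) = 3"
  by simp

text \<open>The weights annihilate every polynomial of degree at most 3. If \<open>a0 = a2\<close>,
  some cubic vanishes at all nodes but one: the one with roots \<open>a0\<close>, \<open>a3\<close>,
  \<open>a4\<close> isolates \<open>a1\<close>, and if \<open>a1\<close> coincides with
  \<open>a3\<close> or \<open>a4\<close>, the one with roots \<open>a0\<close>, \<open>a1\<close>,
  \<open>a1\<close> isolates the other of these two.\<close>

lemma cyclic_pentagon_distinct:
  fixes a0 a1 a2 a3 a4 c0 c1 c2 c3 c4 :: "'b :: idom"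
  assumes c: "c0 \<noteq> 0" "c1 \<noteq> 0" "c2 \<noteq> 0" "c3 \<noteq> 0" "c4 \<noteq> 0"
    and a: "a0 \<noteq> a1" "a1 \<noteq> a2" "a2 \<noteq> a3" "a3 \<noteq> a4" "a4 \<noteq> a0"
    and 0: "c0 + c1 + c2 + c3 + c4 = 0"
    and 1: "a0 * c0 + a1 * c1 + a2 * c2 + a3 * c3 + a4 * c4 = 0"
    and 2: "a0 ^ 2 * c0 + a1 ^ 2 * c1 + a2 ^ 2 * c2 + a3 ^ 2 * c3 + a4 ^ 2 * c4 = 0"
    and 3: "a0 ^ 3 * c0 + a1 ^ 3 * c1 + a2 ^ 3 * c2 + a3 ^ 3 * c3 + a4 ^ 3 * c4 = 0"
  shows "a0 \<noteq> a2"
proof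
  assume eq: "a0 = a2"
  have cubic: "c0 * ((a0 - r) * (a0 - s) * (a0 - t)) + c1 * ((a1 - r) * (a1 - s) * (a1 - t)) + c2 * ((a2 - r) * (a2 - s) * (a2 - t))
      + c3 * ((a3 - r) * (a3 - s) * (a3 - t)) + c4 * ((a4 - r) * (a4 - s) * (a4 - t)) = 0" (is "?L = 0") for r s t
  proof -
    have "?L = (a0 ^ 3 * c0 + a1 ^ 3 * c1 + a2 ^ 3 * c2 + a3 ^ 3 * c3 + a4 ^ 3 * c4)
        - (r + s + t) * (a0 ^ 2 * c0 + a1 ^ 2 * c1 + a2 ^ 2 * c2 + a3 ^ 2 * c3 + a4 ^ 2 * c4)
        + (r * s + s * t + t * r) * (a0 * c0 + a1 * c1 + a2 * c2 + a3 * c3 + a4 * c4)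
        - r * s * t * (c0 + c1 + c2 + c3 + c4)"
      by (simp add: power2_eq_square power3_eq_cube algebra_simps)
    then show ?thesis unfolding 0 1 2 3 by simp
  qed
  show False
  proof (cases "a1 = a3 \<or> a1 = a4")
    case False
    then show False using cubic[of a0 a3 a4] c a eq by auto
  next
    case True
    then show False using cubic[of a0 a1 a1] c a eq by auto
  qed
qed

text \<open>An identity with integer coefficients up to an explicit multiple of 3. The left side is
  the quadratic relation evaluated at the signed minors; the right side is a product of differences
  of the original nodes.\<close>

lemma decagon_resultant:
  fixes x y z w :: "'b :: comm_ring_1"
  defines "T0 \<equiv> (y - x)\<^sup>2" and "T1 \<equiv> y\<^sup>2" and "T2 \<equiv> z\<^sup>2" and "T3 \<equiv> (w - z)\<^sup>2"
    and "s0 \<equiv> x + y" and "s3 \<equiv> z + w"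
  assumes three: "(3 :: 'b) = 0"
  shows "((z * T3 - T2 * s3) - (y * T3 - T1 * s3) + (y * T2 - T1 * z))\<^sup>2 * (y - x)
    + ((z * T3 - T2 * s3) - (s0 * T3 - T0 * s3) + (s0 * T2 - T0 * z))\<^sup>2 * (- y)
    + ((y * T3 - T1 * s3) - (s0 * T3 - T0 * s3) + (s0 * T1 - T0 * y))\<^sup>2 * z
    + ((y * T2 - T1 * z) - (s0 * T2 - T0 * z) + (s0 * T1 - T0 * y))\<^sup>2 * (w - z)
    = x * w * (x - z) * (x - w)\<^sup>2 * (y - z) * (y - w)" (is "?L = ?R")
proof -
  have "?L = ?R + 3 * (2 * x * z^3 * w^3 - 3 * x * z^4 * w^2 + x * y * z * w^4 - 7 * x * y * z^2 * w^3
    + 8 * x * y * z^3 * w^2 - x * y^2 * w^4 + 5 * x * y^2 * z * w^3 - 6 * x * y^2 * z^2 * w^2 + x * y^4 * w^2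
    - 2 * x^2 * z^2 * w^3 + 2 * x^2 * z^3 * w^2 - x^2 * z^4 * w + 3 * x^2 * y * z * w^3 - x^2 * y^2 * w^3
    + 6 * x^2 * y^2 * z^2 * w - 2 * x^2 * y^3 * w^2 - 8 * x^2 * y^3 * z * w + 3 * x^2 * y^4 * w
    + x^3 * z^2 * w^2 - 3 * x^3 * y * z * w^2 - 5 * x^3 * y * z^2 * w + 2 * x^3 * y^2 * w^2
    + 7 * x^3 * y^2 * z * w - 2 * x^3 * y^3 * w + x^4 * z^2 * w - x^4 * y * z * w)"
    unfolding T0_def T1_def T2_def T3_def s0_def s3_def
    by (simp add: power2_eq_square power3_eq_cube power4_eq_xxxx algebra_simps)
  then show ?thesis by (simp add: three)
qed

text \<open>The vectors \<open>(1, s i, T i)\<close> satisfy one linear relation up to scalars, whose coefficients are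
  the \<open>3 \<times> 3\<close> minors.\<close>

lemma square_combination_of_kernel_vector:
  fixes n0 n1 n2 n3 :: "'b :: comm_ring_1"
  assumes 1: "n0 + n1 + n2 + n3 = 0" and 2: "n0 * s0 + n1 * s1 + n2 * s2 + n3 * s3 = 0"
    and 3: "n0 * T0 + n1 * T1 + n2 * T2 + n3 * T3 = 0"
  defines "M0 \<equiv> (s2 * T3 - T2 * s3) - (s1 * T3 - T1 * s3) + (s1 * T2 - T1 * s2)"
    and "M1 \<equiv> (s2 * T3 - T2 * s3) - (s0 * T3 - T0 * s3) + (s0 * T2 - T0 * s2)"
    and "M2 \<equiv> (s1 * T3 - T1 * s3) - (s0 * T3 - T0 * s3) + (s0 * T1 - T0 * s1)"
    and "M3 \<equiv> (s1 * T2 - T1 * s2) - (s0 * T2 - T0 * s2) + (s0 * T1 - T0 * s1)"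
  shows "M0\<^sup>2 * (n0\<^sup>2 * d0 + n1\<^sup>2 * d1 + n2\<^sup>2 * d2 + n3\<^sup>2 * d3) =
    n0\<^sup>2 * (M0\<^sup>2 * d0 + M1\<^sup>2 * d1 + M2\<^sup>2 * d2 + M3\<^sup>2 * d3)"
proof -
  have "n0 * M1 + n1 * M0 = (n0 + n1 + n2 + n3) * (s2 * T3 - T2 * s3) + (n0 * s0 + n1 * s1 + n2 * s2 + n3 * s3) * (T2 - T3)
      + (n0 * T0 + n1 * T1 + n2 * T2 + n3 * T3) * (s3 - s2)"
    unfolding M0_def M1_def by (simp add: power2_eq_square power3_eq_cube algebra_simps)
  then have "n0 * M1 + n1 * M0 = 0" unfolding 1 2 3 by simp
  then have 4: "n1 * M0 = - (n0 * M1)" by (simp add: eq_neg_iff_add_eq_0 add.commute)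
  have "n0 * M2 - n2 * M0 = (n0 + n1 + n2 + n3) * (s1 * T3 - T1 * s3) + (n0 * s0 + n1 * s1 + n2 * s2 + n3 * s3) * (T1 - T3)
      + (n0 * T0 + n1 * T1 + n2 * T2 + n3 * T3) * (s3 - s1)"
    unfolding M0_def M2_def by (simp add: power2_eq_square power3_eq_cube algebra_simps)
  then have 5: "n2 * M0 = n0 * M2" unfolding 1 2 3 by simp
  have "n0 * M3 + n3 * M0 = (n0 + n1 + n2 + n3) * (s1 * T2 - T1 * s2) + (n0 * s0 + n1 * s1 + n2 * s2 + n3 * s3) * (T1 - T2)
      + (n0 * T0 + n1 * T1 + n2 * T2 + n3 * T3) * (s2 - s1)"
    unfolding M0_def M3_def by (simp add: power2_eq_square power3_eq_cube algebra_simps)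
  then have "n0 * M3 + n3 * M0 = 0" unfolding 1 2 3 by simp
  then have 6: "n3 * M0 = - (n0 * M3)" by (simp add: eq_neg_iff_add_eq_0 add.commute)
  have "M0\<^sup>2 * (n0\<^sup>2 * d0 + n1\<^sup>2 * d1 + n2\<^sup>2 * d2 + n3\<^sup>2 * d3) =
      (n0 * M0)\<^sup>2 * d0 + (n1 * M0)\<^sup>2 * d1 + (n2 * M0)\<^sup>2 * d2 + (n3 * M0)\<^sup>2 * d3"
    by (simp add: power_mult_distrib distrib_left mult_ac)
  also have "\<dots> = n0\<^sup>2 * (M0\<^sup>2 * d0 + M1\<^sup>2 * d1 + M2\<^sup>2 * d2 + M3\<^sup>2 * d3)"
    unfolding 4 5 6 by (simp add: power_mult_distrib distrib_left mult_ac)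
  finally show ?thesis .
qed

text \<open>Summation by parts rewrites the system in terms of \<open>n0, ..., n3\<close>, where
  additivity of cubes in characteristic 3 is used. The first three relations put this vector into
  the kernel of the matrix with columns \<open>(1, s i, T i)\<close>; the fourth is a quadratic
  relation, which on that kernel contradicts \<open>decagon_resultant\<close> once all
  \<open>a0, ..., a4\<close> are distinct.\<close>

lemma decagon_free_algebra:
  fixes a0 a1 a2 a3 a4 k0 k1 k2 k3 k4 :: "'b :: field"
  assumes three: "(3 :: 'b) = 0"
    and a: "a0 \<noteq> a1" "a1 \<noteq> a2" "a2 \<noteq> a3" "a3 \<noteq> a4" "a4 \<noteq> a0"
    and k: "k0 \<noteq> k4" "k1 \<noteq> k0" "k2 \<noteq> k1" "k3 \<noteq> k2" "k4 \<noteq> k3"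
    and 1: "a0 * (k0 - k4) + a1 * (k1 - k0) + a2 * (k2 - k1) + a3 * (k3 - k2) + a4 * (k4 - k3) = 0"
    and 2: "a0 ^ 2 * (k0 - k4) + a1 ^ 2 * (k1 - k0) + a2 ^ 2 * (k2 - k1) + a3 ^ 2 * (k3 - k2) + a4 ^ 2 * (k4 - k3) = 0"
    and 3: "a0 ^ 3 * (k0 - k4) + a1 ^ 3 * (k1 - k0) + a2 ^ 3 * (k2 - k1) + a3 ^ 3 * (k3 - k2) + a4 ^ 3 * (k4 - k3) = 0"
    and 4: "a0 ^ 3 * (k0\<^sup>2 - k4\<^sup>2) + a1 ^ 3 * (k1\<^sup>2 - k0\<^sup>2) + a2 ^ 3 * (k2\<^sup>2 - k1\<^sup>2) + a3 ^ 3 * (k3\<^sup>2 - k2\<^sup>2) + a4 ^ 3 * (k4\<^sup>2 - k3\<^sup>2) = 0"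
  shows False
proof -
  have c: "k0 - k4 \<noteq> 0" "k1 - k0 \<noteq> 0" "k2 - k1 \<noteq> 0" "k3 - k2 \<noteq> 0" "k4 - k3 \<noteq> 0" using k by auto
  have c0: "k0 - k4 + (k1 - k0) + (k2 - k1) + (k3 - k2) + (k4 - k3) = 0" by simp
  have ne: "a0 \<noteq> a2" by (rule cyclic_pentagon_distinct[OF c a c0 1 2 3])
  have ne1: "a1 \<noteq> a3"
    by (rule cyclic_pentagon_distinct[OF c(2,3,4,5,1) a(2,3,4,5,1)])
      (use 1 2 3 in \<open>simp_all add: add_ac\<close>)
  have ne2: "a2 \<noteq> a4"
    by (rule cyclic_pentagon_distinct[OF c(3,4,5,1,2) a(3,4,5,1,2)])
      (use 1 2 3 in \<open>simp_all add: add_ac\<close>)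
  have ne3: "a3 \<noteq> a0"
    by (rule cyclic_pentagon_distinct[OF c(4,5,1,2,3) a(4,5,1,2,3)])
      (use 1 2 3 in \<open>simp_all add: add_ac\<close>)
  have ne4: "a4 \<noteq> a1"
    by (rule cyclic_pentagon_distinct[OF c(5,1,2,3,4) a(5,1,2,3,4)])
      (use 1 2 3 in \<open>simp_all add: add_ac\<close>)
  \<comment> \<open>Translation by \<open>a2\<close>. The numbers \<open>y - x\<close>,
    \<open>- y\<close>, \<open>z\<close>, \<open>w - z\<close> are the successive differences of
    \<open>a0, ..., a4\<close>, and each \<open>n\<close> is such a difference times a difference to
    \<open>k4\<close>.\<close>
  define x y z w where "x = a0 - a2" and "y = a1 - a2" and "z = a3 - a2" and "w = a4 - a2"
  define n0 n1 n2 n3 where "n0 = (k0 - k4) * (y - x)" and "n1 = (k1 - k4) * (- y)"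
    and "n2 = (k2 - k4) * z" and "n3 = (k3 - k4) * (w - z)"
  note defs = x_def y_def z_def w_def n0_def n1_def n2_def n3_def
  have "n0 + n1 + n2 + n3 =
      - (a0 * (k0 - k4) + a1 * (k1 - k0) + a2 * (k2 - k1) + a3 * (k3 - k2) + a4 * (k4 - k3))"
    unfolding defs by (simp add: power2_eq_square algebra_simps)
  then have E1: "n0 + n1 + n2 + n3 = 0" unfolding 1 by simp
  have "n0 * (x + y) + n1 * y + n2 * z + n3 * (z + w) =
      2 * a2 * (a0 * (k0 - k4) + a1 * (k1 - k0) + a2 * (k2 - k1) + a3 * (k3 - k2) + a4 * (k4 - k3))
      - (a0 ^ 2 * (k0 - k4) + a1 ^ 2 * (k1 - k0) + a2 ^ 2 * (k2 - k1) + a3 ^ 2 * (k3 - k2) + a4 ^ 2 * (k4 - k3))"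
    unfolding defs by (simp add: power2_eq_square algebra_simps)
  then have E2: "n0 * (x + y) + n1 * y + n2 * z + n3 * (z + w) = 0" unfolding 1 2 by simp
  have cube: "(u - v) ^ 3 = u ^ 3 - v ^ 3" for u v :: 'b
  proof -
    have "(u - v) ^ 3 = u ^ 3 - v ^ 3 - 3 * (u * v * (u - v))" by (simp add: power2_eq_square power3_eq_cube algebra_simps)
    then show ?thesis by (simp add: three)
  qed
  have "y - x = a1 - a0" "- y = a2 - a1" "z = a3 - a2" "w - z = a4 - a3" by (simp_all add: defs)
  then have D: "(y - x) ^ 3 = a1 ^ 3 - a0 ^ 3" "(- y) ^ 3 = a2 ^ 3 - a1 ^ 3" "z ^ 3 = a3 ^ 3 - a2 ^ 3"
    "(w - z) ^ 3 = a4 ^ 3 - a3 ^ 3" by (simp_all only: cube)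
  have "n0 * (y - x)\<^sup>2 + n1 * y\<^sup>2 + n2 * z\<^sup>2 + n3 * (w - z)\<^sup>2 =
      (k0 - k4) * (y - x) ^ 3 + (k1 - k4) * (- y) ^ 3 + (k2 - k4) * z ^ 3 + (k3 - k4) * (w - z) ^ 3"
    unfolding n0_def n1_def n2_def n3_def by (simp add: power2_eq_square power3_eq_cube algebra_simps)
  also have "\<dots> = - (a0 ^ 3 * (k0 - k4) + a1 ^ 3 * (k1 - k0) + a2 ^ 3 * (k2 - k1) + a3 ^ 3 * (k3 - k2) + a4 ^ 3 * (k4 - k3))"
    unfolding D by (simp add: power2_eq_square power3_eq_cube algebra_simps)
  finally have E3: "n0 * (y - x)\<^sup>2 + n1 * y\<^sup>2 + n2 * z\<^sup>2 + n3 * (w - z)\<^sup>2 = 0" unfolding 3 by simp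
  have "n0\<^sup>2 * (y - x) + n1\<^sup>2 * (- y) + n2\<^sup>2 * z + n3\<^sup>2 * (w - z) =
      (k0 - k4)\<^sup>2 * (y - x) ^ 3 + (k1 - k4)\<^sup>2 * (- y) ^ 3 + (k2 - k4)\<^sup>2 * z ^ 3 + (k3 - k4)\<^sup>2 * (w - z) ^ 3"
    unfolding n0_def n1_def n2_def n3_def by (simp add: power2_eq_square power3_eq_cube algebra_simps)
  also have "\<dots> = 2 * k4 * (a0 ^ 3 * (k0 - k4) + a1 ^ 3 * (k1 - k0) + a2 ^ 3 * (k2 - k1) + a3 ^ 3 * (k3 - k2) + a4 ^ 3 * (k4 - k3))
      - (a0 ^ 3 * (k0\<^sup>2 - k4\<^sup>2) + a1 ^ 3 * (k1\<^sup>2 - k0\<^sup>2) + a2 ^ 3 * (k2\<^sup>2 - k1\<^sup>2) + a3 ^ 3 * (k3\<^sup>2 - k2\<^sup>2) + a4 ^ 3 * (k4\<^sup>2 - k3\<^sup>2))"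
    unfolding D by (simp add: power2_eq_square power3_eq_cube algebra_simps)
  finally have E4: "n0\<^sup>2 * (y - x) + n1\<^sup>2 * (- y) + n2\<^sup>2 * z + n3\<^sup>2 * (w - z) = 0" unfolding 3 4 by simp
  have "n0\<^sup>2 * (x * w * (x - z) * (x - w)\<^sup>2 * (y - z) * (y - w)) = 0"
    using square_combination_of_kernel_vector[OF E1 E2 E3, of "y - x" "- y" z "w - z", symmetric]
    unfolding E4 decagon_resultant[OF three] by (simp only: mult_zero_right)
  moreover have "x \<noteq> 0" "w \<noteq> 0" "x - z \<noteq> 0" "x - w \<noteq> 0" "y - z \<noteq> 0" "y - w \<noteq> 0"
    using ne ne1 ne2 ne3 ne4 a by (auto simp: defs)
  ultimately have "n0 = 0" by simp
  then show False using a k by (simp add: n0_def x_def y_def)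
qed


locale finite_subfield_char3 = finite_subfield 3 e q ty for e q :: nat and ty :: "'a :: alg_closed_field itself" +
  fixes d :: nat
  assumes e_eq: "e = 2 * d + 1"
begin

lemma three_eq_0: "(3 :: 'a) = 0"
  using of_nat_CHAR[where 'a = 'a] char by simp

lemma cube_add: "(x + y :: 'a) ^ 3 = x ^ 3 + y ^ 3"
  using Frob_add[of x y 1] by simp

lemma q_eq: "q = 3 * 3 ^ (2 * d)"
  by (simp add: q e_eq)

lemma cube_root:
  assumes "x \<in> F"
  shows "\<exists>y\<in>F. y ^ 3 = x"
proof (intro bexI)
  show "(x ^ 3 ^ (2 * d)) ^ 3 = x"
    using F_power_q[OF assms] unfolding q_eq by (simp add: mult.commute flip: power_mult)
qed (use assms in simp)

text \<open>A square root of the cubing map, which exists because the degree \<open>e\<close> is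
  odd; it is the field automorphism behind the Ree polarity.\<close>

abbreviation \<theta> :: "'a \<Rightarrow> 'a" where "\<theta> x \<equiv> x ^ 3 ^ (d + 1)"

lemma \<theta>_\<theta>: "x \<in> F \<Longrightarrow> \<theta> (\<theta> x) = x ^ 3"
proof -
  assume x: "x \<in> F"
  have "(3::nat) ^ (d + 1) * 3 ^ (d + 1) = q * 3" unfolding q_eq mult_2 by (simp add: power_add)
  then have "\<theta> (\<theta> x) = (x ^ q) ^ 3" by (simp only: flip: power_mult)
  then show ?thesis using F_power_q[OF x] by simp
qed

lemma \<chi>_\<theta>: "x \<in> F \<Longrightarrow> \<chi> (\<theta> x) = \<chi> x"
  by (rule \<chi>_Frob_power)

lemma \<chi>_cube: "x \<in> F \<Longrightarrow> \<chi> (x ^ 3) = \<chi> x"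
  by (rule \<chi>_Frob)

lemma Frob_bij: "bij_betw (\<lambda>x :: 'a. x ^ 3 ^ k) F F"
proof -
  have inj: "inj_on (\<lambda>x :: 'a. x ^ 3 ^ k) F" using Frob_eq_iff by (auto simp: inj_on_def)
  then show ?thesis unfolding bij_betw_def by (intro conjI endo_inj_surj) auto
qed

text \<open>The quadratic Gauss sum, by the substitution \<open>b = a + h\<close>. In characteristic
  3 the coefficient -2 of the cross term is 1, whence the correction by a multiple of 3 in the
  proof.\<close>

lemma sum_\<chi>_square:
  assumes m: "m \<in> F" "m \<noteq> 0"
  shows "(cmod (\<Sum>a\<in>F. \<chi> (m * a\<^sup>2)))\<^sup>2 = real q"
proof -
  have "of_real ((cmod (\<Sum>a\<in>F. \<chi> (m * a\<^sup>2)))\<^sup>2) = (\<Sum>a\<in>F. \<Sum>b\<in>F. \<chi> (m * a\<^sup>2) * cnj (\<chi> (m * b\<^sup>2)))"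
    by (simp add: complex_cmod_square sum_product)
  also have "\<dots> = (\<Sum>a\<in>F. \<Sum>b\<in>F. \<chi> (m * a\<^sup>2 - m * b\<^sup>2))"
    using m by (intro sum.cong refl) (simp add: \<chi>_diff)
  also have "\<dots> = (\<Sum>a\<in>F. \<Sum>h\<in>F. \<chi> (m * a\<^sup>2 - m * (a + h)\<^sup>2))"
  proof (rule sum.cong[OF refl])
    fix a assume "a \<in> F"
    then show "(\<Sum>b\<in>F. \<chi> (m * a\<^sup>2 - m * b\<^sup>2)) = (\<Sum>h\<in>F. \<chi> (m * a\<^sup>2 - m * (a + h)\<^sup>2))"
      by (intro sum.reindex_bij_witness[of _ "\<lambda>h. a + h" "\<lambda>b. b - a"]) auto
  qed
  also have "\<dots> = (\<Sum>h\<in>F. \<Sum>a\<in>F. \<chi> (m * h * a) * \<chi> (- (m * h\<^sup>2)))"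
  proof (subst sum.swap, intro sum.cong refl)
    fix a h assume "a \<in> F" "h \<in> F"
    moreover have "m * a\<^sup>2 - m * (a + h)\<^sup>2 = m * h * a + - (m * h\<^sup>2) - 3 * (m * h * a)"
      by (simp add: power2_eq_square algebra_simps)
    ultimately show "\<chi> (m * a\<^sup>2 - m * (a + h)\<^sup>2) = \<chi> (m * h * a) * \<chi> (- (m * h\<^sup>2))"
      using m by (simp add: three_eq_0 \<chi>_add[symmetric])
  qed
  also have "\<dots> = (\<Sum>h\<in>F. (\<Sum>a\<in>F. \<chi> (m * h * a)) * \<chi> (- (m * h\<^sup>2)))" by (simp add: sum_distrib_right)
  also have "\<dots> = (\<Sum>h\<in>F. if h = 0 then of_nat q else 0)"
    using m by (intro sum.cong refl) (simp add: sum_\<chi>)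
  finally have "complex_of_real ((cmod (\<Sum>a\<in>F. \<chi> (m * a\<^sup>2)))\<^sup>2) = of_real (real q)" by simp
  then show ?thesis unfolding of_real_eq_iff .
qed

text \<open>Completing the square, where one half is -1 in characteristic 3: the centre is
  \<open>L / m\<close> and the constant term is minus the square of \<open>L\<close> over
  \<open>m\<close>.\<close>

lemma sum_\<chi>_quadratic:
  assumes m: "m \<in> F" "m \<noteq> 0" and L: "L \<in> F"
  shows "(\<Sum>a\<in>F. \<chi> (m * a\<^sup>2 + L * a)) = \<chi> (- (L\<^sup>2 / m)) * (\<Sum>a\<in>F. \<chi> (m * a\<^sup>2))"
proof -
  have "(\<Sum>a\<in>F. \<chi> (m * a\<^sup>2 + L * a)) = (\<Sum>a\<in>F. \<chi> (m * (a + L / m)\<^sup>2 + L * (a + L / m)))"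
    using m L by (intro sum.reindex_bij_witness[of _ "\<lambda>a. a + L / m" "\<lambda>a. a - L / m"]) auto
  also have "\<dots> = (\<Sum>a\<in>F. \<chi> (- (L\<^sup>2 / m)) * \<chi> (m * a\<^sup>2))"
  proof (intro sum.cong refl)
    fix a assume "a \<in> F"
    moreover have "m * (a + L / m)\<^sup>2 + L * (a + L / m) = - (L\<^sup>2 / m) + m * a\<^sup>2 + 3 * (L * a + L\<^sup>2 / m)"
      using m by (simp add: power2_eq_square field_simps)
    ultimately show "\<chi> (m * (a + L / m)\<^sup>2 + L * (a + L / m)) = \<chi> (- (L\<^sup>2 / m)) * \<chi> (m * a\<^sup>2)"
      using m L by (simp add: three_eq_0 \<chi>_add[symmetric])
  qed
  finally show ?thesis by (simp add: sum_distrib_left)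
qed

end

context finite_subfield
begin

text \<open>The counterpart of \<open>opnorm_le_fibres\<close> with the non-injective map on the
  side of the frequencies: each frequency is counted at most \<open>k\<close> times in Parseval's
  identity.\<close>

lemma sum_\<chi>_compose_le:
  assumes P: "\<And>c. c \<in> F \<Longrightarrow> P c \<in> F" "\<And>r. r \<in> F \<Longrightarrow> card {c \<in> F. P c = r} \<le> k"
    and g: "bij_betw g F F"
  shows "(\<Sum>c\<in>F. (cmod (\<Sum>b\<in>F. y b * \<chi> (P c * g b)))\<^sup>2) \<le> real k * real q * (\<Sum>b\<in>F. (cmod (y b))\<^sup>2)"
proof -
  define W where "W = (\<lambda>r. (cmod (\<Sum>b\<in>F. y b * \<chi> (r * g b)))\<^sup>2)"
  define g' where "g' = inv_into F g"
  have g': "g' (g b) = b" if "b \<in> F" for b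
    using that bij_betw_imp_inj_on[OF g] by (simp add: g'_def inv_into_f_f)
  have "(\<Sum>c\<in>F. W (P c)) = (\<Sum>r\<in>F. \<Sum>c\<in>{c \<in> F. P c = r}. W (P c))"
    using P(1) by (intro sum.group[symmetric]) auto
  also have "\<dots> = (\<Sum>r\<in>F. real (card {c \<in> F. P c = r}) * W r)" by (intro sum.cong) auto
  also have "\<dots> \<le> (\<Sum>r\<in>F. real k * W r)"
    using P(2) by (intro sum_mono mult_right_mono) (auto simp: W_def)
  also have "\<dots> = real k * (\<Sum>r\<in>F. W r)" by (simp add: sum_distrib_left)
  also have "(\<Sum>r\<in>F. W r) = (\<Sum>r\<in>F. (cmod (\<Sum>l\<in>F. y (g' l) * \<chi> (l * r)))\<^sup>2)"
  proof (intro sum.cong refl)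
    fix r
    have "(\<Sum>b\<in>F. y b * \<chi> (r * g b)) = (\<Sum>b\<in>F. y (g' (g b)) * \<chi> (g b * r))"
      using g' by (intro sum.cong refl) (simp add: mult.commute)
    also have "\<dots> = (\<Sum>l\<in>F. y (g' l) * \<chi> (l * r))"
      by (rule sum.reindex_bij_betw[OF g, of "\<lambda>l. y (g' l) * \<chi> (l * r)"])
    finally show "W r = (cmod (\<Sum>l\<in>F. y (g' l) * \<chi> (l * r)))\<^sup>2" by (simp add: W_def)
  qed
  also have "\<dots> = real q * (\<Sum>l\<in>F. (cmod (y (g' l)))\<^sup>2)" by (rule Parseval_F)
  also have "(\<Sum>l\<in>F. (cmod (y (g' l)))\<^sup>2) = (\<Sum>b\<in>F. (cmod (y (g' (g b))))\<^sup>2)"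
    by (rule sum.reindex_bij_betw[OF g, symmetric])
  also have "\<dots> = (\<Sum>b\<in>F. (cmod (y b))\<^sup>2)" using g' by (intro sum.cong) auto
  finally show ?thesis by (simp add: W_def mult.assoc)
qed

lemma card_cubic_fibre:
  assumes "\<not> (c1 = 0 \<and> c2 = 0 \<and> c3 = (0::'a))"
  shows "card {a \<in> F. c1 * a + c2 * a\<^sup>2 + c3 * a ^ 3 = v} \<le> 3"
proof -
  let ?p = "[:- v, c1, c2, c3:]"
  have nz: "?p \<noteq> 0" using assms by auto
  have "{a \<in> F. c1 * a + c2 * a\<^sup>2 + c3 * a ^ 3 = v} \<subseteq> {a. poly ?p a = 0}"
    by (auto simp: power2_eq_square power3_eq_cube algebra_simps)
  then have "card {a \<in> F. c1 * a + c2 * a\<^sup>2 + c3 * a ^ 3 = v} \<le> card {a. poly ?p a = 0}"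
    using poly_roots_finite[OF nz] by (rule card_mono[rotated])
  also have "\<dots> \<le> degree ?p" by (rule card_poly_roots_bound[OF nz])
  also have "\<dots> \<le> 3" by simp
  finally show ?thesis .
qed

end

context finite_subfield_char3
begin

text \<open>In characteristic 3 the Fourier transform in \<open>a\<close> of the kernel is a Gauss sum, whose phase is
  linear in \<open>1 / (\<kappa> b) ^ 3\<close> and cubic in the dual variable.\<close>

lemma sum_\<chi>_kernel_le:
  assumes s: "s \<in> F" and v: "v \<in> F" "v \<noteq> 0" and \<rho>: "\<rho> \<in> F" "\<rho> \<noteq> 0" and \<kappa>: "bij_betw \<kappa> F F"
  shows "(\<Sum>a\<in>F. (cmod (\<Sum>b\<in>F. x b * \<chi> (\<kappa> b ^ 3 * (s * a + v * a\<^sup>2) + \<rho> * (\<kappa> b)\<^sup>2 * a)))\<^sup>2)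
    \<le> 6 * real q * (\<Sum>b\<in>F. (cmod (x b))\<^sup>2)"
proof -
  define G where "G = (\<lambda>b a. \<chi> (\<kappa> b ^ 3 * (s * a + v * a\<^sup>2) + \<rho> * (\<kappa> b)\<^sup>2 * a))"
  have \<kappa>F: "\<kappa> b \<in> F" if "b \<in> F" for b using bij_betwE[OF \<kappa>] that by blast
  \<comment> \<open>At the zero of \<open>\<kappa>\<close> the kernel is constantly 1 and there is
    no Gauss sum to complete; that single \<open>b\<close> is treated apart.\<close>
  define x0 where "x0 = (\<lambda>b. if \<kappa> b = 0 then x b else 0)"
  define x1 where "x1 = (\<lambda>b. if \<kappa> b = 0 then 0 else x b)"
  define T1 where "T1 = (\<lambda>a. \<Sum>b\<in>F. x1 b * G b a)"
  define m where "m = (\<lambda>b. v * \<kappa> b ^ 3)"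
  define L0 where "L0 = (\<lambda>b. s * \<kappa> b ^ 3 + \<rho> * (\<kappa> b)\<^sup>2)"
  define y where "y = (\<lambda>b. x1 b * \<chi> (- ((L0 b)\<^sup>2 / m b)) * (\<Sum>a\<in>F. \<chi> (m b * a\<^sup>2)))"
  \<comment> \<open>The summand \<open>0 * c\<close> gives \<open>P\<close> the literal shape
    required by \<open>card_cubic_fibre\<close>.\<close>
  define P where "P = (\<lambda>c. 0 * c + (- (1 / v)) * c\<^sup>2 + (\<rho> / v) ^ 3 * c ^ 3)"
  define g where "g = (\<lambda>b. inverse (\<kappa> b ^ 3))"
  have F1: "m b \<in> F" "L0 b \<in> F" "g b \<in> F" if "b \<in> F" for b
    using \<kappa>F[OF that] s v \<rho> by (simp_all add: m_def L0_def g_def)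
  have "(\<Sum>a\<in>F. x1 b * G b a * \<chi> (a * c)) = \<chi> (s * c / v) * (y b * \<chi> (P c * g b))"
    if b: "b \<in> F" and c: "c \<in> F" for b c
  proof (cases "\<kappa> b = 0")
    case False
    have mb: "m b \<noteq> 0" using False v by (simp add: m_def)
    have "(\<Sum>a\<in>F. G b a * \<chi> (a * c)) = (\<Sum>a\<in>F. \<chi> (m b * a\<^sup>2 + (L0 b + c) * a))"
      using b c \<kappa>F[OF b] s v \<rho> by (intro sum.cong refl) (simp add: G_def m_def L0_def algebra_simps flip: \<chi>_add)
    also have "\<dots> = \<chi> (- ((L0 b + c)\<^sup>2 / m b)) * (\<Sum>a\<in>F. \<chi> (m b * a\<^sup>2))"
      using F1[OF b] c mb by (intro sum_\<chi>_quadratic) auto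
    also have "- ((L0 b + c)\<^sup>2 / m b) = - ((L0 b)\<^sup>2 / m b) + s * c / v + (\<rho> / v * c / \<kappa> b) - 1 / v * c\<^sup>2 * g b"
    proof -
      have "- ((L0 b + c)\<^sup>2 / m b) = - ((L0 b)\<^sup>2 / m b) + L0 b / m b * c - 1 / m b * c\<^sup>2 - 3 * (L0 b / m b * c)"
        using mb by (simp add: power2_eq_square field_simps)
      also have "L0 b / m b = s / v + \<rho> / v / \<kappa> b"
        using False v by (simp add: L0_def m_def field_simps power2_eq_square power3_eq_cube)
      also have "1 / m b = 1 / v * g b" using False v by (simp add: m_def g_def field_simps)
      finally show ?thesis by (simp add: three_eq_0 algebra_simps)
    qed
    also have "\<chi> \<dots> = \<chi> (- ((L0 b)\<^sup>2 / m b)) * \<chi> (s * c / v) * \<chi> (\<rho> / v * c / \<kappa> b) * cnj (\<chi> (1 / v * c\<^sup>2 * g b))"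
      using F1[OF b] \<kappa>F[OF b] s v \<rho> c by (simp add: \<chi>_add \<chi>_diff \<chi>_minus)
    \<comment> \<open>Cubing inside \<open>\<chi>\<close> turns the term with
      \<open>1 / \<kappa> b\<close> into one with its cube \<open>g b\<close>. After that the whole
      mixed phase is \<open>P c * g b\<close>, a function of \<open>c\<close> times a function of
      \<open>b\<close>.\<close>
    also have "\<chi> (\<rho> / v * c / \<kappa> b) = \<chi> ((\<rho> / v) ^ 3 * c ^ 3 * g b)"
    proof -
      have "(\<rho> / v * c / \<kappa> b) ^ 3 = (\<rho> / v) ^ 3 * c ^ 3 * g b"
        by (simp add: g_def power_mult_distrib power_divide divide_inverse power_inverse)
      then show ?thesis using \<chi>_cube[of "\<rho> / v * c / \<kappa> b"] \<kappa>F[OF b] v \<rho> c by simp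
    qed
    also have "\<chi> ((\<rho> / v) ^ 3 * c ^ 3 * g b) = \<chi> (P c * g b + 1 / v * c\<^sup>2 * g b)"
      by (simp add: P_def algebra_simps)
    also have "\<dots> = \<chi> (P c * g b) * \<chi> (1 / v * c\<^sup>2 * g b)"
      using F1[OF b] v \<rho> c by (intro \<chi>_add) (simp_all add: P_def)
    finally have "(\<Sum>a\<in>F. G b a * \<chi> (a * c)) = (\<chi> (- ((L0 b)\<^sup>2 / m b)) * (\<Sum>a\<in>F. \<chi> (m b * a\<^sup>2)))
        * (\<chi> (s * c / v) * \<chi> (P c * g b)) * (\<chi> (1 / v * c\<^sup>2 * g b) * cnj (\<chi> (1 / v * c\<^sup>2 * g b)))"
      by (simp only: mult_ac)
    also have "\<chi> (1 / v * c\<^sup>2 * g b) * cnj (\<chi> (1 / v * c\<^sup>2 * g b)) = 1"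
      by (simp add: complex_norm_square[symmetric])
    finally have "x1 b * (\<Sum>a\<in>F. G b a * \<chi> (a * c)) = \<chi> (s * c / v) * (y b * \<chi> (P c * g b))"
      by (simp only: y_def mult_ac mult_1_left mult_1_right)
    then show ?thesis by (simp add: sum_distrib_left mult.assoc)
  qed (simp add: x1_def y_def)
  then have Four: "(\<Sum>a\<in>F. T1 a * \<chi> (a * c)) = \<chi> (s * c / v) * (\<Sum>b\<in>F. y b * \<chi> (P c * g b))" if "c \<in> F" for c
    unfolding T1_def sum_distrib_right sum_distrib_left using that by (subst sum.swap) simp
  have "real q * (\<Sum>a\<in>F. (cmod (T1 a))\<^sup>2) = (\<Sum>c\<in>F. (cmod (\<Sum>a\<in>F. T1 a * \<chi> (a * c)))\<^sup>2)"
    by (rule Parseval_F[symmetric])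
  also have "\<dots> = (\<Sum>c\<in>F. (cmod (\<Sum>b\<in>F. y b * \<chi> (P c * g b)))\<^sup>2)"
    using Four by (intro sum.cong refl) (simp add: norm_mult)
  also have "\<dots> \<le> real 3 * real q * (\<Sum>b\<in>F. (cmod (y b))\<^sup>2)"
  proof (rule sum_\<chi>_compose_le)
    show "P c \<in> F" if "c \<in> F" for c using that v \<rho> by (simp add: P_def)
    show "card {c \<in> F. P c = r} \<le> 3" for r
      unfolding P_def using v \<rho> by (intro card_cubic_fibre) auto
    have "inj_on g F"
    proof (rule inj_onI)
      fix b b' assume "b \<in> F" "b' \<in> F" "g b = g b'"
      then have "\<kappa> b = \<kappa> b'" using Frob_eq_iff[of "\<kappa> b" 1 "\<kappa> b'"] by (simp add: g_def)
      then show "b = b'" using bij_betw_imp_inj_on[OF \<kappa>] \<open>b \<in> F\<close> \<open>b' \<in> F\<close> by (auto dest: inj_onD)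
    qed
    then show "bij_betw g F F"
      unfolding bij_betw_def using F1(3) by (intro conjI endo_inj_surj) auto
  qed
  also have "(\<Sum>b\<in>F. (cmod (y b))\<^sup>2) = real q * (\<Sum>b\<in>F. (cmod (x1 b))\<^sup>2)"
    unfolding sum_distrib_left
  proof (intro sum.cong refl)
    fix b assume b: "b \<in> F"
    show "(cmod (y b))\<^sup>2 = real q * (cmod (x1 b))\<^sup>2"
    proof (cases "\<kappa> b = 0")
      case False
      then have "m b \<noteq> 0" using v by (simp add: m_def)
      then show ?thesis using sum_\<chi>_square[of "m b"] F1[OF b] by (simp add: y_def norm_mult power_mult_distrib)
    qed (simp add: y_def x1_def)
  qed
  finally have "real q * (\<Sum>a\<in>F. (cmod (T1 a))\<^sup>2) \<le> real q * (3 * real q * (\<Sum>b\<in>F. (cmod (x1 b))\<^sup>2))"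
    by (simp add: mult_ac)
  then have bound1: "(\<Sum>a\<in>F. (cmod (T1 a))\<^sup>2) \<le> 3 * real q * (\<Sum>b\<in>F. (cmod (x1 b))\<^sup>2)"
    using q_gt_1 by (simp add: mult_le_cancel_left_pos)
  \<comment> \<open>At most one summand is non-zero, since \<open>\<kappa>\<close> is injective on
    \<open>F\<close>.\<close>
  have bound0: "(cmod (\<Sum>b\<in>F. x0 b))\<^sup>2 \<le> (\<Sum>b\<in>F. (cmod (x0 b))\<^sup>2)"
  proof -
    define S where "S = {b \<in> F. \<kappa> b = 0}"
    have S: "S \<subseteq> F" "finite S" by (auto simp: S_def)
    have "b = b'" if "b \<in> S" "b' \<in> S" for b b'
      using inj_onD[OF bij_betw_imp_inj_on[OF \<kappa>], of b b'] that by (simp add: S_def)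
    then have "card S \<le> 1" using card_le_Suc0_iff_eq[OF S(2)] by simp
    have "(\<Sum>b\<in>F. x0 b) = (\<Sum>b\<in>S. x0 b)"
      using S by (intro sum.mono_neutral_right) (auto simp: S_def x0_def)
    then have "(cmod (\<Sum>b\<in>F. x0 b))\<^sup>2 \<le> real (card S) * (\<Sum>b\<in>S. (cmod (x0 b))\<^sup>2)"
      using sum_square_le_card[OF S(2)] by simp
    also have "\<dots> \<le> 1 * (\<Sum>b\<in>S. (cmod (x0 b))\<^sup>2)"
      using \<open>card S \<le> 1\<close> by (intro mult_right_mono sum_nonneg) auto
    also have "\<dots> \<le> (\<Sum>b\<in>F. (cmod (x0 b))\<^sup>2)" using S(1) by (simp add: sum_mono2)
    finally show ?thesis .
  qed
  have "(\<Sum>a\<in>F. (cmod (\<Sum>b\<in>F. x b * G b a))\<^sup>2) = (\<Sum>a\<in>F. (cmod ((\<Sum>b\<in>F. x0 b) + T1 a))\<^sup>2)"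
  proof (intro sum.cong refl)
    fix a
    have "(\<Sum>b\<in>F. x b * G b a) = (\<Sum>b\<in>F. x0 b + x1 b * G b a)"
      by (intro sum.cong refl) (simp add: x0_def x1_def G_def)
    then show "(cmod (\<Sum>b\<in>F. x b * G b a))\<^sup>2 = (cmod ((\<Sum>b\<in>F. x0 b) + T1 a))\<^sup>2"
      by (simp add: sum.distrib T1_def)
  qed
  also have "\<dots> \<le> (\<Sum>a\<in>F. 2 * (cmod (\<Sum>b\<in>F. x0 b))\<^sup>2 + 2 * (cmod (T1 a))\<^sup>2)"
  proof (intro sum_mono)
    fix a
    have "(cmod ((\<Sum>b\<in>F. x0 b) + T1 a))\<^sup>2 \<le> (cmod (\<Sum>b\<in>F. x0 b) + cmod (T1 a))\<^sup>2"
      by (intro power_mono norm_triangle_ineq) auto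
    also have "\<dots> \<le> 2 * (cmod (\<Sum>b\<in>F. x0 b))\<^sup>2 + 2 * (cmod (T1 a))\<^sup>2"
      using sum_squares_bound[of "cmod (\<Sum>b\<in>F. x0 b)" "cmod (T1 a)"] by (simp add: power2_sum)
    finally show "(cmod ((\<Sum>b\<in>F. x0 b) + T1 a))\<^sup>2 \<le> 2 * (cmod (\<Sum>b\<in>F. x0 b))\<^sup>2 + 2 * (cmod (T1 a))\<^sup>2" .
  qed
  also have "\<dots> = 2 * (real q * (cmod (\<Sum>b\<in>F. x0 b))\<^sup>2) + 2 * (\<Sum>a\<in>F. (cmod (T1 a))\<^sup>2)"
    by (simp add: sum.distrib card_F flip: sum_distrib_left)
  also have "\<dots> \<le> 2 * (real q * (\<Sum>b\<in>F. (cmod (x0 b))\<^sup>2)) + 2 * (3 * real q * (\<Sum>b\<in>F. (cmod (x1 b))\<^sup>2))"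
    using bound0 bound1 by (intro add_mono mult_left_mono) auto
  also have "\<dots> \<le> 6 * real q * ((\<Sum>b\<in>F. (cmod (x0 b))\<^sup>2) + (\<Sum>b\<in>F. (cmod (x1 b))\<^sup>2))"
    using mult_nonneg_nonneg[of "real q" "\<Sum>b\<in>F. (cmod (x0 b))\<^sup>2"] by (simp add: sum_nonneg algebra_simps)
  also have "(\<Sum>b\<in>F. (cmod (x0 b))\<^sup>2) + (\<Sum>b\<in>F. (cmod (x1 b))\<^sup>2) = (\<Sum>b\<in>F. (cmod (x b))\<^sup>2)"
    by (subst sum.distrib[symmetric]) (intro sum.cong, auto simp: x0_def x1_def)
  finally show ?thesis by (simp add: G_def)
qed

text \<open>Applying \<open>\<theta>\<close> inside \<open>\<chi>\<close> to the second and fourth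
  terms makes the phase a polynomial in \<open>a\<close> and \<open>\<theta> b\<close>.\<close>

lemma \<chi>_decagon:
  assumes "s \<in> F" "t \<in> F" "v \<in> F" "w \<in> F" "a \<in> F" "b \<in> F"
  shows "\<chi> (s * (a * \<theta> b) + t * (\<theta> a * b) + v * (a\<^sup>2 * \<theta> b) + w * (\<theta> a * b\<^sup>2)) =
    \<chi> ((s * a + v * a\<^sup>2 + \<theta> t * a ^ 3) * \<theta> b + \<theta> w * a ^ 3 * (\<theta> b)\<^sup>2)"
proof -
  have "\<theta> (t * (\<theta> a * b)) = \<theta> t * a ^ 3 * \<theta> b" "\<theta> (w * (\<theta> a * b\<^sup>2)) = \<theta> w * a ^ 3 * (\<theta> b)\<^sup>2"
    using \<theta>_\<theta>[OF assms(5)] by (simp_all only: power_mult_distrib mult.assoc power_commutes power2_eq_square)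
  then have "\<chi> (t * (\<theta> a * b)) = \<chi> (\<theta> t * a ^ 3 * \<theta> b)" "\<chi> (w * (\<theta> a * b\<^sup>2)) = \<chi> (\<theta> w * a ^ 3 * (\<theta> b)\<^sup>2)"
    using \<chi>_\<theta>[of "t * (\<theta> a * b)"] \<chi>_\<theta>[of "w * (\<theta> a * b\<^sup>2)"] assms by simp_all
  then show ?thesis using assms by (simp add: \<chi>_add distrib_right mult.assoc del: power_Suc)
qed

text \<open>If \<open>w = 0\<close>, the phase is linear in \<open>\<theta> b\<close> with a cubic
  polynomial in \<open>a\<close> as coefficient, and \<open>v = 0\<close> is the transposed case.
  Otherwise completing the square in \<open>\<theta> b\<close> leads to
  \<open>sum_\<chi>_kernel_le\<close>, up to a factor of modulus one that depends on
  \<open>a\<close> alone.\<close>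

lemma opnorm_decagon:
  assumes F: "s \<in> F" "t \<in> F" "v \<in> F" "w \<in> F" and nz: "\<not> (s = 0 \<and> t = 0 \<and> v = 0 \<and> w = 0)"
  shows "opnorm_le F (sqrt (real 6 * real q))
    (\<lambda>a b. \<chi> (s * (a * \<theta> b) + t * (\<theta> a * b) + v * (a\<^sup>2 * \<theta> b) + w * (\<theta> a * b\<^sup>2)))"
proof -
  have no_w: "opnorm_le F (sqrt (real 6 * real q))
    (\<lambda>a b. \<chi> (s * (a * \<theta> b) + t * (\<theta> a * b) + v * (a\<^sup>2 * \<theta> b) + 0 * (\<theta> a * b\<^sup>2)))"
    if F: "s \<in> F" "t \<in> F" "v \<in> F" and nz: "\<not> (s = 0 \<and> t = 0 \<and> v = 0)" for s t v
  proof (rule opnorm_le_fibres[OF _ _ Frob_bij])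
    fix a b assume "a \<in> F" "b \<in> F"
    then show "\<chi> (s * (a * \<theta> b) + t * (\<theta> a * b) + v * (a\<^sup>2 * \<theta> b) + 0 * (\<theta> a * b\<^sup>2)) =
        \<chi> ((s * a + v * a\<^sup>2 + \<theta> t * a ^ 3) * \<theta> b)"
      using \<chi>_decagon[of s t v 0 a b] F by (simp add: power_0_left)
  next
    show "s * a + v * a\<^sup>2 + \<theta> t * a ^ 3 \<in> F" if "a \<in> F" for a using that F by simp
    have "card {a \<in> F. s * a + v * a\<^sup>2 + \<theta> t * a ^ 3 = r} \<le> 3" for r
      using nz by (intro card_cubic_fibre) auto
    then show "card {a \<in> F. s * a + v * a\<^sup>2 + \<theta> t * a ^ 3 = r} \<le> 6" for r
      by (rule order_trans) simp
  qed simp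
  consider "w = 0" | "v = 0" | "v \<noteq> 0" "w \<noteq> 0" by blast
  then show ?thesis
  proof cases
    case 1
    then show ?thesis using no_w[of s t v] F nz by simp
  next
    case 2
    have "t * (a * B) + s * (A * b) + w * (a\<^sup>2 * B) + 0 * (A * b\<^sup>2) =
        s * (b * A) + t * (B * a) + 0 * (b\<^sup>2 * A) + w * (B * a\<^sup>2)" for a b A B :: 'a
      by (simp add: mult_ac add_ac)
    then have eq: "(\<lambda>a b. \<chi> (t * (a * \<theta> b) + s * (\<theta> a * b) + w * (a\<^sup>2 * \<theta> b) + 0 * (\<theta> a * b\<^sup>2))) =
        (\<lambda>a b. \<chi> (s * (b * \<theta> a) + t * (\<theta> b * a) + 0 * (b\<^sup>2 * \<theta> a) + w * (\<theta> b * a\<^sup>2)))"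
      by (intro ext arg_cong[of _ _ \<chi>])
    have nz': "\<not> (t = 0 \<and> s = 0 \<and> w = 0)" using nz 2 by blast
    have "opnorm_le F (sqrt (real 6 * real q))
        (\<lambda>a b. \<chi> (s * (b * \<theta> a) + t * (\<theta> b * a) + 0 * (b\<^sup>2 * \<theta> a) + w * (\<theta> b * a\<^sup>2)))"
      using no_w[OF F(2,1,4) nz'] unfolding eq .
    then show ?thesis unfolding 2 by (rule opnorm_le_swap)
  next
    case 3
    define w' where "w' = \<theta> w"
    have w': "w' \<in> F" "w' \<noteq> 0" using F 3 by (simp_all add: w'_def)
    \<comment> \<open>The shift that completes the square in \<open>\<theta> b\<close>, again with
      -1 as one half. Below, \<open>\<kappa> b\<close> is the cube root of
      \<open>\<theta> b + \<beta>\<close>.\<close>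
    define \<beta> where "\<beta> = - (\<theta> t / w')"
    have \<beta>: "\<beta> \<in> F" using F w' by (simp add: \<beta>_def)
    obtain \<beta>0 where \<beta>0: "\<beta>0 \<in> F" "\<beta>0 ^ 3 = \<beta>" using cube_root[OF \<beta>] by blast
    obtain \<rho> where \<rho>: "\<rho> \<in> F" "\<rho> ^ 3 = w'" using cube_root[OF w'(1)] by blast
    have \<rho>0: "\<rho> \<noteq> 0" using \<rho> w' by auto
    define \<kappa> where "\<kappa> = (\<lambda>b::'a. b ^ 3 ^ d + \<beta>0)"
    have \<kappa>F: "\<kappa> b \<in> F" if "b \<in> F" for b using that \<beta>0 by (simp add: \<kappa>_def)
    have \<kappa>: "bij_betw \<kappa> F F"
    proof -
      have "inj_on \<kappa> F" using Frob_eq_iff by (auto simp: inj_on_def \<kappa>_def)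
      then show ?thesis unfolding bij_betw_def using \<kappa>F by (intro conjI endo_inj_surj) auto
    qed
    define \<gamma> where "\<gamma> = (\<lambda>a. - (\<beta> * (s * a + v * a\<^sup>2)) - w' * a ^ 3 * \<beta>\<^sup>2)"
    have phase: "\<chi> (s * (a * \<theta> b) + t * (\<theta> a * b) + v * (a\<^sup>2 * \<theta> b) + w * (\<theta> a * b\<^sup>2)) =
        \<chi> (\<gamma> a) * \<chi> (\<kappa> b ^ 3 * (s * a + v * a\<^sup>2) + \<rho> * (\<kappa> b)\<^sup>2 * a)" if ab: "a \<in> F" "b \<in> F" for a b
    proof -
      have \<kappa>3: "\<kappa> b ^ 3 = \<theta> b + \<beta>" unfolding \<kappa>_def cube_add \<beta>0(2) by (simp add: mult.commute flip: power_mult)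
      have "(\<rho> * (\<kappa> b)\<^sup>2 * a) ^ 3 = w' * (\<kappa> b ^ 3)\<^sup>2 * a ^ 3"
        unfolding power_mult_distrib \<rho>(2) by (simp add: mult.commute flip: power_mult)
      then have "\<chi> (\<rho> * (\<kappa> b)\<^sup>2 * a) = \<chi> (w' * (\<kappa> b ^ 3)\<^sup>2 * a ^ 3)"
        using \<chi>_cube[of "\<rho> * (\<kappa> b)\<^sup>2 * a"] \<rho> \<kappa>F[OF ab(2)] ab by simp
      then have "\<chi> (\<kappa> b ^ 3 * (s * a + v * a\<^sup>2) + \<rho> * (\<kappa> b)\<^sup>2 * a) =
          \<chi> (\<kappa> b ^ 3 * (s * a + v * a\<^sup>2) + w' * (\<kappa> b ^ 3)\<^sup>2 * a ^ 3)"
        using \<rho>(1) \<kappa>F[OF ab(2)] ab F w' by (simp add: \<chi>_add)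
      then have "\<chi> (\<gamma> a) * \<chi> (\<kappa> b ^ 3 * (s * a + v * a\<^sup>2) + \<rho> * (\<kappa> b)\<^sup>2 * a) =
          \<chi> (\<gamma> a + (\<kappa> b ^ 3 * (s * a + v * a\<^sup>2) + w' * (\<kappa> b ^ 3)\<^sup>2 * a ^ 3))"
        using \<kappa>F[OF ab(2)] ab F w' \<beta> by (simp add: \<gamma>_def \<chi>_add)
      also have "\<gamma> a + (\<kappa> b ^ 3 * (s * a + v * a\<^sup>2) + w' * (\<kappa> b ^ 3)\<^sup>2 * a ^ 3) =
          (s * a + v * a\<^sup>2 - w' * \<beta> * a ^ 3) * \<theta> b + w' * a ^ 3 * (\<theta> b)\<^sup>2 + 3 * (w' * \<beta> * a ^ 3 * \<theta> b)"
        unfolding \<gamma>_def \<kappa>3 by (simp add: power2_eq_square algebra_simps)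
      also have "w' * \<beta> = - \<theta> t" using w' by (simp add: \<beta>_def)
      finally show ?thesis using \<chi>_decagon[OF F ab] by (simp add: three_eq_0 w'_def)
    qed
    show ?thesis
    proof (rule opnorm_le_swap, rule opnorm_leI)
      show "sqrt (real 6 * real q) > 0" using q_gt_1 by simp
      fix x :: "'a \<Rightarrow> complex"
      have "(\<Sum>a\<in>F. (cmod (\<Sum>b\<in>F. \<chi> (s * (a * \<theta> b) + t * (\<theta> a * b) + v * (a\<^sup>2 * \<theta> b) + w * (\<theta> a * b\<^sup>2)) * x b))\<^sup>2) =
          (\<Sum>a\<in>F. (cmod (\<Sum>b\<in>F. x b * \<chi> (\<kappa> b ^ 3 * (s * a + v * a\<^sup>2) + \<rho> * (\<kappa> b)\<^sup>2 * a)))\<^sup>2)"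
      proof (rule sum.cong[OF refl])
        fix a assume a: "a \<in> F"
        have "(\<Sum>b\<in>F. \<chi> (s * (a * \<theta> b) + t * (\<theta> a * b) + v * (a\<^sup>2 * \<theta> b) + w * (\<theta> a * b\<^sup>2)) * x b) =
            \<chi> (\<gamma> a) * (\<Sum>b\<in>F. x b * \<chi> (\<kappa> b ^ 3 * (s * a + v * a\<^sup>2) + \<rho> * (\<kappa> b)\<^sup>2 * a))"
          unfolding sum_distrib_left using phase[OF a] by (intro sum.cong refl) (simp add: mult_ac)
        then show "(cmod (\<Sum>b\<in>F. \<chi> (s * (a * \<theta> b) + t * (\<theta> a * b) + v * (a\<^sup>2 * \<theta> b) + w * (\<theta> a * b\<^sup>2)) * x b))\<^sup>2 =
            (cmod (\<Sum>b\<in>F. x b * \<chi> (\<kappa> b ^ 3 * (s * a + v * a\<^sup>2) + \<rho> * (\<kappa> b)\<^sup>2 * a)))\<^sup>2"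
          by (simp add: norm_mult)
      qed
      also have "\<dots> \<le> 6 * real q * (\<Sum>b\<in>F. (cmod (x b))\<^sup>2)"
        using F 3 \<rho>(1) \<rho>0 \<kappa> by (intro sum_\<chi>_kernel_le) auto
      finally show "(\<Sum>a\<in>F. (cmod (\<Sum>b\<in>F. \<chi> (s * (a * \<theta> b) + t * (\<theta> a * b) + v * (a\<^sup>2 * \<theta> b) + w * (\<theta> a * b\<^sup>2)) * x b))\<^sup>2)
          \<le> (sqrt (real 6 * real q))\<^sup>2 * (\<Sum>b\<in>F. (cmod (x b))\<^sup>2)" by simp
    qed
  qed
qed

text \<open>The even vertices of a decagon supply the nodes \<open>a i\<close>, the odd ones the
  values \<open>k i = \<theta> (b i)\<close>; the four coordinates give the four relations of
  \<open>decagon_free_algebra\<close>.\<close>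

lemma lambda_free_C10_field:
  assumes n: "q ^ 5 \<le> n"
  shows "lambda_free n (cycle_graph 10) \<ge> sqrt (real q) / 4"
proof -
  define f where "f = (\<lambda>i (a::'a) b. if i = (0::nat) then a * \<theta> b else if i = 1 then \<theta> a * b
    else if i = 2 then a\<^sup>2 * \<theta> b else \<theta> a * b\<^sup>2)"
  define \<tau> where "\<tau> = (\<lambda>i :: nat. if i = 0 then 1 else if i = 1 then 0 else if i = 2 then 3 else 2 :: nat)"
  have less4: "i < 4 \<longleftrightarrow> i = 0 \<or> i = 1 \<or> i = 2 \<or> i = 3" for i :: nat by auto
  have \<tau>: "\<tau> i < 4" "\<tau> (\<tau> i) = i" if "i < 4" for i using that by (auto simp: \<tau>_def less4)
  let ?E = "matching_adj 4 \<tau> f"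
  have "lambda_free n (cycle_graph 10) \<ge> 1 + (real q - 1) / (sqrt (real 6 * real q) + 1)"
  proof (rule lambda_free_ge_matching[of 4 \<tau> f])
    show "\<tau> i < 4" "\<tau> (\<tau> i) = i" if "i < 4" for i using \<tau>[OF that] by auto
    show "f i a b \<in> F" if "a \<in> F" "b \<in> F" for i a b using that by (simp add: f_def)
    show "f (\<tau> i) b a = f i a b" if "i < 4" for i a b
      using that by (auto simp: f_def \<tau>_def less4)
    show "q ^ Suc 4 \<le> n" using n by (simp add: eval_nat_numeral)
    show "\<exists>b. (a, b) \<in> parcs (cycle_graph 10)" if "a \<in> pverts (cycle_graph 10)" for a
      using that by (intro cycle_graph_arcs) auto
    fix c assume c: "c \<in> tuples 4" "\<exists>i<4. c i \<noteq> 0"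
    have cF: "- c 0 \<in> F" "- c 1 \<in> F" "- c 2 \<in> F" "- c 3 \<in> F" using tuplesD[OF c(1)] by auto
    have "opnorm_le F (sqrt (real 6 * real q))
        (\<lambda>a b. \<chi> (- c 0 * (a * \<theta> b) + - c 1 * (\<theta> a * b) + - c 2 * (a\<^sup>2 * \<theta> b) + - c 3 * (\<theta> a * b\<^sup>2)))"
      using c(2) by (intro opnorm_decagon cF) (auto simp: less4)
    moreover have "- (\<Sum>i<4. c i * f i a b) =
        - c 0 * (a * \<theta> b) + - c 1 * (\<theta> a * b) + - c 2 * (a\<^sup>2 * \<theta> b) + - c 3 * (\<theta> a * b\<^sup>2)" for a b
      by (simp add: f_def eval_nat_numeral)
    ultimately show "opnorm_le F (sqrt (real 6 * real q)) (\<lambda>a b. \<chi> (- (\<Sum>i<4. c i * f i a b)))" by simp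
  next
    show "\<not> embeds (cycle_graph 10) (F \<times> tuples 4) (\<lambda>u v. u \<noteq> v \<and> ?E u v)"
    proof
      assume "embeds (cycle_graph 10) (F \<times> tuples 4) (\<lambda>u v. u \<noteq> v \<and> ?E u v)"
      then obtain h where h: "inj_on h {..<10}" "\<And>i. i < 10 \<Longrightarrow> h i \<in> F \<times> tuples 4"
        "\<And>i. i < 10 \<Longrightarrow> h i \<noteq> h (Suc i mod 10) \<and> ?E (h i) (h (Suc i mod 10))"
        by (rule embeds_cycleD) blast
      have EE: "?E (h i) (h j)" "?E (h j) (h i)" if "i < 10" "j = Suc i mod 10" for i j
        using h(3)[OF that(1)] that(2)
        by (auto simp: matching_adj_def f_def \<tau>_def less4 add.commute mult.commute)
      have ne: "fst (h i) \<noteq> fst (h k)" if "i < 10" "k < 10" "i \<noteq> k" "?E (h j) (h i)" "?E (h j) (h k)" for i j k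
      proof
        assume eq: "fst (h i) = fst (h k)"
        have "h i = h k"
          using matching_adj_unique[of 4 \<tau> f "h j" "h i" "h k"] \<tau> that h(2) eq by blast
        then show False using h(1) that by (auto simp: inj_on_def)
      qed
      define a b where "a = (\<lambda>i. fst (h (2 * i)))" and "b = (\<lambda>i. fst (h (2 * i + 1)))"
      have F: "a i \<in> F" "b i \<in> F" if "i < 5" for i
        using h(2)[of "2 * i"] h(2)[of "2 * i + 1"] that by (auto simp: a_def b_def)
      have E: "?E (h (2 * i)) (h (2 * i + 1))" "?E (h (2 * (Suc i mod 5))) (h (2 * i + 1))" if "i < 5" for i
      proof -
        have "Suc (2 * i + 1) mod 10 = 2 * (Suc i mod 5)" using mult_mod_right[of 2 "Suc i" 5] by simp
        then show "?E (h (2 * i)) (h (2 * i + 1))" "?E (h (2 * (Suc i mod 5))) (h (2 * i + 1))"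
          using EE(1)[of "2 * i" "2 * i + 1"] EE(2)[of "2 * i + 1" "2 * (Suc i mod 5)"] that by auto
      qed
      \<comment> \<open>Each vertex lies on two edges of the cycle, which enter with opposite signs,
        so its coordinates cancel.\<close>
      have alt: "g 0 0 - g 1 0 + (g 1 1 - g 2 1) + (g 2 2 - g 3 2) + (g 3 3 - g 4 3) + (g 4 4 - g 0 4) = 0"
        if g: "\<And>i. i < 5 \<Longrightarrow> U i + W i = g i i" "\<And>i. i < 5 \<Longrightarrow> U (Suc i mod 5) + W i = g (Suc i mod 5) i"
        for g :: "nat \<Rightarrow> nat \<Rightarrow> 'a" and U W
      proof -
        have "g 0 0 = U 0 + W 0" "g 1 0 = U 1 + W 0" "g 1 1 = U 1 + W 1" "g 2 1 = U 2 + W 1" "g 2 2 = U 2 + W 2"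
          "g 3 2 = U 3 + W 2" "g 3 3 = U 3 + W 3" "g 4 3 = U 4 + W 3" "g 4 4 = U 4 + W 4" "g 0 4 = U 0 + W 4"
          using g(1)[of 0] g(2)[of 0] g(1)[of 1] g(2)[of 1] g(1)[of 2] g(2)[of 2] g(1)[of 3] g(2)[of 3] g(1)[of 4] g(2)[of 4]
          by (simp_all add: numeral_2_eq_2[symmetric])
        then show ?thesis by (simp add: algebra_simps)
      qed
      define k where "k = (\<lambda>i. \<theta> (b i))"
      have A1: "a 0 * k 0 - a 1 * k 0 + (a 1 * k 1 - a 2 * k 1) + (a 2 * k 2 - a 3 * k 2) + (a 3 * k 3 - a 4 * k 3)
          + (a 4 * k 4 - a 0 * k 4) = 0"
      proof (rule alt[of "\<lambda>i. snd (h (2 * i)) 0" "\<lambda>i. snd (h (2 * i + 1)) 1" "\<lambda>i j. a i * k j"])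
        fix i :: nat assume "i < 5"
        then show "snd (h (2 * i)) 0 + snd (h (2 * i + 1)) 1 = a i * k i"
          "snd (h (2 * (Suc i mod 5))) 0 + snd (h (2 * i + 1)) 1 = a (Suc i mod 5) * k i"
          using E[of i] by (auto simp: matching_adj_def f_def \<tau>_def less4 a_def b_def k_def)
      qed
      have A2: "(a 0)\<^sup>2 * k 0 - (a 1)\<^sup>2 * k 0 + ((a 1)\<^sup>2 * k 1 - (a 2)\<^sup>2 * k 1) + ((a 2)\<^sup>2 * k 2 - (a 3)\<^sup>2 * k 2)
          + ((a 3)\<^sup>2 * k 3 - (a 4)\<^sup>2 * k 3) + ((a 4)\<^sup>2 * k 4 - (a 0)\<^sup>2 * k 4) = 0"
      proof (rule alt[of "\<lambda>i. snd (h (2 * i)) 2" "\<lambda>i. snd (h (2 * i + 1)) 3" "\<lambda>i j. (a i)\<^sup>2 * k j"])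
        fix i :: nat assume "i < 5"
        then show "snd (h (2 * i)) 2 + snd (h (2 * i + 1)) 3 = (a i)\<^sup>2 * k i"
          "snd (h (2 * (Suc i mod 5))) 2 + snd (h (2 * i + 1)) 3 = (a (Suc i mod 5))\<^sup>2 * k i"
          using E[of i] by (auto simp: matching_adj_def f_def \<tau>_def less4 a_def b_def k_def)
      qed
      \<comment> \<open>Coordinate 1 of the even vertices carries \<open>\<theta> a * b\<close>;
        \<open>\<theta>\<close> turns this into \<open>a ^ 3 * \<theta> b\<close>. The same works
        for coordinate 3 in \<open>A4\<close>.\<close>
      have A3: "a 0 ^ 3 * k 0 - a 1 ^ 3 * k 0 + (a 1 ^ 3 * k 1 - a 2 ^ 3 * k 1) + (a 2 ^ 3 * k 2 - a 3 ^ 3 * k 2)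
          + (a 3 ^ 3 * k 3 - a 4 ^ 3 * k 3) + (a 4 ^ 3 * k 4 - a 0 ^ 3 * k 4) = 0"
      proof (rule alt[of "\<lambda>i. \<theta> (snd (h (2 * i)) 1)" "\<lambda>i. \<theta> (snd (h (2 * i + 1)) 0)" "\<lambda>i j. a i ^ 3 * k j"])
        fix i :: nat assume i: "i < 5"
        have "snd (h (2 * i)) 1 + snd (h (2 * i + 1)) 0 = \<theta> (a i) * b i"
          "snd (h (2 * (Suc i mod 5))) 1 + snd (h (2 * i + 1)) 0 = \<theta> (a (Suc i mod 5)) * b i"
          using E[OF i] by (auto simp: matching_adj_def f_def \<tau>_def less4 a_def b_def)
        then show "\<theta> (snd (h (2 * i)) 1) + \<theta> (snd (h (2 * i + 1)) 0) = a i ^ 3 * k i"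
          "\<theta> (snd (h (2 * (Suc i mod 5))) 1) + \<theta> (snd (h (2 * i + 1)) 0) = a (Suc i mod 5) ^ 3 * k i"
          using \<theta>_\<theta>[OF F(1)[OF i]] \<theta>_\<theta>[OF F(1), of "Suc i mod 5"]
          by (simp_all only: Frob_add[symmetric] power_mult_distrib k_def mod_less_divisor zero_less_numeral)
      qed
      have A4: "a 0 ^ 3 * (k 0)\<^sup>2 - a 1 ^ 3 * (k 0)\<^sup>2 + (a 1 ^ 3 * (k 1)\<^sup>2 - a 2 ^ 3 * (k 1)\<^sup>2)
          + (a 2 ^ 3 * (k 2)\<^sup>2 - a 3 ^ 3 * (k 2)\<^sup>2) + (a 3 ^ 3 * (k 3)\<^sup>2 - a 4 ^ 3 * (k 3)\<^sup>2)
          + (a 4 ^ 3 * (k 4)\<^sup>2 - a 0 ^ 3 * (k 4)\<^sup>2) = 0"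
      proof (rule alt[of "\<lambda>i. \<theta> (snd (h (2 * i)) 3)" "\<lambda>i. \<theta> (snd (h (2 * i + 1)) 2)" "\<lambda>i j. a i ^ 3 * (k j)\<^sup>2"])
        fix i :: nat assume i: "i < 5"
        have "snd (h (2 * i)) 3 + snd (h (2 * i + 1)) 2 = \<theta> (a i) * (b i)\<^sup>2"
          "snd (h (2 * (Suc i mod 5))) 3 + snd (h (2 * i + 1)) 2 = \<theta> (a (Suc i mod 5)) * (b i)\<^sup>2"
          using E[OF i] by (auto simp: matching_adj_def f_def \<tau>_def less4 a_def b_def)
        moreover have "\<theta> ((b i)\<^sup>2) = (k i)\<^sup>2" by (simp only: k_def power_commutes power2_eq_square power_mult_distrib)
        ultimately show "\<theta> (snd (h (2 * i)) 3) + \<theta> (snd (h (2 * i + 1)) 2) = a i ^ 3 * (k i)\<^sup>2"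
          "\<theta> (snd (h (2 * (Suc i mod 5))) 3) + \<theta> (snd (h (2 * i + 1)) 2) = a (Suc i mod 5) ^ 3 * (k i)\<^sup>2"
          using \<theta>_\<theta>[OF F(1)[OF i]] \<theta>_\<theta>[OF F(1), of "Suc i mod 5"]
          by (simp_all only: Frob_add[symmetric] power_mult_distrib mod_less_divisor zero_less_numeral)
      qed
      have kne: "k i \<noteq> k j" if "fst (h (2 * i + 1)) \<noteq> fst (h (2 * j + 1))" for i j
        using that Frob_eq_iff[of "b i" "d + 1" "b j"] unfolding k_def by (simp only: b_def) simp
      show False
      proof (rule decagon_free_algebra[OF three_eq_0, of "a 0" "a 1" "a 2" "a 3" "a 4" "k 0" "k 4" "k 1" "k 2" "k 3"])
        show "a 0 \<noteq> a 1" using ne[of 0 2 1] EE[of 0 1] EE[of 1 2] by (simp add: a_def)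
        show "a 1 \<noteq> a 2" using ne[of 2 4 3] EE[of 2 3] EE[of 3 4] by (simp add: a_def)
        show "a 2 \<noteq> a 3" using ne[of 4 6 5] EE[of 4 5] EE[of 5 6] by (simp add: a_def)
        show "a 3 \<noteq> a 4" using ne[of 6 8 7] EE[of 6 7] EE[of 7 8] by (simp add: a_def)
        show "a 4 \<noteq> a 0" using ne[of 8 0 9] EE[of 8 9] EE[of 9 0] by (simp add: a_def)
        show "k 0 \<noteq> k 4" using ne[of 1 9 0] EE[of 0 1] EE[of 9 0] by (intro kne) simp
        show "k 1 \<noteq> k 0" using ne[of 3 1 2] EE[of 1 2] EE[of 2 3] by (intro kne) simp
        show "k 2 \<noteq> k 1" using ne[of 5 3 4] EE[of 3 4] EE[of 4 5] by (intro kne) simp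
        show "k 3 \<noteq> k 2" using ne[of 7 5 6] EE[of 5 6] EE[of 6 7] by (intro kne) simp
        show "k 4 \<noteq> k 3" using ne[of 9 7 8] EE[of 7 8] EE[of 8 9] by (intro kne) simp
      qed (rule trans[OF _ A1] trans[OF _ A2] trans[OF _ A3] trans[OF _ A4], simp add: algebra_simps; fail)+
    qed
  qed simp_all
  moreover have "1 + (real q - 1) / (sqrt (real 6 * real q) + 1) \<ge> sqrt (real q) / 4"
  proof -
    define s where "s = sqrt (real q)"
    have s: "s \<ge> 0" "real q = s * s" by (simp_all add: s_def)
    have "sqrt 6 \<le> sqrt (3 * 3)" by (intro real_sqrt_le_mono) simp
    then have "sqrt (real 6 * real q) \<le> 3 * s"
      using s(1) by (simp add: s_def real_sqrt_mult mult_right_mono)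
    then have "(real q - 1) / (3 * s + 1) \<le> (real q - 1) / (sqrt (real 6 * real q) + 1)"
      using q_gt_1 s(1) by (intro divide_left_mono mult_pos_pos add_nonneg_pos) auto
    moreover have "1 + (real q - 1) / (3 * s + 1) \<ge> s / 4"
      using s by (simp add: field_simps)
    ultimately show ?thesis unfolding s_def[symmetric] by linarith
  qed
  ultimately show ?thesis by linarith
qed

end

lemma finite_subfield_K3: "finite_subfield_char3 TYPE(K3) (2 * d + 1) (3 ^ (2 * d + 1)) d"
  by unfold_locales (auto simp: CHAR_K3)

lemma lambda_free_C10: "\<exists>c>0. \<forall>n\<ge>1. lambda_free n (cycle_graph 10) \<ge> c * real n powr (1 / 10)"
proof (rule powr_lower_bound_of_geometric[where B = "3 ^ 10" and K = "3 ^ 5" and c = "1 / 4"])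
  show "lambda_free n (cycle_graph 10) \<ge> 1" if "n \<ge> 1" for n using that by (intro lambda_free_cycle_ge_1) auto
  fix j n :: nat assume n: "3 ^ 5 * (3 ^ 10) ^ j \<le> real n"
  define q :: nat where "q = 3 ^ (2 * j + 1)"
  interpret finite_subfield_char3 "2 * j + 1" q "TYPE(K3)" j
    unfolding q_def by (rule finite_subfield_K3)
  have "q ^ 5 = 3 ^ 5 * (3 ^ 10) ^ j" unfolding q_def power_mult[symmetric] power_add[symmetric]
    by (intro arg_cong[of _ _ "(^) 3"]) simp
  then have "real (q ^ 5) \<le> real n" using n by simp
  then have "lambda_free n (cycle_graph 10) \<ge> sqrt (real q) / 4" by (intro lambda_free_C10_field) (simp only: of_nat_le_iff)
  moreover have "sqrt (real q) \<ge> 3 ^ j"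
    by (intro real_le_rsqrt) (simp add: q_def power2_eq_square mult_2 power_add)
  moreover have "(((3::real) ^ 10) ^ j) powr (1 / 10) = 3 ^ j"
  proof -
    have eq: "((3::real) ^ 10) ^ j = (3 ^ j) powr 10"
    proof -
      have "((3::real) ^ 10) ^ j = (3 ^ j) ^ 10" by (metis mult.commute power_mult)
      also have "\<dots> = (3 ^ j) powr 10" by (rule powr_numeral[symmetric]) simp
      finally show ?thesis .
    qed
    show ?thesis unfolding eq powr_powr by simp
  qed
  ultimately show "lambda_free n (cycle_graph 10) \<ge> 1 / 4 * ((3 ^ 10) ^ j) powr (1 / 10)" by simp
qed auto

section \<open>Odd cycles\<close>

lemma sum_distinct_degrees_nonzero:
  fixes h :: "'k \<Rightarrow> 'b :: idom poly"
  assumes "finite A" and inj: "inj_on (\<lambda>k. degree (h k)) A" and h: "\<And>k. k \<in> A \<Longrightarrow> h k \<noteq> 0"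
    and w: "\<exists>k\<in>A. w k \<noteq> 0"
  shows "(\<Sum>k\<in>A. smult (w k) (h k)) \<noteq> 0"
proof -
  define A' where "A' = {k \<in> A. w k \<noteq> 0}"
  have A': "finite A'" "A' \<noteq> {}" using assms by (auto simp: A'_def)
  define N where "N = Max ((\<lambda>k. degree (h k)) ` A')"
  have "N \<in> (\<lambda>k. degree (h k)) ` A'" unfolding N_def using A' by (intro Max_in) auto
  then obtain k where k: "k \<in> A'" "degree (h k) = N" by auto
  have rest: "coeff (smult (w j) (h j)) N = 0" if j: "j \<in> A - {k}" for j
  proof (cases "w j = 0")
    case False
    then have "j \<in> A'" using j by (simp add: A'_def)
    then have "degree (h j) \<le> N" unfolding N_def using A' by (intro Max_ge) auto
    moreover have "degree (h j) \<noteq> N"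
      using inj_onD[OF inj, of j k] j k by (auto simp: A'_def)
    ultimately have "coeff (h j) N = 0" by (intro coeff_eq_0) simp
    then show ?thesis by simp
  qed simp
  have "coeff (\<Sum>j\<in>A. smult (w j) (h j)) N = (\<Sum>j\<in>A. coeff (smult (w j) (h j)) N)" by (rule coeff_sum)
  also have "\<dots> = coeff (smult (w k) (h k)) N + (\<Sum>j\<in>A - {k}. coeff (smult (w j) (h j)) N)"
    using k(1) assms(1) by (intro sum.remove) (auto simp: A'_def)
  also have "(\<Sum>j\<in>A - {k}. coeff (smult (w j) (h j)) N) = 0" using rest by (rule sum.neutral[OF ballI])
  finally have "coeff (\<Sum>j\<in>A. smult (w j) (h j)) N = coeff (smult (w k) (h k)) N" by simp
  also have "\<dots> \<noteq> 0" using k h[of k] by (auto simp: A'_def)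
  finally show ?thesis by auto
qed

lemma degree_sum_powers_of_2:
  fixes f :: "'b :: idom poly"
  assumes "degree f > 0"
  shows "degree (\<Sum>i<Suc m. f ^ 2 ^ i) = degree f * 2 ^ m"
proof (induction m)
  case (Suc m)
  have "degree (f ^ 2 ^ Suc m) = degree f * 2 ^ Suc m"
    using assms by (subst degree_power_eq) (auto simp: mult.commute)
  moreover have "degree (\<Sum>i<Suc m. f ^ 2 ^ i) < degree f * 2 ^ Suc m" unfolding Suc using assms by simp
  ultimately show ?case unfolding sum.lessThan_Suc[of _ "Suc m"] by (subst degree_add_eq_right) auto
qed simp

section \<open>Stepanov's method on an Artin-Schreier curve\<close>

text \<open>The pair \<open>(A, B)\<close> stands for the function \<open>A + B y\<close> on the curve \<open>y\<^sup>2 + y = f x\<close> with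
  \<open>degree f = 2 * g + 1\<close>; the degree of \<open>pole_poly g A B\<close> is its pole order at infinity.\<close>

definition pole_poly :: "nat \<Rightarrow> 'b :: idom poly \<Rightarrow> 'b poly \<Rightarrow> 'b poly" where
  "pole_poly g A B = pcompose A (monom 1 2) + monom 1 (2 * g + 1) * pcompose B (monom 1 2)"

lemma degree_pcompose_square: "degree (pcompose A (monom (1 :: 'b :: idom) 2)) = 2 * degree A"
  by (simp add: degree_pcompose degree_monom_eq)

lemma degree_monom_mult: "p \<noteq> 0 \<Longrightarrow> degree (monom (1 :: 'b :: idom) n * p) = n + degree p"
  by (subst degree_mult_eq) (auto simp: degree_monom_eq monom_eq_0_iff)

lemma pcompose_square_nonzero: "A \<noteq> 0 \<Longrightarrow> pcompose A (monom (1 :: 'b :: idom) 2) \<noteq> 0"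
  by (simp add: pcompose_eq_0_iff degree_monom_eq)

lemma degree_pole_poly_left:
  assumes "B = 0 \<or> 2 * degree B + (2 * g + 1) < 2 * degree A"
  shows "degree (pole_poly g A B) = 2 * degree A"
proof (cases "B = 0")
  case False
  then have "degree (monom 1 (2 * g + 1) * pcompose B (monom 1 2)) = 2 * g + 1 + 2 * degree B"
    by (simp only: degree_monom_mult pcompose_square_nonzero degree_pcompose_square not_False_eq_True)
  then have "degree (monom 1 (2 * g + 1) * pcompose B (monom 1 2)) < degree (pcompose A (monom 1 2))"
    using assms False degree_pcompose_square[of A] by auto
  then show ?thesis unfolding pole_poly_def by (simp only: degree_add_eq_left degree_pcompose_square)
next
  case True
  then show ?thesis
    by (simp only: pole_poly_def degree_pcompose_square pcompose_0 mult_zero_right add_0_right)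
qed

lemma degree_pole_poly_right:
  assumes "B \<noteq> 0" "2 * degree A < 2 * degree B + (2 * g + 1)"
  shows "degree (pole_poly g A B) = 2 * g + 1 + 2 * degree B"
proof -
  have "degree (monom 1 (2 * g + 1) * pcompose B (monom 1 2)) = 2 * g + 1 + 2 * degree B"
    using assms(1) by (simp only: degree_monom_mult pcompose_square_nonzero degree_pcompose_square not_False_eq_True)
  moreover from this have "degree (pcompose A (monom 1 2)) < degree (monom 1 (2 * g + 1) * pcompose B (monom 1 2))"
    using assms degree_pcompose_square[of A] by auto
  ultimately show ?thesis unfolding pole_poly_def by (simp only: degree_add_eq_right)
qed

lemma pole_poly_sum_smult:
  "pole_poly g (\<Sum>k\<in>S. smult (c k) (A k)) (\<Sum>k\<in>S. smult (c k) (B k)) = (\<Sum>k\<in>S. smult (c k) (pole_poly g (A k) (B k)))"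
  unfolding pole_poly_def
  by (simp add: pcompose_sum pcompose_smult sum_distrib_left sum.distrib smult_add_right)

lemma pole_poly_monom_mult:
  fixes A B :: "'b :: idom poly"
  shows "pole_poly g (monom 1 n * A) (monom 1 n * B) = monom 1 (2 * n) * pole_poly g A B"
proof -
  have "pcompose (monom 1 n) (monom 1 2) = monom (1 :: 'b :: idom) (2 * n)"
    by (induction n) (simp_all add: monom_Suc pcompose_pCons mult_monom monom_0)
  then show ?thesis by (simp add: pole_poly_def pcompose_mult distrib_left mult_ac)
qed

context finite_subfield_char2
begin

text \<open>Stepanov's method in Bombieri's form: a function \<open>\<Sum>\<^sub>k w\<^sub>k u\<^sub>k\<^sup>P v\<^sub>k\<close> that vanishes
  identically gives the function \<open>\<Sum>\<^sub>k w\<^sub>k\<^sup>P u\<^sub>k v\<^sub>k\<^sup>P\<close>, which vanishes at all rational points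
  but not identically. Here \<open>u\<^sub>k\<close> and \<open>v\<^sub>k\<close> are monomials \<open>x\<^sup>d y\<^sup>\<beta>\<close> and
  \<open>x\<^sup>i y\<^sup>\<tau>\<close>, and the first component \<open>\<beta> + 2 \<tau>\<close> of \<open>k\<close> encodes the exponents of \<open>y\<close>.\<close>

lemma Stepanov_bound:
  fixes f :: "'a poly"
  assumes e: "e = 2 * Suc m" and h: "h = 2 ^ m" and f: "degree f = 2 * g + 1" and big: "(g + 1)\<^sup>2 < 2 * h"
  defines "T \<equiv> \<Sum>i<Suc m. f ^ 2 ^ i"
  shows "card {x \<in> F. poly T x ^ (2 * h) = poly T x} \<le> 2 * h\<^sup>2 + (g + 1) * (2 * h)"
proof -
  define P where "P = 2 * h"
  have P: "P = 2 ^ Suc m" by (simp add: P_def h)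
  have h0: "h > 0" by (simp add: h)
  have gh: "g < h"
  proof -
    have "2 * g < (g + 1)\<^sup>2 + 1" by (simp add: power2_eq_square)
    then show ?thesis using big by linarith
  qed
  have qP: "q = P * P" unfolding q p2 e P by (simp only: mult_2 power_add)
  have T: "degree T = (2 * g + 1) * h" unfolding T_def h using f by (subst degree_sum_powers_of_2) auto
  have T0: "T \<noteq> 0" using T h0 by auto
  have T1: "T + 1 \<noteq> 0" "degree (T + 1) = (2 * g + 1) * h"
  proof -
    show "degree (T + 1) = (2 * g + 1) * h" using T h0 by (subst degree_add_eq_left) auto
    then show "T + 1 \<noteq> 0" using h0 by auto
  qed
  \<comment> \<open>The \<open>u\<close> are the monomials of pole order below \<open>P\<close>, the
    \<open>v\<close> those of pole order at most \<open>2 * (h + g)\<close>. A factor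
    \<open>y\<close> costs \<open>2 * g + 1\<close>, which explains the shorter ranges.\<close>
  define I where "I = ({0::nat} \<times> {..<h} \<times> {..<h + g + 1}) \<union> ({1} \<times> {..<h - g} \<times> {..<h + g + 1})
      \<union> ({2} \<times> {..<h} \<times> {..<h}) \<union> ({3} \<times> {..<h - g} \<times> {..<h})" (is "_ = ?I0 \<union> ?I1 \<union> ?I2 \<union> ?I3")
  have finI: "finite I" unfolding I_def by auto
  have cardI: "card I = (2 * h - g) * (2 * h + g + 1)"
  proof -
    have "card I = card (?I0 \<union> ?I1 \<union> ?I2) + card ?I3" unfolding I_def by (intro card_Un_disjoint) auto
    also have "card (?I0 \<union> ?I1 \<union> ?I2) = card (?I0 \<union> ?I1) + card ?I2" by (intro card_Un_disjoint) auto
    also have "card (?I0 \<union> ?I1) = card ?I0 + card ?I1" by (intro card_Un_disjoint) auto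
    finally have "card I = (h + (h - g)) * (h + g + 1) + (h + (h - g)) * h"
      by (simp only: card_cartesian_product card_lessThan distrib_right) simp
    also have "h + (h - g) = 2 * h - g" using gh by simp
    finally show ?thesis by (simp add: distrib_left)
  qed
  \<comment> \<open>On the curve \<open>y ^ P = y + T\<close> and \<open>y * y = y + f\<close>. So
    \<open>R + S y\<close> and \<open>R' + S y\<close> are the reduced forms of the
    \<open>y\<close>-parts of \<open>u ^ P * v\<close> and of \<open>u * v ^ P\<close>; their
    coefficients of \<open>y\<close> coincide.\<close>
  define R where "R = (\<lambda>\<kappa>::nat. if \<kappa> = 0 then 1 else if \<kappa> = 1 then T else if \<kappa> = 2 then 0 else f)"
  define S where "S = (\<lambda>\<kappa>::nat. if \<kappa> = 0 then 0 else if \<kappa> < 3 then 1 else T + 1)"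
  define R' where "R' = (\<lambda>\<kappa>::nat. if \<kappa> = 0 then 1 else if \<kappa> = 1 then 0 else if \<kappa> = 2 then T else f)"
  define \<Theta> where "\<Theta> = (\<lambda>(\<kappa>::nat, d, i) Q. monom 1 (d * P + i) * (Q \<kappa> :: 'a poly))"
  define G where "G = (\<lambda>(\<kappa>::nat, d, i) Q. monom 1 (d + i * P) * (Q \<kappa> :: 'a poly))"
  have I_cases: "(\<kappa> = 0 \<and> d + 1 \<le> h \<and> i \<le> h + g) \<or> (\<kappa> = 1 \<and> d + g + 1 \<le> h \<and> i \<le> h + g) \<or>
      (\<kappa> = 2 \<and> d + 1 \<le> h \<and> i + 1 \<le> h) \<or> (\<kappa> = 3 \<and> d + g + 1 \<le> h \<and> i + 1 \<le> h)" if "(\<kappa>, d, i) \<in> I" for \<kappa> d i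
    using that unfolding I_def by auto
  have deg_monom: "degree (monom 1 n * Q) \<le> n + degree Q" for n and Q :: "'a poly"
    by (rule order_trans[OF degree_mult_le]) (simp add: degree_monom_eq)
  have mono: "(d + c) * P \<le> h * P" if "d + c \<le> h" for d c using that by (rule mult_right_mono) simp
  have hP: "h * P = 2 * h\<^sup>2" by (simp add: P_def power2_eq_square)
  have deg\<Theta>: "degree (\<Theta> k R) \<le> 2 * h\<^sup>2 + g" "degree (\<Theta> k S) < 2 * h\<^sup>2" if kI: "k \<in> I" for k
  proof -
    obtain \<kappa> d i where k: "k = (\<kappa>, d, i)" by (metis prod.collapse)
    have c: "(\<kappa> = 0 \<and> d + 1 \<le> h \<and> i \<le> h + g) \<or> (\<kappa> = 1 \<and> d + (g + 1) \<le> h \<and> i \<le> h + g) \<or>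
      (\<kappa> = 2 \<and> d + 1 \<le> h \<and> i + 1 \<le> h) \<or> (\<kappa> = 3 \<and> d + (g + 1) \<le> h \<and> i + 1 \<le> h)"
      using I_cases[of \<kappa> d i] kI k by auto
    have 1: "degree (\<Theta> k R) \<le> d * P + i + degree (R \<kappa>)" "degree (\<Theta> k S) \<le> d * P + i + degree (S \<kappa>)"
      unfolding k \<Theta>_def by (auto intro: order_trans[OF deg_monom])
    have gP: "g \<le> g * P" using h0 by (simp add: P_def)
    have gP2: "(g + 1) * P = g * P + P" "(2 * g + 1) * h = g * P + h" by (simp_all add: P_def)
    have A1: "d * P + P \<le> 2 * h\<^sup>2" if "d + 1 \<le> h"
      using mono[OF that] hP by simp
    have A2: "d * P + (g * P + P) \<le> 2 * h\<^sup>2" if "d + (g + 1) \<le> h"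
      using mono[OF that] hP by (simp add: distrib_right)
    have Ph: "P = h + h" by (simp add: P_def)
    show "degree (\<Theta> k R) \<le> 2 * h\<^sup>2 + g"
    proof -
      have "degree T = g * P + h" "P \<le> h + h" "h + h \<le> P" using T gP2 Ph by simp_all
      then show ?thesis using c 1(1) A1 A2 f gP h0 by (elim disjE) (simp_all add: R_def)
    qed
    show "degree (\<Theta> k S) < 2 * h\<^sup>2"
    proof -
      consider "\<kappa> \<noteq> 3" "d * P + P \<le> 2 * h\<^sup>2 \<or> d * P + (g * P + P) \<le> 2 * h\<^sup>2" "i \<le> h + g"
        | "\<kappa> = 3" "d * P + (g * P + P) \<le> 2 * h\<^sup>2" "i + 1 \<le> h"
        using c A1 A2 by (elim disjE) auto
      then show ?thesis
      proof cases
        case 1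
        then have "degree (S \<kappa>) = 0" using c by (auto simp: S_def)
        then show ?thesis using 1 \<open>degree (\<Theta> k S) \<le> d * P + i + degree (S \<kappa>)\<close> gh Ph by linarith
      next
        case 2
        then have "degree (S \<kappa>) = g * P + h" using T1 gP2 by (simp add: S_def)
        then show ?thesis using 2 \<open>degree (\<Theta> k S) \<le> d * P + i + degree (S \<kappa>)\<close> h0 Ph by linarith
      qed
    qed
  qed
  have degG: "degree (G k R') \<le> 2 * h\<^sup>2 + (g + 1) * (2 * h)" "degree (G k S) \<le> 2 * h\<^sup>2 + (g + 1) * (2 * h)" if kI: "k \<in> I" for k
  proof -
    obtain \<kappa> d i where k: "k = (\<kappa>, d, i)" by (metis prod.collapse)
    have c: "(\<kappa> = 0 \<and> d + 1 \<le> h \<and> i \<le> h + g) \<or> (\<kappa> = 1 \<and> d + (g + 1) \<le> h \<and> i \<le> h + g) \<or>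
      (\<kappa> = 2 \<and> d + 1 \<le> h \<and> i + 1 \<le> h) \<or> (\<kappa> = 3 \<and> d + (g + 1) \<le> h \<and> i + 1 \<le> h)"
      using I_cases[of \<kappa> d i] kI k by auto
    have 1: "degree (G k R') \<le> d + i * P + degree (R' \<kappa>)" "degree (G k S) \<le> d + i * P + degree (S \<kappa>)"
      unfolding k G_def by (auto intro: order_trans[OF deg_monom])
    have gP2: "(g + 1) * (2 * h) = g * P + P" "(2 * g + 1) * h = g * P + h" by (simp_all add: P_def)
    have A1: "i * P + P \<le> 2 * h\<^sup>2" if "i + 1 \<le> h"
      using mono[OF that] hP by simp
    have A2: "i * P \<le> 2 * h\<^sup>2 + g * P" if "i \<le> h + g"
    proof -
      have "i * P \<le> (h + g) * P" using that by (rule mult_right_mono) simp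
      then show ?thesis using hP by (simp add: distrib_right)
    qed
    have Ph: "P = h + h" by (simp add: P_def)
    have gP: "g \<le> g * P" using h0 by (simp add: P_def)
    show "degree (G k R') \<le> 2 * h\<^sup>2 + (g + 1) * (2 * h)"
    proof -
      have "degree T = g * P + h" "P \<le> h + h" "h + h \<le> P" using T gP2 Ph by simp_all
      then show ?thesis unfolding gP2 using c 1(1) A1 A2 f gP h0 by (elim disjE) (simp_all add: R'_def)
    qed
    show "degree (G k S) \<le> 2 * h\<^sup>2 + (g + 1) * (2 * h)"
    proof -
      have "degree (T + 1) = g * P + h" "P \<le> h + h" "h + h \<le> P" using T1 gP2 Ph by simp_all
      then show ?thesis unfolding gP2 using c 1(2) A1 A2 gP h0 by (elim disjE) (simp_all add: S_def)
    qed
  qed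
  \<comment> \<open>One equation per coefficient of the two components; the numbers come from
    \<open>deg\<Theta>\<close>.\<close>
  define J where "J = ({True} \<times> {..<2 * h\<^sup>2 + g + 1}) \<union> ({False} \<times> {..<2 * h\<^sup>2})"
  define C where "C = (\<lambda>k (b, n). coeff (\<Theta> k (if b then R else S)) n)"
  have "card J = card ({True} \<times> {..<2 * h\<^sup>2 + g + 1}) + card ({False} \<times> {..<2 * h\<^sup>2})"
    unfolding J_def by (intro card_Un_disjoint) auto
  then have "card J = 4 * h\<^sup>2 + g + 1" by (simp add: card_cartesian_product)
  \<comment> \<open>There are \<open>4 * h * h + 2 * h - g * g - g\<close> unknowns, so this
    inequality is precisely the hypothesis \<open>big\<close>.\<close>
  also have "\<dots> < card I"
  proof -
    define a where "a = 2 * h - g"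
    have a: "2 * h = a + g" using gh by (simp add: a_def)
    have "g * g + 2 * g + 1 < a + g" using big unfolding a by (simp add: power2_eq_square)
    then have "(a + g) * (a + g) + g + 1 < a * (a + g + g + 1)" by (simp add: algebra_simps)
    moreover have "4 * h\<^sup>2 = 2 * h * (2 * h)" by (simp add: power2_eq_square)
    ultimately show ?thesis unfolding cardI a_def[symmetric] by (simp only: a)
  qed
  finally obtain w where w: "\<exists>k\<in>I. w k \<noteq> 0" "\<forall>b\<in>J. (\<Sum>k\<in>I. w k * C k b) = 0"
    using homogeneous_system_solution[OF _ finI, of J C] by (auto simp: J_def)
  have zero: "(\<Sum>k\<in>I. smult (w k) (\<Theta> k R)) = 0" "(\<Sum>k\<in>I. smult (w k) (\<Theta> k S)) = 0"
  proof -
    have "coeff (\<Sum>k\<in>I. smult (w k) (\<Theta> k R)) n = 0" for n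
    proof (cases "n < 2 * h\<^sup>2 + g + 1")
      case True
      then show ?thesis using w(2)[rule_format, of "(True, n)"] by (simp add: J_def C_def coeff_sum)
    next
      case False
      then have "coeff (\<Theta> k R) n = 0" if "k \<in> I" for k using deg\<Theta>(1)[OF that] by (intro coeff_eq_0) simp
      then show ?thesis by (simp add: coeff_sum)
    qed
    then show "(\<Sum>k\<in>I. smult (w k) (\<Theta> k R)) = 0" by (intro poly_eqI) simp
    have "coeff (\<Sum>k\<in>I. smult (w k) (\<Theta> k S)) n = 0" for n
    proof (cases "n < 2 * h\<^sup>2")
      case True
      then show ?thesis using w(2)[rule_format, of "(False, n)"] by (simp add: J_def C_def coeff_sum)
    next
      case False
      then have "coeff (\<Theta> k S) n = 0" if "k \<in> I" for k using deg\<Theta>(2)[OF that] by (intro coeff_eq_0) simp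
      then show ?thesis by (simp add: coeff_sum)
    qed
    then show "(\<Sum>k\<in>I. smult (w k) (\<Theta> k S)) = 0" by (intro poly_eqI) simp
  qed
  define G1 G2 where "G1 = (\<Sum>k\<in>I. smult (w k ^ P) (G k R'))" and "G2 = (\<Sum>k\<in>I. smult (w k ^ P) (G k S))"
  \<comment> \<open>The \<open>P\<close>-th power of the vanishing relation, evaluated where
    \<open>x ^ (P * P) = x\<close>. The condition on \<open>T\<close> says that
    \<open>y ^ (P * P) = y\<close> for the points above \<open>x\<close>; the argument is carried
    out on the two components, without mentioning \<open>y\<close>.\<close>
  have roots: "poly G1 x = 0 \<and> poly G2 x = 0" if x: "x \<in> F" "poly T x ^ P = poly T x" for x
  proof -
    have PP: "(x ^ (d * P + i)) ^ P = x ^ (d + i * P)" for d i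
    proof -
      have "(x ^ (d * P + i)) ^ P = (x ^ (P * P)) ^ d * x ^ (i * P)"
        by (simp add: power_add algebra_simps flip: power_mult)
      then show ?thesis using F_power_q[OF x(1)] by (simp add: qP power_add)
    qed
    have FS: "(\<Sum>k\<in>I. u k) ^ P = (\<Sum>k\<in>I. u k ^ P)" for u :: "_ \<Rightarrow> 'a"
      using Frob_sum[of u I "Suc m"] p2 P by simp
    have add1: "(y + 1 :: 'a) ^ P = y ^ P + 1" for y
      using Frob_add[of y 1 "Suc m"] p2 P by simp
    \<comment> \<open>Squaring shifts the exponents in \<open>T\<close> by one, so the square of
      \<open>T\<close> is \<open>T + f + f ^ P\<close>.\<close>
    have TT: "poly T x * (poly T x + 1) = poly f x + poly f x ^ P"
    proof -
      have "poly T x = (\<Sum>i<Suc m. poly f x ^ 2 ^ i)" by (simp add: T_def poly_sum poly_power)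
      moreover have "(\<Sum>i<Suc m. y ^ 2 ^ i) * ((\<Sum>i<Suc m. y ^ 2 ^ i) + 1) = y + y ^ 2 ^ Suc m" for y :: 'a
      proof -
        define s u z where "s = (\<Sum>i<Suc m. y ^ 2 ^ i)" and "u = (\<Sum>i<m. y ^ 2 ^ Suc i)" and "z = y ^ 2 ^ Suc m"
        have "s\<^sup>2 = (\<Sum>i<Suc m. y ^ 2 ^ Suc i)"
          using Frob_sum[of "\<lambda>i. y ^ 2 ^ i" "{..<Suc m}" 1] p2 by (simp add: s_def mult.commute flip: power_mult)
        then have 1: "s\<^sup>2 = u + z" by (simp only: u_def z_def sum.lessThan_Suc)
        have 2: "s = y + u" unfolding s_def u_def by (subst sum.lessThan_Suc_shift) simp
        have "s * (s + 1) = s\<^sup>2 + s" by (simp add: power2_eq_square distrib_left)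
        also have "\<dots> = u + z + (y + u)" unfolding 1 by (subst 2) (rule refl)
        also have "\<dots> = (y + z) + (u + u)" by (simp only: add_ac)
        finally show ?thesis unfolding s_def z_def by (simp only: add_self add_0_right)
      qed
      ultimately show ?thesis by (simp only: P)
    qed
    have kind: "poly (S \<kappa>) x ^ P = poly (S \<kappa>) x" "poly (R' \<kappa>) x = poly (R \<kappa>) x ^ P + poly T x * poly (S \<kappa>) x"
      if "\<kappa> < 4" for \<kappa>
    proof -
      have P0: "(0::'a) ^ P = 0" using h0 by (simp add: P_def power_0_left)
      show "poly (S \<kappa>) x ^ P = poly (S \<kappa>) x" using x(2) P0 by (auto simp: S_def add1)
      have "\<kappa> = 0 \<or> \<kappa> = 1 \<or> \<kappa> = 2 \<or> \<kappa> = 3" using that by auto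
      then consider "\<kappa> = 0" | "\<kappa> = 1" | "\<kappa> = 2" | "\<kappa> = 3" by blast
      then show "poly (R' \<kappa>) x = poly (R \<kappa>) x ^ P + poly T x * poly (S \<kappa>) x"
      proof cases
        case 4
        then show ?thesis using TT by (simp add: R'_def R_def S_def add_ac)
      qed (use x(2) P0 in \<open>simp_all add: R'_def R_def S_def\<close>)
    qed
    have termwise: "poly (G k S) x = poly (\<Theta> k S) x ^ P" "poly (G k R') x = poly (\<Theta> k R) x ^ P + poly T x * poly (G k S) x"
      if kI: "k \<in> I" for k
    proof -
      obtain \<kappa> d i where k: "k = (\<kappa>, d, i)" by (metis prod.collapse)
      have \<kappa>: "\<kappa> < 4" using kI by (auto simp: k I_def)
      show "poly (G k S) x = poly (\<Theta> k S) x ^ P"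
        using kind(1)[OF \<kappa>] PP[of d i] by (simp add: k G_def \<Theta>_def poly_monom power_mult_distrib)
      show "poly (G k R') x = poly (\<Theta> k R) x ^ P + poly T x * poly (G k S) x"
        using kind(2)[OF \<kappa>] PP[of d i]
        by (simp add: k G_def \<Theta>_def poly_monom power_mult_distrib distrib_left mult.left_commute)
    qed
    have z: "(\<Sum>k\<in>I. w k * poly (\<Theta> k R) x) = 0" "(\<Sum>k\<in>I. w k * poly (\<Theta> k S) x) = 0"
      using arg_cong[OF zero(1), of "\<lambda>p. poly p x"] arg_cong[OF zero(2), of "\<lambda>p. poly p x"]
      by (simp_all add: poly_sum)
    have "poly G2 x = (\<Sum>k\<in>I. (w k * poly (\<Theta> k S) x) ^ P)"
      unfolding G2_def poly_sum using termwise(1) by (intro sum.cong refl) (simp add: power_mult_distrib)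
    also have "\<dots> = (\<Sum>k\<in>I. w k * poly (\<Theta> k S) x) ^ P" by (rule FS[symmetric])
    finally have G2: "poly G2 x = 0" unfolding z(2) using h0 by (simp add: P_def power_0_left)
    have "poly G1 x = (\<Sum>k\<in>I. (w k * poly (\<Theta> k R) x) ^ P + poly T x * (w k ^ P * poly (G k S) x))"
      unfolding G1_def poly_sum using termwise(2)
      by (intro sum.cong refl) (simp add: power_mult_distrib distrib_left mult.left_commute)
    also have "\<dots> = (\<Sum>k\<in>I. w k * poly (\<Theta> k R) x) ^ P + poly T x * poly G2 x"
      unfolding FS by (simp add: sum.distrib G2_def poly_sum sum_distrib_left)
    finally have "poly G1 x = 0" unfolding z(1) G2 using h0 by (simp add: P_def power_0_left)
    with G2 show ?thesis by simp
  qed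
  have nonzero: "G1 \<noteq> 0 \<or> G2 \<noteq> 0"
  proof -
    \<comment> \<open>The pole order of \<open>u * v ^ P\<close>. That of \<open>u\<close> is below
      \<open>P\<close>, so division by \<open>P\<close> with remainder recovers both orders, and
      their parities recover the exponents of \<open>y\<close>.\<close>
    define ord where "ord = (\<lambda>(\<kappa>::nat, d, i). (2 * i + (if \<kappa> < 2 then 0 else 2 * g + 1)) * P + (2 * d + (if odd \<kappa> then 2 * g + 1 else 0)))"
    have degE: "degree (pole_poly g (G k R') (G k S)) = ord k" "pole_poly g (G k R') (G k S) \<noteq> 0" if kI: "k \<in> I" for k
    proof -
      obtain \<kappa> d i where k: "k = (\<kappa>, d, i)" by (metis prod.collapse)
      have eq: "pole_poly g (G k R') (G k S) = monom 1 (2 * (d + i * P)) * pole_poly g (R' \<kappa>) (S \<kappa>)"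
        by (simp add: k G_def pole_poly_monom_mult)
      have P2: "P \<ge> 2" using h0 by (simp add: P_def)
      have TP: "2 * degree T = (2 * g + 1) * P" "2 * degree (T + 1) = (2 * g + 1) * P" using T T1 by (simp_all add: P_def)
      have gPP: "(2 * g + 1) * P \<ge> (2 * g + 1) * 2" using P2 by (intro mult_left_mono) auto
      consider "\<kappa> = 0" | "\<kappa> = 1" | "\<kappa> = 2" | "\<kappa> = 3" using kI by (auto simp: k I_def)
      then have D: "degree (pole_poly g (R' \<kappa>) (S \<kappa>)) = (if \<kappa> < 2 then 0 else (2 * g + 1) * P) + (if odd \<kappa> then 2 * g + 1 else 0) \<and>
          pole_poly g (R' \<kappa>) (S \<kappa>) \<noteq> 0"
      proof cases
        case 1
        then show ?thesis by (simp add: R'_def S_def pole_poly_def)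
      next
        case 2
        then show ?thesis by (simp add: R'_def S_def pole_poly_def degree_monom_eq monom_eq_0_iff)
      next
        case 3
        have "degree (pole_poly g T 1) = 2 * degree T"
          using TP gPP by (intro degree_pole_poly_left) simp
        then have "degree (pole_poly g T 1) = (2 * g + 1) * P" "degree (pole_poly g T 1) \<noteq> 0" using TP gPP P2 by simp_all
        then show ?thesis using 3 by (auto simp: R'_def S_def)
      next
        case 4
        have "degree (pole_poly g f (T + 1)) = 2 * g + 1 + 2 * degree (T + 1)"
          using TP gPP T1 f by (intro degree_pole_poly_right) simp_all
        then have "degree (pole_poly g f (T + 1)) = (2 * g + 1) * P + (2 * g + 1)" using TP by simp
        moreover from this have "pole_poly g f (T + 1) \<noteq> 0" by auto
        ultimately show ?thesis using 4 by (simp add: R'_def S_def)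
      qed
      show "pole_poly g (G k R') (G k S) \<noteq> 0" unfolding eq using D by (simp add: monom_eq_0_iff)
      show "degree (pole_poly g (G k R') (G k S)) = ord k"
        unfolding eq degree_monom_mult[OF conjunct2[OF D]] using D by (simp add: ord_def k algebra_simps)
    qed
    have "inj_on (\<lambda>k. degree (pole_poly g (G k R') (G k S))) I"
    proof (rule inj_onI)
      fix k k' assume kI: "k \<in> I" "k' \<in> I" and eq: "degree (pole_poly g (G k R') (G k S)) = degree (pole_poly g (G k' R') (G k' S))"
      obtain \<kappa> d i \<kappa>' d' i' where k: "k = (\<kappa>, d, i)" "k' = (\<kappa>', d', i')" by (metis prod.collapse)
      define a b a' b' where "a = 2 * i + (if \<kappa> < 2 then 0 else 2 * g + 1)" and "b = 2 * d + (if odd \<kappa> then 2 * g + 1 else 0)"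
        and "a' = 2 * i' + (if \<kappa>' < 2 then 0 else 2 * g + 1)" and "b' = 2 * d' + (if odd \<kappa>' then 2 * g + 1 else 0)"
      have "a * P + b = a' * P + b'" using eq degE kI by (simp add: k ord_def a_def b_def a'_def b'_def)
      moreover have bP: "b < P" "b' < P" using I_cases[of \<kappa> d i] I_cases[of \<kappa>' d' i'] kI by (auto simp: k b_def b'_def P_def)
      ultimately have ab: "a = a'" "b = b'"
      proof -
        have "(a * P + b) div P = a" "(a' * P + b') div P = a'" "(a * P + b) mod P = b" "(a' * P + b') mod P = b'"
          using bP by simp_all
        then show "a = a'" "b = b'" using \<open>a * P + b = a' * P + b'\<close> by metis+
      qed
      have par: "(\<kappa> < 2) = (\<kappa>' < 2)" "odd \<kappa> = odd \<kappa>'"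
        using arg_cong[OF ab(1), of even] arg_cong[OF ab(2), of even] unfolding a_def a'_def b_def b'_def
        by (auto split: if_splits)
      have "\<kappa> < 4" "\<kappa>' < 4" using kI by (auto simp: k I_def)
      then have "\<kappa> = \<kappa>'" using par by presburger
      moreover have "i = i'" "d = d'" using ab par unfolding a_def a'_def b_def b'_def by (auto split: if_splits)
      ultimately show "k = k'" by (simp add: k)
    qed
    moreover have "\<exists>k\<in>I. w k ^ P \<noteq> 0" using w(1) by auto
    ultimately have "(\<Sum>k\<in>I. smult (w k ^ P) (pole_poly g (G k R') (G k S))) \<noteq> 0"
      using sum_distinct_degrees_nonzero[OF finI, of "\<lambda>k. pole_poly g (G k R') (G k S)" "\<lambda>k. w k ^ P"] degE(2) by blast
    then have "pole_poly g G1 G2 \<noteq> 0" unfolding G1_def G2_def pole_poly_sum_smult .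
    then show ?thesis by (auto simp: pole_poly_def)
  qed
  have deg: "degree G1 \<le> 2 * h\<^sup>2 + (g + 1) * (2 * h)" "degree G2 \<le> 2 * h\<^sup>2 + (g + 1) * (2 * h)"
    unfolding G1_def G2_def using finI degG
    by (auto intro!: degree_sum_le intro: order_trans[OF degree_smult_le])
  have "card {x \<in> F. poly T x ^ P = poly T x} \<le> 2 * h\<^sup>2 + (g + 1) * (2 * h)"
    if G: "Q \<noteq> 0" "degree Q \<le> 2 * h\<^sup>2 + (g + 1) * (2 * h)"
      "\<And>x. x \<in> F \<Longrightarrow> poly T x ^ P = poly T x \<Longrightarrow> poly Q x = 0" for Q
  proof -
    have "card {x \<in> F. poly T x ^ P = poly T x} \<le> card {x. poly Q x = 0}"
      using G(3) by (intro card_mono poly_roots_finite[OF G(1)]) auto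
    also have "\<dots> \<le> degree Q" by (rule card_poly_roots_bound[OF G(1)])
    finally show ?thesis using G(2) by linarith
  qed
  then show ?thesis using nonzero deg roots unfolding P_def[symmetric] by metis
qed

section \<open>Character sums in characteristic 2\<close>

lemma tr_cases:
  assumes "y \<in> F"
  shows "tr y = 0 \<or> tr y = 1"
proof -
  have "(of_nat (idx (tr y)) :: 'a) = of_nat (idx (tr y) mod 2)" using of_nat_eq_iff_mod p2 by simp
  moreover have "idx (tr y) mod 2 = 0 \<or> idx (tr y) mod 2 = 1" by linarith
  ultimately show ?thesis using of_nat_idx[OF assms] by (elim disjE) simp_all
qed

definition \<epsilon> :: "'a \<Rightarrow> real" where "\<epsilon> y = (if tr y = 0 then 1 else - 1)"

lemma \<chi>_eq_\<epsilon>: "y \<in> F \<Longrightarrow> \<chi> y = of_real (\<epsilon> y)"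
proof (cases "tr y = 0")
  case True
  assume "y \<in> F"
  then show ?thesis using \<chi>_eqI[of y 0] True by (simp add: \<epsilon>_def)
next
  case False
  assume y: "y \<in> F"
  have "\<chi> y = cis (2 * pi * real 1 / real p)"
    using tr_cases[OF y] False by (intro \<chi>_eqI[OF y]) simp
  then have "\<chi> y = - 1" by (simp add: p2)
  then show ?thesis using False by (simp add: \<epsilon>_def)
qed

lemma \<epsilon>_add: "x \<in> F \<Longrightarrow> y \<in> F \<Longrightarrow> \<epsilon> (x + y) = \<epsilon> x * \<epsilon> y"
  using \<chi>_add[of x y] \<chi>_eq_\<epsilon>[of x] \<chi>_eq_\<epsilon>[of y] \<chi>_eq_\<epsilon>[of "x + y"]
  by (simp flip: of_real_mult)

text \<open>\<open>Stepanov_bound\<close> only limits the number of \<open>x\<close> with trace 0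
  from above. Adding a constant of trace 1 exchanges the two classes, so both have at most
  \<open>q / 2\<close> elements plus an error term; as they add up to \<open>q\<close>, neither can
  be much smaller.\<close>

lemma sum_\<epsilon>_poly_bound:
  fixes f :: "'a poly"
  assumes e: "e = 2 * Suc m" and h: "h = 2 ^ m" and f: "degree f = 2 * g + 1" and big: "(g + 1)\<^sup>2 < 2 * h"
    and fF: "\<And>x. x \<in> F \<Longrightarrow> poly f x \<in> F"
  shows "\<bar>\<Sum>x\<in>F. \<epsilon> (poly f x)\<bar> \<le> 4 * (real g + 1) * real h"
proof -
  have q4: "real q = 4 * (real h)\<^sup>2"
  proof -
    have "q = 2 * h * (2 * h)" unfolding q p2 e h power_Suc[symmetric] by (simp only: mult_2 power_add)
    then show ?thesis by (simp add: power2_eq_square)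
  qed
  have count: "real (card {x \<in> F. tr (poly f' x) = 0}) \<le> 2 * (real h)\<^sup>2 + 2 * (real g + 1) * real h"
    if f': "degree f' = 2 * g + 1" "\<And>x. x \<in> F \<Longrightarrow> poly f' x \<in> F" for f'
  proof -
    \<comment> \<open>As \<open>e = 2 * Suc m\<close>, the trace is the half sum \<open>T\<close>
      plus its power with exponent \<open>2 ^ Suc m\<close>. Trace 0 therefore means
      \<open>T ^ (2 * h) = T\<close>.\<close>
    have "{x \<in> F. tr (poly f' x) = 0} \<subseteq> {x \<in> F. poly (\<Sum>i<Suc m. f' ^ 2 ^ i) x ^ (2 * h) = poly (\<Sum>i<Suc m. f' ^ 2 ^ i) x}"
    proof safe
      fix x assume x: "x \<in> F" "tr (poly f' x) = 0"
      define y where "y = poly f' x"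
      have T: "poly (\<Sum>i<Suc m. f' ^ 2 ^ i) x = (\<Sum>i<Suc m. y ^ 2 ^ i)" by (simp add: y_def poly_sum poly_power)
      have split: "(\<Sum>i<a + b. u i) = (\<Sum>i<a. u i) + (\<Sum>i<b. u (a + i))" for a b and u :: "nat \<Rightarrow> 'a"
        by (induction b) (simp_all add: add.assoc)
      have "tr y = (\<Sum>i<e. y ^ p ^ i)" by (rule tr_def)
      also have "\<dots> = (\<Sum>i<Suc m + Suc m. y ^ 2 ^ i)" by (simp only: p2 e mult_2)
      also have "\<dots> = (\<Sum>i<Suc m. y ^ 2 ^ i) + (\<Sum>i<Suc m. y ^ 2 ^ (Suc m + i))" by (rule split)
      also have "(\<Sum>i<Suc m. y ^ 2 ^ (Suc m + i)) = (\<Sum>i<Suc m. (y ^ 2 ^ i) ^ 2 ^ Suc m)"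
        by (intro sum.cong refl) (simp only: power_add mult.commute flip: power_mult)
      also have "\<dots> = (\<Sum>i<Suc m. y ^ 2 ^ i) ^ 2 ^ Suc m"
        using Frob_sum[of "\<lambda>i. y ^ 2 ^ i" "{..<Suc m}" "Suc m"] unfolding p2 by (rule HOL.sym)
      finally have "(\<Sum>i<Suc m. y ^ 2 ^ i) + (\<Sum>i<Suc m. y ^ 2 ^ i) ^ 2 ^ Suc m = 0" using x(2) y_def by simp
      then have "(\<Sum>i<Suc m. y ^ 2 ^ i) = (\<Sum>i<Suc m. y ^ 2 ^ i) ^ 2 ^ Suc m" by (simp only: add_eq_0_iff)
      then show "poly (\<Sum>i<Suc m. f' ^ 2 ^ i) x ^ (2 * h) = poly (\<Sum>i<Suc m. f' ^ 2 ^ i) x"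
        unfolding T h power_Suc[symmetric] by (rule HOL.sym)
    qed
    then have "card {x \<in> F. tr (poly f' x) = 0} \<le> card {x \<in> F. poly (\<Sum>i<Suc m. f' ^ 2 ^ i) x ^ (2 * h) = poly (\<Sum>i<Suc m. f' ^ 2 ^ i) x}"
      by (intro card_mono) auto
    also have "\<dots> \<le> 2 * h\<^sup>2 + (g + 1) * (2 * h)" using e h f'(1) big by (rule Stepanov_bound)
    finally have "real (card {x \<in> F. tr (poly f' x) = 0}) \<le> real (2 * h\<^sup>2 + (g + 1) * (2 * h))"
      by (simp only: of_nat_le_iff)
    then show ?thesis by (simp add: algebra_simps)
  qed
  define N0 N1 where "N0 = {x \<in> F. tr (poly f x) = 0}" and "N1 = {x \<in> F. tr (poly f x) \<noteq> 0}"
  have N: "N0 \<union> N1 = F" "N0 \<inter> N1 = {}" "finite N0" "finite N1" by (auto simp: N0_def N1_def)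
  have cN: "real (card N0) + real (card N1) = real q"
    using card_Un_disjoint[OF N(3,4,2)] N(1) card_F by simp
  have sum: "(\<Sum>x\<in>F. \<epsilon> (poly f x)) = real (card N0) - real (card N1)"
  proof -
    have "(\<Sum>x\<in>F. \<epsilon> (poly f x)) = (\<Sum>x\<in>N0. \<epsilon> (poly f x)) + (\<Sum>x\<in>N1. \<epsilon> (poly f x))"
      using N by (metis sum.union_disjoint)
    also have "(\<Sum>x\<in>N0. \<epsilon> (poly f x)) = (\<Sum>x\<in>N0. 1)" by (intro sum.cong) (auto simp: N0_def \<epsilon>_def)
    also have "(\<Sum>x\<in>N1. \<epsilon> (poly f x)) = (\<Sum>x\<in>N1. - 1)" by (intro sum.cong) (auto simp: N1_def \<epsilon>_def)
    finally show ?thesis by simp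
  qed
  have 0: "real (card N0) \<le> 2 * (real h)\<^sup>2 + 2 * (real g + 1) * real h"
    unfolding N0_def by (rule count[OF f fF])
  have 1: "real (card N1) \<le> 2 * (real h)\<^sup>2 + 2 * (real g + 1) * real h"
  proof -
    obtain \<gamma> where \<gamma>: "\<gamma> \<in> F" "\<chi> \<gamma> \<noteq> 1" using ex_\<chi>_neq_1 by blast
    then have tr\<gamma>: "tr \<gamma> = 1" using tr_cases[of \<gamma>] \<chi>_eq_\<epsilon>[of \<gamma>] by (auto simp: \<epsilon>_def)
    have "N1 = {x \<in> F. tr (poly (f + [:\<gamma>:]) x) = 0}"
      using tr_cases fF by (auto simp: N1_def tr_add tr\<gamma>)
    moreover have "degree (f + [:\<gamma>:]) = 2 * g + 1" using f by (subst degree_add_eq_left) auto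
    ultimately show ?thesis using count[of "f + [:\<gamma>:]"] fF \<gamma> by auto
  qed
  show ?thesis unfolding sum using 0 1 cN q4 by (simp add: abs_le_iff algebra_simps)
qed

text \<open>Even power sums are squares in characteristic 2, so all power sums up to \<open>2 * t\<close> vanish; interpolation
  at the values other than \<open>c\<close> isolates the multiplicity of \<open>c\<close>.\<close>

lemma even_multiplicity_of_odd_power_sums:
  fixes z :: "'i \<Rightarrow> 'a"
  assumes I: "finite I" "card I \<le> 2 * t" and z: "\<And>i. i \<in> I \<Longrightarrow> z i \<noteq> 0"
    and sums: "\<And>j. j < t \<Longrightarrow> (\<Sum>i\<in>I. z i ^ (2 * j + 1)) = 0"
  shows "even (card {i \<in> I. z i = c})"
proof (cases "c \<in> z ` I")
  case False
  then have "{i \<in> I. z i = c} = {}" by auto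
  then show ?thesis by (simp only: card.empty even_zero)
next
  case True
  have pow: "(\<Sum>i\<in>I. z i ^ k) = 0" if "0 < k" "k \<le> 2 * t" for k
    using that
  proof (induction k rule: less_induct)
    case (less k)
    show ?case
    proof (cases "even k")
      case True
      then obtain k' where k': "k = k' * 2" by (elim evenE) simp
      then have "(\<Sum>i\<in>I. z i ^ k') = 0" using less by simp
      then show ?thesis using Frob_sum[of "\<lambda>i. z i ^ k'" I 1] p2 by (simp add: k' power_mult)
    next
      case False
      then obtain j where "k = 2 * j + 1" by (elim oddE) simp
      then show ?thesis using sums[of j] less.prems by simp
    qed
  qed
  define r where "r = (\<Prod>a\<in>z ` I - {c}. [:- a, 1:])"
  have "card (z ` I) \<le> 2 * t" "card (z ` I) > 0"
    using card_image_le[OF I(1), of z] I True by (auto simp: card_gt_0_iff)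
  then have "card (z ` I - {c}) < 2 * t" using True I(1) by (simp add: card_Diff_singleton)
  moreover have "degree r = card (z ` I - {c})"
    unfolding r_def by (subst degree_prod_eq_sum_degree) auto
  ultimately have deg: "degree r < 2 * t" by simp
  have "(\<Sum>i\<in>I. z i * poly r (z i)) = (\<Sum>i\<in>I. \<Sum>k\<le>degree r. coeff r k * z i ^ Suc k)"
    by (simp add: poly_altdef sum_distrib_left mult_ac)
  also have "\<dots> = (\<Sum>k\<le>degree r. coeff r k * (\<Sum>i\<in>I. z i ^ Suc k))"
    unfolding sum_distrib_left by (rule sum.swap)
  also have "\<dots> = 0"
  proof (intro sum.neutral ballI)
    fix k assume "k \<in> {..degree r}"
    then have "(\<Sum>i\<in>I. z i ^ Suc k) = 0" using deg by (intro pow) auto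
    then show "coeff r k * (\<Sum>i\<in>I. z i ^ Suc k) = 0" by (simp only: mult_zero_right)
  qed
  also have "(\<Sum>i\<in>I. z i * poly r (z i)) = (\<Sum>i\<in>{i \<in> I. z i = c}. c * poly r c)"
  proof (rule sum.mono_neutral_cong_right)
    show "\<forall>i\<in>I - {i \<in> I. z i = c}. z i * poly r (z i) = 0"
      using I(1) by (auto simp: r_def poly_prod prod_zero_iff)
  qed (use I in auto)
  also have "\<dots> = of_nat (card {i \<in> I. z i = c}) * (c * poly r c)" by simp
  finally have "of_nat (card {i \<in> I. z i = c}) * (c * poly r c) = 0" .
  moreover have "c \<noteq> 0" using True z by auto
  moreover have "poly r c \<noteq> 0" using I(1) by (simp add: r_def poly_prod prod_zero_iff)
  ultimately have "(of_nat (card {i \<in> I. z i = c}) :: 'a) = of_nat 0" by simp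
  then show ?thesis unfolding of_nat_eq_iff_mod p2 by presburger
qed

text \<open>The weight \<open>A u v\<close> counts the pairs in \<open>W0 \<times> W1\<close> that
  realise the edge, so the eigenvalue at frequency \<open>c\<close> is \<open>s0 c * s1 c\<close>.
  The difference \<open>s0 c - s1 c\<close> is, up to the term of 0, a character sum of odd degree
  \<open>2 * t + 1\<close>, hence of order \<open>sqrt q\<close> for every \<open>c\<close>. A
  closed walk of length \<open>t\<close> would give \<open>2 * t\<close> non-zero elements with
  vanishing odd power sums, exactly \<open>t\<close> of them in \<open>W0\<close>, against the
  parity of \<open>t\<close>.\<close>

lemma lambda_free_odd_cycle_field:
  assumes t: "odd t" "t \<ge> 3" and e: "e = 2 * Suc m" and h: "h = 2 ^ m" and big: "(t + 1)\<^sup>2 < 2 * h"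
    and n: "q ^ t \<le> n"
  shows "lambda_free n (cycle_graph t) \<ge> real q / (16 * (real t + 2)\<^sup>2)"
proof -
  define W0 W1 where "W0 = {x \<in> F. x \<noteq> 0 \<and> tr (x ^ (2 * t + 1)) = 0}" and "W1 = {x \<in> F. x \<noteq> 0 \<and> tr (x ^ (2 * t + 1)) \<noteq> 0}"
  have fin: "finite W0" "finite W1" by (simp_all add: W0_def W1_def)
  have WF: "x \<in> F" "x \<noteq> 0" if "x \<in> W0 \<or> x \<in> W1" for x using that by (auto simp: W0_def W1_def)
  have disj: "x \<noteq> y" if "x \<in> W0" "y \<in> W1" for x y using that by (auto simp: W0_def W1_def)
  \<comment> \<open>The unit factor fits the product shape of \<open>bform_ge_Fourier\<close>, whose
    kernels then are numbers.\<close>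
  define V where "V = {()} \<times> tuples t"
  define ed where "ed = (\<lambda>(u :: unit \<times> (nat \<Rightarrow> 'a)) (v :: unit \<times> (nat \<Rightarrow> 'a)) (x::'a) y. \<forall>i<t. snd u i + snd v i = x ^ (2 * i + 1) + y ^ (2 * i + 1))"
  define A where "A = (\<lambda>u v. \<Sum>x\<in>W0. \<Sum>y\<in>W1. of_bool (ed u v x y) :: real)"
  define E where "E = (\<lambda>u v. \<exists>x\<in>W0. \<exists>y\<in>W1. ed u v x y)"
  define pw where "pw = (\<lambda>c (x::'a). \<Sum>i<t. c i * x ^ (2 * i + 1))"
  define s0 s1 where "s0 = (\<lambda>c. \<Sum>x\<in>W0. \<epsilon> (pw c x))" and "s1 = (\<lambda>c. \<Sum>x\<in>W1. \<epsilon> (pw c x))"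
  define L where "L = 4 * (real t + 2) * real h"
  define \<mu> where "\<mu> = L\<^sup>2 / 4"
  have q4: "q = 4 * h\<^sup>2"
  proof -
    have "q = 2 * h * (2 * h)" unfolding q p2 e h power_Suc[symmetric] by (simp only: mult_2 power_add)
    then show ?thesis by (simp add: power2_eq_square)
  qed
  have h0: "real h > 0" by (simp add: h)
  have \<mu>q: "\<mu> = (real t + 2)\<^sup>2 * real q" by (simp add: \<mu>_def L_def q4 power2_eq_square algebra_simps)
  have \<mu>0: "\<mu> > 0" using h0 by (simp add: \<mu>_def L_def)
  have tr0: "tr 0 = 0" using tr_add[of 0 0] by simp
  have pwF: "pw c x \<in> F" if "c \<in> tuples t" "x \<in> F" for c x
    unfolding pw_def using that by (intro F_sum) (simp add: tuplesD)
  have ed_sym: "ed u v x y \<longleftrightarrow> ed v u x y" for u v x y by (simp add: ed_def add.commute)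
  have A_sym: "A u v = A v u" for u v unfolding A_def using ed_sym by simp
  have E_sym: "symp E"
  proof (rule sympI)
    fix u v assume "E u v"
    then show "E v u" unfolding E_def ed_sym[of v u] .
  qed
  have diff: "\<bar>s0 c - s1 c\<bar> \<le> L" if c: "c \<in> tuples t" for c
  proof -
    \<comment> \<open>The leading term, which separates \<open>W0\<close> from \<open>W1\<close>,
      gives \<open>f\<close> the same odd degree for every \<open>c\<close>, including zero, so that
      no frequency is exceptional.\<close>
    define f where "f = monom 1 (2 * t + 1) + (\<Sum>i<t. monom (c i) (2 * i + 1))"
    have "degree (\<Sum>i<t. monom (c i) (2 * i + 1)) \<le> 2 * t"
      by (intro degree_sum_le) (auto intro!: order_trans[OF degree_monom_le])
    then have f: "degree f = 2 * t + 1"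
      unfolding f_def by (subst degree_add_eq_left) (auto simp: degree_monom_eq)
    have pf: "poly f x = x ^ (2 * t + 1) + pw c x" for x by (simp add: f_def pw_def poly_sum poly_monom)
    have "\<bar>\<Sum>x\<in>F. \<epsilon> (poly f x)\<bar> \<le> 4 * (real t + 1) * real h"
      using e h f big by (rule sum_\<epsilon>_poly_bound) (unfold pf, use pwF[OF c] in simp)
    moreover have "(\<Sum>x\<in>F. \<epsilon> (poly f x)) = 1 + (s0 c - s1 c)"
    proof -
      have F: "F = insert 0 (W0 \<union> W1)" "0 \<notin> W0 \<union> W1" "W0 \<inter> W1 = {}" by (auto simp: W0_def W1_def)
      have eW: "x \<in> W0 \<Longrightarrow> \<epsilon> (x ^ (2 * t + 1)) = 1" "x \<in> W1 \<Longrightarrow> \<epsilon> (x ^ (2 * t + 1)) = - 1" for x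
        by (simp_all add: \<epsilon>_def W0_def W1_def)
      have \<epsilon>f: "\<epsilon> (poly f x) = \<epsilon> (x ^ (2 * t + 1)) * \<epsilon> (pw c x)" if "x \<in> F" for x
        unfolding pf using pwF[OF c that] that by (intro \<epsilon>_add) auto
      have z: "\<epsilon> (poly f 0) = 1" by (simp add: pf pw_def \<epsilon>_def tr0 power_0_left)
      have "(\<Sum>x\<in>F. \<epsilon> (poly f x)) = \<epsilon> (poly f 0) + (\<Sum>x\<in>W0 \<union> W1. \<epsilon> (poly f x))"
        using F(2) fin by (subst F(1)) simp
      also have "(\<Sum>x\<in>W0 \<union> W1. \<epsilon> (poly f x)) = (\<Sum>x\<in>W0. \<epsilon> (poly f x)) + (\<Sum>x\<in>W1. \<epsilon> (poly f x))"
        using fin F(3) by (rule sum.union_disjoint)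
      also have "(\<Sum>x\<in>W0. \<epsilon> (poly f x)) = s0 c" unfolding s0_def
        using \<epsilon>f eW WF by (intro sum.cong refl) simp
      also have "(\<Sum>x\<in>W1. \<epsilon> (poly f x)) = - s1 c" unfolding s1_def sum_negf[symmetric]
        using \<epsilon>f eW WF by (intro sum.cong refl) simp
      finally show ?thesis using z by simp
    qed
    \<comment> \<open>The 1 is the term of \<open>x = 0\<close>, which belongs to neither class;
      \<open>t + 2\<close> instead of \<open>t + 1\<close> in \<open>L\<close> absorbs it.\<close>
    moreover have "4 * (real t + 1) * real h + 1 \<le> L"
    proof -
      have "real h \<ge> 1" by (simp add: h)
      then show ?thesis by (simp add: L_def algebra_simps)
    qed
    ultimately show ?thesis by linarith
  qed
  have prod: "s0 c * s1 c = ((s0 c + s1 c)\<^sup>2 - (s0 c - s1 c)\<^sup>2) / 4" for c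
    by (simp add: power2_eq_square algebra_simps)
  have sq: "(s0 c - s1 c)\<^sup>2 \<le> L\<^sup>2" if "c \<in> tuples t" for c
    using diff[OF that] by (rule power2_le_iff_abs_le[THEN iffD2, rotated]) (simp add: L_def)
  have prod_ge: "s0 c * s1 c \<ge> - \<mu>" if "c \<in> tuples t" for c
  proof -
    have "(0 - L\<^sup>2) / 4 \<le> ((s0 c + s1 c)\<^sup>2 - (s0 c - s1 c)\<^sup>2) / 4"
      using sq[OF that] by (intro divide_right_mono diff_mono) auto
    then show ?thesis unfolding prod \<mu>_def by simp
  qed
  have form: "bform V A x x \<ge> - \<mu> * (\<Sum>u\<in>V. (x u)\<^sup>2)" for x
    unfolding V_def
  proof (rule bform_ge_Fourier[where N = "real (q ^ t)" and C = "tuples t" and ep = "\<psi> t" and \<sigma> = id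
        and H = "\<lambda>c a b. of_real (s0 c * s1 c)"])
    show "real (q ^ t) > 0" using q_gt_1 by simp
    fix a u b v assume ab: "a \<in> {()}" "u \<in> tuples t" "b \<in> {()}" "v \<in> tuples t"
    have "(\<Sum>c\<in>tuples t. of_real (s0 c * s1 c) * \<psi> t c u * \<psi> t (id c) v) =
        (\<Sum>c\<in>tuples t. \<Sum>x\<in>W0. \<Sum>y\<in>W1. \<chi> (\<Sum>i<t. c i * (u i + v i + (x ^ (2 * i + 1) + y ^ (2 * i + 1)))))"
    proof (intro sum.cong refl)
      fix c assume c: "c \<in> tuples t"
      have S: "(\<Sum>i<t. c i * u i) \<in> F" "(\<Sum>i<t. c i * v i) \<in> F" using c ab by (auto intro!: F_sum simp: tuplesD)
      have "of_real (s0 c * s1 c) = (\<Sum>x\<in>W0. \<Sum>y\<in>W1. \<chi> (pw c x) * \<chi> (pw c y))"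
        unfolding s0_def s1_def sum_product of_real_sum
        using pwF[OF c] WF by (intro sum.cong refl) (simp add: \<chi>_eq_\<epsilon>)
      then have "of_real (s0 c * s1 c) * \<psi> t c u * \<psi> t (id c) v =
          (\<Sum>x\<in>W0. \<Sum>y\<in>W1. \<chi> (pw c x) * \<chi> (pw c y) * (\<psi> t c u * \<psi> t c v))"
        by (simp add: sum_distrib_right mult.assoc)
      also have "\<dots> = (\<Sum>x\<in>W0. \<Sum>y\<in>W1. \<chi> (\<Sum>i<t. c i * (u i + v i + (x ^ (2 * i + 1) + y ^ (2 * i + 1)))))"
      proof (intro sum.cong refl)
        fix x y assume "x \<in> W0" "y \<in> W1"
        then have xy: "pw c x \<in> F" "pw c y \<in> F" using pwF[OF c] WF by auto
        have "(\<Sum>i<t. c i * (u i + v i + (x ^ (2 * i + 1) + y ^ (2 * i + 1)))) =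
            pw c x + pw c y + ((\<Sum>i<t. c i * u i) + (\<Sum>i<t. c i * v i))"
          unfolding pw_def by (simp only: distrib_left sum.distrib add_ac)
        then show "\<chi> (pw c x) * \<chi> (pw c y) * (\<psi> t c u * \<psi> t c v) =
            \<chi> (\<Sum>i<t. c i * (u i + v i + (x ^ (2 * i + 1) + y ^ (2 * i + 1))))"
          using xy S by (simp only: \<psi>_def \<chi>_add F_closed(3))
      qed
      finally show "of_real (s0 c * s1 c) * \<psi> t c u * \<psi> t (id c) v =
          (\<Sum>x\<in>W0. \<Sum>y\<in>W1. \<chi> (\<Sum>i<t. c i * (u i + v i + (x ^ (2 * i + 1) + y ^ (2 * i + 1)))))" .
    qed
    also have "\<dots> = (\<Sum>x\<in>W0. \<Sum>y\<in>W1. \<Sum>c\<in>tuples t. \<chi> (\<Sum>i<t. c i * (u i + v i + (x ^ (2 * i + 1) + y ^ (2 * i + 1)))))"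
      by (subst sum.swap) (intro sum.cong refl sum.swap)
    also have "\<dots> = (\<Sum>x\<in>W0. \<Sum>y\<in>W1. of_real (real (q ^ t) * of_bool (ed (a, u) (b, v) x y)))"
    proof (intro sum.cong refl)
      fix x y assume "x \<in> W0" "y \<in> W1"
      then have "x \<in> F" "y \<in> F" using WF by auto
      then have "(\<Sum>c\<in>tuples t. \<chi> (\<Sum>i<t. c i * (u i + v i + (x ^ (2 * i + 1) + y ^ (2 * i + 1))))) =
          (if \<forall>i<t. u i + v i + (x ^ (2 * i + 1) + y ^ (2 * i + 1)) = 0 then of_nat (q ^ t) else 0)"
        using ab by (intro sum_\<chi>_tuples) (simp add: tuplesD)
      then show "(\<Sum>c\<in>tuples t. \<chi> (\<Sum>i<t. c i * (u i + v i + (x ^ (2 * i + 1) + y ^ (2 * i + 1))))) =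
          of_real (real (q ^ t) * of_bool (ed (a, u) (b, v) x y))"
        by (simp only: ed_def add_eq_0_iff snd_conv of_bool_def) auto
    qed
    also have "\<dots> = of_real (real (q ^ t) * A (a, u) (b, v))"
      by (simp only: A_def sum_distrib_left of_real_sum)
    finally show "complex_of_real (real (q ^ t) * A (a, u) (b, v)) =
        (\<Sum>c\<in>tuples t. of_real (s0 c * s1 c) * \<psi> t c u * \<psi> t (id c) v)" by (rule HOL.sym)
  next
    fix c and z :: "unit \<times> (nat \<Rightarrow> 'a) \<Rightarrow> real" and Z
    assume c: "c \<in> tuples t" and Z: "Z = (\<lambda>c a. \<Sum>u\<in>tuples t. of_real (z (a, u)) * \<psi> t c u)"
    define r where "r = (\<Sum>u\<in>tuples t. z ((), u) * \<epsilon> (\<Sum>i<t. c i * u i))"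
    have "Z c () = of_real r"
      unfolding Z r_def of_real_sum
    proof (intro sum.cong refl)
      fix u assume "u \<in> tuples t"
      then have "(\<Sum>i<t. c i * u i) \<in> F" using c by (auto intro!: F_sum simp: tuplesD)
      then show "of_real (z ((), u)) * \<psi> t c u = of_real (z ((), u) * \<epsilon> (\<Sum>i<t. c i * u i))"
        by (simp add: \<psi>_def \<chi>_eq_\<epsilon>)
    qed
    then have eq1: "(\<Sum>a\<in>{()}. \<Sum>b\<in>{()}. of_real (s0 c * s1 c) * Z c a * Z (id c) b) = of_real (s0 c * s1 c * r\<^sup>2)"
      and eq2: "cmod (Z c ()) = \<bar>r\<bar>"
      by (simp_all add: power2_eq_square)
    have "s0 c * s1 c * r\<^sup>2 \<ge> - \<mu> * r\<^sup>2" using prod_ge[OF c] by (rule mult_right_mono) simp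
    then show "Re (\<Sum>a\<in>{()}. \<Sum>b\<in>{()}. of_real (s0 c * s1 c) * Z c a * Z (id c) b) \<ge>
        - \<mu> / 2 * ((\<Sum>a\<in>{()}. (cmod (Z c a))\<^sup>2) + (\<Sum>b\<in>{()}. (cmod (Z (id c) b))\<^sup>2))"
      unfolding eq1 by (simp add: eq2)
  qed (use Parseval_tuples in auto)
  have V: "finite V" "card V = q ^ t" by (simp_all add: V_def card_cartesian_product card_tuples)
  have Vne: "V \<noteq> {}" using V q_gt_1 by (metis card.empty power_not_zero not_one_less_zero)
  have row: "(\<Sum>v\<in>V. A u v) = real (card W0) * real (card W1)" if u: "u \<in> V" for u
  proof -
    have "(\<Sum>v\<in>V. A u v) = (\<Sum>x\<in>W0. \<Sum>y\<in>W1. \<Sum>v\<in>V. of_bool (ed u v x y))"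
      unfolding A_def by (subst sum.swap) (intro sum.cong refl sum.swap)
    also have "\<dots> = (\<Sum>x\<in>W0. \<Sum>y\<in>W1. 1)"
    proof (intro sum.cong refl)
      fix x y assume "x \<in> W0" "y \<in> W1"
      then have xy: "x \<in> F" "y \<in> F" using WF by auto
      define v0 where "v0 = ((), \<lambda>i\<in>{..<t}. snd u i + (x ^ (2 * i + 1) + y ^ (2 * i + 1)))"
      have uF: "snd u i \<in> F" if "i < t" for i using u that by (auto simp: V_def tuplesD)
      have v0: "v0 \<in> V" unfolding v0_def V_def tuples_def using xy uF by auto
      have "ed u v x y \<longleftrightarrow> v = v0" if v: "v \<in> V" for v
      proof
        assume "ed u v x y"
        then have eq: "snd v i = snd v0 i" if "i < t" for i
        proof -
          have "snd v i = snd u i + (snd u i + snd v i)" by (simp flip: add.assoc)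
          also have "snd u i + snd v i = x ^ (2 * i + 1) + y ^ (2 * i + 1)" using \<open>ed u v x y\<close> that by (simp only: ed_def)
          also have "snd u i + (x ^ (2 * i + 1) + y ^ (2 * i + 1)) = snd v0 i" using that by (simp add: v0_def)
          finally show ?thesis .
        qed
        have "snd v = snd v0" using v v0 eq by (intro tuples_eqI[of _ t]) (auto simp: V_def)
        then show "v = v0" by (simp add: prod_eq_iff)
      next
        assume "v = v0"
        then show "ed u v x y" by (simp add: ed_def v0_def flip: add.assoc)
      qed
      then have "(\<Sum>v\<in>V. of_bool (ed u v x y)) = (\<Sum>v\<in>V. if v = v0 then 1 else 0 :: real)"
        by (intro sum.cong) auto
      then show "(\<Sum>v\<in>V. of_bool (ed u v x y)) = (1 :: real)" using v0 V(1) by simp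
    qed
    finally show ?thesis by simp
  qed
  have "lambda_free n (cycle_graph t) \<ge> 1 + (\<Sum>u\<in>V. \<Sum>v\<in>V. A u v) / (\<mu> * card V)"
  proof (rule lambda_free_ge[OF V(1) Vne _ E_sym _ _ _ _ \<mu>0 form])
    show "card V \<le> n" using V(2) n by simp
    show "\<exists>b. (a, b) \<in> parcs (cycle_graph t)" if "a \<in> pverts (cycle_graph t)" for a
      using that t by (intro cycle_graph_arcs) auto
    show "sym_on2 V A" using A_sym by (auto simp: sym_on2_def)
    show "u \<noteq> v \<and> E u v" if "u \<in> V" "v \<in> V" "A u v \<noteq> 0" for u v
    proof
      show E: "E u v"
      proof (rule ccontr)
        assume "\<not> E u v"
        then have "A u v = 0" unfolding A_def E_def by (intro sum.neutral ballI) auto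
        then show False using that by simp
      qed
      show "u \<noteq> v"
      proof
        assume "u = v"
        then obtain x y where xy: "x \<in> W0" "y \<in> W1" "ed u u x y" using E by (auto simp: E_def)
        have "snd u 0 + snd u 0 = x ^ (2 * 0 + 1) + y ^ (2 * 0 + 1)" using xy(3) t unfolding ed_def by (metis odd_pos)
        then have "x + y = 0" by simp
        then show False using disj[OF xy(1,2)] by simp
      qed
    qed
    show "\<not> embeds (cycle_graph t) V E"
    proof
      assume "embeds (cycle_graph t) V E"
      then obtain \<eta> where \<eta>: "\<And>i. i < t \<Longrightarrow> E (\<eta> i) (\<eta> (Suc i mod t))" by (rule embeds_cycleD) blast
      then have "\<forall>i. \<exists>xy. i < t \<longrightarrow> fst xy \<in> W0 \<and> snd xy \<in> W1 \<and> ed (\<eta> i) (\<eta> (Suc i mod t)) (fst xy) (snd xy)"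
        unfolding E_def by (metis fst_conv snd_conv)
      from choice[OF this] obtain xy where xy: "\<And>i. i < t \<Longrightarrow> fst (xy i) \<in> W0"
        "\<And>i. i < t \<Longrightarrow> snd (xy i) \<in> W1" "\<And>i. i < t \<Longrightarrow> ed (\<eta> i) (\<eta> (Suc i mod t)) (fst (xy i)) (snd (xy i))" by blast
      \<comment> \<open>Indexes the two field elements on each edge, with multiplicity. Summed
        around the cycle, each vertex occurs twice and cancels.\<close>
      define I where "I = {..<t} <+> {..<t}"
      define z where "z = case_sum (\<lambda>i. fst (xy i)) (\<lambda>i. snd (xy i))"
      have I: "finite I" "card I \<le> 2 * t" by (simp_all add: I_def card_Plus)
      have even: "even (card {i \<in> I. z i = c})" for c
      proof (rule even_multiplicity_of_odd_power_sums[OF I])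
        show "z i \<noteq> 0" if "i \<in> I" for i using that xy WF(2) by (auto simp: I_def z_def)
        fix j assume j: "j < t"
        have "(\<Sum>i\<in>I. z i ^ (2 * j + 1)) = (\<Sum>i<t. fst (xy i) ^ (2 * j + 1)) + (\<Sum>i<t. snd (xy i) ^ (2 * j + 1))"
          unfolding I_def by (subst sum.Plus) (simp_all add: z_def o_def)
        also have "\<dots> = (\<Sum>i<t. fst (xy i) ^ (2 * j + 1) + snd (xy i) ^ (2 * j + 1))" by (rule sum.distrib[symmetric])
        also have "\<dots> = (\<Sum>i<t. snd (\<eta> i) j + snd (\<eta> (Suc i mod t)) j)"
          using xy(3) j by (intro sum.cong refl) (simp add: ed_def)
        also have "\<dots> = (\<Sum>i<t. snd (\<eta> i) j) + (\<Sum>i<t. snd (\<eta> (Suc i mod t)) j)" by (rule sum.distrib)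
        also have "(\<Sum>i<t. snd (\<eta> (Suc i mod t)) j) = (\<Sum>i<t. snd (\<eta> i) j)"
        proof -
          obtain t' where t': "t = Suc t'" using t not0_implies_Suc[of t] by auto
          have "(\<Sum>i<t. snd (\<eta> (Suc i mod t)) j) = (\<Sum>i<t'. snd (\<eta> (Suc i mod t)) j) + snd (\<eta> (Suc t' mod t)) j"
            by (simp only: t' sum.lessThan_Suc)
          also have "(\<Sum>i<t'. snd (\<eta> (Suc i mod t)) j) = (\<Sum>i<t'. snd (\<eta> (Suc i)) j)"
            by (intro sum.cong refl) (simp add: t')
          also have "Suc t' mod t = 0" by (simp add: t')
          finally show ?thesis by (simp only: t' sum.lessThan_Suc_shift add.commute)
        qed
        finally show "(\<Sum>i\<in>I. z i ^ (2 * j + 1)) = 0" by (simp only: add_self)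
      qed
      \<comment> \<open>Each edge has exactly one of its two elements in \<open>W0\<close>, so an
        odd number \<open>t\<close> of indices falls there, although every value is taken an even
        number of times.\<close>
      have "{i \<in> I. z i \<in> W0} = Inl ` {..<t}"
      proof -
        have "snd (xy i) \<notin> W0" if "i < t" for i using xy(2)[OF that] disj by blast
        then show ?thesis using xy(1) by (auto simp: I_def z_def)
      qed
      then have "card {i \<in> I. z i \<in> W0} = t" by (simp add: card_image)
      moreover have "card {i \<in> I. z i \<in> W0} = (\<Sum>c\<in>W0. card {i \<in> I. z i = c})"
      proof -
        have "(\<Sum>c\<in>W0. \<Sum>i\<in>{i \<in> {i \<in> I. z i \<in> W0}. z i = c}. 1) = (\<Sum>i\<in>{i \<in> I. z i \<in> W0}. 1 :: nat)"
          using I(1) fin by (intro sum.group) auto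
        moreover have "(\<Sum>i\<in>{i \<in> {i \<in> I. z i \<in> W0}. z i = c}. 1 :: nat) = card {i \<in> I. z i = c}" if "c \<in> W0" for c
          using that by (auto intro!: arg_cong[of _ _ card])
        ultimately show ?thesis by simp
      qed
      moreover have "even (\<Sum>c\<in>W0. card {i \<in> I. z i = c})" using even by (intro dvd_sum) auto
      ultimately show False using t by simp
    qed
  qed
  moreover have "(\<Sum>u\<in>V. \<Sum>v\<in>V. A u v) / (\<mu> * card V) = real (card W0) * real (card W1) / \<mu>"
  proof -
    have "(\<Sum>u\<in>V. \<Sum>v\<in>V. A u v) = real (card V) * (real (card W0) * real (card W1))" by (simp add: row)
    moreover have "real (card V) \<noteq> 0" using V q_gt_1 by simp
    ultimately show ?thesis by simp
  qed
  moreover have "real (card W0) * real (card W1) \<ge> (real q - 1)\<^sup>2 / 4 - \<mu>"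
  proof -
    \<comment> \<open>At frequency zero \<open>s0\<close> and \<open>s1\<close> are the sizes of the
      two classes, and the bound on their difference shows that the classes are balanced.\<close>
    define c where "c = (\<lambda>i\<in>{..<t}. 0 :: 'a)"
    have c: "c \<in> tuples t" by (auto simp: c_def tuples_def)
    have "pw c x = 0" for x by (simp add: pw_def c_def)
    then have s: "s0 c = real (card W0)" "s1 c = real (card W1)" by (simp_all add: s0_def s1_def \<epsilon>_def tr0)
    have "F = insert 0 (W0 \<union> W1)" "0 \<notin> W0 \<union> W1" "W0 \<inter> W1 = {}" by (auto simp: W0_def W1_def)
    then have "card F = Suc (card W0 + card W1)" using fin by (simp add: card_Un_disjoint)
    then have "s0 c + s1 c = real q - 1" unfolding s by (simp add: card_F)
    then show ?thesis using sq[OF c] unfolding s[symmetric] prod \<mu>_def by (simp add: diff_divide_distrib)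
  qed
  then have "real (card W0) * real (card W1) / \<mu> \<ge> ((real q - 1)\<^sup>2 / 4 - \<mu>) / \<mu>"
    using \<mu>0 by (intro divide_right_mono) auto
  moreover have "((real q - 1)\<^sup>2 / 4 - \<mu>) / \<mu> = (real q - 1)\<^sup>2 / 4 / \<mu> - 1" using \<mu>0 by (simp add: diff_divide_distrib)
  moreover have "(real q - 1)\<^sup>2 / 4 / \<mu> \<ge> real q / (16 * (real t + 2)\<^sup>2)"
  proof -
    have "real q \<ge> 2" using q_gt_1 by simp
    then have "(real q / 2)\<^sup>2 \<le> (real q - 1)\<^sup>2" by (intro power_mono) auto
    then have "(real q / 2)\<^sup>2 / 4 / \<mu> \<le> (real q - 1)\<^sup>2 / 4 / \<mu>" using \<mu>0 by (intro divide_right_mono) auto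
    moreover have "(real q / 2)\<^sup>2 / 4 / \<mu> = real q / (16 * (real t + 2)\<^sup>2)"
      using q_gt_1 by (simp add: \<mu>q power2_eq_square)
    ultimately show ?thesis by simp
  qed
  ultimately show ?thesis by linarith
qed

end

lemma lambda_free_odd_cycle:
  assumes t: "odd t" "t \<ge> 3"
  shows "\<exists>c>0. \<forall>n\<ge>1. lambda_free n (cycle_graph t) \<ge> c * real n powr (1 / real t)"
proof -
  \<comment> \<open>With exponent \<open>m0 + j\<close> the condition \<open>big\<close> holds for
    every \<open>j\<close>; the price is the size of \<open>K\<close>.\<close>
  define m0 where "m0 = (t + 1)\<^sup>2"
  show ?thesis
  proof (rule powr_lower_bound_of_geometric[where B = "4 ^ t" and K = "4 ^ (t * (m0 + 1))" and c = "1 / (16 * (real t + 2)\<^sup>2)"])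
    show "lambda_free n (cycle_graph t) \<ge> 1" if "n \<ge> 1" for n using that t by (intro lambda_free_cycle_ge_1) auto
    show "(4 :: real) ^ t > 1" using t by (intro one_less_power) auto
    show "1 / (16 * (real t + 2)\<^sup>2) > 0" by (intro divide_pos_pos mult_pos_pos zero_less_power) auto
    fix j n :: nat assume n: "4 ^ (t * (m0 + 1)) * (4 ^ t) ^ j \<le> real n"
    define q :: nat where "q = 2 ^ (2 * Suc (m0 + j))"
    interpret finite_subfield_char2 2 "2 * Suc (m0 + j)" q "TYPE(K2)"
      unfolding q_def by (intro finite_subfield_K2) simp
    have q4: "q = 4 ^ (m0 + 1) * 4 ^ j" unfolding q_def power_mult by (simp add: power_add)
    have "q ^ t = 4 ^ (t * (m0 + 1)) * (4 ^ t) ^ j"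
      unfolding q4 power_mult_distrib by (simp only: mult.commute flip: power_mult)
    then have "real (q ^ t) \<le> real n" using n by simp
    then have "q ^ t \<le> n" by (simp only: of_nat_le_iff)
    moreover have "(t + 1)\<^sup>2 < 2 * 2 ^ (m0 + j)"
    proof -
      have "m0 < 2 * 2 ^ (m0 + j)" using less_exp[of "m0 + j"] by linarith
      then show ?thesis by (simp only: m0_def)
    qed
    ultimately have "lambda_free n (cycle_graph t) \<ge> real q / (16 * (real t + 2)\<^sup>2)"
      using t by (intro lambda_free_odd_cycle_field[where m = "m0 + j"]) auto
    moreover have "(((4::real) ^ t) ^ j) powr (1 / real t) = 4 ^ j"
    proof -
      have eq: "((4::real) ^ t) ^ j = (4 ^ j) powr real t"
      proof -
        have "((4::real) ^ t) ^ j = (4 ^ j) ^ t" by (metis mult.commute power_mult)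
        then show ?thesis by (simp add: powr_realpow)
      qed
      show ?thesis unfolding eq powr_powr using t by simp
    qed
    moreover have "4 ^ j / (16 * (real t + 2)\<^sup>2) \<le> real q / (16 * (real t + 2)\<^sup>2)"
    proof (intro divide_right_mono)
      have "(1::real) * 4 ^ j \<le> 4 ^ (m0 + 1) * 4 ^ j" by (intro mult_right_mono one_le_power) auto
      then show "4 ^ j \<le> real q" by (simp add: q4)
    qed simp
    ultimately show "lambda_free n (cycle_graph t) \<ge> 1 / (16 * (real t + 2)\<^sup>2) * ((4 ^ t) ^ j) powr (1 / real t)" by simp
  qed (use t in auto)
qed

section \<open>Quadrilaterals and small numbers of vertices\<close>

lemma embeds_cycle_4_imp_K22:
  assumes "embeds (cycle_graph 4) V E"
  shows "embeds (complete_bipartite_graph 2 2) V E"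
proof -
  obtain h where h: "inj_on h (pverts (cycle_graph 4))" "h ` pverts (cycle_graph 4) \<subseteq> V"
    "\<forall>(a, b)\<in>parcs (cycle_graph 4). E (h a) (h b)"
    using assms by (auto simp: embeds_def)
  \<comment> \<open>The two sides of the biclique are the even and the odd vertices of the
    quadrilateral.\<close>
  define j :: "nat + nat \<Rightarrow> nat" where "j = case_sum (\<lambda>i. 2 * i) (\<lambda>i. 2 * i + 1)"
  let ?K = "complete_bipartite_graph 2 2"
  have j: "inj_on j (pverts ?K)" "j ` pverts ?K \<subseteq> pverts (cycle_graph 4)"
    by (auto simp: inj_on_def j_def complete_bipartite_graph_def cycle_graph_def Let_def) presburger+
  have "(j a, j b) \<in> parcs (cycle_graph 4)" if "(a, b) \<in> parcs ?K" for a b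
    using that by (auto simp: j_def complete_bipartite_graph_def cycle_graph_def Let_def less_2_cases_iff)
  then have "\<forall>(a, b)\<in>parcs ?K. E ((h \<circ> j) a) ((h \<circ> j) b)" using h(3) by fastforce
  moreover have "inj_on (h \<circ> j) (pverts ?K)" using j h(1) by (metis comp_inj_on inj_on_subset)
  moreover have "(h \<circ> j) ` pverts ?K \<subseteq> V" using j(2) h(2) by fastforce
  ultimately show ?thesis unfolding embeds_def by blast
qed

lemma lambda_free_C4: "\<exists>c>0. \<forall>n\<ge>1. lambda_free n (cycle_graph 4) \<ge> c * real n powr (1 / 4)"
proof (intro exI[of _ "1 / 2"] conjI allI impI)
  fix n :: nat assume n: "n \<ge> 1"
  show "lambda_free n (cycle_graph 4) \<ge> 1 / 2 * real n powr (1 / 4)"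
  proof (cases "n = 1")
    case True
    then show ?thesis using lambda_free_cycle_ge_1[of n 4] by simp
  next
    case False
    have "lambda_free n (cycle_graph 4) \<ge> 1 / 2 * real 2 powr (1/4) * real n powr (1/4)"
      using n False embeds_cycle_4_imp_K22 cycle_graph_arcs[of 4]
      by (intro lambda_free_ge_of_embeds_K2t) (auto simp: cycle_graph_def)
    moreover have "1 * (1 / 2 * real n powr (1/4)) \<le> real 2 powr (1/4) * (1 / 2 * real n powr (1/4))"
      by (intro mult_right_mono ge_one_powr_ge_zero) auto
    ultimately show ?thesis by simp
  qed
qed simp

text \<open>For \<open>n < t\<close> the right-hand factor is at most \<open>D\<close>, which
  depends on \<open>t\<close> alone, and the trivial bound 1 suffices.\<close>

lemma lambda_free_K2t_all:
  assumes t: "t \<ge> 2"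
  shows "\<exists>c>0. \<forall>n\<ge>1. lambda_free n (complete_bipartite_graph 2 t) \<ge> c * real t powr (1/4) * real n powr (1/4)"
proof -
  define D where "D = real t powr (1/4) * real t powr (1/4)"
  have D: "D > 0" using t by (simp add: D_def)
  have "min (1 / 2) (1 / D) * real t powr (1/4) * real n powr (1/4) \<le> lambda_free n (complete_bipartite_graph 2 t)"
    if n: "n \<ge> 1" for n
  proof (cases "n \<ge> t")
    case True
    have "min (1 / 2) (1 / D) * real t powr (1/4) * real n powr (1/4) \<le> 1 / 2 * real t powr (1/4) * real n powr (1/4)"
      by (intro mult_right_mono) auto
    then show ?thesis using lambda_free_K2t[OF t True] by linarith
  next
    case False
    have "real t powr (1/4) * real n powr (1/4) \<le> D"
      unfolding D_def using False by (intro mult_left_mono powr_mono2) auto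
    then have "min (1 / 2) (1 / D) * (real t powr (1/4) * real n powr (1/4)) \<le> 1 / D * D"
      using D by (intro mult_mono) auto
    moreover have "lambda_free n (complete_bipartite_graph 2 t) \<ge> 1"
    proof (rule lambda_free_ge_1[OF n])
      show "pverts (complete_bipartite_graph 2 t) \<noteq> {}" using t by (auto simp: complete_bipartite_graph_def Let_def)
    qed (use t complete_bipartite_graph_arcs[of 2 t] in auto)
    ultimately show ?thesis using D by (simp add: mult.assoc)
  qed
  then show ?thesis using D by (intro exI[of _ "min (1 / 2) (1 / D)"]) auto
qed

text \<open>The last two parts are given in both readings of the implied constant: uniform in
  \<open>t\<close> for \<open>n\<close> large in terms of \<open>t\<close>, and dependent on
  \<open>t\<close> for all \<open>n \<ge> 1\<close>. In the second part a uniform constant cannot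
  serve all \<open>n\<close>: theta is at most \<open>n\<close>, whereas the bound grows with
  \<open>t\<close> for fixed \<open>n\<close>.\<close>

theorem theorem1p4:
  shows
    "(\<forall>t \<in> {4, 6, 10} \<union> {t :: nat. odd t \<and> t \<ge> 3}.
        \<exists>c > 0. \<forall>n \<ge> 1. lambda_free n (cycle_graph t) \<ge> c * real n powr (1 / real t))
   \<and> ((\<exists>c > 0. \<forall>t \<ge> 2. \<forall>n \<ge> t.
        lambda_free n (complete_bipartite_graph 2 t) \<ge> c * real t powr (1/4) * real n powr (1/4))
    \<and> (\<forall>t \<ge> 2. \<exists>c > 0. \<forall>n \<ge> 1.
        lambda_free n (complete_bipartite_graph 2 t) \<ge> c * real t powr (1/4) * real n powr (1/4)))
   \<and> ((\<exists>c > 0. \<forall>t \<ge> 3. \<exists>N. \<forall>n \<ge> N.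
        lambda_free n (complete_bipartite_graph t (fact (t - 1) + 1))
          \<ge> c * real n powr (1/2 * (1 - 1 / real t)))
    \<and> (\<forall>t \<ge> 3. \<exists>c > 0. \<forall>n \<ge> 1.
        lambda_free n (complete_bipartite_graph t (fact (t - 1) + 1))
          \<ge> c * real n powr (1/2 * (1 - 1 / real t))))"
proof (intro conjI)
  show "\<forall>t \<in> {4, 6, 10} \<union> {t :: nat. odd t \<and> t \<ge> 3}.
      \<exists>c > 0. \<forall>n \<ge> 1. lambda_free n (cycle_graph t) \<ge> c * real n powr (1 / real t)"
  proof
    fix t :: nat assume "t \<in> {4, 6, 10} \<union> {t. odd t \<and> t \<ge> 3}"
    then consider "t = 4" | "t = 6" | "t = 10" | "odd t" "t \<ge> 3" by blast
    then show "\<exists>c > 0. \<forall>n \<ge> 1. lambda_free n (cycle_graph t) \<ge> c * real n powr (1 / real t)"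
      using lambda_free_C4 lambda_free_C6 lambda_free_C10 lambda_free_odd_cycle by cases simp_all
  qed
  show "\<exists>c > 0. \<forall>t \<ge> 2. \<forall>n \<ge> t.
      lambda_free n (complete_bipartite_graph 2 t) \<ge> c * real t powr (1/4) * real n powr (1/4)"
    using lambda_free_K2t by (intro exI[of _ "1 / 2"]) auto
  show "\<forall>t \<ge> 2. \<exists>c > 0. \<forall>n \<ge> 1.
      lambda_free n (complete_bipartite_graph 2 t) \<ge> c * real t powr (1/4) * real n powr (1/4)"
    using lambda_free_K2t_all by blast
  show "\<exists>c > 0. \<forall>t \<ge> 3. \<exists>N. \<forall>n \<ge> N.
      lambda_free n (complete_bipartite_graph t (fact (t - 1) + 1)) \<ge> c * real n powr (1/2 * (1 - 1 / real t))"
    using lambda_free_biclique by (intro exI[of _ "1 / 54"] conjI allI impI exI[of _ 1]) auto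
  show "\<forall>t \<ge> 3. \<exists>c > 0. \<forall>n \<ge> 1.
      lambda_free n (complete_bipartite_graph t (fact (t - 1) + 1)) \<ge> c * real n powr (1/2 * (1 - 1 / real t))"
    using lambda_free_biclique by (intro allI impI exI[of _ "1 / 54"] conjI) auto
qed

end
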